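(* Let $p\in[0,1]$ and consider Bernoulli bond percolation on $\mathbb Z^2$ with parameter $p$ (each nearest-neighbour edge kept independently with probability $p$). Let $\rho$ be the law of the connected component of the origin, rooted at the origin. Then the expected spectral measure $\mu_\rho$ has a non-trivial continuous part (i.e. is not purely atomic) if and only if $p>p_c(\mathbb Z^2)=1/2$.
   Context: For a random rooted graph $(G,o)$ with law $\rho$ and bounded degrees, $\mu_\rho=\mathbb E_\rho\,\mu^{e_o}_A$, where $A$ is the adjacency operator of $G$ ($A\psi(u)=\sum_{v\sim u}\psi(v)$ on $\ell^2(V)$) and $\mu^{e_o}_A$ is the probability measure on $\mathbb R$ with $\int x^k d\mu^{e_o}_A=\langle e_o,A^ke_o\rangle$ for all $k\ge1$. Equivalently $\mu_\rho$ is the weak limit of $\mathbb E\,\mu_n^p$, where $\mu^p_n$ is the empirical eigenvalue distribution of the adjacency matrix of the percolation restricted to the box $[0,n]^2\cap\mathbb Z^2$. *)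

theory Defs
  imports "HOL-Probability.Probability"
begin

type_synonym vertex = "int \<times> int"

text \<open>Nearest-neighbour edges of Z^2: an edge is encoded by its lower/left endpoint v
  and a direction flag; (v, True) is the edge {v, v+(1,0)}, (v, False) is {v, v+(0,1)}.
  Each edge is encoded exactly once.\<close>
type_synonym edge = "vertex \<times> bool"

definition perc :: "real \<Rightarrow> (edge \<Rightarrow> bool) measure" where
  "perc p = PiM UNIV (\<lambda>_. measure_pmf (bernoulli_pmf p))"

definition origin :: vertex where "origin = (0, 0)"

definition open_adj :: "(edge \<Rightarrow> bool) \<Rightarrow> vertex \<Rightarrow> vertex \<Rightarrow> bool" where
  "open_adj \<omega> u v \<longleftrightarrow>
     (v = (fst u + 1, snd u) \<and> \<omega> (u, True)) \<or>
     (u = (fst v + 1, snd v) \<and> \<omega> (v, True)) \<or>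
     (v = (fst u, snd u + 1) \<and> \<omega> (u, False)) \<or>
     (u = (fst v, snd v + 1) \<and> \<omega> (v, False))"

definition cluster :: "(edge \<Rightarrow> bool) \<Rightarrow> vertex set" where
  "cluster \<omega> = {v. (open_adj \<omega>)\<^sup>*\<^sup>* origin v}"

definition cl_adj :: "(edge \<Rightarrow> bool) \<Rightarrow> vertex \<Rightarrow> vertex \<Rightarrow> bool" where
  "cl_adj \<omega> u v \<longleftrightarrow> u \<in> cluster \<omega> \<and> v \<in> cluster \<omega> \<and> open_adj \<omega> u v"

definition nbrs :: "vertex \<Rightarrow> vertex set" where
  "nbrs v = {(fst v + 1, snd v), (fst v - 1, snd v), (fst v, snd v + 1), (fst v, snd v - 1)}"

text \<open>Matrix entries of A^k for the adjacency operator A of the cluster graph: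
  A_pow \<omega> k u v = <e_u, A^k e_v>.\<close>
fun A_pow :: "(edge \<Rightarrow> bool) \<Rightarrow> nat \<Rightarrow> vertex \<Rightarrow> vertex \<Rightarrow> real" where
  "A_pow \<omega> 0 u v = (if u = v then 1 else 0)"
| "A_pow \<omega> (Suc k) u v = (\<Sum>w\<in>nbrs u. if cl_adj \<omega> u w then A_pow \<omega> k w v else 0)"

definition expected_spectral_measure :: "real \<Rightarrow> real measure \<Rightarrow> bool" where
  "expected_spectral_measure p \<mu> \<longleftrightarrow>
     prob_space \<mu> \<and> sets \<mu> = sets borel \<and>
     (\<forall>k::nat. k \<ge> 1 \<longrightarrow> integrable \<mu> (\<lambda>x. x ^ k) \<and>
        (\<integral>x. x ^ k \<partial>\<mu>) = (\<integral>\<omega>. A_pow \<omega> k origin origin \<partial>perc p))"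

definition purely_atomic :: "real measure \<Rightarrow> bool" where
  "purely_atomic \<mu> \<longleftrightarrow>
     (\<exists>S. countable S \<and> S \<in> sets \<mu> \<and> emeasure \<mu> S = emeasure \<mu> (space \<mu>))"

end

theory Submission
  imports Defs "HOL-Library.Z2"
begin

text \<open>
  For \<open>p \<le> 1/2\<close> all clusters are finite (Harris--Kesten, by way of Russo--Seymour--Welsh estimates at
  the self-dual point). A finite cluster has an annihilating polynomial, and there are only countably
  many finite graphs, so the measure lives on the countably many roots of these polynomials.

  For \<open>p > 1/2\<close>, sharpness of the phase transition in the dual percolation and Menger's theorem
  produce linearly many disjoint left-right crossings of a \<open>K\<close>-box \<open>V\<close> with probability at least
  \<open>1/2\<close>. In the matrix \<open>X - A\<close> on \<open>V\<close>, replace the row of the right end of each of the \<open>b\<close>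
  crossings by the unit vector of its left end. By planarity the terms of top degree in the
  determinant all have the same sign and use one cycle per crossing, so the determinant is a
  nonzero polynomial of degree at most \<open>|V| - b(K + 1)\<close>, with every eigenvector that vanishes at the
  left ends contributing a root. Hence, up to boundary terms, finitely many eigenspaces have total
  dimension at most \<open>|V| - b(K + 1)\<close>; comparing with the traces of the spectral projections, finite
  sets have mass bounded away from 1.
\<close>

section \<open>Bernoulli percolation with edge-dependent parameters\<close>

text \<open>\<open>expected_spectral_measure\<close> prescribes moments only, so both directions
  treat an arbitrary measure with these moments. Such a measure lives on [-4, 4], and for a
  polynomial g with values in [0, 1] there, the expected diagonal entries of g(A)^m converge to the
  mass of {g = 1}. Masses of finite sets thus become limits of polynomial expressions in A. These
  act on finitely supported functions and depend on finitely many edges, and the percolation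
  inequalities reduce to inductions over finitely many edges. Existence of the measure is a
  Hausdorff moment problem on [-4, 4].

  A countable set has finite subsets F of almost its full mass, so in the supercritical case the gap
  below 1 must not depend on F. With b linear in K the saving b(K + 1) is of order K^2, while the
  boundary terms |F|(4(K + 1) + b) are of order K. Letting K grow with F fixed leaves a gap that
  depends only on the density of crossings; fewer than linearly many crossings would leave none.
  This linear density is what forces the detour through exponential decay of the dual and
  sprinkling.\<close>

definition percf :: "('e \<Rightarrow> real) \<Rightarrow> ('e \<Rightarrow> bool) measure" where
  "percf r = PiM UNIV (\<lambda>e. measure_pmf (bernoulli_pmf (r e)))"

text \<open>Locality. For finite \<open>E\<close> such an \<open>f\<close> takes finitely many
  values, is measurable and integrable, and claims about \<open>EE r f\<close> can be proved by
  induction on \<open>E\<close>, averaging over one edge at a time.\<close>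

definition dep :: "'e set \<Rightarrow> (('e \<Rightarrow> bool) \<Rightarrow> 'b) \<Rightarrow> bool" where
  "dep E f \<longleftrightarrow> (\<forall>w w'. (\<forall>e\<in>E. w e = w' e) \<longrightarrow> f w = f w')"

abbreviation EE :: "('e \<Rightarrow> real) \<Rightarrow> (('e \<Rightarrow> bool) \<Rightarrow> real) \<Rightarrow> real" where
  "EE r f \<equiv> integral\<^sup>L (percf r) f"

abbreviation PP :: "('e \<Rightarrow> real) \<Rightarrow> (('e \<Rightarrow> bool) \<Rightarrow> bool) \<Rightarrow> real" where
  "PP r A \<equiv> integral\<^sup>L (percf r) (\<lambda>w. of_bool (A w))"

lemma perc_eq_percf: "perc p = percf (\<lambda>_. p)"
  by (simp add: perc_def percf_def)

lemma space_percf [simp]: "space (percf r) = UNIV"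
  by (simp add: percf_def space_PiM)

lemma prob_space_percf: "prob_space (percf r)"
  unfolding percf_def by (intro prob_space_PiM prob_space_measure_pmf)

lemma measure_percf_UNIV [simp]: "measure (percf r) UNIV = 1"
  using prob_space.prob_space[OF prob_space_percf[of r]] by simp

lemma depD: "dep E f \<Longrightarrow> (\<And>e. e \<in> E \<Longrightarrow> w e = w' e) \<Longrightarrow> f w = f w'"
  by (auto simp: dep_def)

lemma dep_mono: "dep E f \<Longrightarrow> E \<subseteq> F \<Longrightarrow> dep F f"
  unfolding dep_def by blast

lemma dep_emptyE:
  assumes "dep {} f"
  obtains c where "f = (\<lambda>_. c)"
proof
  show "f = (\<lambda>_. f (\<lambda>_. True))"
    by (rule ext, rule depD[OF assms]) auto
qed

lemma dep_const [simp]: "dep E (\<lambda>_. c)"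
  by (simp add: dep_def)

lemma dep_upd: "dep (insert e E) f \<Longrightarrow> dep E (\<lambda>w. f (w(e := b)))"
  unfolding dep_def by simp

lemma dep_upd': "dep E f \<Longrightarrow> dep (E - {e}) (\<lambda>w. f (w(e := b)))"
  unfolding dep_def by simp

lemma dep_comp: "dep E f \<Longrightarrow> dep E (\<lambda>w. h (f w))"
  unfolding dep_def by metis

lemma dep_comp2: "dep E f \<Longrightarrow> dep E g \<Longrightarrow> dep E (\<lambda>w. h (f w) (g w))"
  unfolding dep_def by metis

lemma measurable_coord [measurable]: "(\<lambda>w. w e) \<in> measurable (percf r) (count_space UNIV)"
proof -
  have "(\<lambda>w. w e) \<in> measurable (percf r) (measure_pmf (bernoulli_pmf (r e)))"
    unfolding percf_def by (rule measurable_component_singleton) auto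
  then show ?thesis by simp
qed

lemma dep_split: "f = (\<lambda>w. if w e then f (w(e := True)) else f (w(e := False)))"
  by (rule ext) (simp add: fun_upd_idem)

lemma dep_measurable:
  assumes "finite E" "dep E f" "space N = UNIV"
  shows "f \<in> measurable (percf r) N"
  using assms(1,2)
proof (induction E arbitrary: f)
  case empty
  then obtain c where "f = (\<lambda>_. c)" using dep_emptyE by blast
  then show ?case using assms(3) by simp
next
  case (insert e E)
  have [measurable]: "(\<lambda>w. f (w(e := b))) \<in> measurable (percf r) N" for b
    by (rule insert.IH[OF dep_upd[OF insert(4)]])
  then have "(\<lambda>w. if w e then f (w(e := True)) else f (w(e := False))) \<in> measurable (percf r) N"
    by measurable
  then show ?case using dep_split[of f e] by simp
qed

lemma dep_bounded:
  assumes "finite E" "dep E f"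
  shows "finite (range f)"
  using assms
proof (induction E arbitrary: f)
  case empty
  then obtain c where "f = (\<lambda>_. c)" using dep_emptyE by blast
  then show ?case by simp
next
  case (insert e E)
  have "range f \<subseteq> range (\<lambda>w. f (w(e := True))) \<union> range (\<lambda>w. f (w(e := False)))"
  proof
    fix y assume "y \<in> range f"
    then obtain w where "y = f w" by auto
    then have "y = f (w(e := w e))" by simp
    then show "y \<in> range (\<lambda>w. f (w(e := True))) \<union> range (\<lambda>w. f (w(e := False)))"
      by (cases "w e") auto
  qed
  moreover have "finite (range (\<lambda>w. f (w(e := b))))" for b
    by (rule insert.IH[OF dep_upd[OF insert(4)]])
  ultimately show ?case by (meson finite_subset finite_UnI)
qed

lemma dep_integrable:
  fixes f :: "('e \<Rightarrow> bool) \<Rightarrow> real"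
  assumes "finite E" "dep E f"
  shows "integrable (percf r) f"
proof -
  interpret prob_space "percf r" by (rule prob_space_percf)
  have fin: "finite (range f)" by (rule dep_bounded[OF assms])
  have "norm (f w) \<le> Max (norm ` range f)" for w
    using fin by (intro Max_ge) auto
  then show ?thesis
    by (intro integrable_const_bound[of _ "Max (norm ` range f)"] AE_I2 dep_measurable[OF assms]) auto
qed

text \<open>Redrawing the coordinate \<open>e\<close> independently preserves the product measure;
  Fubini then separates the two values of the new coordinate.\<close>

lemma resample_percf:
  fixes f :: "('e \<Rightarrow> bool) \<Rightarrow> real"
  assumes f: "integrable (percf r) f" and r: "0 \<le> r e" "r e \<le> 1"
  shows "EE r f = r e * EE r (\<lambda>w. f (w(e := True))) + (1 - r e) * EE r (\<lambda>w. f (w(e := False)))"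
proof -
  let ?M = "\<lambda>e. measure_pmf (bernoulli_pmf (r e))"
  interpret P: prob_space "percf r" by (rule prob_space_percf)
  interpret PS: pair_sigma_finite "?M e" "percf r" ..
  have eq: "distr (?M e \<Otimes>\<^sub>M percf r) (percf r) (\<lambda>(x, X). X(e := x)) = percf r"
    using distr_pair_PiM_eq_PiM[of UNIV ?M e, OF prob_space_measure_pmf prob_space_measure_pmf]
    by (simp add: percf_def)
  have meas: "(\<lambda>(x, X). X(e := x)) \<in> measurable (?M e \<Otimes>\<^sub>M percf r) (percf r)"
    unfolding percf_def split_beta' by (rule measurable_fun_upd[where J=UNIV]) auto
  have fm: "f \<in> borel_measurable (percf r)" using f by auto
  have "EE r f = integral\<^sup>L (distr (?M e \<Otimes>\<^sub>M percf r) (percf r) (\<lambda>(x, X). X(e := x))) f"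
    by (simp only: eq)
  also have "\<dots> = integral\<^sup>L (?M e \<Otimes>\<^sub>M percf r) (\<lambda>z. f ((\<lambda>(x, X). X(e := x)) z))"
    by (rule integral_distr[OF meas fm])
  also have "\<dots> = (\<integral>x. (\<integral>X. f (X(e := x)) \<partial>percf r) \<partial>?M e)"
  proof -
    have "integrable (?M e \<Otimes>\<^sub>M percf r) (\<lambda>z. f ((\<lambda>(x, X). X(e := x)) z))"
      using f integrable_distr[OF meas, of f] by (simp add: eq)
    from PS.integral_fst'[OF this] show ?thesis by simp
  qed
  also have "\<dots> = r e * EE r (\<lambda>w. f (w(e := True))) + (1 - r e) * EE r (\<lambda>w. f (w(e := False)))"
    using r by simp
  finally show ?thesis .
qed

lemma resample:
  fixes f :: "('e \<Rightarrow> bool) \<Rightarrow> real"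
  assumes "finite E" "dep E f" "0 \<le> r e" "r e \<le> 1"
  shows "EE r f = r e * EE r (\<lambda>w. f (w(e := True))) + (1 - r e) * EE r (\<lambda>w. f (w(e := False)))"
  by (intro resample_percf dep_integrable[OF assms(1,2)] assms)

lemma EE_const [simp]: "EE r (\<lambda>_. c) = c"
  using prob_space.prob_space[OF prob_space_percf[of r]] by simp

lemma EE_mono:
  fixes f :: "('e \<Rightarrow> bool) \<Rightarrow> real"
  assumes "finite E" "dep E f" "dep E g" "\<And>w. f w \<le> g w"
  shows "EE r f \<le> EE r g"
  by (rule integral_mono) (use dep_integrable assms in auto)

lemma EE_cong_param:
  fixes f :: "('e \<Rightarrow> bool) \<Rightarrow> real"
  assumes "finite E" "dep E f" "\<And>e. e \<in> E \<Longrightarrow> r e = s e" "\<And>e. 0 \<le> r e \<and> r e \<le> 1" "\<And>e. 0 \<le> s e \<and> s e \<le> 1"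
  shows "EE r f = EE s f"
  using assms(1,2,3)
proof (induction E arbitrary: f)
  case empty
  then obtain c where "f = (\<lambda>_. c)" using dep_emptyE by blast
  then show ?case by simp
next
  case (insert e E)
  have *: "EE r (\<lambda>w. f (w(e := b))) = EE s (\<lambda>w. f (w(e := b)))" for b
    by (rule insert.IH[OF dep_upd[OF insert(4)]]) (use insert(5) in auto)
  have fin: "finite (insert e E)" using insert by simp
  have "EE r f = r e * EE r (\<lambda>w. f (w(e := True))) + (1 - r e) * EE r (\<lambda>w. f (w(e := False)))"
    by (rule resample[OF fin insert(4)]) (use assms(4) in auto)
  also have "\<dots> = s e * EE s (\<lambda>w. f (w(e := True))) + (1 - s e) * EE s (\<lambda>w. f (w(e := False)))"
    unfolding * using insert(5) by simp
  also have "\<dots> = EE s f"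
    by (rule resample[OF fin insert(4), symmetric]) (use assms(5) in auto)
  finally show ?case .
qed

lemma EE_fun_upd_param:
  fixes f :: "('e \<Rightarrow> bool) \<Rightarrow> real"
  assumes "finite E" "dep E f" "\<And>e. 0 \<le> r e \<and> r e \<le> 1" "0 \<le> s" "s \<le> 1"
  shows "EE (r(e := s)) f = EE r (\<lambda>w. s * f (w(e := True)) + (1 - s) * f (w(e := False)))"
proof -
  have d: "dep (E - {e}) (\<lambda>w. f (w(e := b)))" for b by (rule dep_upd'[OF assms(2)])
  have i: "integrable (percf r) (\<lambda>w. f (w(e := b)))" for b
    using dep_integrable[OF _ d] assms(1) by simp
  have c: "EE (r(e := s)) (\<lambda>w. f (w(e := b))) = EE r (\<lambda>w. f (w(e := b)))" for b
    by (rule EE_cong_param[OF _ d]) (use assms in auto)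
  show ?thesis
    using resample[OF assms(1,2), of "r(e := s)" e] assms(4,5) by (simp add: c i)
qed

lemma EE_indep:
  fixes f g :: "('e \<Rightarrow> bool) \<Rightarrow> real"
  assumes "finite E" "finite F" "dep E f" "dep F g" "E \<inter> F = {}" "\<And>e. 0 \<le> r e \<and> r e \<le> 1"
  shows "EE r (\<lambda>w. f w * g w) = EE r f * EE r g"
  using assms(1,3,5)
proof (induction E arbitrary: f)
  case empty
  then obtain c where "f = (\<lambda>_. c)" using dep_emptyE by blast
  then show ?case by simp
next
  case (insert e E)
  have fin: "finite (insert e E)" "finite (insert e (E \<union> F))" using insert assms by simp_all
  have g: "g (w(e := b)) = g w" for w b
    by (rule depD[OF assms(4)]) (use insert(5) in auto)
  have d: "dep (insert e (E \<union> F)) (\<lambda>w. f w * g w)"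
    by (rule dep_comp2[OF dep_mono[OF insert(4)] dep_mono[OF assms(4)]]) auto
  have IH: "EE r (\<lambda>w. f (w(e := b)) * g w) = EE r (\<lambda>w. f (w(e := b))) * EE r g" for b
    by (rule insert.IH[OF dep_upd[OF insert(4)]]) (use insert(5) in auto)
  have r: "0 \<le> r e" "r e \<le> 1" using assms(6) by auto
  have B: "EE r f = r e * EE r (\<lambda>w. f (w(e := True))) + (1 - r e) * EE r (\<lambda>w. f (w(e := False)))"
    by (rule resample[OF fin(1) insert(4), of r e, OF r])
  have "EE r (\<lambda>w. f w * g w) = r e * EE r (\<lambda>w. f (w(e := True)) * g (w(e := True)))
     + (1 - r e) * EE r (\<lambda>w. f (w(e := False)) * g (w(e := False)))"
    by (rule resample[OF fin(2) d, of r e, OF r])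
  then show ?case unfolding g IH B by (simp only: distrib_right mult.assoc)
qed

section \<open>Monotone functions: positive correlation, Russo's formula, change of the
  parameter\<close>

definition incr :: "(('e \<Rightarrow> bool) \<Rightarrow> 'b::order) \<Rightarrow> bool" where
  "incr f \<longleftrightarrow> (\<forall>w w'. (\<forall>e. w e \<longrightarrow> w' e) \<longrightarrow> f w \<le> f w')"

lemma incrD: "incr f \<Longrightarrow> (\<And>e. w e \<Longrightarrow> w' e) \<Longrightarrow> f w \<le> f w'"
  by (auto simp: incr_def)

lemma incr_upd: "incr f \<Longrightarrow> incr (\<lambda>w. f (w(e := b)))"
  by (simp add: incr_def)

lemma incr_of_bool: "incr A \<Longrightarrow> incr (\<lambda>w. of_bool (A w) :: real)"
  unfolding incr_def by (metis le_boolE of_bool_eq(1) of_bool_eq(2) of_bool_less_eq_one order_refl zero_le_one zero_less_eq_of_bool)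

text \<open>Harris' inequality by induction on the edges. With \<open>e\<close> fixed the induction
  hypothesis applies; averaging over \<open>e\<close> then compares two monotone functions on a
  two-point space, whose covariance is t(1 - t)(f1 - f0)(g1 - g0).\<close>

lemma FKG_real:
  fixes f g :: "('e \<Rightarrow> bool) \<Rightarrow> real"
  assumes "finite E" "dep E f" "dep E g" "incr f" "incr g" "\<And>e. 0 \<le> r e \<and> r e \<le> 1"
  shows "EE r f * EE r g \<le> EE r (\<lambda>w. f w * g w)"
  using assms(1-5)
proof (induction E arbitrary: f g)
  case empty
  then obtain c d where "f = (\<lambda>_. c)" "g = (\<lambda>_. d)" using dep_emptyE by metis
  then show ?case by simp
next
  case (insert e E)
  have fin: "finite (insert e E)" using insert by simp
  have d: "dep (insert e E) (\<lambda>w. f w * g w)" by (rule dep_comp2[OF insert(4) insert(5)])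
  define f1 f0 g1 g0 where "f1 = EE r (\<lambda>w. f (w(e := True)))" and "f0 = EE r (\<lambda>w. f (w(e := False)))"
    and "g1 = EE r (\<lambda>w. g (w(e := True)))" and "g0 = EE r (\<lambda>w. g (w(e := False)))"
  have IH: "EE r (\<lambda>w. f (w(e := b))) * EE r (\<lambda>w. g (w(e := b))) \<le> EE r (\<lambda>w. f (w(e := b)) * g (w(e := b)))" for b
    by (rule insert.IH[OF dep_upd[OF insert(4)] dep_upd[OF insert(5)] incr_upd[OF insert(6)] incr_upd[OF insert(7)]])
  have le: "f0 \<le> f1" "g0 \<le> g1" unfolding f0_def f1_def g0_def g1_def
    by (rule EE_mono[OF insert(1) dep_upd[OF insert(4)] dep_upd[OF insert(4)]]; use incrD[OF insert(6)] in auto)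
       (rule EE_mono[OF insert(1) dep_upd[OF insert(5)] dep_upd[OF insert(5)]]; use incrD[OF insert(7)] in auto)
  define t where "t = r e"
  have t: "0 \<le> t" "t \<le> 1" using assms(6) t_def by auto
  have "(t * f1 + (1 - t) * f0) * (t * g1 + (1 - t) * g0) = t * (f1 * g1) + (1 - t) * (f0 * g0) - t * (1 - t) * ((f1 - f0) * (g1 - g0))"
    by (simp add: algebra_simps)
  also have "\<dots> \<le> t * (f1 * g1) + (1 - t) * (f0 * g0)"
    using t le by (simp add: mult_nonneg_nonneg)
  also have "\<dots> \<le> t * EE r (\<lambda>w. f (w(e := True)) * g (w(e := True))) + (1 - t) * EE r (\<lambda>w. f (w(e := False)) * g (w(e := False)))"
    using t IH[of True] IH[of False] unfolding f1_def f0_def g1_def g0_def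
    by (intro add_mono mult_left_mono) auto
  finally show ?case
    unfolding f1_def f0_def g1_def g0_def t_def
      resample[OF fin insert(4), of r e, OF t[unfolded t_def]] resample[OF fin insert(5), of r e, OF t[unfolded t_def]]
      resample[OF fin d, of r e, OF t[unfolded t_def]] .
qed

lemma FKG:
  assumes "finite E" "dep E A" "dep E B" "incr A" "incr B" "\<And>e. 0 \<le> r e \<and> r e \<le> 1"
  shows "PP r A * PP r B \<le> PP r (\<lambda>w. A w \<and> B w)"
proof -
  have "PP r A * PP r B \<le> EE r (\<lambda>w. of_bool (A w) * of_bool (B w))"
    by (rule FKG_real[OF assms(1) dep_comp[OF assms(2)] dep_comp[OF assms(3)] incr_of_bool[OF assms(4)] incr_of_bool[OF assms(5)] assms(6)])
  then show ?thesis by (simp add: of_bool_conj)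
qed

text \<open>Averaging over \<open>e\<close> writes the expectation as p F1(p) + (1 - p) F0(p). The
  explicit factors produce the term of \<open>e\<close> itself; the derivatives of F1 and F0 are
  known by induction and average to the terms of the other edges.\<close>

lemma russo:
  fixes f :: "('e \<Rightarrow> bool) \<Rightarrow> real"
  assumes "finite E" "dep E f" "0 < p" "p < 1"
  shows "((\<lambda>p. EE (\<lambda>_. p) f) has_real_derivative
     (\<Sum>e\<in>E. EE (\<lambda>_. p) (\<lambda>w. f (w(e := True))) - EE (\<lambda>_. p) (\<lambda>w. f (w(e := False))))) (at p)"
  using assms(1,2)
proof (induction E arbitrary: f)
  case empty
  then obtain c where "f = (\<lambda>_. c)" using dep_emptyE by blast
  then show ?case by simp
next
  case (insert e E)
  have fin: "finite (insert e E)" using insert by simp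
  let ?F = "\<lambda>b p. EE (\<lambda>_. p) (\<lambda>w. f (w(e := b)))"
  let ?D = "\<lambda>b. (\<Sum>e'\<in>E. EE (\<lambda>_. p) (\<lambda>w. f (w(e' := True, e := b))) - EE (\<lambda>_. p) (\<lambda>w. f (w(e' := False, e := b))))"
  have IH: "(?F b has_real_derivative ?D b) (at p)" for b
    by (rule insert.IH[OF dep_upd[OF insert(4)]])
  have "((\<lambda>p. p * ?F True p + (1 - p) * ?F False p) has_real_derivative
      (?F True p + p * ?D True) + (- ?F False p + (1 - p) * ?D False)) (at p)"
    by (auto intro!: derivative_eq_intros IH)
  moreover have "?F True p + p * ?D True + (- ?F False p + (1 - p) * ?D False)
     = (\<Sum>e\<in>insert e E. EE (\<lambda>_. p) (\<lambda>w. f (w(e := True))) - EE (\<lambda>_. p) (\<lambda>w. f (w(e := False))))"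
  proof -
    have "EE (\<lambda>_. p) (\<lambda>w. f (w(e' := b))) = p * EE (\<lambda>_. p) (\<lambda>w. f (w(e' := b, e := True)))
      + (1 - p) * EE (\<lambda>_. p) (\<lambda>w. f (w(e' := b, e := False)))" if "e' \<in> E" for e' b
    proof -
      have ne: "e \<noteq> e'" using insert(2) that by auto
      have "dep (insert e E - {e'}) (\<lambda>w. f (w(e' := b)))" using dep_upd'[OF insert(4)] .
      have "EE (\<lambda>_. p) (\<lambda>w. f (w(e' := b))) = p * EE (\<lambda>_. p) (\<lambda>w. f (w(e := True, e' := b)))
        + (1 - p) * EE (\<lambda>_. p) (\<lambda>w. f (w(e := False, e' := b)))"
        by (rule resample[OF _ \<open>dep (insert e E - {e'}) _\<close>]) (use fin assms(3,4) in auto)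
      then show ?thesis unfolding fun_upd_twist[OF ne] .
    qed
    note H = this
    have "(\<Sum>e'\<in>E. EE (\<lambda>_. p) (\<lambda>w. f (w(e' := True))) - EE (\<lambda>_. p) (\<lambda>w. f (w(e' := False)))) = p * ?D True + (1 - p) * ?D False"
      unfolding sum_distrib_left sum.distrib[symmetric]
    proof (intro sum.cong refl)
      fix x assume x: "x \<in> E"
      show "EE (\<lambda>_. p) (\<lambda>w. f (w(x := True))) - EE (\<lambda>_. p) (\<lambda>w. f (w(x := False))) =
         p * (EE (\<lambda>_. p) (\<lambda>w. f (w(x := True, e := True))) - EE (\<lambda>_. p) (\<lambda>w. f (w(x := False, e := True)))) +
         (1 - p) * (EE (\<lambda>_. p) (\<lambda>w. f (w(x := True, e := False))) - EE (\<lambda>_. p) (\<lambda>w. f (w(x := False, e := False))))"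
        using H[OF x, of True] H[OF x, of False] by algebra
    qed
    then show ?thesis unfolding sum.insert[OF insert(1,2)] by linarith
  qed
  \<comment> \<open>The averaging formula holds only for parameters in [0, 1], so it is available
    near p but not as an identity of functions on the line.\<close>
  moreover have ev: "\<forall>\<^sub>F q in nhds p. EE (\<lambda>_. q) f = q * ?F True q + (1 - q) * ?F False q"
  proof -
    have "\<forall>\<^sub>F q in nhds p. q \<in> {0<..<1}" using assms by (intro eventually_nhds_in_open) auto
    then show ?thesis
      by eventually_elim (rule resample[OF fin insert(4)]; simp)
  qed
  ultimately show ?case
    unfolding DERIV_cong_ev[OF refl ev refl] by (simp only:)
qed

lemma EE_bij_reindex:
  fixes f :: "('e \<Rightarrow> bool) \<Rightarrow> real"
  assumes "finite E" "dep E f" "inj \<epsilon>" "0 \<le> p" "p \<le> 1"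
  shows "EE (\<lambda>_. p) (\<lambda>w. f (\<lambda>e. w (\<epsilon> e))) = EE (\<lambda>_. p) f"
  using assms(1,2)
proof (induction E arbitrary: f)
  case empty
  then obtain c where "f = (\<lambda>_. c)" using dep_emptyE by blast
  then show ?case by simp
next
  case (insert e E)
  have fin: "finite (insert e E)" using insert by simp
  have dE: "dep (\<epsilon> ` insert e E) (\<lambda>w. f (\<lambda>e. w (\<epsilon> e)))"
    unfolding dep_def
  proof (intro allI impI)
    fix w w' :: "'a \<Rightarrow> bool" assume "\<forall>e\<in>\<epsilon> ` insert e E. w e = w' e"
    then show "f (\<lambda>e. w (\<epsilon> e)) = f (\<lambda>e. w' (\<epsilon> e))"
      by (intro depD[OF insert(4)]) auto
  qed
  have upd: "(\<lambda>x. (w(\<epsilon> e := b)) (\<epsilon> x)) = (\<lambda>x. w (\<epsilon> x))(e := b)" for w :: "_ \<Rightarrow> bool" and b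
    using assms(3) by (auto simp: fun_eq_iff inj_eq)
  have IH: "EE (\<lambda>_. p) (\<lambda>w. f ((\<lambda>x. w (\<epsilon> x))(e := b))) = EE (\<lambda>_. p) (\<lambda>w. f (w(e := b)))" for b
    by (rule insert.IH[OF dep_upd[OF insert(4)]])
  have "EE (\<lambda>_. p) (\<lambda>w. f (\<lambda>e. w (\<epsilon> e))) =
      p * EE (\<lambda>_. p) (\<lambda>w. f (\<lambda>x. (w(\<epsilon> e := True)) (\<epsilon> x))) + (1 - p) * EE (\<lambda>_. p) (\<lambda>w. f (\<lambda>x. (w(\<epsilon> e := False)) (\<epsilon> x)))"
    by (rule resample[OF _ dE]) (use fin assms(4,5) in auto)
  also have "\<dots> = p * EE (\<lambda>_. p) (\<lambda>w. f (w(e := True))) + (1 - p) * EE (\<lambda>_. p) (\<lambda>w. f (w(e := False)))"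
    unfolding upd IH ..
  also have "\<dots> = EE (\<lambda>_. p) f" by (rule resample[OF fin insert(4), of "\<lambda>_. p", OF assms(4,5), symmetric])
  finally show ?case .
qed

text \<open>Meant for the injection \<open>dual_edge\<close>: the dual of a configuration with
  parameter p is a configuration with parameter 1 - p.\<close>

lemma EE_flip_reindex:
  fixes f :: "('e \<Rightarrow> bool) \<Rightarrow> real"
  assumes "finite E" "dep E f" "inj \<epsilon>" "0 \<le> p" "p \<le> 1"
  shows "EE (\<lambda>_. p) (\<lambda>w. f (\<lambda>e. \<not> w (\<epsilon> e))) = EE (\<lambda>_. 1 - p) f"
  using assms(1,2)
proof (induction E arbitrary: f)
  case empty
  then obtain c where "f = (\<lambda>_. c)" using dep_emptyE by blast
  then show ?case by simp
next
  case (insert e E)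
  have fin: "finite (insert e E)" using insert by simp
  have dE: "dep (\<epsilon> ` insert e E) (\<lambda>w. f (\<lambda>e. \<not> w (\<epsilon> e)))"
    unfolding dep_def
  proof (intro allI impI)
    fix w w' :: "'a \<Rightarrow> bool" assume "\<forall>e\<in>\<epsilon> ` insert e E. w e = w' e"
    then show "f (\<lambda>e. \<not> w (\<epsilon> e)) = f (\<lambda>e. \<not> w' (\<epsilon> e))"
      by (intro depD[OF insert(4)]) auto
  qed
  have upd: "(\<lambda>x. \<not> (w(\<epsilon> e := b)) (\<epsilon> x)) = (\<lambda>x. \<not> w (\<epsilon> x))(e := \<not> b)" for w :: "_ \<Rightarrow> bool" and b
    using assms(3) by (auto simp: fun_eq_iff inj_eq)
  have IH: "EE (\<lambda>_. p) (\<lambda>w. f ((\<lambda>x. \<not> w (\<epsilon> x))(e := b))) = EE (\<lambda>_. 1 - p) (\<lambda>w. f (w(e := b)))" for b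
    by (rule insert.IH[OF dep_upd[OF insert(4)]])
  have "EE (\<lambda>_. p) (\<lambda>w. f (\<lambda>e. \<not> w (\<epsilon> e))) =
      p * EE (\<lambda>_. p) (\<lambda>w. f (\<lambda>x. \<not> (w(\<epsilon> e := True)) (\<epsilon> x))) + (1 - p) * EE (\<lambda>_. p) (\<lambda>w. f (\<lambda>x. \<not> (w(\<epsilon> e := False)) (\<epsilon> x)))"
    by (rule resample[OF _ dE]) (use fin assms(4,5) in auto)
  also have "\<dots> = (1 - p) * EE (\<lambda>_. 1 - p) (\<lambda>w. f (w(e := True))) + (1 - (1 - p)) * EE (\<lambda>_. 1 - p) (\<lambda>w. f (w(e := False)))"
    unfolding upd IH not_True_eq_False not_False_eq_True by (simp only: diff_diff_eq2 add_diff_cancel_left' add.commute)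
  also have "\<dots> = EE (\<lambda>_. 1 - p) f" by (rule resample[OF fin insert(4), symmetric]) (use assms(4,5) in auto)
  finally show ?case .
qed

lemma EE_incr_param:
  fixes f :: "('e \<Rightarrow> bool) \<Rightarrow> real"
  assumes "finite E" "dep E f" "incr f" "0 \<le> p" "p \<le> q" "q \<le> 1"
  shows "EE (\<lambda>_. p) f \<le> EE (\<lambda>_. q) f"
  using assms(1,2,3)
proof (induction E arbitrary: f)
  case empty
  then obtain c where "f = (\<lambda>_. c)" using dep_emptyE by blast
  then show ?case by simp
next
  case (insert e E)
  have fin: "finite (insert e E)" using insert by simp
  let ?F = "\<lambda>b p. EE (\<lambda>_. p) (\<lambda>w. f (w(e := b)))"
  have IH: "?F b p \<le> ?F b q" for b
    by (rule insert.IH[OF dep_upd[OF insert(4)] incr_upd[OF insert(5)]])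
  have le: "?F False q \<le> ?F True q"
    by (rule EE_mono[OF insert(1) dep_upd[OF insert(4)] dep_upd[OF insert(4)]]) (use incrD[OF insert(5)] in auto)
  have "p * ?F True p + (1 - p) * ?F False p \<le> p * ?F True q + (1 - p) * ?F False q"
    using IH assms by (intro add_mono mult_left_mono) auto
  also have "\<dots> = q * ?F True q + (1 - q) * ?F False q - (q - p) * (?F True q - ?F False q)"
    by (simp add: algebra_simps)
  also have "\<dots> \<le> q * ?F True q + (1 - q) * ?F False q"
    using le assms by simp
  finally have "p * ?F True p + (1 - p) * ?F False p \<le> q * ?F True q + (1 - q) * ?F False q" .
  moreover have "EE (\<lambda>_. p) f = p * ?F True p + (1 - p) * ?F False p"
    by (rule resample[OF fin insert(4)]) (use assms in auto)
  moreover have "EE (\<lambda>_. q) f = q * ?F True q + (1 - q) * ?F False q"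
    by (rule resample[OF fin insert(4)]) (use assms in auto)
  ultimately show ?case by (simp only:)
qed

section \<open>Sprinkling: raising the parameter edge by edge\<close>

definition sprinkle :: "real \<Rightarrow> 'e \<Rightarrow> (('e \<Rightarrow> bool) \<Rightarrow> real) \<Rightarrow> ('e \<Rightarrow> bool) \<Rightarrow> real" where
  "sprinkle \<rho> e f = (\<lambda>w. if w e then f w else max (f w) (\<rho> * f (w(e := True))))"

lemma sprinkle_dep: "dep E f \<Longrightarrow> dep (insert e E) (sprinkle \<rho> e f)"
  unfolding dep_def sprinkle_def
proof (intro allI impI)
  fix w w' :: "'a \<Rightarrow> bool"
  assume f: "\<forall>w w'. (\<forall>e\<in>E. w e = w' e) \<longrightarrow> f w = f w'" and eq: "\<forall>a\<in>insert e E. w a = w' a"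
  have "f w = f w'" "f (w(e := True)) = f (w'(e := True))" "w e = w' e"
    using f eq by auto
  then show "(if w e then f w else max (f w) (\<rho> * f (w(e := True)))) =
     (if w' e then f w' else max (f w') (\<rho> * f (w'(e := True))))" by simp
qed

lemma sprinkle_incr:
  assumes "incr f" "\<And>w. 0 \<le> f w" "0 \<le> \<rho>" "\<rho> \<le> 1"
  shows "incr (sprinkle \<rho> e f)"
  unfolding incr_def
proof (intro allI impI)
  fix w w' :: "'a \<Rightarrow> bool" assume le: "\<forall>e. w e \<longrightarrow> w' e"
  have 1: "f w \<le> f w'" using incrD[OF assms(1)] le by auto
  have 2: "f (w(e := True)) \<le> f (w'(e := True))" by (rule incrD[OF assms(1)]) (use le in \<open>auto split: if_splits\<close>)
  have 3: "\<rho> * f (w(e := True)) \<le> \<rho> * f (w'(e := True))" using 2 assms by (simp add: mult_left_mono)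
  have 4: "\<rho> * f (w(e := True)) \<le> f (w(e := True))" using assms by (simp add: mult_left_le_one_le)
  show "sprinkle \<rho> e f w \<le> sprinkle \<rho> e f w'"
  proof (cases "w' e")
    case True
    then have "w'(e := True) = w'" by (simp add: fun_upd_idem)
    then have "f (w(e := True)) \<le> f w'" using 2 by (simp only:)
    then have "max (f w) (\<rho> * f (w(e := True))) \<le> f w'" using 1 4 by linarith
    then show ?thesis using 1 True by (simp add: sprinkle_def)
  next
    case False
    then show ?thesis using le 1 3 by (auto simp: sprinkle_def le_max_iff_disj)
  qed
qed

text \<open>An edge is open at level s if it was open already or is then opened with probability
  \<rho>. Given that it was closed, the new expectation is \<rho> f(open) + (1 - \<rho>) f(closed).
  This dominates f(closed) because f increases, and \<rho> f(open) because f is nonnegative, hence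
  the maximum in \<open>sprinkle\<close>.\<close>

lemma sprinkle_step:
  fixes f :: "('e \<Rightarrow> bool) \<Rightarrow> real"
  assumes "finite E" "dep E f" "incr f" "\<And>w. 0 \<le> f w" "\<And>e. 0 \<le> r e \<and> r e \<le> 1" "r e < 1"
    "r e \<le> s" "s \<le> 1" "\<rho> = (s - r e) / (1 - r e)"
  shows "EE r (sprinkle \<rho> e f) \<le> EE (r(e := s)) f"
proof -
  have rho: "0 \<le> \<rho>" "\<rho> \<le> 1" unfolding assms(9) using assms(6-8) by (auto simp: divide_simps)
  have seq: "s = r e + \<rho> * (1 - r e)" using assms(6,9) by simp
  have d: "dep (E - {e}) (\<lambda>w. f (w(e := b)))" for b by (rule dep_upd'[OF assms(2)])
  have i: "integrable (percf r) (\<lambda>w. f (w(e := b)))" for b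
    using dep_integrable[OF _ d] assms(1) by simp
  have ds: "dep (insert e E) (sprinkle \<rho> e f)" by (rule sprinkle_dep[OF assms(2)])
  have S1: "sprinkle \<rho> e f (w(e := True)) = f (w(e := True))" for w by (simp add: sprinkle_def)
  have S0: "sprinkle \<rho> e f (w(e := False)) \<le> \<rho> * f (w(e := True)) + (1 - \<rho>) * f (w(e := False))" for w
  proof -
    have "f (w(e := False)) \<le> f (w(e := True))" by (rule incrD[OF assms(3)]) (auto split: if_splits)
    then have "f (w(e := False)) * \<rho> \<le> \<rho> * f (w(e := True))" using rho by (simp add: mult.commute mult_left_mono)
    moreover have "0 \<le> (1 - \<rho>) * f (w(e := False))" using rho assms(4) by simp
    ultimately show ?thesis by (simp add: sprinkle_def algebra_simps)
  qed
  have i0: "integrable (percf r) (\<lambda>w. sprinkle \<rho> e f (w(e := False)))"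
    by (rule dep_integrable[OF _ dep_upd'[OF ds]]) (use assms in simp)
  have ic: "integrable (percf r) (\<lambda>w. c * f (w(e := True)) + d * f (w(e := False)))"
    "EE r (\<lambda>w. c * f (w(e := True)) + d * f (w(e := False))) = c * EE r (\<lambda>w. f (w(e := True))) + d * EE r (\<lambda>w. f (w(e := False)))" for c d
    by (intro Bochner_Integration.integrable_add integrable_mult_right i,
        subst Bochner_Integration.integral_add) (intro integrable_mult_right i, intro integrable_mult_right i, simp only: integral_mult_right_zero)
  have re: "0 \<le> r e" "r e \<le> 1" using assms(5) by auto
  have "EE r (sprinkle \<rho> e f) = r e * EE r (\<lambda>w. sprinkle \<rho> e f (w(e := True))) + (1 - r e) * EE r (\<lambda>w. sprinkle \<rho> e f (w(e := False)))"
    by (rule resample[OF _ ds, of r e, OF _ re]) (use assms(1) in simp)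
  also have "\<dots> \<le> r e * EE r (\<lambda>w. f (w(e := True))) + (1 - r e) * EE r (\<lambda>w. \<rho> * f (w(e := True)) + (1 - \<rho>) * f (w(e := False)))"
    unfolding S1 using re S0 by (intro add_left_mono mult_left_mono integral_mono i0 ic(1)) auto
  also have "\<dots> = s * EE r (\<lambda>w. f (w(e := True))) + (1 - s) * EE r (\<lambda>w. f (w(e := False)))"
    unfolding ic(2) seq by (simp only: algebra_simps)
  also have "\<dots> = EE (r(e := s)) f"
    unfolding ic(2)[symmetric]
    by (rule EE_fun_upd_param[OF assms(1,2,5), symmetric]) (use assms(7,8) re in auto)
  finally show ?thesis .
qed

lemma sprinkle_chain_props:
  fixes f :: "('e \<Rightarrow> bool) \<Rightarrow> real"
  assumes "dep E f" "incr f" "\<And>w. 0 \<le> f w" "0 \<le> \<rho>" "\<rho> \<le> 1"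
  shows "dep (set es \<union> E) (foldr (sprinkle \<rho>) es f) \<and> incr (foldr (sprinkle \<rho>) es f) \<and> (\<forall>w. 0 \<le> foldr (sprinkle \<rho>) es f w)"
proof (induction es)
  case Nil
  then show ?case using assms by simp
next
  case (Cons e es)
  then show ?case
    using sprinkle_dep[of "set es \<union> E" "foldr (sprinkle \<rho>) es f" e \<rho>] sprinkle_incr[of "foldr (sprinkle \<rho>) es f" \<rho> e] assms
    by (auto simp: sprinkle_def[of \<rho> e "foldr (sprinkle \<rho>) es f"] le_max_iff_disj)
qed

text \<open>\<open>X\<close> collects the edges already raised to s. The mixed intermediate measures
  are the reason why \<open>percf\<close> allows a parameter for each edge.\<close>

lemma sprinkle_chain_EE:
  fixes f :: "('e \<Rightarrow> bool) \<Rightarrow> real"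
  assumes "finite E" "dep E f" "incr f" "\<And>w. 0 \<le> f w" "0 \<le> p" "p < s" "s \<le> 1"
    "\<rho> = (s - p) / (1 - p)" "distinct es" "X \<inter> set es = {}"
  shows "EE (\<lambda>e. if e \<in> X then s else p) (foldr (sprinkle \<rho>) es f) \<le> EE (\<lambda>e. if e \<in> X \<union> set es then s else p) f"
  using assms(9,10)
proof (induction es arbitrary: X)
  case Nil
  then show ?case by simp
next
  case (Cons e es)
  have rho: "0 \<le> \<rho>" "\<rho> \<le> 1" unfolding assms(8) using assms(5-7) by (auto simp: divide_simps)
  have pr: "dep (set es \<union> E) (foldr (sprinkle \<rho>) es f)" "incr (foldr (sprinkle \<rho>) es f)" "0 \<le> foldr (sprinkle \<rho>) es f w" for w
    using sprinkle_chain_props[OF assms(2-4) rho] by blast+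
  have e: "e \<notin> X" using Cons by auto
  have upd: "(\<lambda>a. if a \<in> X then s else p)(e := s) = (\<lambda>a. if a \<in> insert e X then s else p)" by auto
  have "EE (\<lambda>e. if e \<in> X then s else p) (foldr (sprinkle \<rho>) (e # es) f)
    \<le> EE ((\<lambda>a. if a \<in> X then s else p)(e := s)) (foldr (sprinkle \<rho>) es f)"
    using sprinkle_step[OF _ pr, of "\<lambda>a. if a \<in> X then s else p" e s \<rho>] assms e by simp
  also have "\<dots> \<le> EE (\<lambda>a. if a \<in> insert e X \<union> set es then s else p) f"
    unfolding upd by (rule Cons.IH) (use Cons in auto)
  finally show ?case by simp
qed

text \<open>At an edge of \<open>F\<close> the second argument of the maximum is chosen, at the
  price of one factor \<rho>; at any other edge the first, for free.\<close>

lemma sprinkle_chain_ge: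
  fixes f :: "('e \<Rightarrow> bool) \<Rightarrow> real"
  assumes "\<And>w. 0 \<le> f w" "0 \<le> \<rho>" "\<rho> \<le> 1" "F \<subseteq> set es" "distinct es"
  shows "\<rho> ^ card F * f (\<lambda>e. w e \<or> e \<in> F) \<le> foldr (sprinkle \<rho>) es f w"
  using assms(4,5)
proof (induction es arbitrary: F w)
  case Nil
  then show ?case by simp
next
  case (Cons e es)
  let ?g = "foldr (sprinkle \<rho>) es f"
  show ?case
  proof (cases "e \<in> F")
    case False
    then have "F \<subseteq> set es" using Cons by auto
    then have "\<rho> ^ card F * f (\<lambda>e. w e \<or> e \<in> F) \<le> ?g w" using Cons by simp
    then show ?thesis by (simp add: sprinkle_def[of \<rho> e ?g] le_max_iff_disj)
  next
    case True
    have fin: "finite F" using Cons(2) finite_subset by blast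
    have sub: "F - {e} \<subseteq> set es" using Cons by auto
    have c: "card F = Suc (card (F - {e}))" using True fin by (metis card_Suc_Diff1)
    show ?thesis
    proof (cases "w e")
      case True
      have EQ: "(\<lambda>a. w a \<or> a \<in> F) = (\<lambda>a. w a \<or> a \<in> F - {e})" using True by auto
      have "\<rho> ^ card (F - {e}) * f (\<lambda>e. w e \<or> e \<in> F) \<le> ?g w"
        unfolding EQ by (rule Cons.IH[OF sub]) (use Cons in simp)
      moreover have "\<rho> * (\<rho> ^ card (F - {e}) * f (\<lambda>e. w e \<or> e \<in> F)) \<le> \<rho> ^ card (F - {e}) * f (\<lambda>e. w e \<or> e \<in> F)"
        using assms by (intro mult_left_le_one_le) auto
      ultimately show ?thesis using True by (simp add: sprinkle_def[of \<rho> e ?g] c mult.assoc)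
    next
      case False
      have EQ: "(\<lambda>a. w a \<or> a \<in> F) = (\<lambda>a. (w(e := True)) a \<or> a \<in> F - {e})" using True by auto
      have "\<rho> ^ card (F - {e}) * f (\<lambda>e. w e \<or> e \<in> F) \<le> ?g (w(e := True))"
        unfolding EQ by (rule Cons.IH[OF sub]) (use Cons in simp)
      then have "\<rho> * (\<rho> ^ card (F - {e}) * f (\<lambda>e. w e \<or> e \<in> F)) \<le> \<rho> * ?g (w(e := True))"
        using assms by (simp add: mult_left_mono)
      then show ?thesis using False by (simp add: sprinkle_def[of \<rho> e ?g] c mult.assoc le_max_iff_disj)
    qed
  qed
qed

text \<open>Raising the parameter from \<open>p\<close> to \<open>s\<close> one edge at a time opens each closed edge with
  conditional probability \<open>\<rho>\<close>; by monotonicity the edges outside the prescribed set may be ignored.\<close>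

lemma sprinkling:
  assumes "finite E" "dep E A" "incr A" "0 \<le> p" "p < s" "s \<le> 1"
    "dep E B" "\<And>w. B w \<Longrightarrow> \<exists>F. F \<subseteq> E \<and> card F \<le> k \<and> A (\<lambda>e. w e \<or> e \<in> F)"
  shows "((s - p) / (1 - p)) ^ k * PP (\<lambda>_. p) B \<le> PP (\<lambda>_. s) A"
proof -
  define \<rho> where "\<rho> = (s - p) / (1 - p)"
  have rho: "0 \<le> \<rho>" "\<rho> \<le> 1" using assms(4-6) by (auto simp: \<rho>_def divide_simps)
  obtain es where es: "set es = E" "distinct es" using assms(1) finite_distinct_list by blast
  let ?f = "\<lambda>w. of_bool (A w) :: real"
  have df: "dep E ?f" "incr ?f" by (rule dep_comp[OF assms(2)], rule incr_of_bool[OF assms(3)])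
  let ?g = "foldr (sprinkle \<rho>) es ?f"
  have dg: "dep E ?g" using sprinkle_chain_props[OF df _ rho, of es] es by simp
  have "\<rho> ^ k * of_bool (B w) \<le> ?g w" for w
  proof (cases "B w")
    case False
    then show ?thesis using sprinkle_chain_props[OF df _ rho, of es] by simp
  next
    case True
    then obtain F where F: "F \<subseteq> E" "card F \<le> k" "A (\<lambda>e. w e \<or> e \<in> F)" using assms(8) by blast
    have "\<rho> ^ k \<le> \<rho> ^ card F" using F rho by (simp add: power_decreasing)
    also have "\<rho> ^ card F * ?f (\<lambda>e. w e \<or> e \<in> F) \<le> ?g w"
      by (rule sprinkle_chain_ge) (use rho F es in auto)
    finally show ?thesis using True F by simp
  qed
  then have "EE (\<lambda>_. p) (\<lambda>w. \<rho> ^ k * of_bool (B w)) \<le> EE (\<lambda>_. p) ?g"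
    by (rule EE_mono[OF assms(1) dep_comp[OF assms(7)] dg])
  also have "\<dots> \<le> EE (\<lambda>e. if e \<in> E then s else p) ?f"
    using sprinkle_chain_EE[OF assms(1) df _ assms(4-6) \<rho>_def es(2), of "{}"] es by simp
  also have "\<dots> = EE (\<lambda>_. s) ?f"
    by (rule EE_cong_param[OF assms(1) df(1)]) (use assms in auto)
  finally show ?thesis by (simp add: \<rho>_def)
qed

section \<open>Connections inside a region\<close>

definition nbr :: "vertex \<Rightarrow> vertex \<Rightarrow> bool" where
  "nbr u v \<longleftrightarrow> (snd u = snd v \<and> \<bar>fst u - fst v\<bar> = 1) \<or> (fst u = fst v \<and> \<bar>snd u - snd v\<bar> = 1)"

text \<open>The step relation \<open>r\<close> is a parameter because the same lemmas serve lattice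
  neighbours, open edges and dual open edges. The start is required to lie in \<open>R\<close>, so
  every visited vertex does.\<close>

definition lconn :: "('v \<Rightarrow> 'v \<Rightarrow> bool) \<Rightarrow> 'v set \<Rightarrow> 'v \<Rightarrow> 'v \<Rightarrow> bool" where
  "lconn r R u v \<longleftrightarrow> u \<in> R \<and> (\<lambda>x y. r x y \<and> y \<in> R)\<^sup>*\<^sup>* u v"

lemma lconn_refl: "u \<in> R \<Longrightarrow> lconn r R u u"
  by (simp add: lconn_def)

lemma lconn_step: "lconn r R u v \<Longrightarrow> r v x \<Longrightarrow> x \<in> R \<Longrightarrow> lconn r R u x"
  unfolding lconn_def by (auto intro: rtranclp.rtrancl_into_rtrancl)

lemma lconn_step1: "r v x \<Longrightarrow> v \<in> R \<Longrightarrow> x \<in> R \<Longrightarrow> lconn r R v x"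
  by (rule lconn_step[OF lconn_refl])

lemma lconn_trans [trans]: "lconn r R u v \<Longrightarrow> lconn r R v x \<Longrightarrow> lconn r R u x"
  unfolding lconn_def by (meson rtranclp_trans)

lemma lconn_induct [consumes 1, case_names base step]:
  assumes "lconn r R u v" "u \<in> R \<Longrightarrow> P u"
    "\<And>y z. lconn r R u y \<Longrightarrow> y \<in> R \<Longrightarrow> r y z \<Longrightarrow> z \<in> R \<Longrightarrow> P y \<Longrightarrow> P z"
  shows "P v"
proof -
  have u: "u \<in> R" and "(\<lambda>x y. r x y \<and> y \<in> R)\<^sup>*\<^sup>* u v" using assms(1) by (auto simp: lconn_def)
  from this(2) have "P v \<and> v \<in> R \<and> lconn r R u v"
  proof (induction rule: rtranclp_induct)
    case base
    show ?case using assms(2)[OF u] u lconn_refl[OF u, of r] by simp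
  next
    case (step y z)
    then show ?case using assms(3)[of y z] lconn_step[of r R u y z] by simp
  qed
  then show ?thesis by simp
qed

lemma lconn_in: "lconn r R u v \<Longrightarrow> u \<in> R \<and> v \<in> R"
  by (induction rule: lconn_induct) (auto simp: lconn_def)

lemma lconn_image:
  assumes "lconn r R u v" "\<And>x y. x \<in> R \<Longrightarrow> y \<in> R \<Longrightarrow> r x y \<Longrightarrow> r' (h x) (h y)" "h ` R \<subseteq> R'"
  shows "lconn r' R' (h u) (h v)"
  using assms(1)
proof (induction rule: lconn_induct)
  case base
  then show ?case using assms(3) by (intro lconn_refl) auto
next
  case (step y z)
  then show ?case using assms(2,3) by (intro lconn_step[OF step.IH]) auto
qed

lemma lconn_mono:
  assumes "lconn r R u v" "\<And>x y. x \<in> R \<Longrightarrow> y \<in> R \<Longrightarrow> r x y \<Longrightarrow> r' x y" "R \<subseteq> R'"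
  shows "lconn r' R' u v"
  using lconn_image[of r R u v r' "\<lambda>x. x" R'] assms by auto

lemma lconn_sym:
  assumes "lconn r R u v" "\<And>x y. r x y \<Longrightarrow> r y x"
  shows "lconn r R v u"
  using assms(1)
proof (induction rule: lconn_induct)
  case base
  then show ?case by (rule lconn_refl)
next
  case (step y z)
  then show ?case using lconn_trans[OF lconn_step1[of r z y R]] assms(2) by blast
qed

lemma lconn_finite_subset:
  assumes "lconn r R u v"
  shows "\<exists>R0. R0 \<subseteq> R \<and> finite R0 \<and> lconn r R0 u v"
  using assms
proof (induction rule: lconn_induct)
  case base
  then show ?case by (intro exI[of _ "{u}"]) (auto intro: lconn_refl)
next
  case (step y z)
  then obtain R0 where "R0 \<subseteq> R" "finite R0" "lconn r R0 u y" by blast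
  then have "lconn r (insert z R0) u z"
    using step lconn_step[OF lconn_mono[of r R0 u y r "insert z R0"]] by blast
  then show ?case using \<open>R0 \<subseteq> R\<close> \<open>finite R0\<close> step by (intro exI[of _ "insert z R0"]) auto
qed

lemma nbr_sym: "nbr u v \<Longrightarrow> nbr v u"
  by (auto simp: nbr_def)

lemma open_adj_nbr: "open_adj w u v \<Longrightarrow> nbr u v"
  by (auto simp: open_adj_def nbr_def)

lemma open_adj_sym: "open_adj w u v \<Longrightarrow> open_adj w v u"
  by (auto simp: open_adj_def)

lemma lconn_open_sym: "lconn (open_adj w) R u v \<Longrightarrow> lconn (open_adj w) R v u"
  by (erule lconn_sym) (rule open_adj_sym)

section \<open>Crossing lattice paths meet\<close>

definition emb :: "vertex \<Rightarrow> real^2" where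
  "emb v = vector [real_of_int (fst v), real_of_int (snd v)]"

lemma emb_nth [simp]: "emb v $ 1 = real_of_int (fst v)" "emb v $ 2 = real_of_int (snd v)"
  by (simp_all add: emb_def)

text \<open>The point z lies on a vertex or a unit segment of \<open>X\<close>: the bounding box of
  two neighbours is degenerate in one direction, so coordinate bounds describe the segment
  exactly.\<close>

definition near :: "vertex set \<Rightarrow> real^2 \<Rightarrow> bool" where
  "near X z \<longleftrightarrow> (\<exists>x\<in>X. \<exists>y\<in>X. (x = y \<or> nbr x y) \<and>
     real_of_int (min (fst x) (fst y)) \<le> z $ 1 \<and> z $ 1 \<le> real_of_int (max (fst x) (fst y)) \<and>
     real_of_int (min (snd x) (snd y)) \<le> z $ 2 \<and> z $ 2 \<le> real_of_int (max (snd x) (snd y)))"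

lemma segment_between:
  fixes a b t :: real
  assumes "0 \<le> t" "t \<le> 1"
  shows "min a b \<le> (1 - t) * a + t * b \<and> (1 - t) * a + t * b \<le> max a b"
proof (cases "a \<le> b")
  case True
  have "0 \<le> t * (b - a)" "0 \<le> (1 - t) * (b - a)" using True assms by simp_all
  then show ?thesis using True by (simp add: algebra_simps)
next
  case False
  have "0 \<le> t * (a - b)" "0 \<le> (1 - t) * (a - b)" using False assms by simp_all
  then show ?thesis using False by (simp add: algebra_simps min_def max_def)
qed

lemma near_segment:
  assumes "x \<in> X" "y \<in> X" "x = y \<or> nbr x y" "z \<in> closed_segment (emb x) (emb y)"
  shows "near X z"
proof -
  obtain t where t: "0 \<le> t" "t \<le> 1" "z = (1 - t) *\<^sub>R emb x + t *\<^sub>R emb y"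
    using assms(4) unfolding in_segment(1) by blast
  have "real_of_int (min (fst x) (fst y)) \<le> z $ 1 \<and> z $ 1 \<le> real_of_int (max (fst x) (fst y))"
    "real_of_int (min (snd x) (snd y)) \<le> z $ 2 \<and> z $ 2 \<le> real_of_int (max (snd x) (snd y))"
    using segment_between[OF t(1,2), of "real_of_int (fst x)" "real_of_int (fst y)"]
      segment_between[OF t(1,2), of "real_of_int (snd x)" "real_of_int (snd y)"]
    by (simp_all add: t(3) of_int_min of_int_max)
  then show ?thesis unfolding near_def using assms(1-3) by blast
qed

lemma lconn_path:
  assumes "lconn nbr X u v"
  shows "\<exists>g. path g \<and> pathstart g = emb u \<and> pathfinish g = emb v \<and> (\<forall>z\<in>path_image g. near X z)"
  using assms
proof (induction rule: lconn_induct)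
  case base
  let ?g = "linepath (emb u) (emb u)"
  have "near X z" if "z \<in> path_image ?g" for z
    by (rule near_segment[OF base base]) (use that in \<open>simp_all only: path_image_linepath simp_thms\<close>)
  then show ?case
    by (intro exI[of _ ?g] conjI path_linepath pathstart_linepath pathfinish_linepath ballI)
next
  case (step y z)
  then obtain g where g: "path g" "pathstart g = emb u" "pathfinish g = emb y" "\<forall>z\<in>path_image g. near X z" by blast
  have "\<forall>q\<in>path_image (g +++ linepath (emb y) (emb z)). near X q"
    using g(4) near_segment[of y X z] step by (auto simp: path_image_join g(3))
  then show ?case using g by (intro exI[of _ "g +++ linepath (emb y) (emb z)"]) auto
qed

lemma segments_share_end:
  fixes x y a b :: int
  assumes "\<bar>x - y\<bar> \<le> 1" "\<bar>a - b\<bar> \<le> 1" "min x y \<le> max a b" "min a b \<le> max x y"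
  shows "x = a \<or> x = b \<or> y = a \<or> y = b"
  using assms by arith

text \<open>Two lattice segments through a common real point overlap in both coordinates.
  Overlapping integer intervals of length at most 1 share an endpoint, and as each segment is
  constant in one coordinate, the shared coordinates combine to a vertex of both.\<close>

lemma near_meet:
  assumes "near X z" "near Y z"
  shows "X \<inter> Y \<noteq> {}"
proof -
  obtain x y where xy: "x \<in> X" "y \<in> X" "x = y \<or> nbr x y"
     "real_of_int (min (fst x) (fst y)) \<le> z $ 1" "z $ 1 \<le> real_of_int (max (fst x) (fst y))"
     "real_of_int (min (snd x) (snd y)) \<le> z $ 2" "z $ 2 \<le> real_of_int (max (snd x) (snd y))"
    using assms(1) unfolding near_def by blast
  obtain x' y' where xy': "x' \<in> Y" "y' \<in> Y" "x' = y' \<or> nbr x' y'"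
     "real_of_int (min (fst x') (fst y')) \<le> z $ 1" "z $ 1 \<le> real_of_int (max (fst x') (fst y'))"
     "real_of_int (min (snd x') (snd y')) \<le> z $ 2" "z $ 2 \<le> real_of_int (max (snd x') (snd y'))"
    using assms(2) unfolding near_def by blast
  have le: "min (fst x) (fst y) \<le> max (fst x') (fst y')" "min (fst x') (fst y') \<le> max (fst x) (fst y)"
    "min (snd x) (snd y) \<le> max (snd x') (snd y')" "min (snd x') (snd y') \<le> max (snd x) (snd y)"
    using xy(4-7) xy'(4-7) by linarith+
  have key: "\<exists>p\<in>{fst x, fst y}. \<exists>q\<in>{snd x, snd y}. p \<in> {fst x', fst y'} \<and> q \<in> {snd x', snd y'}"
  proof -
    have "\<bar>fst x - fst y\<bar> \<le> 1" "\<bar>snd x - snd y\<bar> \<le> 1" using xy(3) by (auto simp: nbr_def)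
    moreover have "\<bar>fst x' - fst y'\<bar> \<le> 1" "\<bar>snd x' - snd y'\<bar> \<le> 1" using xy'(3) by (auto simp: nbr_def)
    ultimately show ?thesis
      using segments_share_end[OF _ _ le(1,2)] segments_share_end[OF _ _ le(3,4)] by blast
  qed
  obtain p q where pq: "p \<in> {fst x, fst y}" "q \<in> {snd x, snd y}" "p \<in> {fst x', fst y'}" "q \<in> {snd x', snd y'}"
    using key by blast
  have "(p, q) \<in> {x, y}" using pq(1,2) xy(3) by (cases x; cases y) (auto simp: nbr_def)
  moreover have "(p, q) \<in> {x', y'}" using pq(3,4) xy'(3) by (cases x'; cases y') (auto simp: nbr_def)
  ultimately show ?thesis using xy(1,2) xy'(1,2) by blast
qed

lemma lconn_hline:
  assumes "l \<le> m"
  shows "lconn nbr {(i, k) |i. l \<le> i \<and> i \<le> m} (l, k) (m, k)"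
  using assms
proof (induction m rule: int_ge_induct)
  case base
  show ?case by (rule lconn_refl) auto
next
  case (step m)
  have "lconn nbr {(i, k) |i. l \<le> i \<and> i \<le> m + 1} (l, k) (m, k)"
    by (rule lconn_mono[OF step.IH]) auto
  then show ?case by (rule lconn_step) (use step in \<open>auto simp: nbr_def\<close>)
qed

lemma lconn_vline:
  assumes "l \<le> m"
  shows "lconn nbr {(k, i) |i. l \<le> i \<and> i \<le> m} (k, l) (k, m)"
proof -
  let ?h = "\<lambda>x::vertex. (snd x, fst x)"
  have "lconn nbr {(k, i) |i. l \<le> i \<and> i \<le> m} (?h (l, k)) (?h (m, k))"
    by (rule lconn_image[OF lconn_hline[OF assms]]) (auto simp: nbr_def)
  then show ?thesis by simp
qed

lemma finite_coord_bound:
  assumes "finite (X :: vertex set)"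
  shows "\<exists>M. \<forall>x\<in>X. \<bar>fst x\<bar> \<le> M \<and> \<bar>snd x\<bar> \<le> M"
proof -
  let ?S = "(\<lambda>x. \<bar>fst x\<bar>) ` X \<union> (\<lambda>x. \<bar>snd x\<bar>) ` X"
  have "finite ?S" using assms by simp
  then have "\<forall>x\<in>X. \<bar>fst x\<bar> \<le> Max (insert 0 ?S) \<and> \<bar>snd x\<bar> \<le> Max (insert 0 ?S)"
    by (intro ballI conjI Max_ge) auto
  then show ?thesis by blast
qed

text \<open>Straight lattice rays prolong both connections to the sides of a large square, where
  \<open>fashoda\<close> applies to the polygonal paths. The coordinate bounds keep the rays clear
  of the other connection, so the common vertex lies in the original sets.\<close>

lemma crossing_meet:
  assumes X: "lconn nbr X u v" and Y: "lconn nbr Y s t"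
    and Xb: "\<And>x. x \<in> X \<Longrightarrow> c \<le> snd x \<and> snd x \<le> d" and Yb: "\<And>y. y \<in> Y \<Longrightarrow> a \<le> fst y \<and> fst y \<le> b"
    and "fst u \<le> a" "b \<le> fst v" "snd s \<le> c" "d \<le> snd t"
  shows "X \<inter> Y \<noteq> {}"
proof
  assume disj: "X \<inter> Y = {}"
  obtain X0 where X0: "X0 \<subseteq> X" "finite X0" "lconn nbr X0 u v" using lconn_finite_subset[OF X] by blast
  obtain Y0 where Y0: "Y0 \<subseteq> Y" "finite Y0" "lconn nbr Y0 s t" using lconn_finite_subset[OF Y] by blast
  obtain M where M: "\<And>x. x \<in> X0 \<union> Y0 \<Longrightarrow> \<bar>fst x\<bar> \<le> M \<and> \<bar>snd x\<bar> \<le> M"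
    using finite_coord_bound[of "X0 \<union> Y0"] X0 Y0 by auto
  have ends: "u \<in> X0" "v \<in> X0" "s \<in> Y0" "t \<in> Y0" using lconn_in[OF X0(3)] lconn_in[OF Y0(3)] by auto
  define X1 where "X1 = X0 \<union> {(i, snd u) |i. - M \<le> i \<and> i \<le> fst u} \<union> {(i, snd v) |i. fst v \<le> i \<and> i \<le> M}"
  define Y1 where "Y1 = Y0 \<union> {(fst s, i) |i. - M \<le> i \<and> i \<le> snd s} \<union> {(fst t, i) |i. snd t \<le> i \<and> i \<le> M}"
  have cX: "lconn nbr X1 (- M, snd u) (M, snd v)"
  proof -
    have "lconn nbr X1 (- M, snd u) (fst u, snd u)"
      by (rule lconn_mono[OF lconn_hline]) (use M[of u] ends in \<open>auto simp: X1_def\<close>)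
    also have "lconn nbr X1 (fst u, snd u) (fst v, snd v)"
      using lconn_mono[OF X0(3), of nbr X1] by (auto simp: X1_def)
    also have "lconn nbr X1 (fst v, snd v) (M, snd v)"
      by (rule lconn_mono[OF lconn_hline]) (use M[of v] ends in \<open>auto simp: X1_def\<close>)
    finally show ?thesis .
  qed
  have cY: "lconn nbr Y1 (fst s, - M) (fst t, M)"
  proof -
    have "lconn nbr Y1 (fst s, - M) (fst s, snd s)"
      by (rule lconn_mono[OF lconn_vline]) (use M[of s] ends in \<open>auto simp: Y1_def\<close>)
    also have "lconn nbr Y1 (fst s, snd s) (fst t, snd t)"
      using lconn_mono[OF Y0(3), of nbr Y1] by (auto simp: Y1_def)
    also have "lconn nbr Y1 (fst t, snd t) (fst t, M)"
      by (rule lconn_mono[OF lconn_vline]) (use M[of t] ends in \<open>auto simp: Y1_def\<close>)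
    finally show ?thesis .
  qed
  have Mu: "- M \<le> fst u" "fst u \<le> M" "- M \<le> snd u" "snd u \<le> M" "- M \<le> fst v" "fst v \<le> M" "- M \<le> snd v" "snd v \<le> M"
    "- M \<le> fst s" "fst s \<le> M" "- M \<le> snd s" "snd s \<le> M" "- M \<le> fst t" "fst t \<le> M" "- M \<le> snd t" "snd t \<le> M"
    using M[of u] M[of v] M[of s] M[of t] ends unfolding abs_le_iff by auto
  have bd: "\<bar>fst x\<bar> \<le> M \<and> \<bar>snd x\<bar> \<le> M" if "x \<in> X1 \<union> Y1" for x
  proof (cases "x \<in> X0 \<union> Y0")
    case True
    then show ?thesis by (rule M)
  next
    case False
    then have "((snd x = snd u \<or> snd x = snd v) \<and> - M \<le> fst x \<and> fst x \<le> M) \<or> ((fst x = fst s \<or> fst x = fst t) \<and> - M \<le> snd x \<and> snd x \<le> M)"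
      using that Mu unfolding X1_def Y1_def by auto
    then show ?thesis unfolding abs_le_iff using Mu by auto
  qed
  obtain f where f: "path f" "pathstart f = emb (- M, snd u)" "pathfinish f = emb (M, snd v)" "\<And>z. z \<in> path_image f \<Longrightarrow> near X1 z"
    using lconn_path[OF cX] by blast
  obtain g where g: "path g" "pathstart g = emb (fst s, - M)" "pathfinish g = emb (fst t, M)" "\<And>z. z \<in> path_image g \<Longrightarrow> near Y1 z"
    using lconn_path[OF cY] by blast
  have box: "z \<in> cbox (emb (- M, - M)) (emb (M, M))" if "near Z z" "Z \<subseteq> X1 \<union> Y1" for z Z
  proof -
    obtain x y where xy: "x \<in> Z" "y \<in> Z"
     "real_of_int (min (fst x) (fst y)) \<le> z $ 1" "z $ 1 \<le> real_of_int (max (fst x) (fst y))"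
     "real_of_int (min (snd x) (snd y)) \<le> z $ 2" "z $ 2 \<le> real_of_int (max (snd x) (snd y))"
      using \<open>near Z z\<close> unfolding near_def by blast
    have "- M \<le> min (fst x) (fst y)" "max (fst x) (fst y) \<le> M" "- M \<le> min (snd x) (snd y)" "max (snd x) (snd y) \<le> M"
      using bd[of x] bd[of y] xy(1,2) that(2) by (auto simp: abs_le_iff)
    then have "- real_of_int M \<le> z $ 1" "z $ 1 \<le> real_of_int M" "- real_of_int M \<le> z $ 2" "z $ 2 \<le> real_of_int M"
      using xy(3-6) by linarith+
    then show ?thesis by (simp add: mem_box_cart forall_2)
  qed
  have A: "path_image f \<subseteq> cbox (emb (- M, - M)) (emb (M, M))" "path_image g \<subseteq> cbox (emb (- M, - M)) (emb (M, M))"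
    using box[OF f(4)] box[OF g(4)] by blast+
  have B: "pathstart f $ 1 = emb (- M, - M) $ 1" "pathfinish f $ 1 = emb (M, M) $ 1"
    "pathstart g $ 2 = emb (- M, - M) $ 2" "pathfinish g $ 2 = emb (M, M) $ 2"
    by (simp_all add: f g)
  obtain z where "z \<in> path_image f" "z \<in> path_image g"
    using fashoda[OF f(1) g(1) A B] by blast
  then have "X1 \<inter> Y1 \<noteq> {}" using f(4) g(4) near_meet by blast
  moreover have "X1 \<inter> Y1 = {}"
  proof -
    have U: "u \<in> X" "v \<in> X" "s \<in> Y" "t \<in> Y" using ends X0 Y0 by auto
    have ne: "p \<noteq> q" if "p \<in> X" "q \<in> Y" for p q using disj that by blast
    note b = Xb[OF U(1)] Xb[OF U(2)] Yb[OF U(3)] Yb[OF U(4)] assms(5-8)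
    have "False" if p: "p \<in> X1" "p \<in> Y1" for p
    proof -
      obtain i j where ij: "p = (i, j)" by (cases p)
      have A: "p \<in> X \<or> (j = snd u \<and> i \<le> fst u) \<or> (j = snd v \<and> fst v \<le> i)"
        using p(1) X0(1) by (auto simp: X1_def ij)
      have B: "p \<in> Y \<or> (i = fst s \<and> j \<le> snd s) \<or> (i = fst t \<and> snd t \<le> j)"
        using p(2) Y0(1) by (auto simp: Y1_def ij)
      \<comment> \<open>A horizontal ray lies outside the open strip a < x < b, whereas all of
        \<open>Y\<close> and its rays satisfy a \<le> x \<le> b; only the end of the ray can be
        common.\<close>
      have "p = u \<or> p = v" if "p \<notin> X"
        using A B b Yb[of p] that ij by (auto simp: prod_eq_iff)
      then have pX: "p \<in> X" using U by blast
      have "p = s \<or> p = t" if "p \<notin> Y"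
        using B b Xb[OF pX] that ij by (auto simp: prod_eq_iff)
      then have "p \<in> Y" using U by blast
      then show False using pX disj by blast
    qed
    then show ?thesis by blast
  qed
  ultimately show False by simp
qed

text \<open>\<open>Y\<close> is an arc with both ends on the line x = b, and \<open>X\<close>
  reaches that line between them. Adding the column x = b + 1 below the lower and above the upper
  end of the arc turns \<open>Y\<close> into a vertical crossing, and one further step to the right
  turns \<open>X\<close> into a horizontal one.\<close>

lemma arc_meet:
  assumes X: "lconn nbr X u v" and Y: "lconn nbr Y s t"
    and Xb: "\<And>x. x \<in> X \<Longrightarrow> fst x \<le> b" and Yb: "\<And>y. y \<in> Y \<Longrightarrow> a \<le> fst y \<and> fst y \<le> b"
    and e: "fst u \<le> a" "fst v = b" "fst s = b" "fst t = b" "snd s \<le> snd v" "snd v \<le> snd t"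
  shows "X \<inter> Y \<noteq> {}"
proof
  assume disj: "X \<inter> Y = {}"
  have U: "u \<in> X" "v \<in> X" "s \<in> Y" "t \<in> Y" using lconn_in[OF X] lconn_in[OF Y] by auto
  have "v \<noteq> s" "v \<noteq> t" using U disj by auto
  then have lt: "snd s < snd v" "snd v < snd t" using e by (auto simp: prod_eq_iff)
  obtain X0 where X0: "X0 \<subseteq> X" "finite X0" "lconn nbr X0 u v" using lconn_finite_subset[OF X] by blast
  obtain M where M: "\<And>x. x \<in> insert s (insert t X0) \<Longrightarrow> \<bar>fst x\<bar> \<le> M \<and> \<bar>snd x\<bar> \<le> M"
    using finite_coord_bound[of "insert s (insert t X0)"] X0 by auto
  define X1 where "X1 = insert (b + 1, snd v) X0"
  define Y1 where "Y1 = Y \<union> {(b + 1, i) |i. - M \<le> i \<and> i \<le> snd s} \<union> {(b + 1, i) |i. snd t \<le> i \<and> i \<le> M}"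
  have v0: "u \<in> X0" "v \<in> X0" using lconn_in[OF X0(3)] by auto
  have 1: "lconn nbr X1 u (b + 1, snd v)"
    by (rule lconn_step[OF lconn_mono[OF X0(3)]]) (use e in \<open>auto simp: X1_def nbr_def\<close>)
  have 2: "lconn nbr Y1 (b + 1, - M) (b + 1, M)"
  proof -
    have "lconn nbr Y1 (b + 1, - M) (b + 1, snd s)"
      by (rule lconn_mono[OF lconn_vline]) (use M[of s] in \<open>auto simp: Y1_def\<close>)
    also have "lconn nbr Y1 (b + 1, snd s) s"
      by (rule lconn_step1) (use e U M[of s] in \<open>auto simp: Y1_def nbr_def\<close>)
    also have "lconn nbr Y1 s t" by (rule lconn_mono[OF Y]) (auto simp: Y1_def)
    also have "lconn nbr Y1 t (b + 1, snd t)"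
      by (rule lconn_step1) (use e U M[of t] in \<open>auto simp: Y1_def nbr_def\<close>)
    also have "lconn nbr Y1 (b + 1, snd t) (b + 1, M)"
      by (rule lconn_mono[OF lconn_vline]) (use M[of t] in \<open>auto simp: Y1_def\<close>)
    finally show ?thesis .
  qed
  have "X1 \<inter> Y1 \<noteq> {}"
  proof (rule crossing_meet[OF 1 2, of "- M" M a "b + 1"])
    show "- M \<le> snd x \<and> snd x \<le> M" if "x \<in> X1" for x
      using that M[of v] M[of x] v0 by (auto simp: X1_def abs_le_iff)
    show "a \<le> fst y \<and> fst y \<le> b + 1" if "y \<in> Y1" for y
      using that Yb[of y] Yb[OF U(3)] e by (auto simp: Y1_def)
  qed (use e in auto)
  moreover have "X1 \<inter> Y1 = {}"
  proof -
    have False if p: "p \<in> X1" "p \<in> Y1" for p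
    proof (cases "p = (b + 1, snd v)")
      case True
      then have "p \<notin> Y" using Yb[of p] by auto
      then show False using p(2) True lt by (auto simp: Y1_def)
    next
      case False
      then have "p \<in> X" using p(1) X0(1) by (auto simp: X1_def)
      then have "fst p \<noteq> b + 1" using Xb[of p] by simp
      then have "p \<in> Y" using p(2) by (auto simp: Y1_def)
      then show False using \<open>p \<in> X\<close> disj by blast
    qed
    then show ?thesis by blast
  qed
  ultimately show False by simp
qed

lemma arc_meet_left:
  assumes X: "lconn nbr X u v" and Y: "lconn nbr Y s t"
    and Xb: "\<And>x. x \<in> X \<Longrightarrow> b \<le> fst x" and Yb: "\<And>y. y \<in> Y \<Longrightarrow> b \<le> fst y \<and> fst y \<le> a"
    and e: "a \<le> fst u" "fst v = b" "fst s = b" "fst t = b" "snd s \<le> snd v" "snd v \<le> snd t"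
  shows "X \<inter> Y \<noteq> {}"
proof -
  let ?h = "\<lambda>x::vertex. (- fst x, snd x)"
  have inj: "inj ?h" by (auto simp: inj_def prod_eq_iff)
  have "lconn nbr (?h ` X) (?h u) (?h v)" by (rule lconn_image[OF X]) (auto simp: nbr_def)
  moreover have "lconn nbr (?h ` Y) (?h s) (?h t)" by (rule lconn_image[OF Y]) (auto simp: nbr_def)
  ultimately have "?h ` X \<inter> ?h ` Y \<noteq> {}"
    by (rule arc_meet[of _ _ _ _ _ _ "- b" "- a"]) (use Xb Yb e in auto)
  then show ?thesis using inj by (auto simp: inj_eq prod_eq_iff)
qed

text \<open>If the order were reversed, a bottom-top connection could run up the column b + 1 to t,
  back along \<open>Y\<close> to s, and up the column a - 1. It would avoid \<open>X\<close> even
  after \<open>X\<close> is prolonged by one step on both sides, against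
  \<open>crossing_meet\<close>.\<close>

lemma disjoint_crossings_ordered:
  assumes X: "lconn nbr X u v" and Y: "lconn nbr Y s t"
    and XY: "X \<union> Y \<subseteq> {a..b} \<times> {c..d}" and disj: "X \<inter> Y = {}"
    and e: "fst u = a" "fst v = b" "fst s = a" "fst t = b" "snd u < snd s"
  shows "snd v < snd t"
proof (rule ccontr)
  assume not_lt: "\<not> snd v < snd t"
  have U: "u \<in> X" "v \<in> X" "s \<in> Y" "t \<in> Y" using lconn_in[OF X] lconn_in[OF Y] by auto
  then have "v \<noteq> t" using disj by auto
  then have lt: "snd t < snd v" using e not_lt by (auto simp: prod_eq_iff)
  have B: "c \<le> snd x \<and> snd x \<le> d \<and> a \<le> fst x \<and> fst x \<le> b" if "x \<in> X \<union> Y" for x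
    using XY that by (cases x) auto
  define X1 where "X1 = insert (a - 1, snd u) (insert (b + 1, snd v) X)"
  define Y1 where "Y1 = Y \<union> {(b + 1, i) |i. c \<le> i \<and> i \<le> snd t} \<union> {(a - 1, i) |i. snd s \<le> i \<and> i \<le> d}"
  have 1: "lconn nbr X1 (a - 1, snd u) (b + 1, snd v)"
  proof -
    have "lconn nbr X1 (a - 1, snd u) u" by (rule lconn_step1) (use e U in \<open>auto simp: X1_def nbr_def\<close>)
    moreover have "lconn nbr X1 u v" by (rule lconn_mono[OF X]) (auto simp: X1_def)
    ultimately have "lconn nbr X1 (a - 1, snd u) v" by (rule lconn_trans)
    then show ?thesis by (rule lconn_step) (use e in \<open>auto simp: X1_def nbr_def\<close>)
  qed
  have 2: "lconn nbr Y1 (b + 1, c) (a - 1, d)"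
  proof -
    have "lconn nbr Y1 (b + 1, c) (b + 1, snd t)"
      by (rule lconn_mono[OF lconn_vline]) (use B[of t] U in \<open>auto simp: Y1_def\<close>)
    also have "lconn nbr Y1 (b + 1, snd t) t"
      by (rule lconn_step1) (use e U B[of t] in \<open>auto simp: Y1_def nbr_def\<close>)
    also have "lconn nbr Y1 t s"
      by (rule lconn_mono[OF lconn_sym[OF Y]]) (auto simp: Y1_def intro: nbr_sym)
    also have "lconn nbr Y1 s (a - 1, snd s)"
      by (rule lconn_step1) (use e U B[of s] in \<open>auto simp: Y1_def nbr_def\<close>)
    also have "lconn nbr Y1 (a - 1, snd s) (a - 1, d)"
      by (rule lconn_mono[OF lconn_vline]) (use B[of s] U in \<open>auto simp: Y1_def\<close>)
    finally show ?thesis .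
  qed
  have ab: "a \<le> b" using B[of u] U e by auto
  have "X1 \<inter> Y1 \<noteq> {}"
  proof (rule crossing_meet[OF 1 2, of c d "a - 1" "b + 1"])
    show "c \<le> snd x \<and> snd x \<le> d" if "x \<in> X1" for x
      using that B[of x] B[of u] B[of v] U by (auto simp: X1_def)
    show "a - 1 \<le> fst y \<and> fst y \<le> b + 1" if "y \<in> Y1" for y
      using that B[of y] ab by (auto simp: Y1_def)
  qed auto
  moreover have "X1 \<inter> Y1 = {}"
  proof -
    have "False" if p: "p \<in> X1" "p \<in> Y1" for p
    proof (cases "p \<in> X")
      case True
      then have "fst p \<noteq> b + 1" "fst p \<noteq> a - 1" using B[of p] by auto
      then have "p \<in> Y" using p(2) by (auto simp: Y1_def)
      then show False using True disj by blast
    next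
      case False
      then have q: "p = (a - 1, snd u) \<or> p = (b + 1, snd v)" using p(1) by (auto simp: X1_def)
      then have "p \<notin> Y" using B[of p] ab by auto
      then have "p \<in> {(b + 1, i) |i. c \<le> i \<and> i \<le> snd t} \<or> p \<in> {(a - 1, i) |i. snd s \<le> i \<and> i \<le> d}"
        using p(2) by (auto simp: Y1_def)
      then show False using q lt e(5) ab by auto
    qed
    then show ?thesis by blast
  qed
  ultimately show False by simp
qed

section \<open>Planar duality\<close>

text \<open>The primal edge crossed by the dual edge \<open>e\<close>, when dual vertices are face
  centres with the shift (1/2, 1/2) suppressed.\<close>

definition dual_edge :: "edge \<Rightarrow> edge" where
  "dual_edge e = (if snd e then ((fst (fst e) + 1, snd (fst e)), False) else ((fst (fst e), snd (fst e) + 1), True))"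

text \<open>The dual vertex \<open>(i, j)\<close> stands for the centre \<open>(i + 1/2, j + 1/2)\<close> of a unit face; a dual edge
  is open when the primal edge it crosses is closed.\<close>

definition dualc :: "(edge \<Rightarrow> bool) \<Rightarrow> edge \<Rightarrow> bool" where
  "dualc w = (\<lambda>e. \<not> w (dual_edge e))"

lemma inj_dual_edge: "inj dual_edge"
  by (auto simp: inj_def dual_edge_def prod_eq_iff split: if_splits)

text \<open>The midpoint of an edge in the lattice refined by the factor 2, where primal vertices
  have even coordinates, dual vertices odd ones, and midpoints of edges mixed parity.\<close>

definition mid :: "edge \<Rightarrow> vertex" where
  "mid e = (if snd e then (2 * fst (fst e) + 1, 2 * snd (fst e)) else (2 * fst (fst e), 2 * snd (fst e) + 1))"

lemma mid_inj: "mid e = mid e' \<Longrightarrow> e = e'"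
  unfolding mid_def by (cases "snd e"; cases "snd e'") (simp_all add: prod_eq_iff, presburger+)

lemma open_adj_mid:
  assumes "open_adj w x y"
  shows "\<exists>e. w e \<and> mid e = (fst x + fst y, snd x + snd y)"
proof -
  have "w e \<Longrightarrow> mid e = (fst x + fst y, snd x + snd y) \<Longrightarrow> ?thesis" for e by blast
  from this[of "(x, True)"] this[of "(y, True)"] this[of "(x, False)"] this[of "(y, False)"]
  show ?thesis using assms unfolding open_adj_def by (elim disjE) (simp_all add: mid_def)
qed

lemma open_adj_dual_mid:
  assumes "open_adj (dualc w) x y"
  shows "\<exists>e. \<not> w e \<and> mid e = (fst x + fst y + 1, snd x + snd y + 1)"
proof -
  have "\<not> w e \<Longrightarrow> mid e = (fst x + fst y + 1, snd x + snd y + 1) \<Longrightarrow> ?thesis" for e by blast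
  from this[of "dual_edge (x, True)"] this[of "dual_edge (y, True)"] this[of "dual_edge (x, False)"] this[of "dual_edge (y, False)"]
  show ?thesis using assms unfolding open_adj_def dualc_def by (elim disjE) (simp_all add: mid_def dual_edge_def)
qed

lemma lconn_double:
  assumes "lconn r X u v" "\<And>x y. r x y \<Longrightarrow> nbr x y"
  shows "lconn nbr ({(2 * fst x + k, 2 * snd x + k) |x. x \<in> X} \<union> {(fst x + fst y + k, snd x + snd y + k) |x y. x \<in> X \<and> y \<in> X \<and> r x y})
    (2 * fst u + k, 2 * snd u + k) (2 * fst v + k, 2 * snd v + k)" (is "lconn nbr ?D _ _")
  using assms(1)
proof (induction rule: lconn_induct)
  case base
  then show ?case by (intro lconn_refl) auto
next
  case (step y z)
  have m: "(fst y + fst z + k, snd y + snd z + k) \<in> ?D" "(2 * fst z + k, 2 * snd z + k) \<in> ?D"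
    using step(2,3,4) by blast+
  have n: "nbr (2 * fst y + k, 2 * snd y + k) (fst y + fst z + k, snd y + snd z + k)"
    "nbr (fst y + fst z + k, snd y + snd z + k) (2 * fst z + k, 2 * snd z + k)"
    using assms(2)[OF step(3)] by (auto simp: nbr_def)
  show ?case by (rule lconn_step[OF lconn_step[OF step.IH n(1) m(1)] n(2) m(2)])
qed

text \<open>In the refined lattice both connections become lattice connections (shift 0 for the
  primal, 1 for the dual one), so they meet by \<open>crossing_meet\<close>. By parity the common
  point is a midpoint, of an edge that would be open and closed at once.\<close>

lemma primal_dual_no_crossing:
  assumes X: "lconn (open_adj w) X u v" and Y: "lconn (open_adj (dualc w)) Y s t"
    and Xb: "\<And>x. x \<in> X \<Longrightarrow> c \<le> snd x \<and> snd x \<le> d" and Yb: "\<And>y. y \<in> Y \<Longrightarrow> a \<le> fst y \<and> fst y \<le> b"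
    and e: "fst u \<le> a" "b + 1 \<le> fst v" "snd s \<le> c - 1" "d \<le> snd t"
  shows False
proof -
  let ?D = "{(2 * fst x + 0, 2 * snd x + 0) |x. x \<in> X} \<union> {(fst x + fst y + 0, snd x + snd y + 0) |x y. x \<in> X \<and> y \<in> X \<and> open_adj w x y}"
  let ?E = "{(2 * fst x + 1, 2 * snd x + 1) |x. x \<in> Y} \<union> {(fst x + fst y + 1, snd x + snd y + 1) |x y. x \<in> Y \<and> y \<in> Y \<and> open_adj (dualc w) x y}"
  have "?D \<inter> ?E \<noteq> {}"
  proof (rule crossing_meet[OF lconn_double[OF X open_adj_nbr, where k=0] lconn_double[OF Y open_adj_nbr, where k=1], where c="2 * c" and d="2 * d" and a="2 * a + 1" and b="2 * b + 1"])
    show "2 * c \<le> snd x \<and> snd x \<le> 2 * d" if "x \<in> ?D" for x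
      using that
    proof (elim UnE CollectE exE conjE)
      fix p assume "p \<in> X" "x = (2 * fst p + 0, 2 * snd p + 0)"
      then show ?thesis using Xb[of p] by simp
    next
      fix p q assume "p \<in> X" "q \<in> X" "x = (fst p + fst q + 0, snd p + snd q + 0)"
      then show ?thesis using Xb[of p] Xb[of q] by simp
    qed
    show "2 * a + 1 \<le> fst y \<and> fst y \<le> 2 * b + 1" if "y \<in> ?E" for y
      using that
    proof (elim UnE CollectE exE conjE)
      fix p assume "p \<in> Y" "y = (2 * fst p + 1, 2 * snd p + 1)"
      then show ?thesis using Yb[of p] by simp
    next
      fix p q assume "p \<in> Y" "q \<in> Y" "y = (fst p + fst q + 1, snd p + snd q + 1)"
      then show ?thesis using Yb[of p] Yb[of q] by simp
    qed
  qed (use e in auto)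
  then obtain p where p: "p \<in> ?D" "p \<in> ?E" by blast
  have 1: "(even (fst p) \<and> even (snd p)) \<or> (\<exists>e. w e \<and> mid e = p)"
    using p(1) open_adj_mid[of w] by fastforce
  have 2: "(odd (fst p) \<and> odd (snd p)) \<or> (\<exists>e. \<not> w e \<and> mid e = p)"
    using p(2) open_adj_dual_mid[of w] by fastforce
  have 3: "even (fst (mid e)) \<noteq> even (snd (mid e))" for e by (simp add: mid_def)
  show False using 1 2 3 mid_inj by metis
qed

lemma bit_add_self: "(x::bit) + x = 0"
  by (cases x) auto

lemma bit_telescope:
  fixes x :: "int \<Rightarrow> bit"
  assumes "c \<le> d"
  shows "(\<Sum>j\<in>{c..<d}. x j + x (j + 1)) = x c + x d"
  using assms
proof (induction d rule: int_ge_induct)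
  case base
  show ?case by (simp add: bit_add_self)
next
  case (step d)
  have "{c..<d + 1} = insert d {c..<d}" using step by auto
  then have "(\<Sum>j\<in>{c..<d + 1}. x j + x (j + 1)) = (x d + x (d + 1)) + (\<Sum>j\<in>{c..<d}. x j + x (j + 1))"
    by (simp only:) (rule sum.insert, auto)
  also have "\<dots> = (x d + x (d + 1)) + (x c + x d)" by (simp only: step.IH)
  also have "\<dots> = x c + x (d + 1) + (x d + x d)" by (simp only: ac_simps)
  finally show ?case by (simp only: bit_add_self add_0_right)
qed

text \<open>Summing, modulo 2, the boundary edges of the cluster of the left side around every face
  that is dual-reachable from the bottom row.\<close>

lemma no_crossing_imp_dual_crossing:
  assumes ab: "a < b" and cd: "c \<le> d"
    and no: "\<And>u v. fst u = a \<Longrightarrow> fst v = b \<Longrightarrow> \<not> lconn (open_adj w) ({a..b} \<times> {c..d}) u v"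
  shows "\<exists>s t. snd s = c - 1 \<and> snd t = d \<and> lconn (open_adj (dualc w)) ({a..b - 1} \<times> {c - 1..d}) s t"
proof (rule ccontr)
  assume neg: "\<not> ?thesis"
  define R where "R = {a..b} \<times> {c..d}"
  define F where "F = {a..b - 1} \<times> {c - 1..d}"
  define C where "C v \<longleftrightarrow> (\<exists>u. fst u = a \<and> lconn (open_adj w) R u v)" for v
  define K where "K f \<longleftrightarrow> (\<exists>s. snd s = c - 1 \<and> lconn (open_adj (dualc w)) F s f)" for f
  define S where "S i j = (of_bool (C (i, j)) :: bit)" for i j
  define k where "k i j = (of_bool (K (i, j)) :: bit)" for i j
  define h where "h i j = S i j + S (i + 1) j" for i j
  define v where "v i j = S i j + S i (j + 1)" for i j
  have Cstep: "C y" if "C x" "open_adj w x y" "y \<in> R" for x y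
    using that lconn_step[of "open_adj w" R _ x y] unfolding C_def by auto
  have Kstep: "K y" if "K x" "open_adj (dualc w) x y" "y \<in> F" for x y
    using that lconn_step[of "open_adj (dualc w)" F _ x y] unfolding K_def by auto
  have Cleft: "S a j = 1" if "c \<le> j" "j \<le> d" for j
  proof -
    have "C (a, j)" unfolding C_def
      by (intro exI[of _ "(a, j)"]) (use that ab in \<open>auto intro!: lconn_refl simp: R_def\<close>)
    then show ?thesis by (simp add: S_def)
  qed
  have Cright: "S b j = 0" for j
    using no by (auto simp: S_def C_def R_def)
  have Kbot: "k i (c - 1) = 1" if "a \<le> i" "i < b" for i
  proof -
    have "K (i, c - 1)" unfolding K_def
      by (intro exI[of _ "(i, c - 1)"]) (use that cd in \<open>auto intro!: lconn_refl simp: F_def\<close>)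
    then show ?thesis by (simp add: k_def)
  qed
  have Ktop: "k i d = 0" for i
    using neg by (auto simp: k_def K_def F_def)
  \<comment> \<open>A horizontal edge in the boundary of the cluster \<open>C\<close> is closed, so
    the dual edge across it is open and the two faces beside it are both dual-reachable or both not.
    The same reason gives \<open>vk\<close> for vertical edges.\<close>
  have hk: "k i (j - 1) * h i j = k i j * h i j" if "a \<le> i" "i < b" "c \<le> j" "j \<le> d" for i j
  proof (cases "C (i, j) = C (i + 1, j)")
    case True
    then show ?thesis by (simp add: h_def S_def bit_add_self)
  next
    case False
    have mem: "(i, j) \<in> R" "(i + 1, j) \<in> R" "(i, j - 1) \<in> F" "(i, j) \<in> F" using that by (auto simp: R_def F_def)
    have "\<not> w ((i, j), True)"
      using False Cstep[of "(i, j)" "(i + 1, j)"] Cstep[of "(i + 1, j)" "(i, j)"] mem by (auto simp: open_adj_def)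
    then have "open_adj (dualc w) (i, j - 1) (i, j)" by (auto simp: open_adj_def dualc_def dual_edge_def)
    then have "K (i, j - 1) = K (i, j)" using Kstep mem open_adj_sym by blast
    then show ?thesis by (simp add: k_def)
  qed
  have vk: "k i j * v (i + 1) j = k (i + 1) j * v (i + 1) j" if "a \<le> i" "i + 1 < b" "c \<le> j" "j < d" for i j
  proof (cases "C (i + 1, j) = C (i + 1, j + 1)")
    case True
    then show ?thesis by (simp add: v_def S_def bit_add_self)
  next
    case False
    have mem: "(i + 1, j) \<in> R" "(i + 1, j + 1) \<in> R" "(i, j) \<in> F" "(i + 1, j) \<in> F" using that by (auto simp: R_def F_def)
    have "\<not> w ((i + 1, j), False)"
      using False Cstep[of "(i + 1, j)" "(i + 1, j + 1)"] Cstep[of "(i + 1, j + 1)" "(i + 1, j)"] mem by (auto simp: open_adj_def)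
    then have "open_adj (dualc w) (i, j) (i + 1, j)" by (auto simp: open_adj_def dualc_def dual_edge_def)
    then have "K (i, j) = K (i + 1, j)" using Kstep mem open_adj_sym by blast
    then show ?thesis by (simp add: k_def)
  qed
  have face: "h i j + h i (j + 1) + (v i j + v (i + 1) j) = 0" for i j
  proof -
    have "h i j + h i (j + 1) + (v i j + v (i + 1) j) =
      (S i j + S i j) + (S (i + 1) j + S (i + 1) j) + (S i (j + 1) + S i (j + 1)) + (S (i + 1) (j + 1) + S (i + 1) (j + 1))"
      unfolding h_def v_def by (simp only: ac_simps)
    then show ?thesis by (simp only: bit_add_self add_0_right)
  qed
  define x where "x i j = k i j * h i j" for i j
  \<comment> \<open>There is no column of faces at i = b, hence the value 0 there; the cut-off lets
    the sum over i telescope.\<close>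
  define y where "y i j = (if i < b then k i j * v i j else 0)" for i j
  \<comment> \<open>Every face contributes 0. Regrouped by edges, the vertical ones cancel
    completely and the horizontal ones leave only the bottom row, whose sum is S a c + S b c =
    1.\<close>
  have "0 = (\<Sum>i\<in>{a..<b}. \<Sum>j\<in>{c..<d}. k i j * (h i j + h i (j + 1) + (v i j + v (i + 1) j)))"
    by (simp only: face mult_zero_right sum.neutral_const)
  also have "\<dots> = (\<Sum>i\<in>{a..<b}. \<Sum>j\<in>{c..<d}. (x i j + x i (j + 1)) + (y i j + y (i + 1) j))"
  proof (intro sum.cong refl)
    fix i j assume i: "i \<in> {a..<b}" and j: "j \<in> {c..<d}"
    have "k i j * h i (j + 1) = x i (j + 1)" using hk[of i "j + 1"] i j by (simp add: x_def)
    moreover have "k i j * v (i + 1) j = y (i + 1) j"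
    proof (cases "i + 1 < b")
      case True
      then show ?thesis using vk[of i j] i j by (simp add: y_def)
    next
      case False
      then have "i + 1 = b" using i by auto
      then show ?thesis using Cright by (simp add: y_def v_def)
    qed
    moreover have "k i j * v i j = y i j" using i by (simp add: y_def)
    ultimately show "k i j * (h i j + h i (j + 1) + (v i j + v (i + 1) j)) = (x i j + x i (j + 1)) + (y i j + y (i + 1) j)"
      by (simp only: distrib_left x_def)
  qed
  also have "\<dots> = (\<Sum>i\<in>{a..<b}. \<Sum>j\<in>{c..<d}. x i j + x i (j + 1)) + (\<Sum>i\<in>{a..<b}. \<Sum>j\<in>{c..<d}. y i j + y (i + 1) j)"
    by (simp only: sum.distrib)
  also have "(\<Sum>i\<in>{a..<b}. \<Sum>j\<in>{c..<d}. y i j + y (i + 1) j) = (\<Sum>j\<in>{c..<d}. \<Sum>i\<in>{a..<b}. y i j + y (i + 1) j)"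
    by (rule sum.swap)
  also have "(\<Sum>j\<in>{c..<d}. \<Sum>i\<in>{a..<b}. y i j + y (i + 1) j) = (\<Sum>j\<in>{c..<d}. y a j + y b j)"
    by (intro sum.cong refl bit_telescope[of a b "\<lambda>i. y i _"]) (use ab in auto)
  also have "\<dots> = 0"
  proof (intro sum.neutral ballI)
    fix j assume "j \<in> {c..<d}"
    then have "v a j = 0" using Cleft[of j] Cleft[of "j + 1"] by (simp add: v_def bit_add_self)
    then show "y a j + y b j = 0" by (simp add: y_def)
  qed
  also have "(\<Sum>i\<in>{a..<b}. \<Sum>j\<in>{c..<d}. x i j + x i (j + 1)) = (\<Sum>i\<in>{a..<b}. x i c + x i d)"
    by (intro sum.cong refl bit_telescope cd)
  also have "\<dots> = (\<Sum>i\<in>{a..<b}. S i c + S (i + 1) c)"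
  proof (intro sum.cong refl)
    fix i assume i: "i \<in> {a..<b}"
    have "x i d = 0" by (simp add: x_def Ktop)
    moreover have "x i c = h i c"
    proof -
      have "x i c = k i (c - 1) * h i c" unfolding x_def by (rule hk[symmetric]) (use i cd in auto)
      then show ?thesis using Kbot[of i] i by (simp only: atLeastLessThan_iff mult_1)
    qed
    ultimately show "x i c + x i d = S i c + S (i + 1) c" by (simp add: h_def)
  qed
  also have "\<dots> = S a c + S b c"
    by (rule bit_telescope) (use ab in simp)
  also have "\<dots> = 1" using Cleft[of c] Cright cd by simp
  finally show False by simp
qed

section \<open>Crossing events\<close>

definition ein :: "vertex set \<Rightarrow> edge set" where
  "ein R = {e. fst e \<in> R \<and> (if snd e then (fst (fst e) + 1, snd (fst e)) else (fst (fst e), snd (fst e) + 1)) \<in> R}"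

definition cross :: "(edge \<Rightarrow> bool) \<Rightarrow> vertex set \<Rightarrow> vertex set \<Rightarrow> vertex set \<Rightarrow> bool" where
  "cross w R A B \<longleftrightarrow> (\<exists>u\<in>A. \<exists>v\<in>B. lconn (open_adj w) R u v)"

lemma finite_ein: "finite R \<Longrightarrow> finite (ein R)"
  by (rule finite_subset[of _ "R \<times> UNIV"]) (auto simp: ein_def)

lemma ein_mono: "R \<subseteq> R' \<Longrightarrow> ein R \<subseteq> ein R'"
  by (auto simp: ein_def split: if_splits)

lemma ein_Int: "ein R \<inter> ein R' \<subseteq> ein (R \<inter> R')"
  by (auto simp: ein_def split: if_splits)

lemma ein_empty [simp]: "ein {} = {}"
  by (auto simp: ein_def)

lemma open_adj_cong:
  assumes "\<And>e. e \<in> ein R \<Longrightarrow> w e = w' e" "x \<in> R" "y \<in> R"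
  shows "open_adj w x y = open_adj w' x y"
proof -
  have "w (x, True) = w' (x, True)" if "y = (fst x + 1, snd x)" by (rule assms(1)) (use that assms in \<open>auto simp: ein_def\<close>)
  moreover have "w (y, True) = w' (y, True)" if "x = (fst y + 1, snd y)" by (rule assms(1)) (use that assms in \<open>auto simp: ein_def\<close>)
  moreover have "w (x, False) = w' (x, False)" if "y = (fst x, snd x + 1)" by (rule assms(1)) (use that assms in \<open>auto simp: ein_def\<close>)
  moreover have "w (y, False) = w' (y, False)" if "x = (fst y, snd y + 1)" by (rule assms(1)) (use that assms in \<open>auto simp: ein_def\<close>)
  ultimately show ?thesis unfolding open_adj_def by blast
qed

lemma open_adj_incr: "open_adj w x y \<Longrightarrow> (\<And>e. w e \<Longrightarrow> w' e) \<Longrightarrow> open_adj w' x y"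
  unfolding open_adj_def by blast

lemma lconn_cong:
  assumes "\<And>e. e \<in> ein R \<Longrightarrow> w e = w' e"
  shows "lconn (open_adj w) R u v = lconn (open_adj w') R u v"
proof
  show "lconn (open_adj w) R u v \<Longrightarrow> lconn (open_adj w') R u v"
    by (erule lconn_mono) (use open_adj_cong[of R w w', OF assms] in auto)
  show "lconn (open_adj w') R u v \<Longrightarrow> lconn (open_adj w) R u v"
    by (erule lconn_mono) (use open_adj_cong[of R w w', OF assms] in auto)
qed

lemma lconn_incr: "lconn (open_adj w) R u v \<Longrightarrow> (\<And>e. w e \<Longrightarrow> w' e) \<Longrightarrow> lconn (open_adj w') R u v"
  by (erule lconn_mono) (auto intro: open_adj_incr)

lemma dep_lconn: "dep (ein R) (\<lambda>w. lconn (open_adj w) R u v)"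
  unfolding dep_def using lconn_cong by blast

lemma dep_cross: "dep (ein R) (\<lambda>w. cross w R A B)"
  unfolding dep_def cross_def using lconn_cong by blast

lemma incr_cross: "incr (\<lambda>w. cross w R A B)"
  unfolding incr_def cross_def le_bool_def using lconn_incr by blast

lemma incr_lconn: "incr (\<lambda>w. lconn (open_adj w) R u v)"
  unfolding incr_def le_bool_def using lconn_incr by blast

lemma cross_mono:
  assumes "cross w R A B" "R \<subseteq> R'" "A \<inter> R \<subseteq> A'" "B \<inter> R \<subseteq> B'"
  shows "cross w R' A' B'"
proof -
  obtain u v where uv: "u \<in> A" "v \<in> B" "lconn (open_adj w) R u v" using assms(1) by (auto simp: cross_def)
  have "u \<in> A'" "v \<in> B'" using lconn_in[OF uv(3)] uv assms by auto
  moreover have "lconn (open_adj w) R' u v" by (rule lconn_mono[OF uv(3)]) (use assms in auto)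
  ultimately show ?thesis by (auto simp: cross_def)
qed

section \<open>Symmetries of the lattice and of the measure\<close>

definition aut :: "(vertex \<Rightarrow> vertex) \<Rightarrow> bool" where
  "aut \<tau> \<longleftrightarrow> inj \<tau> \<and> (\<exists>\<epsilon>. inj \<epsilon> \<and> (\<forall>w u v. open_adj (\<lambda>e. w (\<epsilon> e)) u v = open_adj w (\<tau> u) (\<tau> v)))"

lemma aut_comp:
  assumes "aut \<tau>" "aut \<sigma>"
  shows "aut (\<lambda>u. \<tau> (\<sigma> u))"
proof -
  obtain \<epsilon> \<delta> where 1: "inj \<epsilon>" "\<And>w u v. open_adj (\<lambda>e. w (\<epsilon> e)) u v = open_adj w (\<tau> u) (\<tau> v)"
    and 2: "inj \<delta>" "\<And>w u v. open_adj (\<lambda>e. w (\<delta> e)) u v = open_adj w (\<sigma> u) (\<sigma> v)"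
    using assms unfolding aut_def by metis
  have "inj (\<lambda>e. \<epsilon> (\<delta> e))" using inj_compose[OF 1(1) 2(1)] by (simp add: comp_def)
  moreover have "open_adj (\<lambda>e. w (\<epsilon> (\<delta> e))) u v = open_adj w (\<tau> (\<sigma> u)) (\<tau> (\<sigma> v))" for w u v
    using 2(2)[of "\<lambda>e. w (\<epsilon> e)" u v] 1(2)[of w "\<sigma> u" "\<sigma> v"] by simp
  moreover have "inj (\<lambda>u. \<tau> (\<sigma> u))" using inj_compose[of \<tau> \<sigma>] assms by (simp add: comp_def aut_def)
  ultimately show ?thesis unfolding aut_def by (intro conjI exI[of _ "\<lambda>e. \<epsilon> (\<delta> e)"]) auto
qed

lemma aut_translate: "aut (\<lambda>u. (fst u + a, snd u + b))"
  unfolding aut_def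
proof (intro conjI exI allI)
  show "inj (\<lambda>u::vertex. (fst u + a, snd u + b))" by (auto simp: inj_def prod_eq_iff)
  show "inj (\<lambda>e::edge. ((fst (fst e) + a, snd (fst e) + b), snd e))" by (auto simp: inj_def prod_eq_iff)
  fix w u v
  show "open_adj (\<lambda>e. w ((fst (fst e) + a, snd (fst e) + b), snd e)) u v = open_adj w (fst u + a, snd u + b) (fst v + a, snd v + b)"
    by (cases u; cases v) (auto simp: open_adj_def add.commute add.left_commute)
qed

lemma aut_transpose: "aut (\<lambda>u. (snd u, fst u))"
  unfolding aut_def
proof (intro conjI exI allI)
  show "inj (\<lambda>u::vertex. (snd u, fst u))" by (auto simp: inj_def prod_eq_iff)
  show "inj (\<lambda>e::edge. ((snd (fst e), fst (fst e)), \<not> snd e))" by (auto simp: inj_def prod_eq_iff)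
  fix w u v
  show "open_adj (\<lambda>e. w ((snd (fst e), fst (fst e)), \<not> snd e)) u v = open_adj w (snd u, fst u) (snd v, fst v)"
    by (cases u; cases v) (auto simp: open_adj_def)
qed

lemma aut_reflect0: "aut (\<lambda>u. (- fst u, snd u))"
  unfolding aut_def
proof (intro conjI exI allI)
  show "inj (\<lambda>u::vertex. (- fst u, snd u))" by (auto simp: inj_def prod_eq_iff)
  \<comment> \<open>An edge is stored at its left end, and the reflection turns the right end into
    the left one: hence the extra -1 for horizontal edges only.\<close>
  show "inj (\<lambda>e::edge. (if snd e then ((- fst (fst e) - 1, snd (fst e)), True) else ((- fst (fst e), snd (fst e)), False)))"
    by (auto simp: inj_def prod_eq_iff split: if_splits)
  fix w u v
  show "open_adj (\<lambda>e. w (if snd e then ((- fst (fst e) - 1, snd (fst e)), True) else ((- fst (fst e), snd (fst e)), False))) u v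
    = open_adj w (- fst u, snd u) (- fst v, snd v)"
    by (cases u; cases v) (auto simp: open_adj_def)
qed

lemma aut_reflect_x: "aut (\<lambda>u. (c - fst u, snd u))"
  using aut_comp[OF aut_translate[of c 0] aut_reflect0] by simp

lemma aut_reflect_y: "aut (\<lambda>u. (fst u, c - snd u))"
  using aut_comp[OF aut_transpose aut_comp[OF aut_reflect_x[of c] aut_transpose]] by simp

lemma cross_aut:
  assumes "aut \<tau>" "finite R" "0 \<le> p" "p \<le> 1"
  shows "PP (\<lambda>_. p) (\<lambda>w. cross w (\<tau> ` R) (\<tau> ` A) (\<tau> ` B)) = PP (\<lambda>_. p) (\<lambda>w. cross w R A B)"
proof -
  obtain \<epsilon> where inj: "inj \<tau>" and 1: "inj \<epsilon>" "\<And>w u v. open_adj (\<lambda>e. w (\<epsilon> e)) u v = open_adj w (\<tau> u) (\<tau> v)"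
    using assms(1) unfolding aut_def by metis
  have lc: "lconn (open_adj w) (\<tau> ` R) (\<tau> u) (\<tau> v) = lconn (open_adj (\<lambda>e. w (\<epsilon> e))) R u v" for w u v
  proof
    assume "lconn (open_adj w) (\<tau> ` R) (\<tau> u) (\<tau> v)"
    then have "lconn (open_adj (\<lambda>e. w (\<epsilon> e))) R (inv \<tau> (\<tau> u)) (inv \<tau> (\<tau> v))"
      by (rule lconn_image) (auto simp: 1(2) inj)
    then show "lconn (open_adj (\<lambda>e. w (\<epsilon> e))) R u v" by (simp add: inj)
  next
    assume "lconn (open_adj (\<lambda>e. w (\<epsilon> e))) R u v"
    then show "lconn (open_adj w) (\<tau> ` R) (\<tau> u) (\<tau> v)"
      by (rule lconn_image) (auto simp: 1(2))
  qed
  have eq: "cross w (\<tau> ` R) (\<tau> ` A) (\<tau> ` B) = cross (\<lambda>e. w (\<epsilon> e)) R A B" for w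
    unfolding cross_def using lc by auto
  show ?thesis unfolding eq
    by (rule EE_bij_reindex[OF finite_ein[OF assms(2)] dep_comp[OF dep_cross] 1(1) assms(3,4)])
qed

lemma cross_dual:
  assumes "finite R" "0 \<le> p" "p \<le> 1"
  shows "PP (\<lambda>_. p) (\<lambda>w. cross (dualc w) R A B) = PP (\<lambda>_. 1 - p) (\<lambda>w. cross w R A B)"
  unfolding dualc_def
  by (rule EE_flip_reindex[OF finite_ein[OF assms(1)] dep_comp[OF dep_cross] inj_dual_edge assms(2,3)])

section \<open>Box crossings at the self-dual point\<close>

text \<open>Keeps the part after the last entry into the region c \<le> f. As f rises by at most 1
  in a step, the region is entered exactly at level c.\<close>

lemma lconn_truncate_start:
  assumes "lconn r R u v" "\<And>x y. r x y \<Longrightarrow> f y \<le> f x + (1::int)" "f u \<le> c" "c \<le> f v"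
  shows "\<exists>u'. f u' = c \<and> lconn r {x \<in> R. c \<le> f x} u' v"
proof -
  have "c \<le> f v \<longrightarrow> (\<exists>u'. f u' = c \<and> lconn r {x \<in> R. c \<le> f x} u' v)"
    using assms(1)
  proof (induction rule: lconn_induct)
    case base
    then show ?case using assms(3) by (auto intro!: exI[of _ u] lconn_refl)
  next
    case (step y z)
    show ?case
    proof
      assume cz: "c \<le> f z"
      show "\<exists>u'. f u' = c \<and> lconn r {x \<in> R. c \<le> f x} u' z"
      proof (cases "c \<le> f y")
        case True
        then obtain u' where "f u' = c" "lconn r {x \<in> R. c \<le> f x} u' y" using step.IH by blast
        moreover from this(2) have "lconn r {x \<in> R. c \<le> f x} u' z"
          by (rule lconn_step) (use step cz in auto)
        ultimately show ?thesis by blast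
      next
        case False
        then have "f z = c" using assms(2)[OF step(3)] cz by simp
        then show ?thesis using step by (auto intro!: exI[of _ z] lconn_refl)
      qed
    qed
  qed
  then show ?thesis using assms(4) by blast
qed

lemma lconn_truncate_end:
  assumes "lconn r R u v" "\<And>x y. r x y \<Longrightarrow> f y \<le> f x + (1::int)" "f u \<le> c" "c \<le> f v"
  shows "\<exists>v'. f v' = c \<and> lconn r {x \<in> R. f x \<le> c} u v'"
proof -
  let ?R = "{x \<in> R. f x \<le> c}"
  have "(\<exists>v'. f v' = c \<and> lconn r ?R u v') \<or> (f v < c \<and> lconn r ?R u v)"
    using assms(1)
  proof (induction rule: lconn_induct)
    case base
    then have "lconn r ?R u u" using assms(3) by (intro lconn_refl) auto
    then show ?case using assms(3) by (cases "f u = c") auto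
  next
    case (step y z)
    show ?case
    proof (cases "\<exists>v'. f v' = c \<and> lconn r ?R u v'")
      case False
      then have y: "f y < c" "lconn r ?R u y" using step.IH by auto
      have "lconn r ?R u z" by (rule lconn_step[OF y(2)]) (use step y assms(2)[of y z] in auto)
      moreover have "f z \<le> c" using y assms(2)[OF step(3)] by simp
      ultimately show ?thesis by (cases "f z = c") auto
    qed auto
  qed
  then show ?thesis using assms(4) by auto
qed

lemma lconn_cluster: "lconn r R u v \<Longrightarrow> lconn r {x. lconn r R u x} u v"
proof (induction rule: lconn_induct)
  case base
  then show ?case by (auto intro!: lconn_refl)
next
  case (step y z)
  show ?case by (rule lconn_step[OF step.IH step(3)]) (use lconn_step[OF step(1,3,4)] in simp)
qed

lemma lconn_nbr_cluster:
  assumes "lconn (open_adj w) R u v"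
  shows "lconn nbr {x. lconn (open_adj w) R u x} u v"
  by (rule lconn_mono[OF lconn_cluster[OF assms]]) (auto intro: open_adj_nbr)

lemma crossI: "u \<in> A \<Longrightarrow> v \<in> B \<Longrightarrow> lconn (open_adj w) R u v \<Longrightarrow> cross w R A B"
  unfolding cross_def by blast

lemma open_join:
  assumes "lconn (open_adj w) R u x" "lconn (open_adj w) R' s x" "R \<union> R' \<subseteq> Q"
  shows "lconn (open_adj w) Q u s"
proof -
  have "lconn (open_adj w) Q u x" by (rule lconn_mono[OF assms(1)]) (use assms(3) in auto)
  also have "lconn (open_adj w) Q x s" by (rule lconn_mono[OF lconn_open_sym[OF assms(2)]]) (use assms(3) in auto)
  finally show ?thesis .
qed

lemma open_meet:
  assumes X: "lconn (open_adj w) R u v" and Y: "lconn (open_adj w) R' s t"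
    and "\<And>x. x \<in> R \<Longrightarrow> c \<le> snd x \<and> snd x \<le> d" "\<And>y. y \<in> R' \<Longrightarrow> a \<le> fst y \<and> fst y \<le> b"
    and "fst u \<le> a" "b \<le> fst v" "snd s \<le> c" "d \<le> snd t" "R \<union> R' \<subseteq> Q"
  shows "lconn (open_adj w) Q u s"
proof -
  have "{x. lconn (open_adj w) R u x} \<inter> {x. lconn (open_adj w) R' s x} \<noteq> {}"
    by (rule crossing_meet[OF lconn_nbr_cluster[OF X] lconn_nbr_cluster[OF Y], of c d a b])
       (use assms(3-8) lconn_in[of "open_adj w" R u] lconn_in[of "open_adj w" R' s] in auto)
  then obtain x where "lconn (open_adj w) R u x" "lconn (open_adj w) R' s x" by blast
  then show ?thesis by (rule open_join[OF _ _ assms(9)])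
qed

lemma open_arc_meet:
  assumes X: "lconn (open_adj w) R u v" and Y: "lconn (open_adj w) R' s t"
    and "\<And>x. x \<in> R \<Longrightarrow> fst x \<le> b" "\<And>y. y \<in> R' \<Longrightarrow> a \<le> fst y \<and> fst y \<le> b"
    and "fst u \<le> a" "fst v = b" "fst s = b" "fst t = b" "snd s \<le> snd v" "snd v \<le> snd t" "R \<union> R' \<subseteq> Q"
  shows "lconn (open_adj w) Q u s"
proof -
  have "{x. lconn (open_adj w) R u x} \<inter> {x. lconn (open_adj w) R' s x} \<noteq> {}"
    by (rule arc_meet[OF lconn_nbr_cluster[OF X] lconn_nbr_cluster[OF Y], of b a])
       (use assms(3-10) lconn_in[of "open_adj w" R u] lconn_in[of "open_adj w" R' s] in auto)
  then obtain x where "lconn (open_adj w) R u x" "lconn (open_adj w) R' s x" by blast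
  then show ?thesis by (rule open_join[OF _ _ assms(11)])
qed

lemma open_arc_meet_left:
  assumes X: "lconn (open_adj w) R u v" and Y: "lconn (open_adj w) R' s t"
    and "\<And>x. x \<in> R \<Longrightarrow> b \<le> fst x" "\<And>y. y \<in> R' \<Longrightarrow> b \<le> fst y \<and> fst y \<le> a"
    and "a \<le> fst u" "fst v = b" "fst s = b" "fst t = b" "snd s \<le> snd v" "snd v \<le> snd t" "R \<union> R' \<subseteq> Q"
  shows "lconn (open_adj w) Q u s"
proof -
  have "{x. lconn (open_adj w) R u x} \<inter> {x. lconn (open_adj w) R' s x} \<noteq> {}"
    by (rule arc_meet_left[OF lconn_nbr_cluster[OF X] lconn_nbr_cluster[OF Y], of b a])
       (use assms(3-10) lconn_in[of "open_adj w" R u] lconn_in[of "open_adj w" R' s] in auto)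
  then obtain x where "lconn (open_adj w) R u x" "lconn (open_adj w) R' s x" by blast
  then show ?thesis by (rule open_join[OF _ _ assms(11)])
qed

abbreviation PH :: "((edge \<Rightarrow> bool) \<Rightarrow> bool) \<Rightarrow> real" where
  "PH A \<equiv> PP (\<lambda>_. 1/2) A"

text \<open>What positive correlation requires of an event, in one predicate that is stable under
  conjunction.\<close>

definition ev :: "vertex set \<Rightarrow> ((edge \<Rightarrow> bool) \<Rightarrow> bool) \<Rightarrow> bool" where
  "ev R A \<longleftrightarrow> finite R \<and> dep (ein R) A \<and> incr A"

lemma ev_cross: "finite R \<Longrightarrow> ev R (\<lambda>w. cross w R A B)"
  unfolding ev_def using dep_cross incr_cross by simp

lemma ev_mono_region:
  assumes "ev R A" "R \<subseteq> R'" "finite R'"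
  shows "ev R' A"
  using assms dep_mono[OF _ ein_mono[OF assms(2)], of A] unfolding ev_def by simp

lemma incr_conj: "incr A \<Longrightarrow> incr B \<Longrightarrow> incr (\<lambda>w. A w \<and> B w)"
  unfolding incr_def le_bool_def by meson

lemma ev_conj:
  assumes "ev R A" "ev R' B"
  shows "ev (R \<union> R') (\<lambda>w. A w \<and> B w)"
proof -
  have "ev (R \<union> R') A" by (rule ev_mono_region[OF assms(1)]) (use assms in \<open>auto simp: ev_def\<close>)
  moreover have "ev (R \<union> R') B" by (rule ev_mono_region[OF assms(2)]) (use assms in \<open>auto simp: ev_def\<close>)
  ultimately show ?thesis unfolding ev_def using dep_comp2[of "ein (R \<union> R')" A B "(\<and>)"] incr_conj[of A B] by simp
qed

lemma PP_nonneg: "0 \<le> PP r A"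
  by (rule integral_nonneg_AE) simp

lemma PP_mono:
  assumes "finite E" "dep E A" "dep E B" "\<And>w. A w \<Longrightarrow> B w"
  shows "PP r A \<le> PP r B"
  by (rule EE_mono[OF assms(1) dep_comp[OF assms(2)] dep_comp[OF assms(3)]]) (use assms(4) in auto)

lemma PP_le_1:
  assumes "finite E" "dep E A"
  shows "PP r A \<le> 1"
  using EE_mono[OF assms(1) dep_comp[OF assms(2)] dep_const, of of_bool 1 r] by simp

lemma PP_union:
  assumes "finite E" "dep E A" "dep E B" "dep E C" "\<And>w. A w \<Longrightarrow> B w \<or> C w"
  shows "PP r A \<le> PP r B + PP r C"
proof -
  have i: "integrable (percf r) (\<lambda>w. of_bool (B w) :: real)" "integrable (percf r) (\<lambda>w. of_bool (C w) :: real)"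
    using dep_integrable[OF assms(1) dep_comp[OF assms(3)]] dep_integrable[OF assms(1) dep_comp[OF assms(4)]] by auto
  have "PP r A \<le> EE r (\<lambda>w. of_bool (B w) + of_bool (C w))"
    by (rule EE_mono[OF assms(1) dep_comp[OF assms(2)] dep_comp2[OF assms(3,4)]]) (use assms(5) in auto)
  then show ?thesis using i by simp
qed

lemma ev_mono:
  assumes "ev R A" "ev R' B" "\<And>w. A w \<Longrightarrow> B w"
  shows "PH A \<le> PH B"
proof (rule PP_mono[of "ein (R \<union> R')"])
  show "finite (ein (R \<union> R'))" using assms by (auto simp: ev_def intro: finite_ein)
  show "dep (ein (R \<union> R')) A" "dep (ein (R \<union> R')) B"
    using assms dep_mono[OF _ ein_mono, of R A "R \<union> R'"] dep_mono[OF _ ein_mono, of R' B "R \<union> R'"] by (auto simp: ev_def)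
qed (use assms in auto)

lemma ev_FKG:
  assumes "ev R A" "ev R' B" "a \<le> PH A" "b \<le> PH B" "0 \<le> a" "0 \<le> b"
  shows "a * b \<le> PH (\<lambda>w. A w \<and> B w)"
proof -
  have "a * b \<le> PH A * PH B" using assms by (intro mult_mono) auto
  also have "\<dots> \<le> PH (\<lambda>w. A w \<and> B w)"
  proof (rule FKG[of "ein (R \<union> R')"])
    show "finite (ein (R \<union> R'))" using assms by (auto simp: ev_def intro: finite_ein)
    show "dep (ein (R \<union> R')) A" "dep (ein (R \<union> R')) B"
      using assms dep_mono[OF _ ein_mono, of R A "R \<union> R'"] dep_mono[OF _ ein_mono, of R' B "R \<union> R'"] by (auto simp: ev_def)
  qed (use assms in \<open>auto simp: ev_def\<close>)
  finally show ?thesis .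
qed

lemma cross_aut_inverse:
  assumes "aut \<tau>" "\<And>u. \<sigma> (\<tau> u) = u" "\<And>u. \<tau> (\<sigma> u) = u" "finite R" "0 \<le> p" "p \<le> 1"
    "\<And>u. u \<in> R' \<longleftrightarrow> \<sigma> u \<in> R" "\<And>u. u \<in> A' \<longleftrightarrow> \<sigma> u \<in> A" "\<And>u. u \<in> B' \<longleftrightarrow> \<sigma> u \<in> B"
  shows "PP (\<lambda>_. p) (\<lambda>w. cross w R' A' B') = PP (\<lambda>_. p) (\<lambda>w. cross w R A B)"
proof -
  have im: "X' = \<tau> ` X" if "\<And>u. u \<in> X' \<longleftrightarrow> \<sigma> u \<in> X" for X X'
  proof
    show "X' \<subseteq> \<tau> ` X" using that assms(3) by (metis image_eqI subsetI)
    show "\<tau> ` X \<subseteq> X'"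
    proof
      fix y assume "y \<in> \<tau> ` X"
      then obtain x where "x \<in> X" "y = \<tau> x" by blast
      then show "y \<in> X'" using that[of y] assms(2)[of x] by simp
    qed
  qed
  show ?thesis
    unfolding im[of R' R, OF assms(7)] im[of A' A, OF assms(8)] im[of B' B, OF assms(9)]
    by (rule cross_aut[OF assms(1,4,5,6)])
qed

lemma aut_affine:
  assumes "\<sigma> = 1 \<or> \<sigma> = -1" "\<tau> = 1 \<or> \<tau> = -1"
  shows "aut (\<lambda>u. (\<sigma> * fst u + a, \<tau> * snd u + b))"
proof -
  have x: "aut (\<lambda>u. (\<sigma> * fst u, snd u))" using assms(1) aut_reflect0 aut_translate[of 0 0] by auto
  have y: "aut (\<lambda>u. (fst u, \<tau> * snd u))" using assms(2) aut_reflect_y[of 0] aut_translate[of 0 0] by auto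
  show ?thesis using aut_comp[OF aut_translate[of a b] aut_comp[OF x y]] by simp
qed

lemma cross_affine:
  assumes "finite R" "0 \<le> p" "p \<le> 1" "\<sigma> = 1 \<or> \<sigma> = -1" "\<tau> = 1 \<or> \<tau> = -1"
    "\<And>u. u \<in> R' \<longleftrightarrow> (\<sigma> * (fst u - a), \<tau> * (snd u - b)) \<in> R"
    "\<And>u. u \<in> A' \<longleftrightarrow> (\<sigma> * (fst u - a), \<tau> * (snd u - b)) \<in> A"
    "\<And>u. u \<in> B' \<longleftrightarrow> (\<sigma> * (fst u - a), \<tau> * (snd u - b)) \<in> B"
  shows "PP (\<lambda>_. p) (\<lambda>w. cross w R' A' B') = PP (\<lambda>_. p) (\<lambda>w. cross w R A B)"
proof (rule cross_aut_inverse[OF aut_affine[OF assms(4,5), of a b], of "\<lambda>u. (\<sigma> * (fst u - a), \<tau> * (snd u - b))"])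
  have s: "\<sigma> * (\<sigma> * x) = x" "\<tau> * (\<tau> * x) = x" for x using assms(4,5) by auto
  show "(\<sigma> * (fst (\<sigma> * fst u + a, \<tau> * snd u + b) - a), \<tau> * (snd (\<sigma> * fst u + a, \<tau> * snd u + b) - b)) = u" for u
    by (simp add: s)
  show "(\<sigma> * fst (\<sigma> * (fst u - a), \<tau> * (snd u - b)) + a, \<tau> * snd (\<sigma> * (fst u - a), \<tau> * (snd u - b)) + b) = u" for u
    by (simp add: s)
qed (use assms in auto)

lemma cross_transpose:
  assumes "finite R" "0 \<le> p" "p \<le> 1"
    "\<And>u. u \<in> R' \<longleftrightarrow> (snd u, fst u) \<in> R" "\<And>u. u \<in> A' \<longleftrightarrow> (snd u, fst u) \<in> A" "\<And>u. u \<in> B' \<longleftrightarrow> (snd u, fst u) \<in> B"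
  shows "PP (\<lambda>_. p) (\<lambda>w. cross w R' A' B') = PP (\<lambda>_. p) (\<lambda>w. cross w R A B)"
  by (rule cross_aut_inverse[OF aut_transpose, of "\<lambda>u. (snd u, fst u)"]) (use assms in auto)

text \<open>Without a left-right crossing there is a dual crossing from bottom to top of a rectangle
  that is narrower and taller than the square. At p = 1/2 the dual has the primal law, and cutting
  off the bottom row of that crossing leaves a vertical crossing of the square, which by symmetry is
  as likely as a horizontal one. So 1 is at most twice the crossing probability.\<close>

lemma square_cross:
  assumes "1 \<le> L"
  shows "1/2 \<le> PH (\<lambda>w. cross w ({a..a + L} \<times> {c..c + L}) {u. fst u = a} {v. fst v = a + L})"
proof -
  let ?R = "{a..a + L} \<times> {c..c + L}" and ?S = "{a..a + L - 1} \<times> {c - 1..c + L}"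
  let ?H = "\<lambda>w. cross w ?R {u. fst u = a} {v. fst v = a + L}"
  let ?D = "\<lambda>w. cross w ?S {u. snd u = c - 1} {v. snd v = c + L}"
  let ?V = "\<lambda>w. cross w ?R {u. snd u = c} {v. snd v = c + L}"
  have dD: "dep (dual_edge ` ein ?S) (\<lambda>w. ?D (dualc w))"
    unfolding dep_def
  proof (intro allI impI)
    fix w w' :: "edge \<Rightarrow> bool" assume "\<forall>e\<in>dual_edge ` ein ?S. w e = w' e"
    then show "?D (dualc w) = ?D (dualc w')"
      by (intro depD[OF dep_cross]) (auto simp: dualc_def)
  qed
  have HD: "?H w \<or> ?D (dualc w)" for w
  proof (rule ccontr)
    assume neg: "\<not> ?thesis"
    have "\<exists>s t. snd s = c - 1 \<and> snd t = c + L \<and> lconn (open_adj (dualc w)) ?S s t"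
      by (rule no_crossing_imp_dual_crossing) (use assms neg in \<open>auto simp: cross_def\<close>)
    then show False using neg by (auto simp: cross_def)
  qed
  have "PH (\<lambda>w. True) \<le> PH ?H + PH (\<lambda>w. ?D (dualc w))"
    by (rule PP_union[of "ein ?R \<union> dual_edge ` ein ?S"])
       (use HD dep_mono[OF dep_cross, of ?R "ein ?R \<union> dual_edge ` ein ?S"] dep_mono[OF dD] in \<open>auto intro: finite_ein\<close>)
  moreover have "PH (\<lambda>w. ?D (dualc w)) = PH ?D"
    using cross_dual[of ?S "1/2"] by simp
  moreover have "PH ?D \<le> PH ?V"
  proof (rule ev_mono[OF ev_cross ev_cross])
    fix w assume "?D w"
    then obtain s t where st: "snd s = c - 1" "snd t = c + L" "lconn (open_adj w) ?S s t" by (auto simp: cross_def)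
    have "\<exists>u'. snd u' = c \<and> lconn (open_adj w) {x \<in> ?S. c \<le> snd x} u' t"
      by (rule lconn_truncate_start[OF st(3)]) (use st assms in \<open>auto simp: open_adj_def\<close>)
    then obtain u' where u': "snd u' = c" "lconn (open_adj w) {x \<in> ?S. c \<le> snd x} u' t" by blast
    have "lconn (open_adj w) ?R u' t" by (rule lconn_mono[OF u'(2)]) auto
    then show "?V w" by (rule crossI[rotated 2]) (use u' st in auto)
  qed auto
  moreover have "PH ?V = PH ?H"
  proof -
    have "PH ?V = PH (\<lambda>w. cross w ({c..c + L} \<times> {a..a + L}) {u. fst u = c} {v. fst v = c + L})"
      by (rule cross_transpose) auto
    also have "\<dots> = PH ?H"
      by (rule cross_affine[of _ _ 1 1 _ "c - a" "a - c"]) auto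
    finally show ?thesis .
  qed
  ultimately show ?thesis by simp
qed

lemma square_cross_vertical:
  assumes "1 \<le> L"
  shows "1/2 \<le> PH (\<lambda>w. cross w ({a..a + L} \<times> {c..c + L}) {u. snd u = c} {v. snd v = c + L})"
proof -
  have "PH (\<lambda>w. cross w ({a..a + L} \<times> {c..c + L}) {u. snd u = c} {v. snd v = c + L}) =
    PH (\<lambda>w. cross w ({c..c + L} \<times> {a..a + L}) {u. fst u = c} {v. fst v = c + L})"
    by (rule cross_transpose) auto
  then show ?thesis using square_cross[OF assms] by simp
qed

text \<open>Horizontal length \<open>l\<close> in a strip of half-height \<open>n\<close>. The ends
  are half planes and \<open>W\<close> is only a generous window that keeps the region finite, so
  glued crossings need no trimming.\<close>

definition hc :: "int \<Rightarrow> int \<Rightarrow> int \<Rightarrow> real" where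
  "hc n W l = PH (\<lambda>w. cross w ({- W..W} \<times> {- n..n}) {u. fst u \<le> 0} {v. l \<le> fst v})"

text \<open>A crossing and its translate by l - 2n overlap in a square of side 2n, and a vertical
  crossing of this square, of probability at least 1/2, joins them.\<close>

lemma hc_glue:
  assumes "1 \<le> n" "2 * n \<le> l" "0 \<le> W" "0 \<le> c" "c \<le> hc n W l"
  shows "c * c / 2 \<le> hc n (W + l) (2 * l - 2 * n)"
proof -
  define t where "t = l - 2 * n"
  have t: "0 \<le> t" using assms by (simp add: t_def)
  let ?R1 = "{- W..W} \<times> {- n..n}" and ?R2 = "{- W + t..W + t} \<times> {- n..n}" and ?R3 = "{t..t + 2 * n} \<times> {- n..- n + 2 * n}"
  let ?A1 = "\<lambda>w. cross w ?R1 {u. fst u \<le> 0} {v. l \<le> fst v}"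
  let ?A2 = "\<lambda>w. cross w ?R2 {u. fst u \<le> t} {v. l + t \<le> fst v}"
  let ?A3 = "\<lambda>w. cross w ?R3 {u. snd u = - n} {v. snd v = - n + 2 * n}"
  let ?Q = "{- (W + l)..W + l} \<times> {- n..n}"
  have 1: "c \<le> PH ?A1" using assms by (simp add: hc_def)
  have "PH ?A2 = PH ?A1" by (rule cross_affine[of _ _ 1 1 _ t 0]) auto
  then have 2: "c \<le> PH ?A2" using 1 by simp
  have 3: "1/2 \<le> PH ?A3" by (rule square_cross_vertical) (use assms in simp)
  have e: "ev ?R1 ?A1" "ev ?R2 ?A2" "ev ?R3 ?A3" by (auto intro: ev_cross)
  have "c * (c * (1/2)) \<le> PH (\<lambda>w. ?A1 w \<and> ?A2 w \<and> ?A3 w)"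
    by (intro ev_FKG[OF e(1) ev_conj[OF e(2,3)] 1 ev_FKG[OF e(2,3) 2 3]]) (use assms in auto)
  also have "\<dots> \<le> hc n (W + l) (2 * l - 2 * n)"
    unfolding hc_def
  proof (rule ev_mono[OF ev_conj[OF e(1) ev_conj[OF e(2,3)]] ev_cross])
    fix w assume A: "?A1 w \<and> ?A2 w \<and> ?A3 w"
    obtain u1 v1 where 1: "fst u1 \<le> 0" "l \<le> fst v1" "lconn (open_adj w) ?R1 u1 v1" using A by (auto simp: cross_def)
    obtain u2 v2 where 2: "fst u2 \<le> t" "l + t \<le> fst v2" "lconn (open_adj w) ?R2 u2 v2" using A by (auto simp: cross_def)
    obtain s r where 3: "snd s = - n" "snd r = - n + 2 * n" "lconn (open_adj w) ?R3 s r" using A by (auto simp: cross_def)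
    have Q: "?R1 \<union> ?R3 \<subseteq> ?Q" "?R2 \<union> ?R3 \<subseteq> ?Q" "?R2 \<subseteq> ?Q"
      using assms t by (auto simp: t_def)
    have "lconn (open_adj w) ?Q u1 s"
      by (rule open_meet[OF 1(3) 3(3), of "- n" n t "t + 2 * n", OF _ _ _ _ _ _ Q(1)]) (use 1 3 t in \<open>auto simp: t_def\<close>)
    moreover have "lconn (open_adj w) ?Q u2 s"
      by (rule open_meet[OF 2(3) 3(3), of "- n" n t "t + 2 * n", OF _ _ _ _ _ _ Q(2)]) (use 2 3 t in \<open>auto simp: t_def\<close>)
    moreover have "lconn (open_adj w) ?Q u2 v2" by (rule lconn_mono[OF 2(3) _ Q(3)])
    ultimately have "lconn (open_adj w) ?Q u1 v2" by (meson lconn_trans lconn_open_sym)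
    then show "cross w ?Q {u. fst u \<le> 0} {v. 2 * l - 2 * n \<le> fst v}"
      unfolding cross_def using 1(1) 2(2) by (intro bexI[of _ u1] bexI[of _ v2]) (auto simp: t_def)
  qed auto
  finally show ?thesis by simp
qed

text \<open>The length 8n lets four rotated copies, placed at distance about n to 3n from the
  origin, extend beyond a box of radius 3n + 1. The window 60n leaves room for all the gluing
  below.\<close>

definition long :: "int \<Rightarrow> real" where
  "long n = PH (\<lambda>w. cross w ({- 60 * n..60 * n} \<times> {- n..n}) {u. fst u \<le> - 4 * n} {v. 4 * n \<le> fst v})"

text \<open>The excess l - 2n doubles with each gluing. Starting from at least n/2, four gluings
  reach length 2n + 8n, more than the required 8n, and applying c to c^2/2 four times gives
  c^16/2^15. The windows add up to at most 44n, or 48n after centering.\<close>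

lemma long_from_hc:
  assumes n: "1 \<le> n" and l: "5 * n \<le> 2 * l" "l \<le> 4 * n" and c: "0 < c" "c \<le> hc n (4 * n) l"
  shows "c ^ 16 / 2 ^ 15 \<le> long n"
proof -
  define l1 l2 l3 l4 where "l1 = 2 * l - 2 * n" and "l2 = 2 * l1 - 2 * n" and "l3 = 2 * l2 - 2 * n" and "l4 = 2 * l3 - 2 * n"
  have b: "2 * n \<le> l" "2 * n \<le> l1" "2 * n \<le> l2" "2 * n \<le> l3" "8 * n \<le> l4" "l + l1 + l2 + l3 \<le> 40 * n" "0 \<le> l" "0 \<le> l1" "0 \<le> l2" "0 \<le> l3"
  proof -
    have "l1 = 2 * l - 2 * n" "l2 = 4 * l - 6 * n" "l3 = 8 * l - 14 * n" "l4 = 16 * l - 30 * n"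
      by (simp_all add: l1_def l2_def l3_def l4_def)
    then show "2 * n \<le> l" "2 * n \<le> l1" "2 * n \<le> l2" "2 * n \<le> l3" "8 * n \<le> l4" "l + l1 + l2 + l3 \<le> 40 * n" "0 \<le> l" "0 \<le> l1" "0 \<le> l2" "0 \<le> l3"
      using l n by linarith+
  qed
  have 1: "c * c / 2 \<le> hc n (4 * n + l) l1" unfolding l1_def by (rule hc_glue) (use n b c in auto)
  have 2: "(c * c / 2) * (c * c / 2) / 2 \<le> hc n (4 * n + l + l1) l2" unfolding l2_def by (rule hc_glue) (use n b c 1 in auto)
  have 3: "((c * c / 2) * (c * c / 2) / 2) * ((c * c / 2) * (c * c / 2) / 2) / 2 \<le> hc n (4 * n + l + l1 + l2) l3"
    unfolding l3_def by (rule hc_glue) (use n b c 2 in auto)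
  have 4: "(((c * c / 2) * (c * c / 2) / 2) * ((c * c / 2) * (c * c / 2) / 2) / 2) * (((c * c / 2) * (c * c / 2) / 2) * ((c * c / 2) * (c * c / 2) / 2) / 2) / 2
     \<le> hc n (4 * n + l + l1 + l2 + l3) l4"
    unfolding l4_def by (rule hc_glue) (use n b c 3 in auto)
  have eq: "c ^ 16 / 2 ^ 15 = (((c * c / 2) * (c * c / 2) / 2) * ((c * c / 2) * (c * c / 2) / 2) / 2) * (((c * c / 2) * (c * c / 2) / 2) * ((c * c / 2) * (c * c / 2) / 2) / 2) / 2"
    by (simp add: power_numeral_reduce)
  let ?W = "4 * n + l + l1 + l2 + l3"
  have "hc n ?W l4 = PH (\<lambda>w. cross w ({- ?W - 4 * n..?W - 4 * n} \<times> {- n..n}) {u. fst u \<le> - 4 * n} {v. l4 - 4 * n \<le> fst v})"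
    unfolding hc_def by (rule cross_affine[of _ _ 1 1 _ "4 * n" 0]) auto
  also have "\<dots> \<le> long n"
    unfolding long_def
  proof (rule ev_mono[OF ev_cross ev_cross])
    fix w assume "cross w ({- ?W - 4 * n..?W - 4 * n} \<times> {- n..n}) {u. fst u \<le> - 4 * n} {v. l4 - 4 * n \<le> fst v}"
    then show "cross w ({- 60 * n..60 * n} \<times> {- n..n}) {u. fst u \<le> - 4 * n} {v. 4 * n \<le> fst v}"
      by (rule cross_mono) (use b n in auto)
  qed auto
  finally show ?thesis using 4 eq by simp
qed

section \<open>Landing heights of square crossings, and long crossings built from them\<close>

definition sqr :: "int \<Rightarrow> int \<Rightarrow> int \<Rightarrow> vertex set" where
  "sqr x y n = {x - n..x + n} \<times> {y - n..y + n}"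

lemma finite_sqr [simp]: "finite (sqr x y n)"
  by (simp add: sqr_def)

lemma mem_sqr: "u \<in> sqr x y n \<longleftrightarrow> x - n \<le> fst u \<and> fst u \<le> x + n \<and> y - n \<le> snd u \<and> snd u \<le> y + n"
  by (cases u) (auto simp: sqr_def)

text \<open>Together with \<open>gH\<close> this splits the crossings that land on the upper half of
  the right side at height \<alpha>. One of the two always has probability at least 1/8, and the
  critical height is compared at different scales.\<close>

definition fH :: "int \<Rightarrow> int \<Rightarrow> real" where
  "fH n \<alpha> = PH (\<lambda>w. cross w (sqr 0 0 n) {u. fst u = - n} {v. fst v = n \<and> 0 \<le> snd v \<and> snd v \<le> \<alpha>})"

definition gH :: "int \<Rightarrow> int \<Rightarrow> real" where
  "gH n \<alpha> = PH (\<lambda>w. cross w (sqr 0 0 n) {u. fst u = - n} {v. fst v = n \<and> \<alpha> \<le> snd v})"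

lemma gH_0:
  assumes "1 \<le> n"
  shows "1/4 \<le> gH n 0"
proof -
  let ?L = "\<lambda>w. cross w (sqr 0 0 n) {u. fst u = - n} {v. fst v = n}"
  let ?U = "\<lambda>w. cross w (sqr 0 0 n) {u. fst u = - n} {v. fst v = n \<and> 0 \<le> snd v}"
  let ?D = "\<lambda>w. cross w (sqr 0 0 n) {u. fst u = - n} {v. fst v = n \<and> snd v \<le> 0}"
  have "1/2 \<le> PH ?L"
    using square_cross[of "2 * n" "- n" "- n"] assms by (simp add: sqr_def)
  also have "PH ?L \<le> PH ?U + PH ?D"
  proof (rule PP_union[of "ein (sqr 0 0 n)"])
    fix w assume "?L w"
    then show "?U w \<or> ?D w" unfolding cross_def by (metis (mono_tags, lifting) linear mem_Collect_eq)
  qed (auto intro: finite_ein dep_cross)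
  also have "PH ?D = PH ?U"
    by (rule cross_affine[of _ _ 1 "-1" _ 0 0]) (auto simp: mem_sqr)
  finally show ?thesis by (simp add: gH_def)
qed

lemma fH_or_gH:
  assumes "1 \<le> n"
  shows "1/8 \<le> fH n \<alpha> \<or> 1/8 \<le> gH n \<alpha>"
proof -
  have "gH n 0 \<le> fH n \<alpha> + gH n \<alpha>"
    unfolding fH_def gH_def
  proof (rule PP_union[of "ein (sqr 0 0 n)"])
    fix w assume "cross w (sqr 0 0 n) {u. fst u = - n} {v. fst v = n \<and> 0 \<le> snd v}"
    then obtain u v where "fst u = - n" "fst v = n" "0 \<le> snd v" "lconn (open_adj w) (sqr 0 0 n) u v" by (auto simp: cross_def)
    then show "cross w (sqr 0 0 n) {u. fst u = - n} {v. fst v = n \<and> 0 \<le> snd v \<and> snd v \<le> \<alpha>} \<or>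
         cross w (sqr 0 0 n) {u. fst u = - n} {v. fst v = n \<and> \<alpha> \<le> snd v}"
    proof (cases "snd v \<le> \<alpha>")
      case True
      have "cross w (sqr 0 0 n) {u. fst u = - n} {v. fst v = n \<and> 0 \<le> snd v \<and> snd v \<le> \<alpha>}"
        by (rule crossI[OF _ _ \<open>lconn (open_adj w) (sqr 0 0 n) u v\<close>])
           (use True \<open>fst u = - n\<close> \<open>fst v = n\<close> \<open>0 \<le> snd v\<close> in auto)
      then show ?thesis ..
    next
      case False
      have "cross w (sqr 0 0 n) {u. fst u = - n} {v. fst v = n \<and> \<alpha> \<le> snd v}"
        by (rule crossI[OF _ _ \<open>lconn (open_adj w) (sqr 0 0 n) u v\<close>])
           (use False \<open>fst u = - n\<close> \<open>fst v = n\<close> in auto)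
      then show ?thesis ..
    qed
  qed (auto intro: finite_ein dep_cross)
  then show ?thesis using gH_0[OF assms] by linarith
qed

lemma fH_mono:
  assumes "\<alpha> \<le> \<beta>"
  shows "fH n \<alpha> \<le> fH n \<beta>"
  unfolding fH_def
proof (rule ev_mono[OF ev_cross ev_cross])
  fix w assume "cross w (sqr 0 0 n) {u. fst u = - n} {v. fst v = n \<and> 0 \<le> snd v \<and> snd v \<le> \<alpha>}"
  then show "cross w (sqr 0 0 n) {u. fst u = - n} {v. fst v = n \<and> 0 \<le> snd v \<and> snd v \<le> \<beta>}"
    by (rule cross_mono) (use assms in auto)
qed auto

text \<open>The X-shaped event of Tassion's proof of the Russo-Seymour-Welsh theorem: \<sigma>
  selects the right or left side, \<tau> the upper or lower arm. The common hub z makes any two arm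
  ends connected.\<close>

definition HX :: "int \<Rightarrow> int \<Rightarrow> int \<Rightarrow> int \<Rightarrow> (edge \<Rightarrow> bool) \<Rightarrow> bool" where
  "HX x y n \<alpha> w \<longleftrightarrow> (\<exists>z. \<forall>\<sigma>\<in>{-1, 1}. \<forall>\<tau>\<in>{-1, 1}. \<exists>q. fst q = x + \<sigma> * n \<and> \<alpha> \<le> \<tau> * (snd q - y) \<and> lconn (open_adj w) (sqr x y n) z q)"

lemma ev_HX: "ev (sqr x y n) (HX x y n \<alpha>)"
  unfolding ev_def
proof (intro conjI)
  show "dep (ein (sqr x y n)) (HX x y n \<alpha>)"
    unfolding dep_def
  proof (intro allI impI)
    fix w w' :: "edge \<Rightarrow> bool" assume "\<forall>e\<in>ein (sqr x y n). w e = w' e"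
    then have "lconn (open_adj w) (sqr x y n) u v = lconn (open_adj w') (sqr x y n) u v" for u v
      by (intro lconn_cong) auto
    then show "HX x y n \<alpha> w = HX x y n \<alpha> w'" by (simp add: HX_def)
  qed
  show "incr (HX x y n \<alpha>)"
    unfolding incr_def le_bool_def
  proof (intro allI impI)
    fix w w' :: "edge \<Rightarrow> bool" assume le: "\<forall>e. w e \<longrightarrow> w' e" and "HX x y n \<alpha> w"
    have "lconn (open_adj w) (sqr x y n) u v \<Longrightarrow> lconn (open_adj w') (sqr x y n) u v" for u v
      by (erule lconn_incr) (use le in auto)
    then show "HX x y n \<alpha> w'" using \<open>HX x y n \<alpha> w\<close> unfolding HX_def by meson
  qed
qed simp

text \<open>Four reflected copies of the event of \<open>gH\<close> supply the arms, and one
  vertical crossing of the square meets all four and provides the hub: (1/8)^4 times 1/2.\<close>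

lemma HX_prob:
  assumes n: "1 \<le> n" and g: "1/8 \<le> gH n \<alpha>"
  shows "(1/8) ^ 4 / 2 \<le> PH (HX x y n \<alpha>)"
proof -
  let ?E = "\<lambda>\<sigma> \<tau> w. cross w (sqr x y n) {u. fst u = x - \<sigma> * n} {v. fst v = x + \<sigma> * n \<and> \<alpha> \<le> \<tau> * (snd v - y)}"
  let ?V = "\<lambda>w. cross w (sqr x y n) {u. snd u = y - n} {v. snd v = y + n}"
  have E: "1/8 \<le> PH (?E \<sigma> \<tau>)" if "\<sigma> \<in> {-1, 1}" "\<tau> \<in> {-1, 1}" for \<sigma> \<tau>
  proof -
    have "PH (?E \<sigma> \<tau>) = gH n \<alpha>" unfolding gH_def
      by (rule cross_affine[of _ _ \<sigma> \<tau> _ x y]) (use that in \<open>auto simp: mem_sqr\<close>)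
    then show ?thesis using g by simp
  qed
  have xy: "x - n + 2 * n = x + n" "y - n + 2 * n = y + n" by simp_all
  have V: "1/2 \<le> PH ?V" unfolding sqr_def
    by (rule square_cross_vertical[of "2 * n" "x - n" "y - n", unfolded xy]) (use n in simp)
  have e: "ev (sqr x y n) (?E \<sigma> \<tau>)" "ev (sqr x y n) ?V" for \<sigma> \<tau> by (auto intro: ev_cross)
  have "1/8 * (1/8 * (1/8 * (1/8 * (1/2)))) \<le> PH (\<lambda>w. ?E 1 1 w \<and> ?E 1 (-1) w \<and> ?E (-1) 1 w \<and> ?E (-1) (-1) w \<and> ?V w)"
    by (intro ev_FKG[OF e(1) ev_conj[OF e(1) ev_conj[OF e(1) ev_conj[OF e(1) e(2)]]] E ev_FKG[OF e(1) ev_conj[OF e(1) ev_conj[OF e(1) e(2)]] E ev_FKG[OF e(1) ev_conj[OF e(1) e(2)] E ev_FKG[OF e(1) e(2) E V]]]]) auto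
  also have "\<dots> \<le> PH (HX x y n \<alpha>)"
  proof (rule ev_mono[OF ev_conj[OF e(1) ev_conj[OF e(1) ev_conj[OF e(1) ev_conj[OF e(1) e(2)]]]] ev_HX])
    fix w assume A: "?E 1 1 w \<and> ?E 1 (-1) w \<and> ?E (-1) 1 w \<and> ?E (-1) (-1) w \<and> ?V w"
    obtain s t where st: "snd s = y - n" "snd t = y + n" "lconn (open_adj w) (sqr x y n) s t" using A by (auto simp: cross_def)
    have "\<exists>q. fst q = x + \<sigma> * n \<and> \<alpha> \<le> \<tau> * (snd q - y) \<and> lconn (open_adj w) (sqr x y n) s q"
      if s: "\<sigma> \<in> {-1, 1}" and "\<tau> \<in> {-1, 1}" for \<sigma> \<tau>
    proof -
      have "?E \<sigma> \<tau> w" using A that by auto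
      then obtain u q where uq: "fst u = x - \<sigma> * n" "fst q = x + \<sigma> * n" "\<alpha> \<le> \<tau> * (snd q - y)" "lconn (open_adj w) (sqr x y n) u q"
        by (auto simp: cross_def)
      have us: "lconn (open_adj w) (sqr x y n) u s"
      proof (cases "\<sigma> = 1")
        case True
        show ?thesis
          by (rule open_meet[OF uq(4) st(3), of "y - n" "y + n" "x - n" "x + n"]) (use uq st True in \<open>auto simp: mem_sqr\<close>)
      next
        case False
        then have "\<sigma> = -1" using s by simp
        then have "lconn (open_adj w) (sqr x y n) q s"
          by (intro open_meet[OF lconn_open_sym[OF uq(4)] st(3), of "y - n" "y + n" "x - n" "x + n"]) (use uq st in \<open>auto simp: mem_sqr\<close>)
        then show ?thesis using uq(4) lconn_trans by meson
      qed
      have "lconn (open_adj w) (sqr x y n) s q"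
        by (rule lconn_trans[OF lconn_open_sym[OF us] uq(4)])
      then show ?thesis using uq by blast
    qed
    then show "HX x y n \<alpha> w" unfolding HX_def by blast
  qed
  finally show ?thesis by (simp add: power_numeral_reduce)
qed

text \<open>The sides x = m - n' and x = m + n' of the small square are the landing sides of the two
  large ones, since m = n - n'. Both large crossings land at heights in [0, 2\<alpha>], between the
  lower and upper arm ends of an X centred at height \<alpha>, so each meets the X. The joined
  crossing has length 2m + 2n = 4n - 2n'.\<close>

lemma hc_case_meet:
  assumes n: "1 \<le> n'" "3 * n' \<le> 2 * n" and a: "0 \<le> \<alpha>" "2 * \<alpha> \<le> n'"
    and f: "1/8 \<le> fH n (2 * \<alpha>)" and g: "1/8 \<le> gH n' \<alpha>"
  shows "(1/8) ^ 6 / 2 \<le> hc n (4 * n) (4 * n - 2 * n')"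
proof -
  define m where "m = n - n'"
  have m: "n' \<le> n" "0 \<le> m" "\<alpha> + n' \<le> n" "1 \<le> n" using n a by (auto simp: m_def)
  let ?F1 = "\<lambda>w. cross w (sqr 0 0 n) {u. fst u = - n} {v. fst v = n \<and> 0 \<le> snd v \<and> snd v \<le> 2 * \<alpha>}"
  let ?F2 = "\<lambda>w. cross w (sqr (2 * m) 0 n) {u. fst u = 2 * m + n} {v. fst v = 2 * m - n \<and> 0 \<le> snd v \<and> snd v \<le> 2 * \<alpha>}"
  let ?F3 = "HX m \<alpha> n' \<alpha>"
  let ?Q = "{- n..2 * m + n} \<times> {- n..n}"
  have 1: "1/8 \<le> PH ?F1" using f by (simp add: fH_def)
  have "PH ?F2 = PH ?F1" by (rule cross_affine[of _ _ "-1" 1 _ "2 * m" 0]) (auto simp: mem_sqr)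
  then have 2: "1/8 \<le> PH ?F2" using 1 by simp
  have 3: "(1/8) ^ 4 / 2 \<le> PH ?F3" by (rule HX_prob[OF n(1) g])
  have e: "ev (sqr 0 0 n) ?F1" "ev (sqr (2 * m) 0 n) ?F2" "ev (sqr m \<alpha> n') ?F3" by (auto intro: ev_cross ev_HX)
  have "1/8 * (1/8 * ((1/8) ^ 4 / 2)) \<le> PH (\<lambda>w. ?F1 w \<and> ?F2 w \<and> ?F3 w)"
    by (intro ev_FKG[OF e(1) ev_conj[OF e(2,3)] 1 ev_FKG[OF e(2,3) 2 3]]) auto
  also have "\<dots> \<le> PH (\<lambda>w. cross w ?Q {u. fst u \<le> - n} {v. 2 * m + n \<le> fst v})"
  proof (rule ev_mono[OF ev_conj[OF e(1) ev_conj[OF e(2,3)]] ev_cross])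
    fix w assume A: "?F1 w \<and> ?F2 w \<and> ?F3 w"
    obtain u1 v1 where 1: "fst u1 = - n" "fst v1 = n" "0 \<le> snd v1" "snd v1 \<le> 2 * \<alpha>" "lconn (open_adj w) (sqr 0 0 n) u1 v1"
      using A by (auto simp: cross_def)
    obtain u2 v2 where 2: "fst u2 = 2 * m + n" "fst v2 = 2 * m - n" "0 \<le> snd v2" "snd v2 \<le> 2 * \<alpha>" "lconn (open_adj w) (sqr (2 * m) 0 n) u2 v2"
      using A by (auto simp: cross_def)
    obtain z where z: "\<And>\<sigma> \<tau>. \<sigma> \<in> {-1, 1} \<Longrightarrow> \<tau> \<in> {-1, 1} \<Longrightarrow> \<exists>q. fst q = m + \<sigma> * n' \<and> \<alpha> \<le> \<tau> * (snd q - \<alpha>) \<and> lconn (open_adj w) (sqr m \<alpha> n') z q"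
      using A unfolding HX_def by blast
    obtain a b where a: "fst a = m + n'" "\<alpha> \<le> snd a - \<alpha>" "lconn (open_adj w) (sqr m \<alpha> n') z a"
      and b: "fst b = m + n'" "\<alpha> \<le> - (snd b - \<alpha>)" "lconn (open_adj w) (sqr m \<alpha> n') z b"
      using z[of 1 1] z[of 1 "-1"] by auto
    obtain a' b' where a': "fst a' = m - n'" "\<alpha> \<le> snd a' - \<alpha>" "lconn (open_adj w) (sqr m \<alpha> n') z a'"
      and b': "fst b' = m - n'" "\<alpha> \<le> - (snd b' - \<alpha>)" "lconn (open_adj w) (sqr m \<alpha> n') z b'"
      using z[of "-1" 1] z[of "-1" "-1"] by auto
    have Q: "sqr 0 0 n \<union> sqr m \<alpha> n' \<subseteq> ?Q" "sqr (2 * m) 0 n \<union> sqr m \<alpha> n' \<subseteq> ?Q" "sqr m \<alpha> n' \<subseteq> ?Q"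
      using m assms(3) n by (auto simp: sqr_def m_def)
    have "lconn (open_adj w) ?Q u1 b"
      by (rule open_arc_meet[OF 1(5) lconn_trans[OF lconn_open_sym[OF b(3)] a(3)], of n "m - n'", OF _ _ _ _ _ _ _ _ Q(1)])
         (use 1 a b m in \<open>auto simp: mem_sqr m_def\<close>)
    moreover have "lconn (open_adj w) ?Q u2 b'"
      by (rule open_arc_meet_left[OF 2(5) lconn_trans[OF lconn_open_sym[OF b'(3)] a'(3)], of "m - n'" "m + n'", OF _ _ _ _ _ _ _ _ Q(2)])
         (use 2 a' b' m in \<open>auto simp: mem_sqr m_def\<close>)
    moreover have "lconn (open_adj w) ?Q z b" "lconn (open_adj w) ?Q z b'"
      by (rule lconn_mono[OF b(3) _ Q(3)], simp, rule lconn_mono[OF b'(3) _ Q(3)], simp)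
    ultimately have "lconn (open_adj w) ?Q u1 u2" by (meson lconn_trans lconn_open_sym)
    then show "cross w ?Q {u. fst u \<le> - n} {v. 2 * m + n \<le> fst v}"
      unfolding cross_def using 1(1) 2(1) by (intro bexI[of _ u1] bexI[of _ u2]) auto
  qed auto
  also have "PH (\<lambda>w. cross w ?Q {u. fst u \<le> - n} {v. 2 * m + n \<le> fst v}) =
     PH (\<lambda>w. cross w ({0..2 * m + 2 * n} \<times> {- n..n}) {u. fst u \<le> 0} {v. 2 * m + 2 * n \<le> fst v})"
    by (rule cross_affine[of _ _ 1 1 _ "- n" 0]) auto
  also have "\<dots> \<le> hc n (4 * n) (4 * n - 2 * n')"
    unfolding hc_def
  proof (rule ev_mono[OF ev_cross ev_cross])
    fix w assume "cross w ({0..2 * m + 2 * n} \<times> {- n..n}) {u. fst u \<le> 0} {v. 2 * m + 2 * n \<le> fst v}"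
    then show "cross w ({- (4 * n)..4 * n} \<times> {- n..n}) {u. fst u \<le> 0} {v. 4 * n - 2 * n' \<le> fst v}"
      by (rule cross_mono) (use n m in \<open>auto simp: m_def\<close>)
  qed auto
  finally show ?thesis by (simp add: power_numeral_reduce)
qed

text \<open>Landing at height 0 or 1 leaves two possible end points, one of which has probability at
  least 1/16. The mirror image in the line x = n ends at the same vertex, so the two crossings join
  there.\<close>

lemma hc_case_point:
  assumes n: "1 \<le> n" and f: "1/8 \<le> fH n 1"
  shows "(1/16) ^ 2 \<le> hc n (4 * n) (4 * n)"
proof -
  let ?F = "\<lambda>y w. cross w (sqr 0 0 n) {u. fst u = - n} {(n, y)}"
  let ?G = "\<lambda>y w. cross w (sqr (2 * n) 0 n) {u. fst u = 3 * n} {(n, y)}"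
  let ?Q = "{- n..3 * n} \<times> {- n..n}"
  have "fH n 1 \<le> PH (?F 0) + PH (?F 1)"
    unfolding fH_def
  proof (rule PP_union[of "ein (sqr 0 0 n)"])
    fix w assume "cross w (sqr 0 0 n) {u. fst u = - n} {v. fst v = n \<and> 0 \<le> snd v \<and> snd v \<le> 1}"
    then obtain u v where uv: "fst u = - n" "fst v = n" "0 \<le> snd v" "snd v \<le> 1" "lconn (open_adj w) (sqr 0 0 n) u v"
      by (auto simp: cross_def)
    then have "v = (n, 0) \<or> v = (n, 1)" by (cases v) auto
    then show "?F 0 w \<or> ?F 1 w"
      using crossI[of u "{u. fst u = - n}" v "{(n, 0)}", OF _ _ uv(5)] crossI[of u "{u. fst u = - n}" v "{(n, 1)}", OF _ _ uv(5)] uv(1)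
      by blast
  qed (auto intro: finite_ein dep_cross)
  then have "1/16 \<le> PH (?F 0) \<or> 1/16 \<le> PH (?F 1)" using f by linarith
  then obtain y where y: "1/16 \<le> PH (?F y)" by blast
  have "PH (?G y) = PH (?F y)"
    by (rule cross_affine[of _ _ "-1" 1 _ "2 * n" 0]) (auto simp: mem_sqr prod_eq_iff)
  then have y': "1/16 \<le> PH (?G y)" using y by simp
  have e: "ev (sqr 0 0 n) (?F y)" "ev (sqr (2 * n) 0 n) (?G y)" by (auto intro: ev_cross)
  have "1/16 * (1/16) \<le> PH (\<lambda>w. ?F y w \<and> ?G y w)"
    by (intro ev_FKG[OF e y y']) auto
  also have "\<dots> \<le> PH (\<lambda>w. cross w ?Q {u. fst u \<le> - n} {v. 3 * n \<le> fst v})"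
  proof (rule ev_mono[OF ev_conj[OF e] ev_cross])
    fix w assume A: "?F y w \<and> ?G y w"
    obtain u1 where 1: "fst u1 = - n" "lconn (open_adj w) (sqr 0 0 n) u1 (n, y)" using A by (auto simp: cross_def)
    obtain u2 where 2: "fst u2 = 3 * n" "lconn (open_adj w) (sqr (2 * n) 0 n) u2 (n, y)" using A by (auto simp: cross_def)
    have "lconn (open_adj w) ?Q u1 u2"
      by (rule open_join[OF 1(2) 2(2)]) (use n in \<open>auto simp: sqr_def\<close>)
    then show "cross w ?Q {u. fst u \<le> - n} {v. 3 * n \<le> fst v}"
      unfolding cross_def using 1(1) 2(1) by (intro bexI[of _ u1] bexI[of _ u2]) auto
  qed auto
  also have "PH (\<lambda>w. cross w ?Q {u. fst u \<le> - n} {v. 3 * n \<le> fst v}) =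
     PH (\<lambda>w. cross w ({0..4 * n} \<times> {- n..n}) {u. fst u \<le> 0} {v. 4 * n \<le> fst v})"
    by (rule cross_affine[of _ _ 1 1 _ "- n" 0]) auto
  also have "\<dots> \<le> hc n (4 * n) (4 * n)"
    unfolding hc_def
  proof (rule ev_mono[OF ev_cross ev_cross])
    fix w assume "cross w ({0..4 * n} \<times> {- n..n}) {u. fst u \<le> 0} {v. 4 * n \<le> fst v}"
    then show "cross w ({- (4 * n)..4 * n} \<times> {- n..n}) {u. fst u \<le> 0} {v. 4 * n \<le> fst v}"
      by (rule cross_mono) (use n in auto)
  qed auto
  finally show ?thesis by (simp add: power2_eq_square)
qed

text \<open>X events with arms of height h are stacked at vertical distance 2h. The lower right arm
  of each ends between the right ends of the X below it, so \<open>arc_meet\<close> joins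
  neighbours. Nine of them span the height 18h, which is at least 8n.\<close>

lemma long_case_stack:
  assumes n: "9 \<le> n" and h: "h = n div 2" and g: "1/8 \<le> gH n h"
  shows "((1/8) ^ 4 / 2) ^ 9 \<le> long n"
proof -
  \<comment> \<open>The bound 8n \<le> 18h, with h rounded down, is where n \<ge> 9 comes from; n
    \<le> 3h is what traps the arm of the next X.\<close>
  have h3: "n \<le> 3 * h" "8 * n \<le> 18 * h" "2 * h \<le> n" using n h by auto
  let ?X = "\<lambda>i::nat. HX 0 (2 * h * int i) n h"
  let ?R = "\<lambda>m::nat. {- n..n} \<times> {- n..2 * h * int m + n}"
  have sub: "sqr 0 (2 * h * int i) n \<subseteq> ?R m" if "i \<le> m" for i m
  proof -
    have "2 * h * int i \<le> 2 * h * int m" "0 \<le> 2 * h * int i" using that h3 n by (auto intro!: mult_left_mono)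
    then show ?thesis by (auto simp: sqr_def)
  qed
  have P: "ev (?R m) (\<lambda>w. \<forall>i\<le>m. ?X i w) \<and> ((1/8) ^ 4 / 2) ^ Suc m \<le> PH (\<lambda>w. \<forall>i\<le>m. ?X i w)" for m
  proof (induction m)
    case 0
    have "ev (?R 0) (?X 0)" by (rule ev_mono_region[OF ev_HX]) (use sub[of 0 0] in auto)
    moreover have "(1/8) ^ 4 / 2 \<le> PH (?X 0)" by (rule HX_prob[OF _ g]) (use n in simp)
    ultimately show ?case by simp
  next
    case (Suc m)
    have eq: "(\<forall>i\<le>Suc m. ?X i w) \<longleftrightarrow> ?X (Suc m) w \<and> (\<forall>i\<le>m. ?X i w)" for w
      by (auto simp: le_Suc_eq)
    have 1: "ev (?R (Suc m)) (?X (Suc m))" by (rule ev_mono_region[OF ev_HX]) (use sub[of "Suc m" "Suc m"] in auto)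
    have "2 * h * int m \<le> 2 * h * int (Suc m)" using h3 n by (auto intro!: mult_left_mono)
    then have "?R m \<subseteq> ?R (Suc m)" by auto
    then have 2: "ev (?R (Suc m)) (\<lambda>w. \<forall>i\<le>m. ?X i w)" by (intro ev_mono_region[OF conjunct1[OF Suc.IH]]) auto
    have 3: "(1/8) ^ 4 / 2 \<le> PH (?X (Suc m))" by (rule HX_prob[OF _ g]) (use n in simp)
    have "ev (?R (Suc m)) (\<lambda>w. ?X (Suc m) w \<and> (\<forall>i\<le>m. ?X i w))"
      using ev_conj[OF 1 2] by simp
    moreover have "(1/8) ^ 4 / 2 * ((1/8) ^ 4 / 2) ^ Suc m \<le> PH (\<lambda>w. ?X (Suc m) w \<and> (\<forall>i\<le>m. ?X i w))"
      by (rule ev_FKG[OF 1 2 3 conjunct2[OF Suc.IH]]) auto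
    ultimately show ?case unfolding eq power_Suc[of _ "Suc m"] by blast
  qed
  let ?Q = "?R 8"
  have "((1/8) ^ 4 / 2) ^ 9 \<le> PH (\<lambda>w. \<forall>i\<le>8. ?X i w)" using P[of 8] by simp
  also have "\<dots> \<le> PH (\<lambda>w. cross w ?Q {u. snd u \<le> - h} {v. 17 * h \<le> snd v})"
  proof (rule ev_mono[OF conjunct1[OF P] ev_cross])
    fix w assume A: "\<forall>i\<le>8. ?X i w"
    have "\<forall>i. \<exists>z. i \<le> 8 \<longrightarrow> (\<forall>\<sigma>\<in>{-1, 1}. \<forall>\<tau>\<in>{-1, 1}. \<exists>q. fst q = 0 + \<sigma> * n \<and> h \<le> \<tau> * (snd q - 2 * h * int i) \<and>
       lconn (open_adj w) (sqr 0 (2 * h * int i) n) z q)"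
      using A unfolding HX_def by blast
    then obtain z where z: "\<And>i \<sigma> \<tau>. i \<le> 8 \<Longrightarrow> \<sigma> \<in> {-1, 1} \<Longrightarrow> \<tau> \<in> {-1, 1} \<Longrightarrow>
       \<exists>q. fst q = 0 + \<sigma> * n \<and> h \<le> \<tau> * (snd q - 2 * h * int i) \<and> lconn (open_adj w) (sqr 0 (2 * h * int i) n) (z i) q"
      by metis
    have zz: "lconn (open_adj w) ?Q (z (Suc i)) (z i)" if i: "Suc i \<le> 8" for i
    proof -
      have hs: "2 * h * int (Suc i) = 2 * h * int i + 2 * h" by (simp add: algebra_simps)
      obtain a where a: "fst a = n" "h \<le> snd a - 2 * h * int i" "lconn (open_adj w) (sqr 0 (2 * h * int i) n) (z i) a"
        using z[of i 1 1] i by auto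
      obtain b where b: "fst b = n" "h \<le> - (snd b - 2 * h * int i)" "lconn (open_adj w) (sqr 0 (2 * h * int i) n) (z i) b"
        using z[of i 1 "-1"] i by auto
      obtain c where c: "fst c = - n" "lconn (open_adj w) (sqr 0 (2 * h * int (Suc i)) n) (z (Suc i)) c"
        using z[of "Suc i" "-1" 1] i by auto
      obtain d where d: "fst d = n" "h \<le> - (snd d - 2 * h * int (Suc i))" "lconn (open_adj w) (sqr 0 (2 * h * int (Suc i)) n) (z (Suc i)) d"
        using z[of "Suc i" 1 "-1"] i by auto
      have dn: "2 * h * int (Suc i) - n \<le> snd d" using lconn_in[OF d(3)] by (auto simp: mem_sqr)
      have "sqr 0 (2 * h * int (Suc i)) n \<union> sqr 0 (2 * h * int i) n \<subseteq> ?Q"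
        using sub[of i 8] sub[of "Suc i" 8] i by simp
      moreover have "snd b \<le> snd d" "snd d \<le> snd a" using a(2) b(2) d(2) dn hs h3 by linarith+
      ultimately have "lconn (open_adj w) ?Q c b"
        by (intro open_arc_meet[OF lconn_trans[OF lconn_open_sym[OF c(2)] d(3)] lconn_trans[OF lconn_open_sym[OF b(3)] a(3)], of n "- n"])
           (use a(1) b(1) c(1) d(1) in \<open>simp_all add: mem_sqr\<close>)
      moreover have "lconn (open_adj w) ?Q (z (Suc i)) c" by (rule lconn_mono[OF c(2) _ sub]) (use i in auto)
      moreover have "lconn (open_adj w) ?Q (z i) b" by (rule lconn_mono[OF b(3) _ sub]) (use i in auto)
      ultimately show ?thesis by (meson lconn_trans lconn_open_sym)
    qed
    obtain a where a: "h \<le> snd a - 2 * h * int 8" "lconn (open_adj w) (sqr 0 (2 * h * int 8) n) (z 8) a"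
      using z[of 8 1 1] by auto
    obtain b where b: "h \<le> - snd b" "lconn (open_adj w) (sqr 0 (2 * h * int 0) n) (z 0) b"
      using z[of 0 1 "-1"] by auto
    have z0: "lconn (open_adj w) ?Q (z i) b" if "i \<le> 8" for i
      using that
    proof (induction i)
      case 0
      show ?case by (rule lconn_mono[OF b(2) _ sub]) auto
    next
      case (Suc i)
      then show ?case using lconn_trans[OF zz[of i]] by simp
    qed
    have "lconn (open_adj w) ?Q (z 8) a" by (rule lconn_mono[OF a(2) _ sub]) auto
    then have "lconn (open_adj w) ?Q b a" using z0[of 8] lconn_trans[OF lconn_open_sym] by blast
    then show "cross w ?Q {u. snd u \<le> - h} {v. 17 * h \<le> snd v}"
      unfolding cross_def using a b by (intro bexI[of _ b] bexI[of _ a]) auto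
  qed auto
  also have "PH (\<lambda>w. cross w ?Q {u. snd u \<le> - h} {v. 17 * h \<le> snd v}) =
    PH (\<lambda>w. cross w ({- n..n} \<times> {- n - 8 * h..8 * h + n}) {u. snd u \<le> - 9 * h} {v. 9 * h \<le> snd v})"
    by (rule cross_affine[of _ _ 1 1 _ 0 "8 * h"]) auto
  also have "\<dots> = PH (\<lambda>w. cross w ({- n - 8 * h..8 * h + n} \<times> {- n..n}) {u. fst u \<le> - 9 * h} {v. 9 * h \<le> fst v})"
    by (rule cross_transpose) auto
  also have "\<dots> \<le> long n"
    unfolding long_def
  proof (rule ev_mono[OF ev_cross ev_cross])
    fix w assume "cross w ({- n - 8 * h..8 * h + n} \<times> {- n..n}) {u. fst u \<le> - 9 * h} {v. 9 * h \<le> fst v}"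
    then show "cross w ({- 60 * n..60 * n} \<times> {- n..n}) {u. fst u \<le> - 4 * n} {v. 4 * n \<le> fst v}"
      by (rule cross_mono) (use h3 n in auto)
  qed auto
  finally show ?thesis .
qed

text \<open>One entry for each way to a long crossing: \<open>hc_case_meet\<close> and
  \<open>hc_case_point\<close>, both followed by \<open>long_from_hc\<close>, and
  \<open>long_case_stack\<close>.\<close>

definition rsw_const :: real where
  "rsw_const = min (min (((1/8) ^ 6 / 2) ^ 16 / 2 ^ 15) (((1/16) ^ 2) ^ 16 / 2 ^ 15)) (((1/8) ^ 4 / 2) ^ 9)"

lemma rsw_const_pos: "0 < rsw_const"
  by (simp add: rsw_const_def)

text \<open>If long crossings were unlikely at all large scales, the landing scale \<open>al n\<close> would
  more than double whenever \<open>n\<close> grows by the factor \<open>3/2\<close>.\<close>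

lemma rsw: "\<exists>n\<ge>N. rsw_const \<le> long n"
proof (rule ccontr)
  assume "\<not> ?thesis"
  then have no: "long n < rsw_const" if "N \<le> n" for n using that by (meson not_le)
  \<comment> \<open>The largest height, capped at n/2, above which landing still has probability at
    least 1/8. If long crossings were rare, stacking would exclude the cap,
    \<open>hc_case_point\<close> would exclude 0, and \<open>hc_case_meet\<close> would force the
    doubling.\<close>
  define al where "al n = Max {\<alpha> \<in> {0..n div 2}. 1/8 \<le> gH n \<alpha>}" for n
  have al: "0 \<le> al n \<and> al n \<le> n div 2 \<and> 1/8 \<le> gH n (al n) \<and> (\<forall>\<alpha>\<in>{0..n div 2}. al n < \<alpha> \<longrightarrow> \<not> 1/8 \<le> gH n \<alpha>)" if "1 \<le> n" for n
  proof -
    let ?S = "{\<alpha> \<in> {0..n div 2}. 1/8 \<le> gH n \<alpha>}"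
    have fin: "finite ?S" by (rule finite_subset[of _ "{0..n div 2}"]) auto
    have "0 \<in> ?S" using gH_0[OF that] that by simp
    then have "al n \<in> ?S" unfolding al_def using Max_in[OF fin] by blast
    moreover have "\<alpha> \<le> al n" if "\<alpha> \<in> ?S" for \<alpha> unfolding al_def using Max_ge[OF fin that] .
    then have "\<not> 1/8 \<le> gH n \<alpha>" if "\<alpha> \<in> {0..n div 2}" "al n < \<alpha>" for \<alpha>
      using that by (metis (mono_tags, lifting) mem_Collect_eq not_le)
    ultimately show ?thesis by simp
  qed
  have not_capped: "al n < n div 2" if "max 9 N \<le> n" for n
  proof (rule ccontr)
    assume "\<not> al n < n div 2"
    then have "al n = n div 2" using al[of n] that by simp
    then have "1/8 \<le> gH n (n div 2)" using al[of n] that by simp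
    then have "((1/8) ^ 4 / 2) ^ 9 \<le> long n" using long_case_stack[of n "n div 2"] that by simp
    then show False using no[of n] that unfolding rsw_const_def by linarith
  qed
  have f_al: "1/8 \<le> fH n (al n + 1)" if "max 9 N \<le> n" for n
  proof -
    have "al n + 1 \<in> {0..n div 2}" using not_capped[OF that] al[of n] that by simp
    then have "\<not> 1/8 \<le> gH n (al n + 1)" using al[of n] that by simp
    then show ?thesis using fH_or_gH[of n "al n + 1"] that by auto
  qed
  have al_pos: "1 \<le> al n" if "max 9 N \<le> n" for n
  proof (rule ccontr)
    assume "\<not> 1 \<le> al n"
    then have "al n = 0" using al[of n] that by simp
    then have "1/8 \<le> fH n 1" using f_al[OF that] by simp
    then have "(1/16) ^ 2 \<le> hc n (4 * n) (4 * n)" by (intro hc_case_point) (use that in auto)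
    then have "((1/16) ^ 2) ^ 16 / 2 ^ 15 \<le> long n"
      by (intro long_from_hc[of n "4 * n"]) (use that in auto)
    then show False using no[of n] that unfolding rsw_const_def by linarith
  qed
  have double: "2 * al n \<le> al ((3 * n + 1) div 2)" if n: "max 9 N \<le> n" for n
  proof (rule ccontr)
    assume neg: "\<not> ?thesis"
    define k where "k = (3 * n + 1) div 2"
    have k: "3 * n \<le> 2 * k" "max 9 N \<le> k" "1 \<le> n" using n by (auto simp: k_def)
    have "1/8 \<le> fH k (2 * al n)"
      using f_al[OF k(2)] fH_mono[of "al k + 1" "2 * al n" k] neg by (simp add: k_def)
    then have "(1/8) ^ 6 / 2 \<le> hc k (4 * k) (4 * k - 2 * n)"
      by (intro hc_case_meet[of n k "al n"]) (use k al[of n] in auto)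
    then have "((1/8) ^ 6 / 2) ^ 16 / 2 ^ 15 \<le> long k"
      by (intro long_from_hc[of k "4 * k - 2 * n"]) (use k in auto)
    then show False using no[of k] k unfolding rsw_const_def by linarith
  qed
  define s where "s i = ((\<lambda>n. (3 * n + 1) div 2) ^^ i) (max 9 N)" for i
  have s0: "s 0 = max 9 N" and sS: "s (Suc i) = (3 * s i + 1) div 2" for i by (simp_all add: s_def)
  have sge: "max 9 N \<le> s i" for i
  proof (induction i)
    case (Suc i)
    then show ?case using sS[of i] by linarith
  qed (simp add: s0)
  have alge: "2 ^ i \<le> al (s i)" for i
  proof (induction i)
    case 0
    then show ?case using al_pos[OF sge[of 0]] by simp
  next
    case (Suc i)
    then show ?case using double[OF sge[of i]] by (simp add: sS)
  qed
  have sle: "real_of_int (s i) \<le> (7/4) ^ i * real_of_int (max 9 N)" for i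
  proof (induction i)
    case 0
    then show ?case by (simp add: s0)
  next
    case (Suc i)
    \<comment> \<open>Rounding up turns the factor 3/2 into at most 7/4, still less than 2, so the
      doubling landing height outgrows its bound s i / 2.\<close>
    have "4 * s (Suc i) \<le> 7 * s i" using sge[of i] sS[of i] by linarith
    then have "real_of_int (s (Suc i)) \<le> 7/4 * real_of_int (s i)" by linarith
    then show ?case using Suc by simp
  qed
  obtain i where i: "real_of_int (max 9 N) < (8/7) ^ i" using real_arch_pow[of "8/7::real"] by auto
  have "2 ^ i \<le> s i" using alge[of i] al[of "s i"] sge[of i] by linarith
  then have "2 ^ i \<le> real_of_int (s i)" by (metis of_int_le_iff of_int_numeral of_int_power)
  also have "\<dots> \<le> (7/4) ^ i * real_of_int (max 9 N)" by (rule sle)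
  also have "\<dots> < (7/4) ^ i * (8/7) ^ i" using i by (intro mult_strict_left_mono) auto
  also have "\<dots> = (2::real) ^ i" by (simp flip: power_mult_distrib)
  finally show False by simp
qed

section \<open>No percolation at the self-dual point\<close>

definition mnorm :: "vertex \<Rightarrow> int" where
  "mnorm u = max \<bar>fst u\<bar> \<bar>snd u\<bar>"

definition box :: "int \<Rightarrow> vertex set" where
  "box N = {u. mnorm u \<le> N}"

definition arm :: "int \<Rightarrow> (edge \<Rightarrow> bool) \<Rightarrow> bool" where
  "arm N w \<longleftrightarrow> cross w (box N) {origin} {u. mnorm u = N}"

lemma box_eq: "box N = {- N..N} \<times> {- N..N}"
  by (auto simp: box_def mnorm_def)

lemma finite_box [simp]: "finite (box N)"
  by (simp add: box_eq)

lemma mnorm_step: "open_adj w x y \<Longrightarrow> mnorm y \<le> mnorm x + 1"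
  by (auto simp: open_adj_def mnorm_def)

lemma mnorm_origin [simp]: "mnorm origin = 0"
  by (simp add: mnorm_def origin_def)

lemma arm_truncate:
  assumes "lconn (open_adj w) R origin v" "0 \<le> M" "M \<le> mnorm v"
  shows "\<exists>v'. mnorm v' = M \<and> lconn (open_adj w) (R \<inter> box M) origin v'"
  using lconn_truncate_end[OF assms(1), of mnorm M] mnorm_step assms(2,3)
  by (auto simp: box_def Int_def)

text \<open>To be read in the dual configuration; each crossing alone bars the exit through its own
  side. The dual vertex i stands for i + 1/2, whose reflection is (-i - 1) + 1/2, hence the ranges
  -3n - 1 to -n - 1.\<close>

definition blocked :: "int \<Rightarrow> (edge \<Rightarrow> bool) \<Rightarrow> bool" where
  "blocked n v \<longleftrightarrow>
     cross v ({n..3 * n} \<times> {- 60 * n..60 * n}) {u. snd u \<le> - 4 * n} {u. 4 * n \<le> snd u} \<and>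
     cross v ({- 3 * n - 1..- n - 1} \<times> {- 60 * n..60 * n}) {u. snd u \<le> - 4 * n} {u. 4 * n \<le> snd u} \<and>
     cross v ({- 60 * n..60 * n} \<times> {n..3 * n}) {u. fst u \<le> - 4 * n} {u. 4 * n \<le> fst u} \<and>
     cross v ({- 60 * n..60 * n} \<times> {- 3 * n - 1..- n - 1}) {u. fst u \<le> - 4 * n} {u. 4 * n \<le> fst u}"

text \<open>Dualizing twice is a translation by (1, 1). This allows the primal and dual roles in
  \<open>primal_dual_no_crossing\<close> to be exchanged.\<close>

lemma dualc_dualc: "open_adj (dualc (dualc w)) u v = open_adj w (fst u + 1, snd u + 1) (fst v + 1, snd v + 1)"
  by (cases u; cases v) (auto simp: open_adj_def dualc_def dual_edge_def)

lemma lconn_dualc_dualc: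
  assumes "lconn (open_adj w) R u v"
  shows "lconn (open_adj (dualc (dualc w))) ((\<lambda>x. (fst x - 1, snd x - 1)) ` R) (fst u - 1, snd u - 1) (fst v - 1, snd v - 1)"
  by (rule lconn_image[OF assms]) (auto simp: dualc_dualc)

text \<open>The arm is cut where it first reaches radius 3n + 1. It leaves through one of four
  sides, and there it would cross the dual connection, which overshoots the box at both
  ends.\<close>

lemma blocked_imp_not_arm:
  assumes n: "2 \<le> n" "3 * n + 1 \<le> N" and bl: "blocked n (dualc w)"
  shows "\<not> arm N w"
proof
  assume "arm N w"
  define M where "M = 3 * n + 1"
  obtain v where "mnorm v = N" "lconn (open_adj w) (box N) origin v" using \<open>arm N w\<close> by (auto simp: arm_def cross_def)
  then obtain v where v: "mnorm v = M" "lconn (open_adj w) (box N \<inter> box M) origin v"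
    using arm_truncate[of w "box N" v M] n by (auto simp: M_def)
  have P: "lconn (open_adj w) (box M) origin v" by (rule lconn_mono[OF v(2)]) auto
  have bM: "- M \<le> fst x \<and> fst x \<le> M \<and> - M \<le> snd x \<and> snd x \<le> M" if "x \<in> box M" for x
    using that by (auto simp: box_eq)
  have bD: "- M - 1 \<le> fst y \<and> fst y \<le> M - 1" if "y \<in> (\<lambda>x. (fst x - 1, snd x - 1)) ` box M" for y
    using that
  proof (elim imageE)
    fix x assume "y = (fst x - 1, snd x - 1)" "x \<in> box M"
    then show ?thesis using bM[of x] by simp
  qed
  have oM: "origin = (0, 0)" "M = 3 * n + 1" by (auto simp: origin_def M_def)
  consider "fst v = M" | "fst v = - M" | "snd v = M" | "snd v = - M" using v(1) by (auto simp: mnorm_def max_def abs_if split: if_splits)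
  then show False
  proof cases
    case 1
    obtain s t where st: "snd s \<le> - 4 * n" "4 * n \<le> snd t" "lconn (open_adj (dualc w)) ({n..3 * n} \<times> {- 60 * n..60 * n}) s t"
      using bl by (auto simp: blocked_def cross_def)
    show False
      by (rule primal_dual_no_crossing[OF P st(3), of "- M" M n "3 * n"]) (use bM 1 st n in \<open>auto simp: origin_def M_def\<close>)
  next
    case 2
    obtain s t where st: "snd s \<le> - 4 * n" "4 * n \<le> snd t" "lconn (open_adj (dualc w)) ({- 3 * n - 1..- n - 1} \<times> {- 60 * n..60 * n}) s t"
      using bl by (auto simp: blocked_def cross_def)
    show False
      by (rule primal_dual_no_crossing[OF lconn_open_sym[OF P] st(3), of "- M" M "- 3 * n - 1" "- n - 1"]) (use bM 2 st n in \<open>auto simp: origin_def M_def\<close>)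
  next
    case 3
    \<comment> \<open>The dual connection is now the horizontal one and takes the primal role; the
      arm, seen as a connection in the twice dualized configuration, becomes its vertical
      counterpart.\<close>
    obtain s t where st: "fst s \<le> - 4 * n" "4 * n \<le> fst t" "lconn (open_adj (dualc w)) ({- 60 * n..60 * n} \<times> {n..3 * n}) s t"
      using bl by (auto simp: blocked_def cross_def)
    show False
    proof (rule primal_dual_no_crossing[OF st(3) lconn_dualc_dualc[OF P], of n "3 * n" "- M - 1" "M - 1"])
      show "- M - 1 \<le> fst y \<and> fst y \<le> M - 1" if "y \<in> (\<lambda>x. (fst x - 1, snd x - 1)) ` box M" for y
        using that by (rule bD)
    qed (use 3 st n oM in \<open>auto simp: origin_def\<close>)
  next
    case 4
    obtain s t where st: "fst s \<le> - 4 * n" "4 * n \<le> fst t" "lconn (open_adj (dualc w)) ({- 60 * n..60 * n} \<times> {- 3 * n - 1..- n - 1}) s t"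
      using bl by (auto simp: blocked_def cross_def)
    show False
    proof (rule primal_dual_no_crossing[OF st(3) lconn_dualc_dualc[OF lconn_open_sym[OF P]], of "- 3 * n - 1" "- n - 1" "- M - 1" "M - 1"])
      show "- M - 1 \<le> fst y \<and> fst y \<le> M - 1" if "y \<in> (\<lambda>x. (fst x - 1, snd x - 1)) ` box M" for y
        using that by (rule bD)
    qed (use 4 st n oM in \<open>auto simp: origin_def\<close>)
  qed
qed

definition annulus :: "int \<Rightarrow> vertex set" where
  "annulus n = {u. n \<le> mnorm u \<and> mnorm u \<le> 60 * n}"

lemma finite_annulus [simp]: "finite (annulus n)"
  by (rule finite_subset[OF _ finite_box[of "60 * n"]]) (auto simp: annulus_def box_def)

lemma blocked_prob:
  assumes n: "1 \<le> n"
  shows "ev (annulus n) (blocked n) \<and> (long n) ^ 4 \<le> PH (blocked n)"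
proof -
  let ?R1 = "{n..3 * n} \<times> {- 60 * n..60 * n}" and ?R2 = "{- 3 * n - 1..- n - 1} \<times> {- 60 * n..60 * n}"
  let ?R3 = "{- 60 * n..60 * n} \<times> {n..3 * n}" and ?R4 = "{- 60 * n..60 * n} \<times> {- 3 * n - 1..- n - 1}"
  let ?A1 = "\<lambda>v. cross v ?R1 {u. snd u \<le> - 4 * n} {u. 4 * n \<le> snd u}"
  let ?A2 = "\<lambda>v. cross v ?R2 {u. snd u \<le> - 4 * n} {u. 4 * n \<le> snd u}"
  let ?A3 = "\<lambda>v. cross v ?R3 {u. fst u \<le> - 4 * n} {u. 4 * n \<le> fst u}"
  let ?A4 = "\<lambda>v. cross v ?R4 {u. fst u \<le> - 4 * n} {u. 4 * n \<le> fst u}"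
  have 3: "PH ?A3 = long n" unfolding long_def by (rule cross_affine[of _ _ 1 1 _ 0 "2 * n"]) auto
  have 4: "PH ?A4 = long n" unfolding long_def by (rule cross_affine[of _ _ 1 1 _ 0 "- 2 * n - 1"]) auto
  have "PH ?A1 = PH ?A3" by (rule cross_transpose) auto
  then have 1: "PH ?A1 = long n" using 3 by simp
  have "PH ?A2 = PH ?A4" by (rule cross_transpose) auto
  then have 2: "PH ?A2 = long n" using 4 by simp
  have sub: "?R1 \<subseteq> annulus n" "?R2 \<subseteq> annulus n" "?R3 \<subseteq> annulus n" "?R4 \<subseteq> annulus n"
    using n by (auto simp: annulus_def mnorm_def)
  have e: "ev (annulus n) ?A1" "ev (annulus n) ?A2" "ev (annulus n) ?A3" "ev (annulus n) ?A4"
    by (rule ev_mono_region[OF ev_cross]; use sub in auto)+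
  have l0: "0 \<le> long n" unfolding long_def by (rule PP_nonneg)
  have "long n * (long n * (long n * long n)) \<le> PH (\<lambda>v. ?A1 v \<and> ?A2 v \<and> ?A3 v \<and> ?A4 v)"
    by (intro ev_FKG[OF e(1) ev_conj[OF e(2) ev_conj[OF e(3,4)]] _ ev_FKG[OF e(2) ev_conj[OF e(3,4)] _ ev_FKG[OF e(3,4)]]])
       (use 1 2 3 4 l0 in auto)
  moreover have "ev (annulus n) (\<lambda>v. ?A1 v \<and> ?A2 v \<and> ?A3 v \<and> ?A4 v)"
    using ev_conj[OF e(1) ev_conj[OF e(2) ev_conj[OF e(3,4)]]] by simp
  moreover have "blocked n = (\<lambda>v. ?A1 v \<and> ?A2 v \<and> ?A3 v \<and> ?A4 v)" by (simp add: blocked_def fun_eq_iff)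
  ultimately show ?thesis by (simp add: power_numeral_reduce mult.assoc)
qed

lemma dep_arm: "dep (ein (box N)) (arm N)"
  unfolding arm_def[abs_def] by (rule dep_cross)

lemma incr_arm: "incr (arm N)"
  unfolding arm_def[abs_def] by (rule incr_cross)

text \<open>Each new scale n \<ge> N0 + 2 supplies an annulus disjoint from the box used so far,
  hence an independent chance of at least rsw_const^4 to be blocked. The event \<open>A\<close>
  concerns the dual configuration, which has the same law at 1/2.\<close>

lemma blocked_chain:
  "\<exists>N0\<ge>0. \<exists>A. dep (ein (box N0)) A \<and> (\<forall>N\<ge>N0. \<forall>w. arm N w \<longrightarrow> A (dualc w)) \<and> PH A \<le> (1 - rsw_const ^ 4) ^ k"
proof (induction k)
  case 0
  show ?case by (intro exI[of _ 0] conjI exI[of _ "\<lambda>_. True"]) auto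
next
  case (Suc k)
  then obtain N0 A where N0: "0 \<le> N0" and A: "dep (ein (box N0)) A" "\<And>N w. N0 \<le> N \<Longrightarrow> arm N w \<Longrightarrow> A (dualc w)"
    "PH A \<le> (1 - rsw_const ^ 4) ^ k" by blast
  obtain n where n: "N0 + 2 \<le> n" "rsw_const \<le> long n" using rsw by blast
  have bl: "ev (annulus n) (blocked n)" "(long n) ^ 4 \<le> PH (blocked n)" using blocked_prob[of n] n N0 by auto
  have db: "dep (ein (annulus n)) (\<lambda>v. \<not> blocked n v)" using bl(1) dep_comp[of "ein (annulus n)" "blocked n" Not] by (simp add: ev_def)
  let ?B = "\<lambda>v. A v \<and> \<not> blocked n v"
  have sub: "box N0 \<subseteq> box (60 * n)" "annulus n \<subseteq> box (60 * n)" using n N0 by (auto simp: box_def annulus_def)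
  have 1: "dep (ein (box (60 * n))) ?B"
    by (rule dep_comp2[OF dep_mono[OF A(1) ein_mono[OF sub(1)]] dep_mono[OF db ein_mono[OF sub(2)]]])
  have 2: "?B (dualc w)" if "60 * n \<le> N" "arm N w" for N w
    using A(2)[of N w] blocked_imp_not_arm[of n N w] that n N0 by auto
  have ib: "PH (\<lambda>v. \<not> blocked n v) = 1 - PH (blocked n)"
  proof -
    have "integrable (percf (\<lambda>_. 1/2)) (\<lambda>w. of_bool (blocked n w) :: real)"
      by (rule dep_integrable[OF finite_ein[OF finite_annulus[of n]] dep_comp]) (use bl(1) in \<open>simp add: ev_def\<close>)
    moreover have "integrable (percf (\<lambda>_. 1/2)) (\<lambda>w::edge \<Rightarrow> bool. 1::real)"
      by (rule dep_integrable[OF finite.emptyI dep_const])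
    ultimately show ?thesis by (simp only: of_bool_not_iff Bochner_Integration.integral_diff EE_const)
  qed
  have "PH ?B = EE (\<lambda>_. 1/2) (\<lambda>w. of_bool (A w) * of_bool (\<not> blocked n w))" by (simp only: of_bool_conj)
  also have "\<dots> = PH A * PH (\<lambda>v. \<not> blocked n v)"
  proof (rule EE_indep[OF _ _ dep_comp[OF A(1)] dep_comp[OF db]])
    have "box N0 \<inter> annulus n = {}" using n by (auto simp: box_def annulus_def)
    then show "ein (box N0) \<inter> ein (annulus n) = {}" using ein_Int[of "box N0" "annulus n"] by simp
  qed (auto intro: finite_ein)
  also have "\<dots> \<le> (1 - rsw_const ^ 4) ^ k * (1 - rsw_const ^ 4)"
  proof (rule mult_mono)
    have "rsw_const ^ 4 \<le> (long n) ^ 4" using n(2) rsw_const_pos by (intro power_mono) auto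
    then show "PH (\<lambda>v. \<not> blocked n v) \<le> 1 - rsw_const ^ 4" using ib bl(2) by simp
    have "0 \<le> PH (\<lambda>v. \<not> blocked n v)" by (rule PP_nonneg)
    then show "0 \<le> (1 - rsw_const ^ 4) ^ k" using A(3) PP_nonneg[of "\<lambda>_. 1/2" A] by linarith
  qed (use A(3) PP_nonneg in auto)
  finally have 3: "PH ?B \<le> (1 - rsw_const ^ 4) ^ Suc k" by (simp only: power_Suc2)
  have "0 \<le> 60 * n" using n N0 by simp
  then show ?case using 1 2 3 by blast
qed

lemma arm_half_small:
  assumes "0 < \<epsilon>"
  shows "\<exists>N0\<ge>0. \<forall>N\<ge>N0. PH (arm N) < \<epsilon>"
proof -
  have "rsw_const \<le> ((1/8) ^ 4 / 2) ^ 9" by (simp only: rsw_const_def min.cobounded2)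
  also have "\<dots> \<le> 1" by (rule power_le_one) (simp_all add: power_numeral_reduce)
  finally have c: "0 < rsw_const ^ 4" "rsw_const ^ 4 \<le> 1"
    using rsw_const_pos by (simp_all add: power_le_one)
  obtain k where k: "(1 - rsw_const ^ 4) ^ k < \<epsilon>"
    using real_arch_pow_inv[OF assms, of "1 - rsw_const ^ 4"] c by auto
  obtain N0 A where N0: "0 \<le> N0" and A: "dep (ein (box N0)) A" "\<And>N w. N0 \<le> N \<Longrightarrow> arm N w \<Longrightarrow> A (dualc w)"
    "PH A \<le> (1 - rsw_const ^ 4) ^ k" using blocked_chain[of k] by blast
  have "PH (arm N) < \<epsilon>" if N: "N0 \<le> N" for N
  proof -
    have dD: "dep (dual_edge ` ein (box N0)) (\<lambda>w. A (dualc w))"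
      unfolding dep_def
    proof (intro allI impI)
      fix w w' :: "edge \<Rightarrow> bool" assume "\<forall>e\<in>dual_edge ` ein (box N0). w e = w' e"
      then show "A (dualc w) = A (dualc w')" by (intro depD[OF A(1)]) (auto simp: dualc_def)
    qed
    have "PH (arm N) \<le> PH (\<lambda>w. A (dualc w))"
      by (rule PP_mono[of "ein (box N) \<union> dual_edge ` ein (box N0)", OF _ dep_mono[OF dep_arm] dep_mono[OF dD]])
         (use A(2)[OF N] in \<open>auto intro: finite_ein[OF finite_box] finite_imageI\<close>)
    also have "\<dots> = PH A"
      using EE_flip_reindex[OF finite_ein dep_comp[OF A(1), of "of_bool :: bool \<Rightarrow> real"] inj_dual_edge, of "1/2"]
      by (simp add: dualc_def)
    finally show ?thesis using A(3) k by linarith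
  qed
  then show ?thesis using N0 by blast
qed

lemma AE_cluster_finite:
  assumes "0 \<le> p" "p \<le> 1/2"
  shows "AE w in perc p. finite (cluster w)"
proof -
  interpret P: prob_space "perc p" unfolding perc_eq_percf by (rule prob_space_percf)
  let ?I = "{w. \<forall>N::nat. arm (int N) w}"
  have am: "{w. arm (int N) w} \<in> sets (perc p)" for N
  proof -
    have "arm (int N) \<in> measurable (percf (\<lambda>_. p)) (count_space UNIV)"
      by (rule dep_measurable[OF finite_ein dep_arm]) auto
    from measurable_sets[OF this, of "{True}"] show ?thesis
      by (simp add: perc_eq_percf vimage_def)
  qed
  have Im: "?I \<in> sets (perc p)"
  proof -
    have "?I = (\<Inter>N. {w. arm (int N) w})" by auto
    then show ?thesis using am by auto
  qed
  have inf: "w \<in> ?I" if "infinite (cluster w)" for w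
  proof (intro CollectI allI)
    fix N :: nat
    have "\<not> cluster w \<subseteq> box (int N)" using that finite_subset[OF _ finite_box] by blast
    then obtain v where v: "v \<in> cluster w" "v \<notin> box (int N)" by blast
    then have "lconn (open_adj w) UNIV origin v" by (simp add: cluster_def lconn_def)
    then obtain v' where v': "mnorm v' = int N" "lconn (open_adj w) (UNIV \<inter> box (int N)) origin v'"
      using arm_truncate[of w UNIV v "int N"] v(2) by (auto simp: box_def)
    then show "arm (int N) w" unfolding arm_def by (intro crossI[of origin _ v']) auto
  qed
  have le: "measure (perc p) ?I \<le> \<epsilon>" if e: "0 < \<epsilon>" for \<epsilon>
  proof -
    obtain N0 where N0: "0 \<le> N0" "\<forall>N\<ge>N0. PH (arm N) < \<epsilon>" using arm_half_small[OF e] by blast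
    have "measure (perc p) ?I \<le> measure (perc p) {w. arm (int (nat N0)) w}"
    proof (rule P.finite_measure_mono)
      show "?I \<subseteq> {w. arm (int (nat N0)) w}" by blast
      show "{w. arm (int (nat N0)) w} \<in> sets (perc p)" by (rule am)
    qed
    also have "\<dots> = PP (\<lambda>_. p) (arm N0)"
    proof -
      have "(\<lambda>w. of_bool (arm N0 w) :: real) = indicator {w. arm N0 w}" by (auto simp: indicator_def)
      then show ?thesis using N0(1) am[of "nat N0"] by (simp add: perc_eq_percf)
    qed
    also have "\<dots> \<le> PH (arm N0)"
      by (rule EE_incr_param[OF finite_ein[OF finite_box] dep_comp[OF dep_arm] incr_of_bool[OF incr_arm]]) (use assms in auto)
    finally show ?thesis using N0 by force
  qed
  have "measure (perc p) ?I = 0"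
  proof (rule antisym)
    show "measure (perc p) ?I \<le> 0" by (rule field_le_epsilon) (use le in simp)
  qed simp
  then have "?I \<in> null_sets (perc p)" using Im by (intro null_setsI) (simp_all add: P.emeasure_eq_measure)
  then show ?thesis by (rule AE_I') (use inf in blast)
qed

section \<open>Exponential decay below the self-dual point\<close>

definition oe :: "edge \<Rightarrow> vertex" where
  "oe e = (if snd e then (fst (fst e) + 1, snd (fst e)) else (fst (fst e), snd (fst e) + 1))"

text \<open>The code of the edge joining two neighbours; the last branch also receives
  non-neighbours, where the value has no meaning.\<close>

definition ee :: "vertex \<Rightarrow> vertex \<Rightarrow> edge" where
  "ee x y = (if y = (fst x + 1, snd x) then (x, True) else if x = (fst y + 1, snd y) then (y, True)
     else if y = (fst x, snd x + 1) then (x, False) else (y, False))"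

lemma ein_oe: "ein R = {e. fst e \<in> R \<and> oe e \<in> R}"
  by (simp add: ein_def oe_def)

lemma nbrs_sym: "y \<in> nbrs x \<Longrightarrow> x \<in> nbrs y"
  by (auto simp: nbrs_def prod_eq_iff)

lemma finite_nbrs [simp]: "finite (nbrs x)"
  by (simp add: nbrs_def)

lemma open_adj_nbrs: "open_adj w x y \<Longrightarrow> y \<in> nbrs x"
  by (auto simp: open_adj_def nbrs_def prod_eq_iff)

lemma open_adj_ee:
  assumes "y \<in> nbrs x"
  shows "open_adj w x y \<longleftrightarrow> w (ee x y)"
  using assms by (cases x; cases y) (auto simp: open_adj_def ee_def nbrs_def)

lemma ee_ends:
  assumes "y \<in> nbrs x"
  shows "{fst (ee x y), oe (ee x y)} = {x, y}"
  using assms by (cases x; cases y) (auto simp: ee_def oe_def nbrs_def)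

lemma mnorm_nbrs: "y \<in> nbrs x \<Longrightarrow> mnorm y \<le> mnorm x + 1"
  by (auto simp: nbrs_def mnorm_def)

lemma EE_sum:
  fixes f :: "'i \<Rightarrow> ('e \<Rightarrow> bool) \<Rightarrow> real"
  assumes "finite E" "\<And>i. i \<in> I \<Longrightarrow> dep E (f i)"
  shows "EE r (\<lambda>w. \<Sum>i\<in>I. f i w) = (\<Sum>i\<in>I. EE r (f i))"
  by (rule Bochner_Integration.integral_sum) (rule dep_integrable[OF assms(1) assms(2)])

lemma dep_sum:
  fixes f :: "'i \<Rightarrow> ('e \<Rightarrow> bool) \<Rightarrow> real"
  assumes "\<And>i. i \<in> I \<Longrightarrow> dep E (f i)"
  shows "dep E (\<lambda>w. \<Sum>i\<in>I. f i w)"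
  unfolding dep_def
proof (intro allI impI)
  fix w w' :: "'e \<Rightarrow> bool" assume "\<forall>e\<in>E. w e = w' e"
  then show "(\<Sum>i\<in>I. f i w) = (\<Sum>i\<in>I. f i w')"
    by (intro sum.cong refl depD[OF assms]) auto
qed

lemma PP_edge:
  assumes "0 \<le> p" "p \<le> 1"
  shows "PP (\<lambda>_. p) (\<lambda>w. w e) = p"
proof -
  have "dep {e} (\<lambda>w. of_bool (w e) :: real)" by (simp add: dep_def)
  from resample[OF _ this, of "\<lambda>_. p" e] show ?thesis using assms by simp
qed

text \<open>The quantity \<phi>_p(S) of Duminil-Copin and Tassion: the expected number of open edges
  leaving S whose inner end is connected to the origin inside S.\<close>

definition phi :: "real \<Rightarrow> vertex set \<Rightarrow> real" where
  "phi p S = p * (\<Sum>x\<in>S. \<Sum>y\<in>nbrs x - S. PP (\<lambda>_. p) (\<lambda>w. lconn (open_adj w) S origin x))"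

lemma phi_mono:
  assumes "finite S" "0 \<le> p" "p \<le> q" "q \<le> 1"
  shows "phi p S \<le> phi q S"
  unfolding phi_def
proof (rule mult_mono)
  show "(\<Sum>x\<in>S. \<Sum>y\<in>nbrs x - S. PP (\<lambda>_. p) (\<lambda>w. lconn (open_adj w) S origin x))
    \<le> (\<Sum>x\<in>S. \<Sum>y\<in>nbrs x - S. PP (\<lambda>_. q) (\<lambda>w. lconn (open_adj w) S origin x))"
    by (intro sum_mono EE_incr_param[OF finite_ein[OF assms(1)] dep_comp[OF dep_lconn] incr_of_bool[OF incr_lconn]] assms(2-4))
  show "0 \<le> (\<Sum>x\<in>S. \<Sum>y\<in>nbrs x - S. PP (\<lambda>_. p) (\<lambda>w. lconn (open_adj w) S origin x))"
    by (intro sum_nonneg PP_nonneg)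
qed (use assms in auto)

lemma phi_nonneg: "0 \<le> p \<Longrightarrow> 0 \<le> phi p S"
  unfolding phi_def by (intro mult_nonneg_nonneg sum_nonneg PP_nonneg)

definition clus :: "vertex set \<Rightarrow> (edge \<Rightarrow> bool) \<Rightarrow> vertex set" where
  "clus S w = {v. lconn (open_adj w) S origin v}"

lemma clus_subset: "clus S w \<subseteq> S"
  unfolding clus_def using lconn_in[of "open_adj w" S origin] by blast

lemma clus_step: "x \<in> clus S w \<Longrightarrow> open_adj w x y \<Longrightarrow> y \<in> S \<Longrightarrow> y \<in> clus S w"
  unfolding clus_def using lconn_step[of "open_adj w" S origin x y] by simp

text \<open>Exploring the cluster of the origin inside S up to its value C inspects only edges with
  an end in C. What happens off C stays independent of the event.\<close>

lemma dep_clus: "dep {e \<in> ein S. fst e \<in> C \<or> oe e \<in> C} (\<lambda>w. clus S w = C)"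
proof -
  let ?E = "{e \<in> ein S. fst e \<in> C \<or> oe e \<in> C}"
  have imp: "clus S w' = C" if eq: "\<And>e. e \<in> ?E \<Longrightarrow> w e = w' e" and C: "clus S w = C" for w w'
  proof
    show "C \<subseteq> clus S w'"
    proof
      fix v assume "v \<in> C"
      then have "lconn (open_adj w) S origin v" using C by (auto simp: clus_def)
      from lconn_cluster[OF this] have "lconn (open_adj w) C origin v" using C by (simp add: clus_def)
      moreover have "w e = w' e" if "e \<in> ein C" for e
        by (rule eq) (use that clus_subset[of S w] C in \<open>auto simp: ein_oe\<close>)
      ultimately have "lconn (open_adj w') C origin v" using lconn_cong[of C w w'] by blast
      then have "lconn (open_adj w') S origin v" by (rule lconn_mono) (use clus_subset[of S w] C in auto)
      then show "v \<in> clus S w'" by (simp add: clus_def)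
    qed
    show "clus S w' \<subseteq> C"
    proof
      fix v assume "v \<in> clus S w'"
      then have "lconn (open_adj w') S origin v" by (simp add: clus_def)
      then show "v \<in> C"
      proof (induction rule: lconn_induct)
        case base
        then show ?case using C by (auto simp: clus_def intro: lconn_refl)
      next
        case (step y z)
        have n: "z \<in> nbrs y" by (rule open_adj_nbrs[OF step(3)])
        have "ee y z \<in> ?E" using ee_ends[OF n] step by (auto simp: ein_oe doubleton_eq_iff)
        then have "w (ee y z) = w' (ee y z)" by (rule eq)
        then have "open_adj w y z" using step(3) unfolding open_adj_ee[OF n] by simp
        then show ?case using clus_step[of y S w z] step C by simp
      qed
    qed
  qed
  show ?thesis unfolding dep_def
  proof (intro allI impI)
    fix w w' :: "edge \<Rightarrow> bool" assume a: "\<forall>e\<in>?E. w e = w' e"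
    have 1: "clus S w = C \<Longrightarrow> clus S w' = C" by (rule imp[of w w'], erule bspec[OF a], assumption)
    have 2: "clus S w' = C \<Longrightarrow> clus S w = C" by (rule imp[of w' w], rule sym, erule bspec[OF a], assumption)
    show "(clus S w = C) = (clus S w' = C)" using 1 2 by argo
  qed
qed

lemma arm_from:
  assumes "0 \<le> N" "finite R" "\<And>v. v \<in> T \<Longrightarrow> N \<le> mnorm (fst v - fst y, snd v - snd y)" "0 \<le> p" "p \<le> 1"
  shows "PP (\<lambda>_. p) (\<lambda>w. cross w R {y} T) \<le> PP (\<lambda>_. p) (arm N)"
proof -
  let ?m = "\<lambda>v. mnorm (fst v - fst y, snd v - snd y)"
  let ?B = "{v. (1 * (fst v - fst y), 1 * (snd v - snd y)) \<in> box N}"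
  let ?A = "\<lambda>w. cross w ?B {y} {v. ?m v = N}"
  have fB: "finite ?B"
  proof -
    have "?B \<subseteq> (\<lambda>v. (fst v + fst y, snd v + snd y)) ` box N"
    proof
      fix v assume "v \<in> ?B"
      then show "v \<in> (\<lambda>v. (fst v + fst y, snd v + snd y)) ` box N"
        by (intro image_eqI[of _ _ "(fst v - fst y, snd v - snd y)"]) auto
    qed
    then show ?thesis by (rule finite_subset) simp
  qed
  have "PP (\<lambda>_. p) (\<lambda>w. cross w R {y} T) \<le> PP (\<lambda>_. p) ?A"
  proof (rule PP_mono[of "ein (R \<union> ?B)"])
    show "finite (ein (R \<union> ?B))" using fB assms by (intro finite_ein) auto
    show "dep (ein (R \<union> ?B)) (\<lambda>w. cross w R {y} T)" by (rule dep_mono[OF dep_cross ein_mono]) auto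
    show "dep (ein (R \<union> ?B)) ?A" by (rule dep_mono[OF dep_cross ein_mono]) auto
    fix w assume "cross w R {y} T"
    then obtain v where v: "v \<in> T" "lconn (open_adj w) R y v" by (auto simp: cross_def)
    have "N \<le> ?m v" by (rule assms(3)[OF v(1)])
    then have "\<exists>v'. ?m v' = N \<and> lconn (open_adj w) {x \<in> R. ?m x \<le> N} y v'"
    proof (intro lconn_truncate_end[OF v(2)])
      fix a b assume "open_adj w a b"
      then have "\<bar>fst b - fst a\<bar> \<le> 1" "\<bar>snd b - snd a\<bar> \<le> 1" by (auto simp: open_adj_def)
      then show "?m b \<le> ?m a + 1" unfolding mnorm_def fst_conv snd_conv by linarith
    qed (use assms(1) in \<open>simp add: mnorm_def\<close>)
    then obtain v' where v': "?m v' = N" "lconn (open_adj w) {x \<in> R. ?m x \<le> N} y v'" by blast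
    have "lconn (open_adj w) ?B y v'" by (rule lconn_mono[OF v'(2)]) (auto simp: box_def)
    then show "?A w" by (intro crossI[of y _ v']) (use v' in auto)
  qed
  also have "\<dots> = PP (\<lambda>_. p) (arm N)"
    unfolding arm_def
    by (rule cross_affine[of _ _ 1 1 _ "fst y" "snd y"]) (use assms in \<open>auto simp: origin_def prod_eq_iff\<close>)
  finally show ?thesis .
qed

text \<open>Let C be the cluster of the origin in S. After its last visit to C the arm uses an open
  edge xy with y outside S and continues off C. The value of C, the edge xy and the continuation
  depend on disjoint sets of edges, so the probabilities multiply. As y has norm at most L, the
  continuation contains a translated arm of length N.\<close>

lemma arm_submult:
  assumes S: "finite S" "S \<subseteq> box (L - 1)" "origin \<in> S" and N: "0 \<le> N" "1 \<le> L" and p: "0 \<le> p" "p \<le> 1"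
  shows "PP (\<lambda>_. p) (arm (N + L)) \<le> phi p S * PP (\<lambda>_. p) (arm N)"
proof -
  let ?P = "PP (\<lambda>_. p)"
  let ?B = "box (N + L)" and ?D = "{v. mnorm v = N + L}"
  let ?H = "\<lambda>C y w. cross w (?B - C) {y} ?D"
  let ?T = "\<lambda>C x y w. of_bool (clus S w = C) * (of_bool (w (ee x y)) * of_bool (?H C y w)) :: real"
  let ?E = "ein ?B"
  have SB: "S \<subseteq> ?B" using S N by (auto simp: box_def)
  have fE: "finite ?E" by (rule finite_ein) simp
  have yB: "y \<in> ?B" "mnorm y \<le> L" if "x \<in> S" "y \<in> nbrs x" for x y
    using mnorm_nbrs[OF that(2)] that(1) S N by (auto simp: box_def)
  have eB: "ee x y \<in> ?E" if "x \<in> S" "y \<in> nbrs x" for x y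
    using ee_ends[OF that(2)] yB[OF that] SB that(1) by (auto simp: ein_oe doubleton_eq_iff)
  have dH: "dep (ein (?B - C)) (\<lambda>w. of_bool (?H C y w) :: real)" for C y by (rule dep_comp[OF dep_cross])
  have de: "dep {e} (\<lambda>w. of_bool (w e) :: real)" for e by (simp add: dep_def)
  have dc: "dep {e \<in> ein S. fst e \<in> C \<or> oe e \<in> C} (\<lambda>w. of_bool (clus S w = C) :: real)" for C
    by (rule dep_comp[OF dep_clus])
  have dT: "dep ?E (?T C x y)" if "x \<in> S" "y \<in> nbrs x" for C x y
  proof (rule dep_comp2[OF dep_mono[OF dc] dep_comp2[OF dep_mono[OF de] dep_mono[OF dH]]])
    show "{e \<in> ein S. fst e \<in> C \<or> oe e \<in> C} \<subseteq> ?E" using ein_mono[OF SB] by blast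
    show "{ee x y} \<subseteq> ?E" using eB[OF that] by simp
    show "ein (?B - C) \<subseteq> ?E" by (rule ein_mono) auto
  qed
  have le: "of_bool (arm (N + L) w) \<le> (\<Sum>C\<in>Pow S. \<Sum>x\<in>C. \<Sum>y\<in>nbrs x - S. ?T C x y w)" (is "_ \<le> ?sum w") for w
  proof (cases "arm (N + L) w")
    case False
    have "0 \<le> ?sum w" by (intro sum_nonneg) simp
    then show ?thesis using False by simp
  next
    case True
    define C where "C = clus S w"
    have CS: "C \<subseteq> S" unfolding C_def by (rule clus_subset)
    obtain v where v: "mnorm v = N + L" "lconn (open_adj w) ?B origin v" using True by (auto simp: arm_def cross_def)
    have vC: "v \<notin> C" using v(1) CS S N by (auto simp: box_def)
    have oC: "origin \<in> C" using S by (auto simp: C_def clus_def intro: lconn_refl)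
    \<comment> \<open>Follows the connection and restarts at each exit from C, so that the final y
      belongs to the last exit. An open edge from C to a vertex outside C must leave S.\<close>
    have "v \<in> C \<or> (\<exists>x\<in>C. \<exists>y. y \<in> nbrs x - S \<and> open_adj w x y \<and> lconn (open_adj w) (?B - C) y v)"
      using v(2)
    proof (induction rule: lconn_induct)
      case base
      then show ?case using oC by simp
    next
      case (step a b)
      show ?case
      proof (cases "b \<in> C")
        case False
        show ?thesis
        proof (cases "a \<in> C")
          case True
          have "b \<notin> S" using clus_step[of a S w b] True step(3) False by (auto simp: C_def)
          then show ?thesis using True open_adj_nbrs[OF step(3)] step False
            by (intro disjI2 bexI[OF _ True] exI[of _ b]) (auto intro: lconn_refl)
        next
          case aC: False
          then obtain x y where xy: "x \<in> C" "y \<in> nbrs x - S" "open_adj w x y" "lconn (open_adj w) (?B - C) y a" using step.IH by blast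
          have "lconn (open_adj w) (?B - C) y b" by (rule lconn_step[OF xy(4) step(3)]) (use step False in auto)
          then show ?thesis using xy by blast
        qed
      qed simp
    qed
    then obtain x y where xy: "x \<in> C" "y \<in> nbrs x - S" "open_adj w x y" "lconn (open_adj w) (?B - C) y v" using vC by blast
    have "?H C y w" by (rule crossI[OF _ _ xy(4)]) (use v in auto)
    then have T1: "?T C x y w = 1" using xy open_adj_ee[of y x w] by (simp add: C_def)
    have "1 \<le> (\<Sum>y\<in>nbrs x - S. ?T C x y w)"
      unfolding T1[symmetric] by (rule member_le_sum) (use xy in auto)
    also have "\<dots> \<le> (\<Sum>x\<in>C. \<Sum>y\<in>nbrs x - S. ?T C x y w)"
      by (rule member_le_sum[of x C "\<lambda>x. \<Sum>y\<in>nbrs x - S. ?T C x y w"]) (use xy CS S finite_subset in \<open>auto intro!: sum_nonneg\<close>)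
    also have "\<dots> \<le> ?sum w"
      by (rule member_le_sum[of C "Pow S" "\<lambda>C. \<Sum>x\<in>C. \<Sum>y\<in>nbrs x - S. ?T C x y w"]) (use CS S in \<open>auto intro!: sum_nonneg\<close>)
    finally show ?thesis using True by simp
  qed
  have sub: "N + L = N + L" by simp
  have ET: "EE (\<lambda>_. p) (?T C x y) \<le> ?P (\<lambda>w. clus S w = C) * (p * ?P (arm N))"
    if C: "C \<subseteq> S" and x: "x \<in> C" and y: "y \<in> nbrs x - S" for C x y
  proof -
    have xS: "x \<in> S" using C x by auto
    have ends: "{fst (ee x y), oe (ee x y)} = {x, y}" by (rule ee_ends) (use y in simp)
    have n1: "ee x y \<notin> ein S" using ends y by (auto simp: ein_oe doubleton_eq_iff)
    have n2: "ee x y \<notin> ein (?B - C)" using ends x by (auto simp: ein_oe doubleton_eq_iff)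
    have "EE (\<lambda>_. p) (?T C x y) = ?P (\<lambda>w. clus S w = C) * EE (\<lambda>_. p) (\<lambda>w. of_bool (w (ee x y)) * of_bool (?H C y w))"
    proof (rule EE_indep[OF _ _ dc])
      show "dep (insert (ee x y) (ein (?B - C))) (\<lambda>w. of_bool (w (ee x y)) * of_bool (?H C y w) :: real)"
        by (rule dep_comp2[OF dep_mono[OF de] dep_mono[OF dH]]) auto
      show "{e \<in> ein S. fst e \<in> C \<or> oe e \<in> C} \<inter> insert (ee x y) (ein (?B - C)) = {}"
        using n1 by (auto simp: ein_oe)
      show "finite {e \<in> ein S. fst e \<in> C \<or> oe e \<in> C}" using finite_ein[OF S(1)] by simp
      show "finite (insert (ee x y) (ein (?B - C)))" by (simp add: finite_ein)
    qed (use p in auto)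
    also have "EE (\<lambda>_. p) (\<lambda>w. of_bool (w (ee x y)) * of_bool (?H C y w)) = p * ?P (?H C y)"
    proof -
      have "EE (\<lambda>_. p) (\<lambda>w. of_bool (w (ee x y)) * of_bool (?H C y w)) = ?P (\<lambda>w. w (ee x y)) * ?P (?H C y)"
        by (rule EE_indep[OF _ _ de dH]) (use n2 p in \<open>auto intro: finite_ein\<close>)
      then show ?thesis by (simp add: PP_edge[OF p])
    qed
    also have "?P (\<lambda>w. clus S w = C) * (p * ?P (?H C y)) \<le> ?P (\<lambda>w. clus S w = C) * (p * ?P (arm N))"
    proof (intro mult_left_mono PP_nonneg p)
      show "?P (?H C y) \<le> ?P (arm N)"
      proof (rule arm_from)
        fix v assume "v \<in> ?D"
        moreover have "mnorm v \<le> mnorm (fst v - fst y, snd v - snd y) + mnorm y" unfolding mnorm_def fst_conv snd_conv by linarith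
        ultimately show "N \<le> mnorm (fst v - fst y, snd v - snd y)" using yB(2)[OF xS, of y] y by simp
      qed (use N p in auto)
    qed
    finally show ?thesis .
  qed
  have "?P (arm (N + L)) \<le> EE (\<lambda>_. p) (\<lambda>w. \<Sum>C\<in>Pow S. \<Sum>x\<in>C. \<Sum>y\<in>nbrs x - S. ?T C x y w)"
  proof (rule EE_mono[OF fE dep_comp[OF dep_arm]])
    show "of_bool (arm (N + L) w) \<le> (\<Sum>C\<in>Pow S. \<Sum>x\<in>C. \<Sum>y\<in>nbrs x - S. ?T C x y w)" for w by (rule le)
    show "dep ?E (\<lambda>w. \<Sum>C\<in>Pow S. \<Sum>x\<in>C. \<Sum>y\<in>nbrs x - S. ?T C x y w)"
      by (rule dep_sum, rule dep_sum, rule dep_sum, rule dT) auto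
  qed
  also have "\<dots> = (\<Sum>C\<in>Pow S. \<Sum>x\<in>C. \<Sum>y\<in>nbrs x - S. EE (\<lambda>_. p) (?T C x y))"
  proof -
    have "EE (\<lambda>_. p) (\<lambda>w. \<Sum>C\<in>Pow S. \<Sum>x\<in>C. \<Sum>y\<in>nbrs x - S. ?T C x y w) =
      (\<Sum>C\<in>Pow S. EE (\<lambda>_. p) (\<lambda>w. \<Sum>x\<in>C. \<Sum>y\<in>nbrs x - S. ?T C x y w))"
      by (rule EE_sum[OF fE], rule dep_sum, rule dep_sum, rule dT) auto
    also have "\<dots> = (\<Sum>C\<in>Pow S. \<Sum>x\<in>C. EE (\<lambda>_. p) (\<lambda>w. \<Sum>y\<in>nbrs x - S. ?T C x y w))"
      by (rule sum.cong[OF refl], rule EE_sum[OF fE], rule dep_sum, rule dT) auto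
    also have "\<dots> = (\<Sum>C\<in>Pow S. \<Sum>x\<in>C. \<Sum>y\<in>nbrs x - S. EE (\<lambda>_. p) (?T C x y))"
      by (rule sum.cong[OF refl], rule sum.cong[OF refl], rule EE_sum[OF fE], rule dT) auto
    finally show ?thesis .
  qed
  also have "\<dots> \<le> (\<Sum>C\<in>Pow S. \<Sum>x\<in>C. \<Sum>y\<in>nbrs x - S. ?P (\<lambda>w. clus S w = C) * (p * ?P (arm N)))"
    by (intro sum_mono ET) auto
  also have "\<dots> = p * ?P (arm N) * (\<Sum>C\<in>Pow S. \<Sum>x\<in>C. \<Sum>y\<in>nbrs x - S. ?P (\<lambda>w. clus S w = C))"
    by (simp only: sum_distrib_left mult.commute mult.left_commute)
  \<comment> \<open>The indicator makes the range of x independent of C; the sum over C can then be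
    done first and yields the probability that x is connected to the origin in S.\<close>
  also have "(\<Sum>C\<in>Pow S. \<Sum>x\<in>C. \<Sum>y\<in>nbrs x - S. ?P (\<lambda>w. clus S w = C)) =
     (\<Sum>C\<in>Pow S. \<Sum>x\<in>S. \<Sum>y\<in>nbrs x - S. of_bool (x \<in> C) * ?P (\<lambda>w. clus S w = C))"
  proof (rule sum.cong[OF refl])
    fix C assume "C \<in> Pow S"
    then have "C \<subseteq> S" by simp
    then have "(\<Sum>x\<in>C. \<Sum>y\<in>nbrs x - S. ?P (\<lambda>w. clus S w = C)) = (\<Sum>x\<in>C. \<Sum>y\<in>nbrs x - S. of_bool (x \<in> C) * ?P (\<lambda>w. clus S w = C))"
      by (intro sum.cong refl) simp
    also have "\<dots> = (\<Sum>x\<in>S. \<Sum>y\<in>nbrs x - S. of_bool (x \<in> C) * ?P (\<lambda>w. clus S w = C))"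
      by (rule sum.mono_neutral_left) (use \<open>C \<subseteq> S\<close> S in auto)
    finally show "(\<Sum>x\<in>C. \<Sum>y\<in>nbrs x - S. ?P (\<lambda>w. clus S w = C)) = (\<Sum>x\<in>S. \<Sum>y\<in>nbrs x - S. of_bool (x \<in> C) * ?P (\<lambda>w. clus S w = C))" .
  qed
  also have "\<dots> = (\<Sum>x\<in>S. \<Sum>y\<in>nbrs x - S. \<Sum>C\<in>Pow S. of_bool (x \<in> C) * ?P (\<lambda>w. clus S w = C))"
    by (subst sum.swap, rule sum.cong[OF refl], rule sum.swap)
  also have "\<dots> = (\<Sum>x\<in>S. \<Sum>y\<in>nbrs x - S. ?P (\<lambda>w. lconn (open_adj w) S origin x))"
  proof (intro sum.cong refl)
    fix x y
    have dl: "dep (ein S) (\<lambda>w. of_bool (x \<in> C) * of_bool (clus S w = C) :: real)" for C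
      by (rule dep_comp2[OF dep_const dep_mono[OF dc]]) auto
    have "(\<Sum>C\<in>Pow S. of_bool (x \<in> C) * ?P (\<lambda>w. clus S w = C)) = EE (\<lambda>_. p) (\<lambda>w. \<Sum>C\<in>Pow S. of_bool (x \<in> C) * of_bool (clus S w = C))"
      by (subst EE_sum[OF finite_ein[OF S(1)] dl]) auto
    also have "\<dots> = ?P (\<lambda>w. lconn (open_adj w) S origin x)"
    proof (rule Bochner_Integration.integral_cong[OF refl])
      fix w
      have "(\<Sum>C\<in>Pow S. of_bool (x \<in> C) * of_bool (clus S w = C)) = (\<Sum>C\<in>{clus S w}. of_bool (x \<in> C) :: real)"
        by (rule sum.mono_neutral_cong_right) (use S clus_subset[of S w] in auto)
      then show "(\<Sum>C\<in>Pow S. of_bool (x \<in> C) * of_bool (clus S w = C)) = (of_bool (lconn (open_adj w) S origin x) :: real)"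
        by (simp add: clus_def)
    qed
    finally show "(\<Sum>C\<in>Pow S. of_bool (x \<in> C) * ?P (\<lambda>w. clus S w = C)) = ?P (\<lambda>w. lconn (open_adj w) S origin x)" .
  qed
  also have "p * ?P (arm N) * (\<Sum>x\<in>S. \<Sum>y\<in>nbrs x - S. ?P (\<lambda>w. lconn (open_adj w) S origin x)) = phi p S * ?P (arm N)"
    by (simp add: phi_def)
  finally show ?thesis .
qed

text \<open>The part of the box cut off from its boundary; it contains the origin exactly when there
  is no arm. As it is explored from the boundary, its interior remains fresh.\<close>

definition cutset :: "int \<Rightarrow> (edge \<Rightarrow> bool) \<Rightarrow> vertex set" where
  "cutset N w = {x \<in> box N. \<not> cross w (box N) {x} {v. mnorm v = N}}"

lemma cutset_boundary: "mnorm v = N \<Longrightarrow> v \<notin> cutset N w"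
  by (auto simp: cutset_def box_def intro!: crossI[of v _ v] lconn_refl)

lemma cutset_open:
  assumes "x \<in> cutset N w" "open_adj w x y" "y \<in> box N"
  shows "y \<in> cutset N w"
proof (rule ccontr)
  assume "y \<notin> cutset N w"
  then obtain v where v: "mnorm v = N" "lconn (open_adj w) (box N) y v" using assms(3) by (auto simp: cutset_def cross_def)
  have "lconn (open_adj w) (box N) x v"
    by (rule lconn_trans[OF lconn_step1[of "open_adj w", OF assms(2)] v(2)]) (use assms in \<open>auto simp: cutset_def\<close>)
  then have "cross w (box N) {x} {v. mnorm v = N}" by (intro crossI[of x _ v]) (use v in auto)
  then show False using assms(1) by (simp add: cutset_def)
qed

text \<open>The connections from the boundary to vertices outside S avoid S, and all edges between S
  and the rest are closed. Edges with both ends in S are never inspected, which makes connections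
  inside S independent of this event.\<close>

lemma dep_cutset: "dep (ein (box N) - ein S) (\<lambda>w. cutset N w = S)"
proof -
  let ?E = "ein (box N) - ein S"
  have imp: "cutset N w' = S" if eq: "\<And>e. e \<in> ?E \<Longrightarrow> w e = w' e" and S: "cutset N w = S" for w w'
  proof -
    have adj: "open_adj w x y \<longleftrightarrow> open_adj w' x y" if "x \<in> box N" "y \<in> box N" "x \<notin> S \<or> y \<notin> S" for x y
    proof (cases "y \<in> nbrs x")
      case True
      have "ee x y \<in> ?E" using ee_ends[OF True] that by (auto simp: ein_oe doubleton_eq_iff)
      then show ?thesis using eq open_adj_ee[OF True] by simp
    next
      case False
      then show ?thesis using open_adj_nbrs by blast
    qed
    have 1: "y \<notin> cutset N w'" if y: "y \<in> box N" "y \<notin> S" for y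
    proof -
      obtain v where v: "mnorm v = N" "lconn (open_adj w) (box N) y v" using y S by (auto simp: cutset_def cross_def)
      have "lconn (open_adj w) (box N - S) y v"
        using v(2)
      proof (induction rule: lconn_induct)
        case base
        then show ?case using y by (intro lconn_refl) auto
      next
        case (step a b)
        have "a \<notin> S" using lconn_in[OF step.IH] by simp
        then have "b \<notin> S" using cutset_open[of b N w a] open_adj_sym[OF step(3)] step S by auto
        then show ?case using lconn_step[OF step.IH step(3)] step by simp
      qed
      then have "lconn (open_adj w') (box N) y v"
        by (rule lconn_mono) (use adj in auto)
      then show ?thesis using v(1) by (auto simp: cutset_def intro: crossI[of y _ v])
    qed
    have 2: "x \<in> cutset N w'" if x: "x \<in> S" for x
    proof (rule ccontr)
      assume "x \<notin> cutset N w'"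
      moreover have xb: "x \<in> box N" using x S by (auto simp: cutset_def)
      ultimately obtain v where v: "mnorm v = N" "lconn (open_adj w') (box N) x v" by (auto simp: cutset_def cross_def)
      have "v \<in> S" using v(2)
      proof (induction rule: lconn_induct)
        case base
        then show ?case using x by simp
      next
        case (step a b)
        show ?case
        proof (rule ccontr)
          assume b: "b \<notin> S"
          then have "open_adj w a b" using adj[of a b] step by simp
          then show False using cutset_open[of a N w b] step S b by simp
        qed
      qed
      then show False using cutset_boundary[OF v(1)] S by blast
    qed
    show ?thesis using 1 2 S by (auto simp: cutset_def)
  qed
  show ?thesis unfolding dep_def
  proof (intro allI impI)
    fix w w' :: "edge \<Rightarrow> bool" assume a: "\<forall>e\<in>?E. w e = w' e"
    have 1: "cutset N w = S \<Longrightarrow> cutset N w' = S" by (rule imp[of w w'], erule bspec[OF a], assumption)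
    have 2: "cutset N w' = S \<Longrightarrow> cutset N w = S" by (rule imp[of w' w], rule sym, erule bspec[OF a], assumption)
    show "(cutset N w = S) = (cutset N w' = S)" using 1 2 by argo
  qed
qed

text \<open>Without an arm the cutset S contains the origin. Every edge from a vertex connected to
  the origin inside S to a vertex outside S is closed, and opening it creates an arm. By
  independence the conditional expected number of such edges is \<phi>_p(S)/p, hence at least 1;
  each is counted in the derivative given by Russo's formula.\<close>

lemma arm_deriv_bound:
  assumes N: "0 \<le> N" and p: "0 < p" "p < 1" and ph: "\<And>S. finite S \<Longrightarrow> origin \<in> S \<Longrightarrow> 1 \<le> phi p S"
  shows "1 - PP (\<lambda>_. p) (arm N) \<le> (\<Sum>e\<in>ein (box N). EE (\<lambda>_. p) (\<lambda>w. of_bool (arm N (w(e := True)))) - EE (\<lambda>_. p) (\<lambda>w. of_bool (arm N (w(e := False)))))"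
proof -
  let ?P = "PP (\<lambda>_. p)"
  let ?E = "ein (box N)"
  let ?I = "{S \<in> Pow (box N). origin \<in> S}"
  let ?piv = "\<lambda>e w. \<not> w e \<and> arm N (w(e := True)) \<and> \<not> arm N w"
  let ?T = "\<lambda>S x y w. of_bool (cutset N w = S) * of_bool (lconn (open_adj w) S origin x) :: real"
  have fE: "finite ?E" by (rule finite_ein) simp
  have da: "dep ?E (\<lambda>w. arm N (w(e := b)))" for e b
    by (rule dep_upd[OF dep_mono[OF dep_arm]]) auto
  have dpiv: "dep ?E (?piv e)" if "e \<in> ?E" for e
  proof (rule dep_comp2[where h="(\<and>)"])
    show "dep ?E (\<lambda>w. \<not> w e)" using that by (auto simp: dep_def)
    show "dep ?E (\<lambda>w. arm N (w(e := True)) \<and> \<not> arm N w)"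
      by (rule dep_comp2[OF da dep_arm])
  qed
  have T: "EE (\<lambda>_. p) (?T S x y) = ?P (\<lambda>w. cutset N w = S) * ?P (\<lambda>w. lconn (open_adj w) S origin x)"
    if "S \<subseteq> box N" for S x y
    by (rule EE_indep[OF _ _ dep_comp[OF dep_cutset] dep_comp[OF dep_lconn]])
       (use p finite_subset[OF that finite_box] finite_ein[OF finite_box] in \<open>auto intro: finite_ein\<close>)
  have dT: "dep ?E (?T S x y)" if "S \<subseteq> box N" for S x y
    by (rule dep_comp2[OF dep_mono[OF dep_cutset] dep_mono[OF dep_lconn ein_mono[OF that]]]) auto
  have le: "(\<Sum>S\<in>?I. \<Sum>x\<in>S. \<Sum>y\<in>nbrs x - S. ?T S x y w) \<le> (\<Sum>e\<in>?E. of_bool (?piv e w))" for w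
  proof -
    define S where "S = cutset N w"
    have Sb: "S \<subseteq> box N" by (auto simp: S_def cutset_def)
    have fS: "finite S" by (rule finite_subset[OF Sb]) simp
    show ?thesis
    proof (cases "origin \<in> S")
      case False
      then have "?T S' x y w = 0" if "S' \<in> ?I" for S' x y using that by (auto simp: S_def)
      then have "(\<Sum>S\<in>?I. \<Sum>x\<in>S. \<Sum>y\<in>nbrs x - S. ?T S x y w) = 0" by (intro sum.neutral ballI)
      then show ?thesis by (simp add: sum_nonneg)
    next
      case True
      have noarm: "\<not> arm N w" using True by (auto simp: S_def cutset_def arm_def)
      let ?X = "{(x, y). x \<in> S \<and> y \<in> nbrs x - S \<and> lconn (open_adj w) S origin x}"
      have "?X \<subseteq> (SIGMA x:S. nbrs x - S)" by auto
      then have fX: "finite ?X" by (rule finite_subset) (use fS in auto)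
      have "(\<Sum>S'\<in>?I. \<Sum>x\<in>S'. \<Sum>y\<in>nbrs x - S'. ?T S' x y w) = (\<Sum>S'\<in>{S}. \<Sum>x\<in>S'. \<Sum>y\<in>nbrs x - S'. ?T S' x y w)"
        by (rule sum.mono_neutral_right) (use True Sb in \<open>auto simp: S_def intro!: sum.neutral\<close>)
      also have "\<dots> = (\<Sum>x\<in>S. \<Sum>y\<in>nbrs x - S. of_bool (lconn (open_adj w) S origin x))"
        by (simp add: S_def)
      also have "\<dots> = (\<Sum>(x, y)\<in>(SIGMA x:S. nbrs x - S). of_bool (lconn (open_adj w) S origin x))"
        by (rule sum.Sigma) (use fS in auto)
      also have "\<dots> = (\<Sum>z\<in>?X. 1)"
        by (rule sum.mono_neutral_cong_right) (use fS in auto)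
      also have "\<dots> = (\<Sum>e\<in>(\<lambda>(x, y). ee x y) ` ?X. 1)"
      proof (rule sum.reindex[unfolded comp_def, symmetric])
        show "inj_on (\<lambda>(x, y). ee x y) ?X"
        proof (rule inj_onI)
          fix a b assume a: "a \<in> ?X" and b: "b \<in> ?X" and eq: "(\<lambda>(x, y). ee x y) a = (\<lambda>(x, y). ee x y) b"
          obtain x y x' y' where ab: "a = (x, y)" "b = (x', y')" by (cases a; cases b)
          have "{x, y} = {x', y'}" using ee_ends[of y x] ee_ends[of y' x'] a b eq ab by auto
          then show "a = b" using a b ab by (auto simp: doubleton_eq_iff)
        qed
      qed
      also have "\<dots> \<le> (\<Sum>e\<in>?E. of_bool (?piv e w))"
      proof -
        have piv: "e \<in> ?E \<and> ?piv e w" if et: "e \<in> (\<lambda>(x, y). ee x y) ` ?X" for e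
        proof -
          obtain x y where xy: "e = ee x y" "x \<in> S" "y \<in> nbrs x" "y \<notin> S" "lconn (open_adj w) S origin x" using et by auto
          have xb: "x \<in> box N" "mnorm x \<noteq> N" using xy(2) Sb cutset_boundary[of x N w] by (auto simp: S_def)
          then have yb: "y \<in> box N" using mnorm_nbrs[OF xy(3)] by (auto simp: box_def)
          have eE: "e \<in> ?E" using ee_ends[OF xy(3)] xb yb xy(1) by (auto simp: ein_oe doubleton_eq_iff)
          have "\<not> open_adj w x y" using cutset_open[of x N w y] xy yb by (auto simp: S_def)
          then have we: "\<not> w e" using open_adj_ee[OF xy(3)] xy(1) by simp
          let ?w = "w(e := True)"
          have up: "\<And>e'. w e' \<Longrightarrow> ?w e'" by simp
          obtain v where v: "mnorm v = N" "lconn (open_adj w) (box N) y v" using xy(4) yb by (auto simp: S_def cutset_def cross_def)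
          have "lconn (open_adj w) (box N) origin x" by (rule lconn_mono[OF xy(5) _ Sb])
          then have "lconn (open_adj ?w) (box N) origin x" by (rule lconn_incr) (rule up)
          also have "lconn (open_adj ?w) (box N) x y" by (rule lconn_step1) (use open_adj_ee[OF xy(3)] xy(1) xb yb in auto)
          also have "lconn (open_adj ?w) (box N) y v" by (rule lconn_incr[OF v(2)]) (rule up)
          finally have "arm N ?w" unfolding arm_def by (intro crossI[of origin _ v]) (use v in auto)
          then show ?thesis using eE we noarm by blast
        qed
        have "(\<Sum>e\<in>(\<lambda>(x, y). ee x y) ` ?X. 1) = (\<Sum>e\<in>(\<lambda>(x, y). ee x y) ` ?X. of_bool (?piv e w) :: real)"
          by (rule sum.cong[OF refl]) (use piv in simp)
        also have "\<dots> \<le> (\<Sum>e\<in>?E. of_bool (?piv e w))"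
        proof (rule sum_mono2[OF fE])
          show "(\<lambda>(x, y). ee x y) ` ?X \<subseteq> ?E" by (intro subsetI conjunct1[OF piv])
        qed simp
        finally show ?thesis by simp
      qed
      finally show ?thesis by simp
    qed
  qed
  have "1 - ?P (arm N) = ?P (\<lambda>w. \<not> arm N w)"
  proof -
    have "integrable (percf (\<lambda>_. p)) (\<lambda>w. of_bool (arm N w) :: real)"
      by (rule dep_integrable[OF fE dep_comp[OF dep_arm]])
    moreover have "integrable (percf (\<lambda>_. p)) (\<lambda>w::edge \<Rightarrow> bool. 1::real)"
      by (rule dep_integrable[OF finite.emptyI dep_const])
    ultimately show ?thesis by (simp only: of_bool_not_iff Bochner_Integration.integral_diff EE_const)
  qed
  also have "\<dots> = EE (\<lambda>_. p) (\<lambda>w. \<Sum>S\<in>?I. of_bool (cutset N w = S))"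
  proof (rule Bochner_Integration.integral_cong[OF refl])
    fix w
    have "(\<Sum>S\<in>?I. of_bool (cutset N w = S)) = (\<Sum>S\<in>?I \<inter> {cutset N w}. 1 :: real)"
      by (rule sum.mono_neutral_cong_right) auto
    moreover have "cutset N w \<in> ?I \<longleftrightarrow> \<not> arm N w" using N by (auto simp: cutset_def arm_def box_def)
    ultimately show "(of_bool (\<not> arm N w) :: real) = (\<Sum>S\<in>?I. of_bool (cutset N w = S))"
      by (cases "arm N w") auto
  qed
  also have "\<dots> = (\<Sum>S\<in>?I. ?P (\<lambda>w. cutset N w = S))"
    by (rule EE_sum[OF fE], rule dep_comp, rule dep_mono[OF dep_cutset]) auto
  also have "\<dots> \<le> (\<Sum>S\<in>?I. \<Sum>x\<in>S. \<Sum>y\<in>nbrs x - S. EE (\<lambda>_. p) (?T S x y))"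
  proof (rule sum_mono)
    fix S assume S: "S \<in> ?I"
    then have "S \<subseteq> box N" "origin \<in> S" "finite S" using finite_subset[OF _ finite_box] by auto
    have "1 \<le> phi p S" by (rule ph) fact+
    also have "\<dots> \<le> (\<Sum>x\<in>S. \<Sum>y\<in>nbrs x - S. ?P (\<lambda>w. lconn (open_adj w) S origin x))"
      unfolding phi_def by (rule mult_left_le_one_le) (use p in \<open>auto intro!: sum_nonneg PP_nonneg\<close>)
    finally have "?P (\<lambda>w. cutset N w = S) * 1 \<le> ?P (\<lambda>w. cutset N w = S) * (\<Sum>x\<in>S. \<Sum>y\<in>nbrs x - S. ?P (\<lambda>w. lconn (open_adj w) S origin x))"
      by (rule mult_left_mono) (rule PP_nonneg)
    then show "?P (\<lambda>w. cutset N w = S) \<le> (\<Sum>x\<in>S. \<Sum>y\<in>nbrs x - S. EE (\<lambda>_. p) (?T S x y))"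
      unfolding T[OF \<open>S \<subseteq> box N\<close>] by (simp only: sum_distrib_left mult_1_right)
  qed
  also have "\<dots> = EE (\<lambda>_. p) (\<lambda>w. \<Sum>S\<in>?I. \<Sum>x\<in>S. \<Sum>y\<in>nbrs x - S. ?T S x y w)"
  proof -
    have "EE (\<lambda>_. p) (\<lambda>w. \<Sum>S\<in>?I. \<Sum>x\<in>S. \<Sum>y\<in>nbrs x - S. ?T S x y w) = (\<Sum>S\<in>?I. EE (\<lambda>_. p) (\<lambda>w. \<Sum>x\<in>S. \<Sum>y\<in>nbrs x - S. ?T S x y w))"
      by (rule EE_sum[OF fE], rule dep_sum, rule dep_sum, rule dT) auto
    also have "\<dots> = (\<Sum>S\<in>?I. \<Sum>x\<in>S. EE (\<lambda>_. p) (\<lambda>w. \<Sum>y\<in>nbrs x - S. ?T S x y w))"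
      by (rule sum.cong[OF refl], rule EE_sum[OF fE], rule dep_sum, rule dT) auto
    also have "\<dots> = (\<Sum>S\<in>?I. \<Sum>x\<in>S. \<Sum>y\<in>nbrs x - S. EE (\<lambda>_. p) (?T S x y))"
      by (rule sum.cong[OF refl], rule sum.cong[OF refl], rule EE_sum[OF fE], rule dT) auto
    finally show ?thesis by simp
  qed
  also have "\<dots> \<le> EE (\<lambda>_. p) (\<lambda>w. \<Sum>e\<in>?E. of_bool (?piv e w))"
  proof (rule EE_mono[OF fE _ _ le])
    show "dep ?E (\<lambda>w. \<Sum>S\<in>?I. \<Sum>x\<in>S. \<Sum>y\<in>nbrs x - S. ?T S x y w)"
      by (rule dep_sum, rule dep_sum, rule dep_sum, rule dT) auto
    show "dep ?E (\<lambda>w. \<Sum>e\<in>?E. of_bool (?piv e w) :: real)"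
      by (rule dep_sum, rule dep_comp[OF dpiv])
  qed
  also have "\<dots> = (\<Sum>e\<in>?E. ?P (?piv e))"
    by (rule EE_sum[OF fE], rule dep_comp[OF dpiv])
  also have "\<dots> \<le> (\<Sum>e\<in>?E. EE (\<lambda>_. p) (\<lambda>w. of_bool (arm N (w(e := True)))) - EE (\<lambda>_. p) (\<lambda>w. of_bool (arm N (w(e := False)))))"
  proof (rule sum_mono)
    fix e assume e: "e \<in> ?E"
    have i: "integrable (percf (\<lambda>_. p)) (\<lambda>w. of_bool (arm N (w(e := b))) :: real)" for b
      by (rule dep_integrable[OF fE dep_comp[OF da]])
    have "?P (?piv e) \<le> EE (\<lambda>_. p) (\<lambda>w. of_bool (arm N (w(e := True))) - of_bool (arm N (w(e := False))))"
    proof (rule EE_mono[OF fE dep_comp[OF dpiv[OF e]] dep_comp2[OF da da]])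
      fix w
      have m: "arm N (w(e := False)) \<Longrightarrow> arm N (w(e := True))"
        using incrD[OF incr_arm, of "w(e := False)" "w(e := True)" N] by (auto simp: le_bool_def split: if_splits)
      have "w(e := False) = w" if "\<not> w e" using that by (simp add: fun_upd_idem)
      then show "of_bool (?piv e w) \<le> (of_bool (arm N (w(e := True))) - of_bool (arm N (w(e := False))) :: real)"
        using m by (cases "?piv e w") (auto simp: of_bool_def)
    qed
    then show "?P (?piv e) \<le> EE (\<lambda>_. p) (\<lambda>w. of_bool (arm N (w(e := True)))) - EE (\<lambda>_. p) (\<lambda>w. of_bool (arm N (w(e := False))))"
      unfolding Bochner_Integration.integral_diff[OF i i] .
  qed
  finally show ?thesis .
qed

text \<open>Otherwise \<phi> is at least 1 on all of [q, 1/2] by monotonicity, so the derivative of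
  the arm probability is at least 1/2 wherever that probability is at most 1/2. It would then be at
  least (1/2 - q)/2 at 1/2, although arms become arbitrarily unlikely there.\<close>

lemma exists_phi_less_1:
  assumes q: "0 < q" "q < 1/2"
  shows "\<exists>S. finite S \<and> origin \<in> S \<and> phi q S < 1"
proof (rule ccontr)
  assume no: "\<not> ?thesis"
  obtain N0 where N0: "0 \<le> N0" "\<forall>N\<ge>N0. PH (arm N) < min (1/2) ((1/2 - q) / 4)"
    using arm_half_small[of "min (1/2) ((1/2 - q) / 4)"] q by auto
  let ?N = "N0"
  let ?f = "\<lambda>p. PP (\<lambda>_. p) (arm ?N)"
  let ?d = "\<lambda>p. \<Sum>e\<in>ein (box ?N). EE (\<lambda>_. p) (\<lambda>w. of_bool (arm ?N (w(e := True)))) - EE (\<lambda>_. p) (\<lambda>w. of_bool (arm ?N (w(e := False))))"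
  have fE: "finite (ein (box ?N))" by (rule finite_ein) simp
  have half: "?f (1/2) < 1/2" "?f (1/2) < (1/2 - q) / 4" using N0 by force+
  have D: "(?f has_real_derivative ?d p) (at p)" if "q \<le> p" "p \<le> 1/2" for p
    by (rule russo[OF fE dep_comp[OF dep_arm]]) (use that q in auto)
  obtain z where z: "q < z" "z < 1/2" "?f (1/2) - ?f q = (1/2 - q) * ?d z"
    using MVT2[OF q(2), of ?f ?d] D by blast
  have "1 \<le> phi z S" if S: "finite S" "origin \<in> S" for S
  proof -
    have "1 \<le> phi q S" using no S by force
    also have "\<dots> \<le> phi z S" by (rule phi_mono) (use S q z in auto)
    finally show ?thesis .
  qed
  then have "1 - ?f z \<le> ?d z" by (intro arm_deriv_bound) (use N0 z q in auto)
  moreover have "?f z \<le> ?f (1/2)"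
    by (rule EE_incr_param[OF fE dep_comp[OF dep_arm] incr_of_bool[OF incr_arm]]) (use z q in auto)
  ultimately have "1/2 \<le> ?d z" using half by linarith
  then have "(1/2 - q) * (1/2) \<le> (1/2 - q) * ?d z" using q by (intro mult_left_mono) auto
  moreover have "0 \<le> ?f q" by (rule PP_nonneg)
  ultimately show False using z(3) half q by argo
qed

lemma arm_exponential_decay:
  assumes q: "0 < q" "q < 1/2"
  shows "\<exists>L a. 1 \<le> L \<and> 0 \<le> a \<and> a < 1 \<and> (\<forall>k::nat. PP (\<lambda>_. q) (arm (int k * L)) \<le> a ^ k)"
proof -
  obtain S where S: "finite S" "origin \<in> S" "phi q S < 1" using exists_phi_less_1[OF q] by blast
  obtain M where M: "\<forall>x\<in>S. \<bar>fst x\<bar> \<le> M \<and> \<bar>snd x\<bar> \<le> M" using finite_coord_bound[OF S(1)] by blast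
  define L where "L = max M 0 + 1"
  have SL: "S \<subseteq> box (L - 1)" using M by (force simp: box_def mnorm_def L_def)
  have "PP (\<lambda>_. q) (arm (int k * L)) \<le> phi q S ^ k" for k
  proof (induction k)
    case 0
    have "PP (\<lambda>_. q) (arm 0) \<le> 1" by (rule PP_le_1[OF finite_ein[OF finite_box] dep_arm])
    then show ?case by simp
  next
    case (Suc k)
    have "PP (\<lambda>_. q) (arm (int k * L + L)) \<le> phi q S * PP (\<lambda>_. q) (arm (int k * L))"
      by (rule arm_submult[OF S(1) SL S(2)]) (use q in \<open>auto simp: L_def\<close>)
    also have "\<dots> \<le> phi q S * phi q S ^ k" by (rule mult_left_mono[OF Suc]) (use phi_nonneg q in auto)
    finally show ?case by (simp add: algebra_simps)
  qed
  then show ?thesis using S(3) phi_nonneg[of q S] q by (intro exI[of _ L] exI[of _ "phi q S"]) (auto simp: L_def)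
qed

section \<open>Hall's theorem and disjoint paths\<close>

text \<open>The induction of Halmos and Vaughan. Without a proper tight set one pair may be matched
  and removed freely; a tight set W is matched within its neighbourhood, and the rest outside that
  neighbourhood.\<close>

lemma hall:
  assumes "finite X" "\<And>x. x \<in> X \<Longrightarrow> finite (N x)" "\<And>W. W \<subseteq> X \<Longrightarrow> card W \<le> card (\<Union>(N ` W))"
  shows "\<exists>f. inj_on f X \<and> (\<forall>x\<in>X. f x \<in> N x)"
  using assms
proof (induction "card X" arbitrary: X N rule: less_induct)
  case less
  note fX = less.prems(1) and fN = less.prems(2) and H = less.prems(3)
  have fU: "finite (\<Union>(N ` W))" if "W \<subseteq> X" for W
    using that fX fN finite_subset[OF that fX] by auto
  show ?case
  proof (cases "X = {}")
    case True
    then show ?thesis by auto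
  next
    case ne: False
    show ?thesis
    proof (cases "\<exists>W. W \<subset> X \<and> W \<noteq> {} \<and> card W = card (\<Union>(N ` W))")
      case False
      then have strict: "card W < card (\<Union>(N ` W))" if "W \<subset> X" "W \<noteq> {}" for W
        using H[of W] that by (metis le_neq_implies_less psubset_imp_subset)
      obtain x where x: "x \<in> X" using ne by blast
      have "1 \<le> card (\<Union>(N ` {x}))" using H[of "{x}"] x by simp
      then have "N x \<noteq> {}" by auto
      then obtain y where y: "y \<in> N x" by blast
      let ?N = "\<lambda>z. N z - {y}"
      have "\<exists>f. inj_on f (X - {x}) \<and> (\<forall>z\<in>X - {x}. f z \<in> ?N z)"
      proof (rule less.hyps)
        show "card (X - {x}) < card X" by (rule psubset_card_mono[OF fX]) (use x in auto)
        show "finite (X - {x})" using fX by simp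
        show "finite (?N z)" if "z \<in> X - {x}" for z using fN that by auto
        fix W assume W: "W \<subseteq> X - {x}"
        show "card W \<le> card (\<Union>(?N ` W))"
        proof (cases "W = {}")
          case False
          have "W \<subset> X" using W x by blast
          then have "card W < card (\<Union>(N ` W))" using strict False by blast
          moreover have eq: "(\<Union>(?N ` W)) = (\<Union>(N ` W)) - {y}" by auto
          moreover have "card (\<Union>(N ` W)) - 1 \<le> card ((\<Union>(N ` W)) - {y})"
            using diff_card_le_card_Diff[of "{y}" "\<Union>(N ` W)"] by simp
          ultimately show ?thesis unfolding eq by linarith
        qed simp
      qed
      then obtain f where f: "inj_on f (X - {x})" "\<forall>z\<in>X - {x}. f z \<in> ?N z" by blast
      have "inj_on (f(x := y)) X"
        using f by (auto simp: inj_on_def)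
      moreover have "\<forall>z\<in>X. (f(x := y)) z \<in> N z" using f y by auto
      ultimately show ?thesis by blast
    next
      case True
      then obtain W where W: "W \<subset> X" "W \<noteq> {}" "card W = card (\<Union>(N ` W))" by blast
      have fW: "finite W" using W fX finite_subset by blast
      have "\<exists>f. inj_on f W \<and> (\<forall>z\<in>W. f z \<in> N z)"
      proof (rule less.hyps[OF psubset_card_mono[OF fX W(1)] fW])
        show "finite (N z)" if "z \<in> W" for z using fN that W by blast
        show "card U \<le> card (\<Union>(N ` U))" if "U \<subseteq> W" for U by (rule H) (use that W in blast)
      qed
      then obtain f where f: "inj_on f W" "\<forall>z\<in>W. f z \<in> N z" by blast
      let ?Y = "\<Union>(N ` W)"
      let ?N = "\<lambda>z. N z - ?Y"
      have "\<exists>g. inj_on g (X - W) \<and> (\<forall>z\<in>X - W. g z \<in> ?N z)"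
      proof (rule less.hyps)
        show "card (X - W) < card X"
          using W fX by (intro psubset_card_mono) auto
        show "finite (X - W)" using fX by simp
        show "finite (?N z)" if "z \<in> X - W" for z using fN that by auto
        fix U assume U: "U \<subseteq> X - W"
        have "card (U \<union> W) \<le> card (\<Union>(N ` (U \<union> W)))" by (rule H) (use U W in auto)
        moreover have "card (U \<union> W) = card U + card W"
          by (rule card_Un_disjoint) (use U fX fW finite_subset[of U X] in auto)
        moreover have "\<Union>(N ` (U \<union> W)) = \<Union>(?N ` U) \<union> ?Y" by auto
        moreover have "card (\<Union>(?N ` U) \<union> ?Y) \<le> card (\<Union>(?N ` U)) + card ?Y" by (rule card_Un_le)
        ultimately show "card U \<le> card (\<Union>(?N ` U))" using W(3) by simp
      qed
      then obtain g where g: "inj_on g (X - W)" "\<forall>z\<in>X - W. g z \<in> ?N z" by blast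
      let ?h = "\<lambda>z. if z \<in> W then f z else g z"
      have "inj_on ?h X"
      proof (rule inj_onI)
        fix a b assume ab: "a \<in> X" "b \<in> X" "?h a = ?h b"
        have cross: False if "c \<in> W" "d \<in> X" "d \<notin> W" "f c = g d" for c d
        proof -
          have "f c \<in> ?Y" using f that by blast
          moreover have "g d \<notin> ?Y" using g that by blast
          ultimately show False using that by simp
        qed
        show "a = b"
          using ab f(1) g(1) cross[of a b] cross[of b a]
          by (cases "a \<in> W"; cases "b \<in> W") (auto simp: inj_on_def)
      qed
      moreover have "\<forall>z\<in>X. ?h z \<in> N z" using f g by auto
      ultimately show ?thesis by blast
    qed
  qed
qed

text \<open>Adds d dummy partners available to everyone, applies \<open>hall\<close>, and drops the
  at most d elements matched to dummies.\<close>

lemma hall_deficient: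
  assumes "finite X" "\<And>x. x \<in> X \<Longrightarrow> finite (N x)" "\<And>W. W \<subseteq> X \<Longrightarrow> card W \<le> card (\<Union>(N ` W)) + d"
  shows "\<exists>X' f. X' \<subseteq> X \<and> card X \<le> card X' + d \<and> inj_on f X' \<and> (\<forall>x\<in>X'. f x \<in> N x)"
proof -
  let ?N = "\<lambda>x. Inl ` N x \<union> Inr ` {..<d}"
  have "\<exists>f. inj_on f X \<and> (\<forall>x\<in>X. f x \<in> ?N x)"
  proof (rule hall[OF assms(1)])
    show "finite (?N x)" if "x \<in> X" for x using assms(2)[OF that] by simp
    fix W assume W: "W \<subseteq> X"
    show "card W \<le> card (\<Union>(?N ` W))"
    proof (cases "W = {}")
      case False
      have fU: "finite (\<Union>(N ` W))" using W assms finite_subset[OF W assms(1)] by auto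
      have "\<Union>(?N ` W) = Inl ` \<Union>(N ` W) \<union> Inr ` {..<d}" using False by auto
      also have "card \<dots> = card (\<Union>(N ` W)) + d"
        by (subst card_Un_disjoint) (use fU in \<open>auto simp: card_image\<close>)
      finally show ?thesis using assms(3)[OF W] by simp
    qed simp
  qed
  then obtain f where f: "inj_on f X" "\<forall>x\<in>X. f x \<in> ?N x" by blast
  let ?X = "{x \<in> X. \<exists>y. f x = Inl y}"
  have "card (X - ?X) \<le> card (Inr ` {..<d} :: ('b + nat) set)"
  proof (rule card_inj_on_le[of f])
    show "inj_on f (X - ?X)" by (rule inj_on_subset[OF f(1)]) auto
    show "f ` (X - ?X) \<subseteq> Inr ` {..<d}" using f(2) by auto
  qed simp
  also have "\<dots> = d" by (simp add: card_image)
  finally have "card (X - ?X) \<le> d" .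
  moreover have "card X = card ?X + card (X - ?X)"
    using assms(1) card_Un_disjoint[of ?X "X - ?X"] by (simp add: Un_Diff_cancel2 Int_Diff_disjoint Un_absorb1 Collect_conj_eq Int_commute)
  ultimately have "card X \<le> card ?X + d" by simp
  moreover have "inj_on (\<lambda>x. projl (f x)) ?X"
    using f(1) by (auto simp: inj_on_def)
  moreover have "\<forall>x\<in>?X. projl (f x) \<in> N x" using f(2) by force
  ultimately show ?thesis by (intro exI[of _ ?X] exI[of _ "\<lambda>x. projl (f x)"]) auto
qed

lemma card_filter_split:
  assumes "finite A"
  shows "card A = card {x \<in> A. P x} + card {x \<in> A. \<not> P x}"
proof -
  have "A = {x \<in> A. P x} \<union> {x \<in> A. \<not> P x}" by blast
  then have "card A = card ({x \<in> A. P x} \<union> {x \<in> A. \<not> P x})" by simp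
  also have "\<dots> = card {x \<in> A. P x} + card {x \<in> A. \<not> P x}"
    by (rule card_Un_disjoint) (use assms in auto)
  finally show ?thesis .
qed

section \<open>Orbits of a partial injection\<close>

definition exit_time :: "('a \<Rightarrow> 'a) \<Rightarrow> 'a set \<Rightarrow> 'a \<Rightarrow> nat" where
  "exit_time f X i = (LEAST n. (f ^^ n) i \<notin> X)"

definition chain_end :: "('a \<Rightarrow> 'a) \<Rightarrow> 'a set \<Rightarrow> 'a \<Rightarrow> 'a" where
  "chain_end f X i = (f ^^ exit_time f X i) i"

definition chain :: "('a \<Rightarrow> 'a) \<Rightarrow> 'a set \<Rightarrow> 'a \<Rightarrow> 'a set" where
  "chain f X i = (\<lambda>m. (f ^^ m) i) ` {..exit_time f X i}"

text \<open>Injectivity allows both orbits to be traced back from the common point; the starts have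
  no preimage in \<open>X\<close>, so they must be reached simultaneously.\<close>

lemma chain_meet:
  assumes inj: "inj_on f X" and i: "i \<notin> f ` X" "i' \<notin> f ` X"
    and "\<And>m. m < n \<Longrightarrow> (f ^^ m) i \<in> X" "\<And>m. m < n' \<Longrightarrow> (f ^^ m) i' \<in> X" "(f ^^ n) i = (f ^^ n') i'"
  shows "i = i' \<and> n = n'"
  using assms(4-6)
proof (induction n arbitrary: n')
  case 0
  show ?case
  proof (cases n')
    case (Suc k)
    then have "i = f ((f ^^ k) i')" "(f ^^ k) i' \<in> X" using 0 by auto
    then show ?thesis using i(1) by blast
  qed (use 0 in auto)
next
  case (Suc n)
  show ?case
  proof (cases n')
    case 0
    then have "i' = f ((f ^^ n) i)" "(f ^^ n) i \<in> X" using Suc.prems by auto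
    then show ?thesis using i(2) by blast
  next
    case (Suc k)
    have "(f ^^ n) i \<in> X" "(f ^^ k) i' \<in> X" "f ((f ^^ n) i) = f ((f ^^ k) i')"
      using Suc.prems Suc by auto
    then have "(f ^^ n) i = (f ^^ k) i'" using inj by (auto simp: inj_on_def)
    then have "i = i' \<and> n = k" using Suc.IH[of k] Suc.prems Suc by auto
    then show ?thesis using Suc by simp
  qed
qed

text \<open>An orbit that starts outside the image and never leaves \<open>X\<close> would by
  \<open>chain_meet\<close> never repeat a value, which is impossible in a finite set.\<close>

lemma chain_exits:
  assumes "finite X" "inj_on f X" "i \<notin> f ` X"
  shows "chain_end f X i \<notin> X" "\<And>m. m < exit_time f X i \<Longrightarrow> (f ^^ m) i \<in> X"
proof -
  have "\<exists>n. (f ^^ n) i \<notin> X"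
  proof (rule ccontr)
    assume no: "\<not> ?thesis"
    have "inj (\<lambda>n. (f ^^ n) i)"
    proof (rule injI)
      fix n n' assume "(f ^^ n) i = (f ^^ n') i"
      then show "n = n'" using chain_meet[OF assms(2,3,3), of n n'] no by blast
    qed
    moreover have "range (\<lambda>n. (f ^^ n) i) \<subseteq> X" using no by auto
    ultimately show False using assms(1) finite_subset range_inj_infinite by blast
  qed
  then show "chain_end f X i \<notin> X" unfolding chain_end_def exit_time_def by (rule LeastI_ex)
  show "(f ^^ m) i \<in> X" if "m < exit_time f X i" for m
    using not_less_Least[of m "\<lambda>n. (f ^^ n) i \<notin> X"] that unfolding exit_time_def by blast
qed

lemma chain_props:
  assumes "finite X" "inj_on f X" "i \<notin> f ` X"
  shows "i \<in> chain f X i" "chain_end f X i \<in> chain f X i" "finite (chain f X i)"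
    "chain f X i - {chain_end f X i} \<subseteq> X" "\<And>u. u \<in> chain f X i \<Longrightarrow> u \<in> X \<Longrightarrow> f u \<in> chain f X i"
    "\<And>u. u \<in> chain f X i \<Longrightarrow> u \<noteq> i \<Longrightarrow> \<exists>u'\<in>chain f X i. u' \<in> X \<and> f u' = u"
proof -
  show "i \<in> chain f X i" unfolding chain_def by (rule image_eqI[of _ _ 0]) auto
  show "chain_end f X i \<in> chain f X i" "finite (chain f X i)" by (auto simp: chain_def chain_end_def)
  show "chain f X i - {chain_end f X i} \<subseteq> X"
    using chain_exits(2)[OF assms] by (auto simp: chain_def chain_end_def) (metis le_neq_implies_less)
  show "f u \<in> chain f X i" if u: "u \<in> chain f X i" "u \<in> X" for u
  proof -
    obtain m where m: "m \<le> exit_time f X i" "u = (f ^^ m) i" using u(1) by (auto simp: chain_def)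
    have "m \<noteq> exit_time f X i" using chain_exits(1)[OF assms] u(2) m by (auto simp: chain_end_def)
    then have "Suc m \<le> exit_time f X i" using m by simp
    then show ?thesis unfolding chain_def by (intro image_eqI[of _ _ "Suc m"]) (auto simp: m)
  qed
  show "\<exists>u'\<in>chain f X i. u' \<in> X \<and> f u' = u" if u: "u \<in> chain f X i" "u \<noteq> i" for u
  proof -
    obtain m where m: "m \<le> exit_time f X i" "u = (f ^^ m) i" using u(1) by (auto simp: chain_def)
    then obtain k where k: "m = Suc k" using u(2) by (cases m) auto
    have "(f ^^ k) i \<in> X" by (rule chain_exits(2)[OF assms]) (use m k in simp)
    then show ?thesis using m k by (intro bexI[of _ "(f ^^ k) i"]) (auto simp: chain_def)
  qed
qed

lemma chain_unique:
  assumes "finite X" "inj_on f X" "i \<notin> f ` X" "i' \<notin> f ` X" "u \<in> chain f X i" "u \<in> chain f X i'"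
  shows "i = i'"
proof -
  obtain m m' where m: "m \<le> exit_time f X i" "m' \<le> exit_time f X i'" "u = (f ^^ m) i" "u = (f ^^ m') i'"
    using assms(5,6) by (auto simp: chain_def)
  show ?thesis
    using chain_meet[OF assms(2,3,4), of m m'] chain_exits(2)[OF assms(1,2,3)] chain_exits(2)[OF assms(1,2,4)] m
    by (metis order.strict_trans2)
qed

lemma chain_lconn:
  assumes "finite X" "inj_on f X" "i \<notin> f ` X" "\<And>u. u \<in> X \<Longrightarrow> f u = u \<or> r u (f u)"
  shows "lconn r (chain f X i) i (chain_end f X i)"
proof -
  have "n \<le> exit_time f X i \<Longrightarrow> lconn r (chain f X i) i ((f ^^ n) i)" for n
  proof (induction n)
    case 0
    then show ?case using chain_props(1)[OF assms(1-3)] by (auto intro: lconn_refl)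
  next
    case (Suc n)
    then have IH: "lconn r (chain f X i) i ((f ^^ n) i)" by simp
    have "(f ^^ n) i \<in> X" by (rule chain_exits(2)[OF assms(1-3)]) (use Suc in simp)
    then consider "f ((f ^^ n) i) = (f ^^ n) i" | "r ((f ^^ n) i) (f ((f ^^ n) i))" using assms(4) by blast
    then show ?case
    proof cases
      case 1
      then show ?thesis using IH by simp
    next
      case 2
      have "(f ^^ Suc n) i \<in> chain f X i" unfolding chain_def using Suc by blast
      then show ?thesis using lconn_step[OF IH 2] by simp
    qed
  qed
  from this[of "exit_time f X i"] show ?thesis by (simp add: chain_end_def)
qed

definition sqK :: "int \<Rightarrow> vertex set" where
  "sqK K = {0..K} \<times> {0..K}"

text \<open>A system of \<open>b\<close> disjoint left-right crossings of the square, closed up to cycles: the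
  permutation \<open>\<sigma>\<close> moves along open edges, except that it sends the right ends \<open>J\<close> back to the
  left ends by the order preserving bijection \<open>\<pi>\<close>.\<close>

definition linked_perm :: "int \<Rightarrow> (edge \<Rightarrow> bool) \<Rightarrow> vertex set \<Rightarrow> (vertex \<Rightarrow> vertex) \<Rightarrow> (vertex \<Rightarrow> vertex) \<Rightarrow> bool" where
  "linked_perm K w J \<pi> \<sigma> \<longleftrightarrow> \<sigma> permutes sqK K \<and> (\<forall>j\<in>J. \<sigma> j = \<pi> j) \<and>
     (\<forall>u\<in>sqK K - J. \<sigma> u = u \<or> open_adj w u (\<sigma> u))"

definition order_match :: "int \<Rightarrow> vertex set \<Rightarrow> (vertex \<Rightarrow> vertex) \<Rightarrow> bool" where
  "order_match K J \<pi> \<longleftrightarrow> J \<subseteq> {u \<in> sqK K. fst u = K} \<and> \<pi> ` J \<subseteq> {u \<in> sqK K. fst u = 0} \<and>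
     (\<forall>j\<in>J. \<forall>j'\<in>J. snd j < snd j' \<longrightarrow> snd (\<pi> j) < snd (\<pi> j'))"

definition many_crossings :: "int \<Rightarrow> nat \<Rightarrow> (edge \<Rightarrow> bool) \<Rightarrow> bool" where
  "many_crossings K b w \<longleftrightarrow> (\<exists>J \<pi> \<sigma>. card J = b \<and> order_match K J \<pi> \<and> linked_perm K w J \<pi> \<sigma>)"

lemma finite_sqK [simp]: "finite (sqK K)"
  by (simp add: sqK_def)

lemma mem_sqK: "u \<in> sqK K \<longleftrightarrow> 0 \<le> fst u \<and> fst u \<le> K \<and> 0 \<le> snd u \<and> snd u \<le> K"
  by (cases u) (auto simp: sqK_def)

lemma card_column: "0 \<le> K \<Longrightarrow> card {u \<in> sqK K. fst u = c} = (if 0 \<le> c \<and> c \<le> K then nat (K + 1) else 0)"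
proof -
  assume "0 \<le> K"
  have "{u \<in> sqK K. fst u = c} = (if 0 \<le> c \<and> c \<le> K then (\<lambda>y. (c, y)) ` {0..K} else {})"
    by (auto simp: mem_sqK image_iff prod_eq_iff)
  moreover have "inj_on (\<lambda>y::int. (c, y)) {0..K}" by (auto simp: inj_on_def)
  ultimately show ?thesis by (simp add: card_image)
qed

lemma chains_ordered:
  assumes "finite X" "inj_on f X" "\<And>u. u \<in> X \<Longrightarrow> f u = u \<or> nbr u (f u)" "X \<subseteq> sqK K" "f ` X \<subseteq> sqK K"
    and i: "i \<notin> f ` X" "i \<in> sqK K" "fst i = 0" "fst (chain_end f X i) = K"
    and i': "i' \<notin> f ` X" "i' \<in> sqK K" "fst i' = 0" "fst (chain_end f X i') = K"
    and lt: "snd i < snd i'"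
  shows "snd (chain_end f X i) < snd (chain_end f X i')"
proof (rule disjoint_crossings_ordered[OF chain_lconn[where r=nbr, OF assms(1,2) i(1) assms(3)] chain_lconn[where r=nbr, OF assms(1,2) i'(1) assms(3)]])
  have sub: "chain f X k \<subseteq> sqK K" if "k \<in> sqK K" "k \<notin> f ` X" for k
  proof
    fix u assume "u \<in> chain f X k"
    then show "u \<in> sqK K" using chain_props(6)[OF assms(1,2) that(2), of u] that(1) assms(5) by blast
  qed
  show "chain f X i \<union> chain f X i' \<subseteq> {0..K} \<times> {0..K}" using sub[OF i(2,1)] sub[OF i'(2,1)] by (simp add: sqK_def)
  show "chain f X i \<inter> chain f X i' = {}" using chain_unique[OF assms(1,2) i(1) i'(1)] lt by blast
qed (use i i' lt in auto)

text \<open>Menger's theorem from Hall's. Each vertex off the right side is to be matched with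
  itself or an open neighbour, always off the left side. The matching moves along disjoint chains
  that start at the left side; a chain that does not reach the right side ends in an unmatched
  vertex, and at most d = K + 1 - b of these exist.\<close>

lemma menger_grid:
  assumes K: "1 \<le> K" and b: "b \<le> nat (K + 1)"
    and cut: "\<And>S. S \<subseteq> sqK K \<Longrightarrow> card S < b \<Longrightarrow> cross w (sqK K - S) {u. fst u = 0} {v. fst v = K}"
  shows "many_crossings K b w"
proof -
  let ?V = "sqK K" and ?L = "{u \<in> sqK K. fst u = 0}" and ?R = "{u \<in> sqK K. fst u = K}"
  let ?X = "?V - ?R"
  let ?N = "\<lambda>u. {v \<in> ?V - ?L. v = u \<or> open_adj w u v}"
  define d where "d = nat (K + 1) - b"
  have cL: "card ?L = nat (K + 1)" and cR: "card ?R = nat (K + 1)" using card_column[of K 0] card_column[of K K] K by auto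
  have hallc: "card W \<le> card (\<Union>(?N ` W)) + d" if W: "W \<subseteq> ?X" for W
  proof (rule ccontr)
    assume neg: "\<not> ?thesis"
    define D where "D = \<Union>(?N ` W)"
    have fW: "finite W" by (rule finite_subset[OF W]) simp
    have fD: "finite D" by (rule finite_subset[of _ ?V]) (auto simp: D_def)
    have DW: "W - ?L \<subseteq> D" using W by (auto simp: D_def)
    \<comment> \<open>A violation of Hall's condition by W yields a cut with fewer than b vertices:
      a connection from the left side avoiding S starts in W and cannot leave it, and W misses the
      right side.\<close>
    define S where "S = (?L - W) \<union> (D - W)"
    have "card D = card (D - W) + card (W - ?L)"
    proof -
      have "D \<inter> ?L = {}" by (auto simp: D_def)
      then have "D = (D - W) \<union> (W - ?L)" using DW by blast
      then have "card D = card ((D - W) \<union> (W - ?L))" by simp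
      also have "\<dots> = card (D - W) + card (W - ?L)" by (rule card_Un_disjoint) (use fD fW in auto)
      finally show ?thesis .
    qed
    moreover have "card W = card (W - ?L) + card (W \<inter> ?L)" using card_Int_Diff[OF fW, of ?L] by simp
    moreover have "card (?L - W) = nat (K + 1) - card (W \<inter> ?L)"
      using cL card_Diff_subset_Int[of ?L W] fW by (simp add: Int_commute)
    moreover have "card (W \<inter> ?L) \<le> nat (K + 1)" using cL card_mono[of ?L "W \<inter> ?L"] by simp
    moreover have "card S \<le> card (?L - W) + card (D - W)" unfolding S_def by (rule card_Un_le)
    moreover have "card D + d < card W" using neg by (simp add: D_def)
    ultimately have "card S < b" using b unfolding d_def by linarith
    moreover have "S \<subseteq> ?V" by (auto simp: S_def D_def)
    ultimately have "cross w (?V - S) {u. fst u = 0} {v. fst v = K}" by (intro cut)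
    then obtain u v where uv: "fst u = 0" "fst v = K" "lconn (open_adj w) (?V - S) u v"
      unfolding cross_def by blast
    have "v \<in> W" using uv(3)
    proof (induction rule: lconn_induct)
      case base
      then show ?case using uv(1) by (auto simp: S_def)
    next
      case (step y z)
      show ?case
      proof (rule ccontr)
        assume z: "z \<notin> W"
        show False
        proof (cases "z \<in> ?L")
          case True
          then show False using step z by (auto simp: S_def)
        next
          case False
          then have "z \<in> D" using step by (auto simp: D_def)
          then show False using step z by (auto simp: S_def)
        qed
      qed
    qed
    then show False using W uv(2) by auto
  qed
  obtain X f where Xf: "X \<subseteq> ?X" "card ?X \<le> card X + d" "inj_on f X" "\<forall>x\<in>X. f x \<in> ?N x"
    using hall_deficient[of ?X ?N d] hallc by auto
  have fX: "finite X" by (rule finite_subset[OF Xf(1)]) simp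
  have fim: "f ` X \<subseteq> ?V" using Xf(4) by auto
  have notin: "i \<notin> f ` X" if "i \<in> ?L" for i using Xf(4) that by auto
  have adj: "f u = u \<or> open_adj w u (f u)" if "u \<in> X" for u using Xf(4) that by auto
  have adjn: "f u = u \<or> nbr u (f u)" if "u \<in> X" for u using adj[OF that] open_adj_nbr[of w u "f u"] by blast
  let ?e = "chain_end f X"
  have e_in: "?e i \<in> ?V - X" if i: "i \<in> ?L" for i
  proof -
    have "?e i \<in> ?V" using chain_props(6)[OF fX Xf(3) notin[OF i] chain_props(2)[OF fX Xf(3) notin[OF i]]] i fim by (cases "?e i = i") auto
    then show ?thesis using chain_exits(1)[OF fX Xf(3) notin[OF i]] by simp
  qed
  have e_inj: "i = i'" if "i \<in> ?L" "i' \<in> ?L" "?e i = ?e i'" for i i'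
    using chain_unique[OF fX Xf(3) notin[OF that(1)] notin[OF that(2)], of "?e i"]
      chain_props(2)[OF fX Xf(3) notin[OF that(1)]] chain_props(2)[OF fX Xf(3) notin[OF that(2)]] that(3) by metis
  have "b \<le> card {i \<in> ?L. ?e i \<in> ?R}"
  proof -
    have "card {i \<in> ?L. ?e i \<notin> ?R} \<le> card (?X - X)"
    proof (rule card_inj_on_le[of ?e])
      show "inj_on ?e {i \<in> ?L. ?e i \<notin> ?R}" using e_inj by (auto simp: inj_on_def)
      show "?e ` {i \<in> ?L. ?e i \<notin> ?R} \<subseteq> ?X - X" using e_in by auto
    qed simp
    also have "\<dots> = card ?X - card X" using Xf(1) fX by (simp add: card_Diff_subset)
    also have "\<dots> \<le> d" using Xf(2) by simp
    finally have "card {i \<in> ?L. ?e i \<notin> ?R} \<le> d" .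
    moreover have "card ?L = card {i \<in> ?L. ?e i \<in> ?R} + card {i \<in> ?L. ?e i \<notin> ?R}"
      by (rule card_filter_split) simp
    ultimately show ?thesis using cL b unfolding d_def by linarith
  qed
  from obtain_subset_with_card_n[OF this]
  obtain I where I: "I \<subseteq> {i \<in> ?L. ?e i \<in> ?R}" "card I = b" "finite I" .
  have IL: "i \<in> ?L" "?e i \<in> ?R" if "i \<in> I" for i using I(1) that by auto
  define J where "J = ?e ` I"
  have inje: "inj_on ?e I" using e_inj IL by (auto simp: inj_on_def)
  have cJ: "card J = b" using inje I by (simp add: J_def card_image)
  define \<pi> where "\<pi> = inv_into I ?e"
  have pi: "\<pi> (?e i) = i" if "i \<in> I" for i using inje that by (simp add: \<pi>_def)
  have om: "order_match K J \<pi>"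
    unfolding order_match_def
  proof (intro conjI ballI impI)
    show "J \<subseteq> {u \<in> sqK K. fst u = K}" using IL by (auto simp: J_def)
    show "\<pi> ` J \<subseteq> {u \<in> sqK K. fst u = 0}" using IL pi by (auto simp: J_def)
    fix j j' assume j: "j \<in> J" "j' \<in> J" "snd j < snd j'"
    then obtain i i' where i: "i \<in> I" "i' \<in> I" "j = ?e i" "j' = ?e i'" by (auto simp: J_def)
    have ord: "snd (?e a) < snd (?e c)" if ac: "a \<in> I" "c \<in> I" "snd a < snd c" for a c
      by (rule chains_ordered[where K=K, OF fX Xf(3) adjn _ fim]) 
         (use Xf(1) notin[OF IL(1)[OF ac(1)]] notin[OF IL(1)[OF ac(2)]] IL[OF ac(1)] IL[OF ac(2)] ac(3) in auto)
    have "i \<noteq> i'" using i(3,4) j(3) by auto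
    then have "snd i \<noteq> snd i'" using IL(1)[OF i(1)] IL(1)[OF i(2)] by (auto simp: prod_eq_iff)
    moreover have "\<not> snd i' < snd i" using ord[of i' i] i j by auto
    ultimately show "snd (\<pi> j) < snd (\<pi> j')" using pi i by simp
  qed
  define Z where "Z = (\<Union>i\<in>I. chain f X i)"
  have nI: "i \<notin> f ` X" if "i \<in> I" for i using notin IL that by blast
  note cp = chain_props[OF fX Xf(3) nI]
  have ZV: "Z \<subseteq> ?V"
  proof
    fix u assume "u \<in> Z"
    then obtain i where i: "i \<in> I" "u \<in> chain f X i" by (auto simp: Z_def)
    show "u \<in> ?V" using cp(6)[OF i] IL(1)[OF i(1)] fim by (cases "u = i") auto
  qed
  have ZJ: "Z - J \<subseteq> X"
  proof
    fix u assume u: "u \<in> Z - J"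
    then obtain i where i: "i \<in> I" "u \<in> chain f X i" by (auto simp: Z_def)
    then have "u \<noteq> ?e i" using u by (auto simp: J_def)
    then show "u \<in> X" using cp(4)[OF i(1)] i by auto
  qed
  have JZ: "J \<subseteq> Z" using cp(2) by (auto simp: J_def Z_def)
  have IZ: "I \<subseteq> Z" using cp(1) by (auto simp: Z_def)
  \<comment> \<open>Follows the matching along the b chosen chains, returns from their ends to their
    starts, and fixes everything else.\<close>
  define \<sigma> where "\<sigma> u = (if u \<in> J then \<pi> u else if u \<in> Z then f u else u)" for u
  have fZ: "finite Z" by (rule finite_subset[OF ZV]) simp
  have sZ: "\<sigma> ` Z \<subseteq> Z"
  proof
    fix v assume "v \<in> \<sigma> ` Z"
    then obtain u where u: "u \<in> Z" "v = \<sigma> u" by blast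
    show "v \<in> Z"
    proof (cases "u \<in> J")
      case True
      then show ?thesis using pi IZ u by (auto simp: \<sigma>_def J_def)
    next
      case False
      obtain i where i: "i \<in> I" "u \<in> chain f X i" using u by (auto simp: Z_def)
      have "u \<in> X" using ZJ u False by auto
      then show ?thesis using cp(5)[OF i] i u False by (auto simp: \<sigma>_def Z_def)
    qed
  qed
  have sinj: "inj_on \<sigma> Z"
  proof (rule inj_onI)
    fix a c assume ac: "a \<in> Z" "c \<in> Z" "\<sigma> a = \<sigma> c"
    have mixed: False if "x \<in> J" "y \<in> Z - J" "\<sigma> x = \<sigma> y" for x y
    proof -
      have "\<sigma> x \<in> I" using that(1) pi by (auto simp: \<sigma>_def J_def)
      moreover have "\<sigma> y \<in> f ` X" using that(2) ZJ by (auto simp: \<sigma>_def)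
      ultimately show False using that(3) nI by auto
    qed
    show "a = c"
    proof (cases "a \<in> J"; cases "c \<in> J")
      assume "a \<in> J" "c \<in> J"
      then show ?thesis using ac pi by (auto simp: \<sigma>_def J_def)
    next
      assume "a \<notin> J" "c \<notin> J"
      then have "a \<in> X" "c \<in> X" "f a = f c" using ac ZJ by (auto simp: \<sigma>_def)
      then show ?thesis using Xf(3) by (auto simp: inj_on_def)
    qed (use mixed[of a c] mixed[of c a] ac in auto)
  qed
  have "bij_betw \<sigma> Z Z" using sZ sinj fZ by (simp add: bij_betw_def endo_inj_surj)
  then have perm: "\<sigma> permutes Z" by (rule bij_imp_permutes) (use JZ in \<open>auto simp: \<sigma>_def\<close>)
  have "linked_perm K w J \<pi> \<sigma>"
    unfolding linked_perm_def
  proof (intro conjI ballI)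
    show "\<sigma> permutes sqK K" by (rule permutes_subset[OF perm ZV])
    show "\<sigma> j = \<pi> j" if "j \<in> J" for j using that by (simp add: \<sigma>_def)
    show "\<sigma> u = u \<or> open_adj w u (\<sigma> u)" if "u \<in> sqK K - J" for u
      using that adj[of u] ZJ by (auto simp: \<sigma>_def)
  qed
  then show ?thesis unfolding many_crossings_def using cJ om by blast
qed

lemma dep_many_crossings: "dep (ein (sqK K)) (many_crossings K b)"
  unfolding dep_def
proof (intro allI impI)
  fix w w' :: "edge \<Rightarrow> bool" assume a: "\<forall>e\<in>ein (sqK K). w e = w' e"
  have "linked_perm K w J \<pi> \<sigma> = linked_perm K w' J \<pi> \<sigma>" for J \<pi> \<sigma>
  proof -
    have "open_adj w u (\<sigma> u) = open_adj w' u (\<sigma> u)" if "\<sigma> permutes sqK K" "u \<in> sqK K" for u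
      by (rule open_adj_cong[of "sqK K"]) (use that a permutes_in_image[OF that(1)] in auto)
    then show ?thesis unfolding linked_perm_def by (metis DiffD1)
  qed
  then show "many_crossings K b w = many_crossings K b w'" by (simp add: many_crossings_def)
qed

section \<open>Linearly many disjoint crossings above the self-dual point\<close>

text \<open>By Menger, fewer than b vertices cut the square. Closing all edges at these vertices, at
  most 4 for each, destroys every crossing; so opening at most 4b edges in the dual produces a dual
  crossing.\<close>

lemma few_crossings_dual:
  assumes K: "1 \<le> K" and b: "b \<le> nat (K + 1)" and no: "\<not> many_crossings K b w"
  shows "\<exists>F. F \<subseteq> ein ({0..K - 1} \<times> {-1..K}) \<and> card F \<le> 4 * b \<and>
    cross (\<lambda>e. dualc w e \<or> e \<in> F) ({0..K - 1} \<times> {-1..K}) {s. snd s = -1} {t. snd t = K}"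
proof -
  obtain S where S: "S \<subseteq> sqK K" "card S < b" "\<not> cross w (sqK K - S) {u. fst u = 0} {v. fst v = K}"
    using menger_grid[OF K b] no by blast
  have fS: "finite S" by (rule finite_subset[OF S(1)]) simp
  define w' where "w' e \<longleftrightarrow> w e \<and> fst e \<notin> S \<and> oe e \<notin> S" for e
  let ?D = "{0..K - 1} \<times> {-1..K}"
  have no': "\<not> lconn (open_adj w') ({0..K} \<times> {0..K}) u v" if uv: "fst u = 0" "fst v = K" for u v
  proof
    assume "lconn (open_adj w') ({0..K} \<times> {0..K}) u v"
    then have "u = v \<or> lconn (open_adj w) (sqK K - S) u v"
    proof (induction rule: lconn_induct)
      case (step y z)
      have n: "z \<in> nbrs y" by (rule open_adj_nbrs[OF step(3)])
      have "w' (ee y z)" using step(3) open_adj_ee[OF n] by simp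
      then have yz: "y \<notin> S" "z \<notin> S" "open_adj w y z" using ee_ends[OF n] open_adj_ee[OF n, of w] by (auto simp: w'_def doubleton_eq_iff)
      have "y \<in> sqK K - S" "z \<in> sqK K - S" using step yz by (auto simp: sqK_def)
      then have "lconn (open_adj w) (sqK K - S) y z" by (intro lconn_step1[of "open_adj w", OF yz(3)])
      then show ?case using step.IH lconn_trans[of "open_adj w" "sqK K - S" u y z] by auto
    qed simp
    moreover have "u \<noteq> v" using uv K by auto
    ultimately have "cross w (sqK K - S) {u. fst u = 0} {v. fst v = K}"
      using crossI[of u "{u. fst u = 0}" v "{v. fst v = K}" w "sqK K - S"] uv by blast
    then show False using S(3) by contradiction
  qed
  obtain s t where st: "snd s = 0 - 1" "snd t = K" "lconn (open_adj (dualc w')) ({0..K - 1} \<times> {0 - 1..K}) s t"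
    using no_crossing_imp_dual_crossing[of 0 K 0 K w'] no' K by auto
  define F where "F = {e \<in> ein ?D. fst (dual_edge e) \<in> S \<or> oe (dual_edge e) \<in> S}"
  have "lconn (open_adj (\<lambda>e. dualc w e \<or> e \<in> F)) ?D s t"
  proof -
    have "lconn (open_adj (\<lambda>e. dualc w e \<or> e \<in> F)) ?D s t = lconn (open_adj (dualc w')) ?D s t"
      by (rule lconn_cong) (auto simp: F_def dualc_def w'_def)
    then show ?thesis using st(3) by simp
  qed
  then have "cross (\<lambda>e. dualc w e \<or> e \<in> F) ?D {s. snd s = -1} {t. snd t = K}"
    by (rule crossI[rotated 2]) (use st in auto)
  moreover have "card F \<le> 4 * b"
  proof -
    have "dual_edge ` F \<subseteq> (\<Union>x\<in>S. \<Union>y\<in>nbrs x. {ee x y})"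
    proof
      fix g assume "g \<in> dual_edge ` F"
      then have g: "fst g \<in> S \<or> oe g \<in> S" by (auto simp: F_def)
      have n: "oe g \<in> nbrs (fst g)" "ee (fst g) (oe g) = g" "ee (oe g) (fst g) = g"
        by (cases g; auto simp: oe_def nbrs_def ee_def prod_eq_iff)+
      from g show "g \<in> (\<Union>x\<in>S. \<Union>y\<in>nbrs x. {ee x y})"
      proof
        assume "fst g \<in> S"
        then show ?thesis using n by (intro UN_I[of "fst g"] UN_I[of "oe g"]) auto
      next
        assume "oe g \<in> S"
        then show ?thesis using n nbrs_sym[OF n(1)] by (intro UN_I[of "oe g"] UN_I[of "fst g"]) auto
      qed
    qed
    then have "card (dual_edge ` F) \<le> card (\<Union>x\<in>S. \<Union>y\<in>nbrs x. {ee x y})"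
      by (intro card_mono) (use fS in auto)
    also have "\<dots> \<le> (\<Sum>x\<in>S. card (\<Union>y\<in>nbrs x. {ee x y}))" by (rule card_UN_le[OF fS])
    also have "\<dots> \<le> (\<Sum>x\<in>S. 4)"
    proof (rule sum_mono)
      fix x
      have "card (\<Union>y\<in>nbrs x. {ee x y}) \<le> (\<Sum>y\<in>nbrs x. card {ee x y})" by (rule card_UN_le) simp
      also have "\<dots> = card (nbrs x)" by simp
      also have "\<dots> \<le> 4" by (simp add: nbrs_def card_insert_if)
      finally show "card (\<Union>y\<in>nbrs x. {ee x y}) \<le> 4" .
    qed
    also have "\<dots> \<le> 4 * b" using S(2) by simp
    finally show ?thesis by (simp add: card_image inj_on_subset[OF inj_dual_edge])
  qed
  ultimately show ?thesis by (intro exI[of _ F]) (auto simp: F_def)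
qed

text \<open>The dual of a configuration at 1 - q has parameter q. Sprinkling up to s > q turns the
  presence of at most 4b missing edges into a genuine crossing at a cost exponential in b, and a
  crossing starts at one of K points, from each of which an arm of length K emerges.\<close>

lemma few_crossings_prob:
  assumes q: "0 \<le> q" "q < s" "s \<le> 1" and K: "1 \<le> K" and b: "b \<le> nat (K + 1)"
  shows "((s - q) / (1 - q)) ^ (4 * b) * PP (\<lambda>_. 1 - q) (\<lambda>w. \<not> many_crossings K b w) \<le> real_of_int K * PP (\<lambda>_. s) (arm K)"
proof -
  let ?D = "{0..K - 1} \<times> {-1..K}"
  let ?A = "\<lambda>v. cross v ?D {s. snd s = -1} {t. snd t = K}"
  let ?B = "\<lambda>v. \<exists>F. F \<subseteq> ein ?D \<and> card F \<le> 4 * b \<and> ?A (\<lambda>e. v e \<or> e \<in> F)"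
  have fD: "finite (ein ?D)" by (rule finite_ein) simp
  have dB: "dep (ein ?D) ?B"
    unfolding dep_def
  proof (intro allI impI)
    fix w w' :: "edge \<Rightarrow> bool" assume a: "\<forall>e\<in>ein ?D. w e = w' e"
    have "?A (\<lambda>e. w e \<or> e \<in> F) = ?A (\<lambda>e. w' e \<or> e \<in> F)" for F
      by (rule depD[OF dep_cross]) (use a in auto)
    then show "?B w = ?B w'" by simp
  qed
  have dBd: "dep (dual_edge ` ein ?D) (\<lambda>w. ?B (dualc w))"
    unfolding dep_def
  proof (intro allI impI)
    fix w w' :: "edge \<Rightarrow> bool" assume "\<forall>e\<in>dual_edge ` ein ?D. w e = w' e"
    then show "?B (dualc w) = ?B (dualc w')" by (intro depD[OF dB]) (auto simp: dualc_def)
  qed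
  have "PP (\<lambda>_. 1 - q) (\<lambda>w. \<not> many_crossings K b w) \<le> PP (\<lambda>_. 1 - q) (\<lambda>w. ?B (dualc w))"
  proof (rule PP_mono[of "ein (sqK K) \<union> dual_edge ` ein ?D"])
    show "finite (ein (sqK K) \<union> dual_edge ` ein ?D)" using fD finite_ein[OF finite_sqK] by simp
    show "dep (ein (sqK K) \<union> dual_edge ` ein ?D) (\<lambda>w. \<not> many_crossings K b w)"
      by (rule dep_mono[OF dep_comp[OF dep_many_crossings]]) simp
    show "dep (ein (sqK K) \<union> dual_edge ` ein ?D) (\<lambda>w. ?B (dualc w))" by (rule dep_mono[OF dBd]) simp
  qed (rule few_crossings_dual[OF K b])
  also have "\<dots> = PP (\<lambda>_. q) ?B"
    using EE_flip_reindex[OF fD dep_comp[OF dB, of "of_bool :: bool \<Rightarrow> real"] inj_dual_edge, of "1 - q"] q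
    by (simp add: dualc_def)
  finally have 1: "PP (\<lambda>_. 1 - q) (\<lambda>w. \<not> many_crossings K b w) \<le> PP (\<lambda>_. q) ?B" .
  have "((s - q) / (1 - q)) ^ (4 * b) * PP (\<lambda>_. q) ?B \<le> PP (\<lambda>_. s) ?A"
    by (rule sprinkling[OF fD dep_cross incr_cross q dB]) blast
  also have "PP (\<lambda>_. s) ?A \<le> (\<Sum>x\<in>{0..K - 1}. PP (\<lambda>_. s) (\<lambda>v. cross v ?D {(x, -1)} {t. snd t = K}))"
  proof -
    have "PP (\<lambda>_. s) ?A \<le> EE (\<lambda>_. s) (\<lambda>v. \<Sum>x\<in>{0..K - 1}. of_bool (cross v ?D {(x, -1)} {t. snd t = K}))"
    proof (rule EE_mono[OF fD dep_comp[OF dep_cross]])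
      show "dep (ein ?D) (\<lambda>v. \<Sum>x\<in>{0..K - 1}. of_bool (cross v ?D {(x, -1)} {t. snd t = K}) :: real)"
        by (rule dep_sum, rule dep_comp[OF dep_cross])
      fix v
      show "of_bool (?A v) \<le> (\<Sum>x\<in>{0..K - 1}. of_bool (cross v ?D {(x, -1)} {t. snd t = K}) :: real)"
      proof (cases "?A v")
        case True
        then obtain a c where ac: "snd a = -1" "snd c = K" "lconn (open_adj v) ?D a c" by (auto simp: cross_def)
        then have a: "a = (fst a, -1)" "fst a \<in> {0..K - 1}" using lconn_in[OF ac(3)] by (auto simp: prod_eq_iff)
        have "cross v ?D {(fst a, -1)} {t. snd t = K}" by (rule crossI[OF _ _ ac(3)]) (use a ac in auto)
        then have "1 \<le> (of_bool (cross v ?D {(fst a, -1)} {t. snd t = K}) :: real)" by simp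
        also have "\<dots> \<le> (\<Sum>x\<in>{0..K - 1}. of_bool (cross v ?D {(x, -1)} {t. snd t = K}))"
          by (rule member_le_sum[OF a(2)]) auto
        finally show ?thesis using True by simp
      qed (simp add: sum_nonneg)
    qed
    also have "\<dots> = (\<Sum>x\<in>{0..K - 1}. PP (\<lambda>_. s) (\<lambda>v. cross v ?D {(x, -1)} {t. snd t = K}))"
      by (rule EE_sum[OF fD], rule dep_comp[OF dep_cross])
    finally show ?thesis .
  qed
  also have "\<dots> \<le> (\<Sum>x\<in>{0..K - 1}. PP (\<lambda>_. s) (arm K))"
    by (rule sum_mono, rule arm_from) (use K q in \<open>auto simp: mnorm_def\<close>)
  also have "\<dots> = real_of_int K * PP (\<lambda>_. s) (arm K)" using K by simp
  finally have 2: "((s - q) / (1 - q)) ^ (4 * b) * PP (\<lambda>_. q) ?B \<le> real_of_int K * PP (\<lambda>_. s) (arm K)" .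
  have "((s - q) / (1 - q)) ^ (4 * b) * PP (\<lambda>_. 1 - q) (\<lambda>w. \<not> many_crossings K b w) \<le> ((s - q) / (1 - q)) ^ (4 * b) * PP (\<lambda>_. q) ?B"
    by (rule mult_left_mono[OF 1]) (use q in \<open>auto intro!: zero_le_power divide_nonneg_nonneg\<close>)
  then show ?thesis using 2 by linarith
qed

text \<open>Half of the exponential decay pays for the sprinkling: with c = 1/sqrt a0 and m so large
  that 1/\<rho> \<le> c^m, the choice b = k div m costs at most c^k, and c^k a0^k = (sqrt a0)^k
  still beats the factor K.\<close>

lemma many_crossings_likely:
  assumes p: "1/2 < p" "p \<le> 1"
  shows "\<exists>L m k0. 1 \<le> L \<and> 1 \<le> m \<and> (\<forall>k\<ge>k0. 1/2 \<le> PP (\<lambda>_. p) (many_crossings (int k * L) (k div m)))"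
proof -
  define q where "q = 1 - p"
  \<comment> \<open>Strictly between q and 1/2: below 1/2 for exponential decay, above q to leave
    room for sprinkling.\<close>
  define s where "s = (q + 1/2) / 2"
  have q: "0 \<le> q" "q < s" "s < 1/2" "0 < s" using p by (auto simp: q_def s_def)
  obtain L a where L: "1 \<le> L" and a: "0 \<le> a" "a < 1" and dec: "\<And>k::nat. PP (\<lambda>_. s) (arm (int k * L)) \<le> a ^ k"
    using arm_exponential_decay[OF q(4,3)] by blast
  define \<rho> where "\<rho> = ((s - q) / (1 - q)) ^ 4"
  have rho: "0 < \<rho>" using q by (simp add: \<rho>_def)
  \<comment> \<open>The rate a may be 0; any positive lower bound below 1, here 1/4, makes 1/sqrt a0
    meaningful.\<close>
  define a0 where "a0 = max a (1/4)"
  have a0: "0 < a0" "a0 < 1" "a \<le> a0" using a by (auto simp: a0_def)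
  define c where "c = 1 / sqrt a0"
  have c: "1 < c" "c * a0 = sqrt a0" using a0 by (auto simp: c_def real_div_sqrt)
  obtain m0 where m0: "1 / \<rho> < c ^ m0" using real_arch_pow[OF c(1)] by blast
  define m where "m = Suc m0"
  have "c ^ m0 \<le> c ^ m" unfolding m_def using c by (intro power_increasing) auto
  then have m: "1 \<le> m" "1 / \<rho> \<le> c ^ m" using m0 by (auto simp: m_def)
  have "(\<lambda>k. real k * sqrt a0 ^ k) \<longlonglongrightarrow> 0" using a0 by (intro powser_times_n_limit_0) auto
  then have "(\<lambda>k. real_of_int L * (real k * sqrt a0 ^ k)) \<longlonglongrightarrow> real_of_int L * 0" by (intro tendsto_mult tendsto_const)
  then have "\<forall>\<^sub>F k in sequentially. real_of_int L * (real k * sqrt a0 ^ k) < 1/2" by (rule order_tendstoD) simp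
  then obtain k1 where k1: "\<And>k. k1 \<le> k \<Longrightarrow> real_of_int L * (real k * sqrt a0 ^ k) < 1/2" by (auto simp: eventually_sequentially)
  have "1/2 \<le> PP (\<lambda>_. p) (many_crossings (int k * L) (k div m))" if k: "max 1 k1 \<le> k" for k
  proof -
    define K where "K = int k * L"
    define b where "b = k div m"
    have k': "1 \<le> k" "k1 \<le> k" using k by auto
    have kK: "int k \<le> K" using L mult_left_mono[of 1 L "int k"] by (simp add: K_def)
    have K: "1 \<le> K" using kK k' by linarith
    have b: "b \<le> nat (K + 1)" using kK div_le_dividend[of k m] unfolding b_def by linarith
    let ?P = "PP (\<lambda>_. p) (\<lambda>w. \<not> many_crossings K b w)"
    have "\<rho> ^ b * ?P \<le> real_of_int K * PP (\<lambda>_. s) (arm K)"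
      using few_crossings_prob[OF q(1,2) _ K b] q by (simp add: \<rho>_def power_mult q_def)
    also have "\<dots> \<le> real_of_int K * a0 ^ k"
    proof (rule mult_left_mono)
      have "PP (\<lambda>_. s) (arm K) \<le> a ^ k" using dec[of k] by (simp add: K_def)
      also have "\<dots> \<le> a0 ^ k" using a a0 by (intro power_mono) auto
      finally show "PP (\<lambda>_. s) (arm K) \<le> a0 ^ k" .
    qed (use K in auto)
    finally have 1: "\<rho> ^ b * ?P \<le> real_of_int K * a0 ^ k" .
    have 2: "(1 / \<rho>) ^ b \<le> c ^ k"
    proof -
      have "(1 / \<rho>) ^ b \<le> (c ^ m) ^ b" using m(2) rho by (intro power_mono) auto
      also have "\<dots> = c ^ (m * b)" by (simp add: power_mult)
      also have "\<dots> \<le> c ^ k" using c by (intro power_increasing) (auto simp: b_def)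
      finally show ?thesis .
    qed
    have "?P = (1 / \<rho>) ^ b * (\<rho> ^ b * ?P)" using rho by (simp add: power_divide)
    also have "\<dots> \<le> c ^ k * (real_of_int K * a0 ^ k)"
      by (rule mult_mono[OF 2 1]) (use rho PP_nonneg[of "\<lambda>_. p"] c in auto)
    also have "\<dots> = real_of_int L * (real k * sqrt a0 ^ k)"
      unfolding c(2)[symmetric] power_mult_distrib K_def by simp
    also have "\<dots> < 1/2" using k1 k' by blast
    finally have "?P < 1/2" .
    moreover have "?P = 1 - PP (\<lambda>_. p) (many_crossings K b)"
    proof -
      have "integrable (percf (\<lambda>_. p)) (\<lambda>w. of_bool (many_crossings K b w) :: real)"
        by (rule dep_integrable[OF finite_ein[OF finite_sqK] dep_comp[OF dep_many_crossings]])
      moreover have "integrable (percf (\<lambda>_. p)) (\<lambda>w::edge \<Rightarrow> bool. 1::real)"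
        by (rule dep_integrable[OF finite.emptyI dep_const])
      ultimately show ?thesis by (simp only: of_bool_not_iff Bochner_Integration.integral_diff EE_const)
    qed
    ultimately show ?thesis unfolding K_def b_def by linarith
  qed
  then show ?thesis using L m(1) by blast
qed

section \<open>Finitely supported functions\<close>

text \<open>Polynomials in the adjacency operator preserve finite support, and the class instance
  below supplies norms, orthogonality, spans and independence.\<close>

typedef 'a fvec = "{f :: 'a \<Rightarrow> real. finite {v. f v \<noteq> 0}}" morphisms fv Fv
  by (rule exI[of _ "\<lambda>_. 0"]) simp

setup_lifting type_definition_fvec

lemma finite_supp [simp]: "finite {v. fv x v \<noteq> 0}"
  using fv[of x] by simp

instantiation fvec :: (type) real_inner
begin

lift_definition zero_fvec :: "'a fvec" is "\<lambda>_. 0" by simp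

lift_definition plus_fvec :: "'a fvec \<Rightarrow> 'a fvec \<Rightarrow> 'a fvec" is "\<lambda>f g v. f v + g v"
proof -
  fix f g :: "'a \<Rightarrow> real" assume "finite {v. f v \<noteq> 0}" "finite {v. g v \<noteq> 0}"
  then show "finite {v. f v + g v \<noteq> 0}"
    by (rule_tac finite_subset[of _ "{v. f v \<noteq> 0} \<union> {v. g v \<noteq> 0}"]) auto
qed

lift_definition minus_fvec :: "'a fvec \<Rightarrow> 'a fvec \<Rightarrow> 'a fvec" is "\<lambda>f g v. f v - g v"
proof -
  fix f g :: "'a \<Rightarrow> real" assume "finite {v. f v \<noteq> 0}" "finite {v. g v \<noteq> 0}"
  then show "finite {v. f v - g v \<noteq> 0}"
    by (rule_tac finite_subset[of _ "{v. f v \<noteq> 0} \<union> {v. g v \<noteq> 0}"]) auto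
qed

lift_definition uminus_fvec :: "'a fvec \<Rightarrow> 'a fvec" is "\<lambda>f v. - f v" by simp

lift_definition scaleR_fvec :: "real \<Rightarrow> 'a fvec \<Rightarrow> 'a fvec" is "\<lambda>c f v. c * f v"
proof -
  fix c and f :: "'a \<Rightarrow> real" assume "finite {v. f v \<noteq> 0}"
  then show "finite {v. c * f v \<noteq> 0}" by (rule_tac finite_subset[of _ "{v. f v \<noteq> 0}"]) auto
qed

definition inner_fvec :: "'a fvec \<Rightarrow> 'a fvec \<Rightarrow> real" where
  "inner_fvec x y = (\<Sum>v\<in>{v. fv x v \<noteq> 0}. fv x v * fv y v)"

definition norm_fvec :: "'a fvec \<Rightarrow> real" where "norm_fvec x = sqrt (inner x x)"
definition sgn_fvec :: "'a fvec \<Rightarrow> 'a fvec" where "sgn_fvec x = scaleR (inverse (norm x)) x"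
definition dist_fvec :: "'a fvec \<Rightarrow> 'a fvec \<Rightarrow> real" where "dist_fvec x y = norm (x - y)"
definition uniformity_fvec :: "('a fvec \<times> 'a fvec) filter" where
  "uniformity_fvec = (INF e\<in>{0 <..}. principal {(x, y). dist x y < e})"
definition open_fvec :: "'a fvec set \<Rightarrow> bool" where
  "open_fvec U = (\<forall>x\<in>U. eventually (\<lambda>(x', y). x' = x \<longrightarrow> y \<in> U) uniformity)"

lemma inner_fvec_sum:
  assumes "finite S" "{v. fv x v \<noteq> 0} \<subseteq> S"
  shows "inner x y = (\<Sum>v\<in>S. fv x v * fv y v)"
  unfolding inner_fvec_def by (rule sum.mono_neutral_left) (use assms in auto)

instance
proof
  fix a b c :: "'a fvec" and r s :: real
  show "a + b + c = a + (b + c)" by transfer (simp add: fun_eq_iff)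
  show "a + b = b + a" by transfer (simp add: fun_eq_iff)
  show "0 + a = a" by transfer simp
  show "- a + a = 0" by transfer (simp add: fun_eq_iff)
  show "a - b = a + - b" by transfer (simp add: fun_eq_iff)
  show "r *\<^sub>R (a + b) = r *\<^sub>R a + r *\<^sub>R b" by transfer (simp add: fun_eq_iff algebra_simps)
  show "(r + s) *\<^sub>R a = r *\<^sub>R a + s *\<^sub>R a" by transfer (simp add: fun_eq_iff algebra_simps)
  show "r *\<^sub>R s *\<^sub>R a = (r * s) *\<^sub>R a" by transfer (simp add: fun_eq_iff)
  show "1 *\<^sub>R a = a" by transfer simp
  show "sgn a = scaleR (inverse (norm a)) a" by (rule sgn_fvec_def)
  show "dist a b = norm (a - b)" by (rule dist_fvec_def)
  show "(uniformity :: ('a fvec \<times> 'a fvec) filter) = (INF e\<in>{0 <..}. principal {(x, y). dist x y < e})"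
    by (rule uniformity_fvec_def)
  show "open U = (\<forall>x\<in>U. eventually (\<lambda>(x', y). x' = x \<longrightarrow> y \<in> U) uniformity)" for U :: "'a fvec set"
    by (rule open_fvec_def)
  let ?S = "{v. fv a v \<noteq> 0} \<union> {v. fv b v \<noteq> 0} \<union> {v. fv c v \<noteq> 0}"
  have fS: "finite ?S" by simp
  have sub: "{v. fv a v \<noteq> 0} \<subseteq> ?S" "{v. fv b v \<noteq> 0} \<subseteq> ?S" by blast+
  show "inner a b = inner b a"
    unfolding inner_fvec_sum[OF fS sub(1)] inner_fvec_sum[OF fS sub(2)] by (simp add: mult.commute)
  have "{v. fv (a + b) v \<noteq> 0} \<subseteq> ?S" by transfer auto
  then have "inner (a + b) c = (\<Sum>v\<in>?S. fv (a + b) v * fv c v)" by (rule inner_fvec_sum[OF fS])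
  also have "\<dots> = (\<Sum>v\<in>?S. fv a v * fv c v + fv b v * fv c v)"
    by (intro sum.cong refl) (simp add: plus_fvec.rep_eq algebra_simps)
  also have "\<dots> = inner a c + inner b c"
    unfolding inner_fvec_sum[OF fS sub(1)] inner_fvec_sum[OF fS sub(2)] by (rule sum.distrib)
  finally show "inner (a + b) c = inner a c + inner b c" .
  have "{v. fv (r *\<^sub>R a) v \<noteq> 0} \<subseteq> {v. fv a v \<noteq> 0}" by transfer auto
  then have "inner (r *\<^sub>R a) b = (\<Sum>v\<in>{v. fv a v \<noteq> 0}. fv (r *\<^sub>R a) v * fv b v)" by (intro inner_fvec_sum) simp
  then show "inner (r *\<^sub>R a) b = r * inner a b"
    by (simp add: inner_fvec_def scaleR_fvec.rep_eq sum_distrib_left mult.assoc)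
  show "0 \<le> inner a a" unfolding inner_fvec_def by (rule sum_nonneg) simp
  show "(inner a a = 0) = (a = 0)"
  proof
    assume "inner a a = 0"
    then have "\<forall>v\<in>{v. fv a v \<noteq> 0}. fv a v * fv a v = 0"
      unfolding inner_fvec_def by (subst (asm) sum_nonneg_eq_0_iff) auto
    then have "fv a v = 0" for v by (cases "fv a v = 0") auto
    then show "a = 0" by transfer (simp add: fun_eq_iff)
  qed (simp add: inner_fvec_def zero_fvec.rep_eq)
  show "norm a = sqrt (inner a a)" by (rule norm_fvec_def)
qed

end

declare zero_fvec.rep_eq [simp] plus_fvec.rep_eq [simp] minus_fvec.rep_eq [simp] uminus_fvec.rep_eq [simp] scaleR_fvec.rep_eq [simp]

lemma fvec_eqI: "(\<And>v. fv x v = fv y v) \<Longrightarrow> x = y"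
  by transfer (simp add: fun_eq_iff)

lemma fv_sum [simp]: "fv (\<Sum>i\<in>I. f i) v = (\<Sum>i\<in>I. fv (f i) v)"
  by (induction I rule: infinite_finite_induct) auto

lift_definition ev1 :: "'a \<Rightarrow> 'a fvec" is "\<lambda>a v. if v = a then 1 else 0"
  by simp

declare ev1.rep_eq [simp]

lemma inner_ev1 [simp]: "inner (ev1 a) x = fv x a"
proof -
  have "inner (ev1 a) x = (\<Sum>v\<in>{a}. fv (ev1 a) v * fv x v)" by (rule inner_fvec_sum) auto
  then show ?thesis by simp
qed

lemma inner_ev1_right [simp]: "inner x (ev1 a) = fv x a"
  by (subst inner_commute) simp

lemma norm_ev1 [simp]: "norm (ev1 a) = 1"
  by (simp add: norm_eq_sqrt_inner)

lemma fvec_expand: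
  assumes "finite S" "{v. fv x v \<noteq> 0} \<subseteq> S"
  shows "x = (\<Sum>v\<in>S. fv x v *\<^sub>R ev1 v)"
proof (rule fvec_eqI)
  fix u
  have "fv (\<Sum>v\<in>S. fv x v *\<^sub>R ev1 v) u = (\<Sum>v\<in>S. if v = u then fv x u else 0)"
    unfolding fv_sum by (rule sum.cong[OF refl]) auto
  also have "\<dots> = fv x u" using assms by (auto simp: sum.delta)
  finally show "fv x u = fv (\<Sum>v\<in>S. fv x v *\<^sub>R ev1 v) u" ..
qed

section \<open>The adjacency operator\<close>

text \<open>The operator of the whole percolation graph rather than of the cluster of the origin:
  started at the origin it never leaves the cluster, and it makes translation invariance
  available.\<close>

lift_definition adj :: "(edge \<Rightarrow> bool) \<Rightarrow> vertex fvec \<Rightarrow> vertex fvec" is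
  "\<lambda>w f u. \<Sum>v\<in>nbrs u. if open_adj w u v then f v else 0"
proof -
  fix w :: "edge \<Rightarrow> bool" and f :: "vertex \<Rightarrow> real" assume f: "finite {v. f v \<noteq> 0}"
  have "{u. (\<Sum>v\<in>nbrs u. if open_adj w u v then f v else 0) \<noteq> 0} \<subseteq> (\<Union>v\<in>{v. f v \<noteq> 0}. nbrs v)"
  proof
    fix u assume "u \<in> {u. (\<Sum>v\<in>nbrs u. if open_adj w u v then f v else 0) \<noteq> 0}"
    then obtain v where "v \<in> nbrs u" "(if open_adj w u v then f v else 0) \<noteq> 0"
      using sum.not_neutral_contains_not_neutral by blast
    then show "u \<in> (\<Union>v\<in>{v. f v \<noteq> 0}. nbrs v)" using nbrs_sym[of v u] by (simp del: split_paired_Ex split: if_splits) blast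
  qed
  then show "finite {u. (\<Sum>v\<in>nbrs u. if open_adj w u v then f v else 0) \<noteq> 0}"
    by (rule finite_subset) (use f in auto)
qed

lemma linear_adj: "linear (adj w)"
proof (rule linearI)
  show "adj w (x + y) = adj w x + adj w y" for x y
  proof (rule fvec_eqI)
    show "fv (adj w (x + y)) u = fv (adj w x + adj w y) u" for u
      unfolding adj.rep_eq plus_fvec.rep_eq sum.distrib[symmetric] by (rule sum.cong) auto
  qed
  show "adj w (c *\<^sub>R x) = c *\<^sub>R adj w x" for c x
  proof (rule fvec_eqI)
    show "fv (adj w (c *\<^sub>R x)) u = fv (c *\<^sub>R adj w x) u" for u
      unfolding adj.rep_eq scaleR_fvec.rep_eq sum_distrib_left by (rule sum.cong) auto
  qed
qed

lemma adj_sum_over: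
  assumes "finite S" "{v. fv x v \<noteq> 0} \<subseteq> S"
  shows "fv (adj w x) u = (\<Sum>v\<in>S. if open_adj w u v then fv x v else 0)"
proof -
  have "fv (adj w x) u = (\<Sum>v\<in>nbrs u \<inter> S. if open_adj w u v then fv x v else 0)"
    unfolding adj.rep_eq by (rule sum.mono_neutral_right) (use assms in auto)
  also have "\<dots> = (\<Sum>v\<in>S. if open_adj w u v then fv x v else 0)"
    by (rule sum.mono_neutral_left) (use assms(1) open_adj_nbrs[of w u] in \<open>simp_all del: split_paired_All\<close>, blast)
  finally show ?thesis .
qed

lemma adj_sym: "inner (adj w x) y = inner x (adj w y)"
proof -
  define S where "S = {v. fv x v \<noteq> 0} \<union> {v. fv y v \<noteq> 0} \<union> {v. fv (adj w x) v \<noteq> 0}"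
  have S: "finite S" "{v. fv x v \<noteq> 0} \<subseteq> S" "{v. fv y v \<noteq> 0} \<subseteq> S" "{v. fv (adj w x) v \<noteq> 0} \<subseteq> S" by (auto simp: S_def)
  have "inner (adj w x) y = (\<Sum>u\<in>S. \<Sum>v\<in>S. (if open_adj w u v then fv x v else 0) * fv y u)"
    unfolding inner_fvec_sum[OF S(1,4)] adj_sum_over[OF S(1,2)] sum_distrib_right ..
  also have "\<dots> = (\<Sum>v\<in>S. \<Sum>u\<in>S. (if open_adj w u v then fv x v else 0) * fv y u)" by (rule sum.swap)
  also have "\<dots> = (\<Sum>v\<in>S. fv x v * (\<Sum>u\<in>S. if open_adj w v u then fv y u else 0))"
    unfolding sum_distrib_left by (intro sum.cong refl) (use open_adj_sym in auto)
  also have "\<dots> = inner x (adj w y)"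
    unfolding inner_fvec_sum[OF S(1,2)] adj_sum_over[OF S(1,3)] ..
  finally show ?thesis .
qed

lemma card_nbrs: "card (nbrs x) \<le> 4"
  by (simp add: nbrs_def card_insert_if)

text \<open>Schur's test: the Cauchy-Schwarz inequality in each row costs a factor 4, and each
  vertex occurs in at most 4 rows.\<close>

lemma norm_adj: "norm (adj w x) \<le> 4 * norm x"
proof -
  define T where "T = {u. fv (adj w x) u \<noteq> 0}"
  define S where "S = {v. fv x v \<noteq> 0}"
  have fin: "finite T" "finite S" by (simp_all add: T_def S_def)
  have row: "(fv (adj w x) u)\<^sup>2 \<le> 4 * (\<Sum>v\<in>S. of_bool (v \<in> nbrs u) * (fv x v)\<^sup>2)" for u
  proof -
    have "(fv (adj w x) u)\<^sup>2 \<le> (\<Sum>v\<in>nbrs u. (if open_adj w u v then fv x v else 0)\<^sup>2) * card (nbrs u)"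
      unfolding adj.rep_eq by (rule sum_squared_le_sum_of_squares)
    also have "\<dots> \<le> (\<Sum>v\<in>nbrs u. (fv x v)\<^sup>2) * 4"
      using card_nbrs[of u] by (intro mult_mono sum_mono) (auto intro: sum_nonneg)
    also have "(\<Sum>v\<in>nbrs u. (fv x v)\<^sup>2) = (\<Sum>v\<in>nbrs u \<inter> S. of_bool (v \<in> nbrs u) * (fv x v)\<^sup>2)"
      by (rule sum.mono_neutral_cong_right) (auto simp: S_def)
    also have "\<dots> = (\<Sum>v\<in>S. of_bool (v \<in> nbrs u) * (fv x v)\<^sup>2)"
      by (rule sum.mono_neutral_left) (use fin in auto)
    finally show ?thesis by simp
  qed
  have "inner (adj w x) (adj w x) = (\<Sum>u\<in>T. (fv (adj w x) u)\<^sup>2)"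
    by (simp add: inner_fvec_def T_def power2_eq_square)
  also have "\<dots> \<le> (\<Sum>u\<in>T. 4 * (\<Sum>v\<in>S. of_bool (v \<in> nbrs u) * (fv x v)\<^sup>2))" by (rule sum_mono[OF row])
  also have "\<dots> = 4 * (\<Sum>v\<in>S. (\<Sum>u\<in>T. of_bool (v \<in> nbrs u)) * (fv x v)\<^sup>2)"
    unfolding sum_distrib_left[symmetric] sum_distrib_right by (subst sum.swap) simp
  also have "\<dots> \<le> 4 * (\<Sum>v\<in>S. 4 * (fv x v)\<^sup>2)"
  proof (intro mult_left_mono sum_mono mult_right_mono)
    fix v
    have "(\<Sum>u\<in>T. of_bool (v \<in> nbrs u)) = (\<Sum>u\<in>T \<inter> nbrs v. 1 :: real)"
      by (rule sum.mono_neutral_cong_right) (use fin nbrs_sym[of v] nbrs_sym[of _ v] in \<open>simp_all del: split_paired_All\<close>, blast)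
    also have "\<dots> \<le> real (card (nbrs v))" using card_mono[of "nbrs v" "T \<inter> nbrs v"] by simp
    also have "\<dots> \<le> 4" using card_nbrs[of v] by simp
    finally show "(\<Sum>u\<in>T. of_bool (v \<in> nbrs u)) \<le> (4::real)" .
  qed auto
  also have "\<dots> = 16 * inner x x" by (simp add: inner_fvec_def S_def sum_distrib_left power2_eq_square)
  finally have "(norm (adj w x))\<^sup>2 \<le> (4 * norm x)\<^sup>2" by (simp add: power2_norm_eq_inner power_mult_distrib)
  then show ?thesis by (rule power2_le_imp_le) simp
qed

section \<open>Polynomials in a linear operator\<close>

definition pop :: "('v::real_vector \<Rightarrow> 'v) \<Rightarrow> real poly \<Rightarrow> 'v \<Rightarrow> 'v" where
  "pop T q x = (\<Sum>i\<le>degree q. coeff q i *\<^sub>R (T ^^ i) x)"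

lemma pop_ge_degree:
  assumes "degree q \<le> n"
  shows "pop T q x = (\<Sum>i\<le>n. coeff q i *\<^sub>R (T ^^ i) x)"
  unfolding pop_def by (rule sum.mono_neutral_left) (use assms in \<open>auto simp: coeff_eq_0\<close>)

lemma pop_0 [simp]: "pop T 0 x = 0"
  by (simp add: pop_def)

lemma pop_1 [simp]: "pop T 1 x = x"
  by (simp add: pop_def)

lemma pop_add: "pop T (p + q) x = pop T p x + pop T q x"
proof -
  let ?n = "max (degree p) (degree q)"
  have "pop T (p + q) x = (\<Sum>i\<le>?n. coeff (p + q) i *\<^sub>R (T ^^ i) x)" by (rule pop_ge_degree) (rule degree_add_le_max)
  also have "\<dots> = pop T p x + pop T q x"
    unfolding pop_ge_degree[of p ?n T x, OF max.cobounded1] pop_ge_degree[of q ?n T x, OF max.cobounded2]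
    by (simp add: sum.distrib scaleR_left_distrib)
  finally show ?thesis .
qed

lemma pop_smult: "pop T (smult c p) x = c *\<^sub>R pop T p x"
  unfolding pop_ge_degree[of "smult c p" "degree p" T x, OF degree_smult_le] pop_def by (simp add: scaleR_sum_right)

lemma pop_pCons:
  assumes "linear T"
  shows "pop T (pCons a q) x = a *\<^sub>R x + T (pop T q x)"
proof -
  have "pop T (pCons a q) x = (\<Sum>i\<le>Suc (degree q). coeff (pCons a q) i *\<^sub>R (T ^^ i) x)"
    by (rule pop_ge_degree) (rule degree_pCons_le)
  also have "\<dots> = a *\<^sub>R x + (\<Sum>i\<le>degree q. coeff q i *\<^sub>R T ((T ^^ i) x))"
    by (subst sum.atMost_Suc_shift) simp
  also have "(\<Sum>i\<le>degree q. coeff q i *\<^sub>R T ((T ^^ i) x)) = T (pop T q x)"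
    by (simp add: pop_def linear_sum[OF assms] linear_scale[OF assms])
  finally show ?thesis .
qed

lemma linear_pop:
  assumes "linear T"
  shows "linear (pop T q)"
proof (induction q)
  case 0
  then show ?case by (auto intro!: linearI)
next
  case (pCons a q)
  show ?case
    by (rule linearI)
       (simp_all add: pop_pCons[OF assms] linear_add[OF pCons(2)] linear_scale[OF pCons(2)] linear_add[OF assms] linear_scale[OF assms] algebra_simps)
qed

lemma pop_mult:
  assumes "linear T"
  shows "pop T (p * q) x = pop T p (pop T q x)"
proof (induction p)
  case (pCons a p)
  have "pop T (pCons a p * q) x = a *\<^sub>R pop T q x + pop T (pCons 0 (p * q)) x"
    by (simp only: mult_pCons_left pop_add pop_smult)
  then show ?case using pCons by (simp add: pop_pCons[OF assms])
qed simp

lemma pop_power: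
  assumes "linear T"
  shows "pop T (q ^ n) x = (pop T q ^^ n) x"
  by (induction n) (simp_all add: pop_mult[OF assms])

lemma pop_sum: "pop T (\<Sum>i\<in>I. f i) x = (\<Sum>i\<in>I. pop T (f i) x)"
  by (induction I rule: infinite_finite_induct) (auto simp: pop_add)

lemma pop_const: "pop T [:c:] x = c *\<^sub>R x"
  by (simp add: pop_def)

lemma pop_sym:
  fixes T :: "'v::real_inner \<Rightarrow> 'v"
  assumes "linear T" "\<And>x y. inner (T x) y = inner x (T y)"
  shows "inner (pop T q x) y = inner x (pop T q y)"
proof (induction q arbitrary: x y)
  case (pCons a q)
  have "pop T q (T y) = T (pop T q y)"
    using pop_mult[OF assms(1), of q "[:0, 1:]" y] pop_mult[OF assms(1), of "[:0, 1:]" q y]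
    by (simp add: pop_pCons[OF assms(1)] mult.commute linear_0[OF assms(1)] pop_const)
  then show ?case by (simp add: pop_pCons[OF assms(1)] inner_left_distrib inner_right_distrib assms(2) pCons(2))
qed simp

lemma pop_adj_sym: "inner (pop (adj w) q x) y = inner x (pop (adj w) q y)"
  by (rule pop_sym[OF linear_adj adj_sym])

text \<open>The source of all positivity statements: the quadratic form of q r q at x is that of r
  at q(A)x.\<close>

lemma pop_adj_square: "inner x (pop (adj w) (q * r * q) x) = inner (pop (adj w) q x) (pop (adj w) r (pop (adj w) q x))"
  by (simp add: pop_mult[OF linear_adj] pop_adj_sym)

section \<open>Moments\<close>

lemma A_pow_eq:
  assumes "u \<in> cluster w"
  shows "A_pow w k u v = fv ((adj w ^^ k) (ev1 v)) u"
  using assms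
proof (induction k arbitrary: u)
  case (Suc k)
  have "A_pow w (Suc k) u v = (\<Sum>x\<in>nbrs u. if open_adj w u x then fv ((adj w ^^ k) (ev1 v)) x else 0)"
    unfolding A_pow.simps
  proof (rule sum.cong[OF refl])
    fix x assume "x \<in> nbrs u"
    have "open_adj w u x \<Longrightarrow> x \<in> cluster w"
      using Suc.prems rtranclp.rtrancl_into_rtrancl[of "open_adj w" origin u x] by (simp add: cluster_def)
    then show "(if cl_adj w u x then A_pow w k x v else 0) = (if open_adj w u x then fv ((adj w ^^ k) (ev1 v)) x else 0)"
      using Suc.IH[of x] Suc.prems by (auto simp: cl_adj_def)
  qed
  then show ?case by (simp add: adj.rep_eq)
qed simp

lemma adj_pow_outside_cluster: "u \<notin> cluster w \<Longrightarrow> fv ((adj w ^^ k) (ev1 origin)) u = 0"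
proof (induction k arbitrary: u)
  case 0
  then show ?case by (auto simp: cluster_def)
next
  case (Suc k)
  have "x \<notin> cluster w" if "open_adj w u x" for x
    using Suc.prems open_adj_sym[OF that] rtranclp.rtrancl_into_rtrancl[of "open_adj w" origin x u] by (auto simp: cluster_def)
  then show ?case using Suc.IH by (auto simp: adj.rep_eq intro!: sum.neutral)
qed

lemma origin_in_cluster: "origin \<in> cluster w"
  by (simp add: cluster_def)

primrec hood :: "nat \<Rightarrow> vertex \<Rightarrow> vertex set" where
  "hood 0 v = {v}"
| "hood (Suc k) v = hood k v \<union> (\<Union>x\<in>hood k v. nbrs x)"

lemma finite_hood [simp]: "finite (hood k v)"
  by (induction k) auto

lemma hood_mono: "k \<le> l \<Longrightarrow> hood k v \<subseteq> hood l v"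
  by (induction l) (auto simp: le_Suc_eq)

lemma adj_pow_outside: "u \<notin> hood k v \<Longrightarrow> fv ((adj w ^^ k) (ev1 v)) u = 0"
proof (induction k arbitrary: u)
  case (Suc k)
  have "x \<notin> hood k v" if "x \<in> nbrs u" for x
    using Suc.prems nbrs_sym[OF that] by auto
  then show ?case using Suc.IH by (auto simp: adj.rep_eq intro!: sum.neutral)
qed simp

lemma dep_adj_pow: "dep (ein (hood k v)) (\<lambda>w. fv ((adj w ^^ k) (ev1 v)) u)"
  unfolding dep_def
proof (intro allI impI)
  fix w w' :: "edge \<Rightarrow> bool" assume "\<forall>e\<in>ein (hood k v). w e = w' e"
  then show "fv ((adj w ^^ k) (ev1 v)) u = fv ((adj w' ^^ k) (ev1 v)) u"
  proof (induction k arbitrary: u)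
    case (Suc k)
    have IH: "fv ((adj w ^^ k) (ev1 v)) x = fv ((adj w' ^^ k) (ev1 v)) x" for x
      by (rule Suc.IH) (use Suc.prems ein_mono[of "hood k v" "hood (Suc k) v"] in auto)
    have "(if open_adj w u x then fv ((adj w ^^ k) (ev1 v)) x else 0) = (if open_adj w' u x then fv ((adj w' ^^ k) (ev1 v)) x else 0)"
      if x: "x \<in> nbrs u" for x
    proof (cases "x \<in> hood k v")
      case True
      have "open_adj w u x = open_adj w' u x"
        by (rule open_adj_cong[of "hood (Suc k) v"]) (use Suc.prems True nbrs_sym[OF x] in auto)
      then show ?thesis using IH by simp
    next
      case False
      then show ?thesis by (simp add: adj_pow_outside)
    qed
    then show ?case by (simp add: adj.rep_eq)
  qed simp
qed

lemma dep_pop: "dep (ein (hood (degree q) v)) (\<lambda>w. fv (pop (adj w) q (ev1 v)) u)"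
  unfolding pop_def fv_sum scaleR_fvec.rep_eq
proof (rule dep_sum)
  fix i assume "i \<in> {..degree q}"
  then show "dep (ein (hood (degree q) v)) (\<lambda>w. coeff q i * fv ((adj w ^^ i) (ev1 v)) u)"
    by (intro dep_comp[OF dep_mono[OF dep_adj_pow ein_mono[OF hood_mono]]]) simp
qed

text \<open>Integration of polynomials against the expected spectral measure, as a functional
  available before any such measure is known to exist.\<close>

definition EL :: "real \<Rightarrow> real poly \<Rightarrow> real" where
  "EL p q = EE (\<lambda>_. p) (\<lambda>w. fv (pop (adj w) q (ev1 origin)) origin)"

lemma integrable_pop: "integrable (percf (\<lambda>_. p)) (\<lambda>w. fv (pop (adj w) q (ev1 v)) u)"
  by (rule dep_integrable[OF finite_ein[OF finite_hood] dep_pop])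

lemma EL_add: "EL p (q + r) = EL p q + EL p r"
  unfolding EL_def pop_add plus_fvec.rep_eq by (rule Bochner_Integration.integral_add[OF integrable_pop integrable_pop])

lemma EL_smult: "EL p (smult c q) = c * EL p q"
  unfolding EL_def pop_smult scaleR_fvec.rep_eq by (rule integral_mult_right_zero)

lemma EL_1: "EL p 1 = 1"
  by (simp add: EL_def)

lemma EL_sum: "EL p (\<Sum>i\<in>I. f i) = (\<Sum>i\<in>I. EL p (f i))"
proof (induction I rule: infinite_finite_induct)
  case (insert i I)
  then show ?case by (simp add: EL_add)
qed (simp_all add: EL_def)

lemma EL_monom: "EL p (monom 1 k) = (\<integral>w. A_pow w k origin origin \<partial>perc p)"
proof -
  have "pop (adj w) (monom 1 k) x = (adj w ^^ k) x" for w x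
  proof -
    have "pop (adj w) (monom 1 k) x = (\<Sum>i\<le>k. (if i = k then 1 else 0) *\<^sub>R (adj w ^^ i) x)"
      unfolding pop_ge_degree[of "monom 1 k" k "adj w" x, OF degree_monom_le] by (simp add: coeff_monom eq_commute)
    also have "\<dots> = (\<Sum>i\<le>k. if i = k then (adj w ^^ i) x else 0)" by (rule sum.cong) auto
    finally show ?thesis by simp
  qed
  then show ?thesis by (simp add: EL_def perc_eq_percf A_pow_eq[OF origin_in_cluster])
qed

lemma EL_nonneg:
  assumes "\<And>w. 0 \<le> fv (pop (adj w) q (ev1 origin)) origin"
  shows "0 \<le> EL p q"
  unfolding EL_def by (rule integral_nonneg_AE) (use assms in simp)

lemma EL_mono:
  assumes "\<And>w. fv (pop (adj w) q (ev1 origin)) origin \<le> fv (pop (adj w) r (ev1 origin)) origin"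
  shows "EL p q \<le> EL p r"
  unfolding EL_def by (rule integral_mono[OF integrable_pop integrable_pop]) (use assms in simp)

lemma inner_adj_bounds: "- 4 * inner x x \<le> inner x (adj w x)" "inner x (adj w x) \<le> 4 * inner x x" "inner (adj w x) (adj w x) \<le> 16 * inner x x"
proof -
  have "\<bar>inner x (adj w x)\<bar> \<le> norm x * norm (adj w x)" by (rule Cauchy_Schwarz_ineq2)
  also have "\<dots> \<le> norm x * (4 * norm x)" by (intro mult_left_mono norm_adj) simp
  also have "\<dots> = 4 * inner x x" by (simp add: power2_norm_eq_inner[symmetric] power2_eq_square)
  finally show "- 4 * inner x x \<le> inner x (adj w x)" "inner x (adj w x) \<le> 4 * inner x x" by linarith+
  have "(norm (adj w x))\<^sup>2 \<le> (4 * norm x)\<^sup>2" by (intro power_mono norm_adj) simp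
  then show "inner (adj w x) (adj w x) \<le> 16 * inner x x" by (simp add: power2_norm_eq_inner power_mult_distrib)
qed

text \<open>With s = (4 + A)/8 and t = (4 - A)/8, even powers are moved symmetrically to both sides
  of the form, leaving exponents 0 or 1. The three nontrivial cases are the positivity of s, of t,
  and of st = (16 - A^2)/64, all from the norm bound 4.\<close>

lemma bernstein_positive:
  "0 \<le> inner x (pop (adj w) ([:1/2, 1/8:] ^ j * [:1/2, -1/8:] ^ k) x)"
proof -
  let ?s = "[:1/2, 1/8:] :: real poly" and ?t = "[:1/2, -1/8:] :: real poly"
  have split: "\<exists>a b. b \<le> 1 \<and> n = a + b + a" for n :: nat by (rule exI[of _ "n div 2"], rule exI[of _ "n mod 2"]) presburger
  obtain a b where ab: "b \<le> 1" "j = a + b + a" using split by blast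
  obtain c d where cd: "d \<le> 1" "k = c + d + c" using split by blast
  have eq: "?s ^ j * ?t ^ k = (?s ^ a * ?t ^ c) * (?s ^ b * ?t ^ d) * (?s ^ a * ?t ^ c)"
    unfolding ab(2) cd(2) power_add by (simp only: ac_simps)
  define y where "y = pop (adj w) (?s ^ a * ?t ^ c) x"
  have p1: "pop (adj w) [:\<alpha>, \<beta>:] y = \<alpha> *\<^sub>R y + \<beta> *\<^sub>R adj w y" for \<alpha> \<beta>
    by (simp add: pop_pCons[OF linear_adj] pop_const linear_scale[OF linear_adj])
  have st: "?s * ?t = [:1/4, 0, -1/64:]" by simp
  have p2: "pop (adj w) [:1/4, 0, -1/64:] y = (1/4) *\<^sub>R y - (1/64) *\<^sub>R adj w (adj w y)"
    by (simp add: pop_pCons[OF linear_adj] pop_const linear_scale[OF linear_adj] linear_neg[OF linear_adj] linear_0[OF linear_adj] linear_add[OF linear_adj])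
  have "0 \<le> inner y (pop (adj w) (?s ^ b * ?t ^ d) y)"
  proof -
    consider "b = 0" "d = 0" | "b = 1" "d = 0" | "b = 0" "d = 1" | "b = 1" "d = 1" using ab cd by linarith
    then show ?thesis
    proof cases
      case 1
      then show ?thesis by simp
    next
      case 2
      then show ?thesis using inner_adj_bounds(1,2)[of y w] by (simp add: p1 inner_right_distrib)
    next
      case 3
      then show ?thesis using inner_adj_bounds(1,2)[of y w] by (simp add: p1 inner_right_distrib inner_diff_right)
    next
      case 4
      have "?s ^ b * ?t ^ d = [:1/4, 0, -1/64:]" using 4 by simp
      then show ?thesis using inner_adj_bounds(3)[where x=y and w=w] by (simp only: p2 inner_diff_right inner_scaleR_right adj_sym[symmetric])
    qed
  qed
  then show ?thesis unfolding eq pop_adj_square y_def .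
qed

section \<open>The moment problem on an interval\<close>

text \<open>The binomial identity behind the factorial moments of Bernstein weights: after
  exchanging the two coefficients the remaining sum is (x + (1 - x))^(n - k).\<close>

lemma bernstein_sum:
  fixes x :: "'a::comm_ring_1"
  assumes "k \<le> n"
  shows "(\<Sum>j\<le>n. of_nat ((j choose k) * (n choose j)) * (x ^ j * (1 - x) ^ (n - j))) = of_nat (n choose k) * x ^ k"
proof -
  have "(\<Sum>j\<le>n. of_nat ((j choose k) * (n choose j)) * (x ^ j * (1 - x) ^ (n - j)))
    = (\<Sum>j\<in>{k..n}. of_nat ((j choose k) * (n choose j)) * (x ^ j * (1 - x) ^ (n - j)))"
    by (rule sum.mono_neutral_right) (auto simp: binomial_eq_0)
  also have "\<dots> = (\<Sum>j\<in>{k..n}. of_nat (n choose k) * (of_nat ((n - k) choose (j - k)) * (x ^ j * (1 - x) ^ (n - j))))"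
  proof (rule sum.cong[OF refl])
    fix j assume j: "j \<in> {k..n}"
    have "(n choose j) * (j choose k) = (n choose k) * ((n - k) choose (j - k))"
      by (rule choose_mult) (use j in auto)
    then have eq: "(j choose k) * (n choose j) = (n choose k) * ((n - k) choose (j - k))" by (simp add: mult.commute)
    show "of_nat ((j choose k) * (n choose j)) * (x ^ j * (1 - x) ^ (n - j)) =
         of_nat (n choose k) * (of_nat ((n - k) choose (j - k)) * (x ^ j * (1 - x) ^ (n - j)))"
      unfolding eq by (simp add: mult.assoc)
  qed
  also have "\<dots> = of_nat (n choose k) * (\<Sum>j\<in>{k..n}. of_nat ((n - k) choose (j - k)) * (x ^ j * (1 - x) ^ (n - j)))"
    by (simp only: sum_distrib_left)
  also have "(\<Sum>j\<in>{k..n}. of_nat ((n - k) choose (j - k)) * (x ^ j * (1 - x) ^ (n - j)))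
    = (\<Sum>i\<le>n - k. of_nat ((n - k) choose i) * (x ^ (i + k) * (1 - x) ^ (n - k - i)))"
    by (rule sum.reindex_bij_witness[of _ "\<lambda>i. i + k" "\<lambda>j. j - k"]) (use assms in auto)
  also have "\<dots> = x ^ k * (\<Sum>i\<le>n - k. of_nat ((n - k) choose i) * x ^ i * (1 - x) ^ (n - k - i))"
    unfolding sum_distrib_left by (intro sum.cong refl) (simp add: power_add mult.left_commute mult.commute)
  also have "(\<Sum>i\<le>n - k. of_nat ((n - k) choose i) * x ^ i * (1 - x) ^ (n - k - i)) = (x + (1 - x)) ^ (n - k)"
    by (rule binomial_ring[symmetric])
  finally show ?thesis by simp
qed

text \<open>Both quantities are products of k factors of absolute value at most 1, j/n against (j -
  i)/(n - i), which differ by at most k/(n - k) factor by factor.\<close>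

lemma choose_ratio_close:
  assumes "2 * k < n" "j \<le> n"
  shows "\<bar>(real j / real n) ^ k - real (j choose k) / real (n choose k)\<bar> \<le> real k * real k / real (n - k)"
proof -
  have prod: "real (m choose k) = (\<Prod>i<k. (real m - real i)) / fact k" for m
    by (simp add: binomial_gbinomial gbinomial_prod_rev lessThan_atLeast0)
  have "real (j choose k) / real (n choose k) = (\<Prod>i<k. (real j - real i) / (real n - real i))"
    unfolding prod by (simp add: prod_dividef)
  moreover have "(real j / real n) ^ k = (\<Prod>i<k. real j / real n)" by simp
  moreover have "norm ((\<Prod>i<k. real j / real n) - (\<Prod>i<k. (real j - real i) / (real n - real i)))
     \<le> (\<Sum>i<k. norm (real j / real n - (real j - real i) / (real n - real i)))"
  proof (rule norm_prod_diff)
    fix i assume "i \<in> {..<k}"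
    then have "real i < real k" "2 * real k < real n" using assms by auto
    then have "- (real n - real i) \<le> real j - real i" "real j - real i \<le> real n - real i" "0 < real n - real i" using assms by linarith+
    then show "norm ((real j - real i) / (real n - real i)) \<le> 1" by (simp add: abs_le_iff)
  qed (use assms in simp)
  moreover have "(\<Sum>i<k. norm (real j / real n - (real j - real i) / (real n - real i))) \<le> (\<Sum>i<k. real k / real (n - k))"
  proof (rule sum_mono)
    fix i assume "i \<in> {..<k}"
    then have i: "real i < real k" "2 * real k < real n" "0 < real n" using assms by auto
    have "real j / real n - (real j - real i) / (real n - real i) = real i * ((real n - real j) / real n) / (real n - real i)"
      using i by (simp add: field_simps)
    also have "norm \<dots> \<le> real k * 1 / (real n - real k)"
    proof -
      have jn: "real j \<le> real n" using assms by simp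
      have f: "0 \<le> (real n - real j) / real n" "(real n - real j) / real n \<le> 1" using assms i by auto
      have "norm (real i * ((real n - real j) / real n) / (real n - real i)) = real i * ((real n - real j) / real n) / (real n - real i)"
        using f i jn by (subst real_norm_def, intro abs_of_nonneg divide_nonneg_nonneg mult_nonneg_nonneg) auto
      also have "\<dots> \<le> real k * 1 / (real n - real k)"
        using f i by (intro frac_le mult_mono) auto
      finally show ?thesis .
    qed
    finally show "norm (real j / real n - (real j - real i) / (real n - real i)) \<le> real k / real (n - k)"
      using assms by (simp add: of_nat_diff)
  qed
  ultimately show ?thesis by simp
qed

text \<open>Positivity on the Bernstein basis gives weights on the points j/n that sum to 1. Their
  factorial moments reproduce \<open>L\<close> exactly, so their ordinary moments converge to
  \<open>L\<close>. A weakly convergent subsequence then yields the measure.\<close>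

lemma hausdorff_moment:
  fixes L :: "real poly \<Rightarrow> real"
  assumes add: "\<And>p q. L (p + q) = L p + L q" and smult: "\<And>c p. L (smult c p) = c * L p" and one: "L 1 = 1"
    and pos: "\<And>j k. 0 \<le> L ([:0, 1:] ^ j * (1 - [:0, 1:]) ^ k)"
  shows "\<exists>M. prob_space M \<and> sets M = sets borel \<and> (\<forall>q. integrable M (poly q) \<and> (\<integral>x. poly q x \<partial>M) = L q)"
proof -
  let ?X = "[:0, 1:] :: real poly"
  have L0: "L 0 = 0" using smult[of 0 0] by simp
  have Lsum: "L (\<Sum>i\<in>I. f i) = (\<Sum>i\<in>I. L (f i))" for I :: "nat set" and f
    by (induction I rule: infinite_finite_induct) (auto simp: L0 add)
  define wt where "wt n j = (if j \<le> n then real (n choose j) * L (?X ^ j * (1 - ?X) ^ (n - j)) else 0)" for n j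
  have wt0: "0 \<le> wt n j" for n j using pos by (simp add: wt_def)
  have mom: "(\<Sum>j\<le>n. real (j choose k) * wt n j) = real (n choose k) * L (?X ^ k)" if "k \<le> n" for n k
  proof -
    have "(\<Sum>j\<le>n. real (j choose k) * wt n j) = (\<Sum>j\<le>n. L (smult (real ((j choose k) * (n choose j))) (?X ^ j * (1 - ?X) ^ (n - j))))"
      by (intro sum.cong refl) (simp add: wt_def smult mult.assoc)
    also have "\<dots> = L (\<Sum>j\<le>n. of_nat ((j choose k) * (n choose j)) * (?X ^ j * (1 - ?X) ^ (n - j)))"
      unfolding Lsum by (intro sum.cong refl arg_cong[where f=L]) (simp add: of_nat_poly)
    also have "\<dots> = L (smult (real (n choose k)) (?X ^ k))"
      unfolding bernstein_sum[OF that] by (simp add: of_nat_poly)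
    finally show ?thesis by (simp add: smult)
  qed
  have wt1: "(\<Sum>j\<le>n. wt n j) = 1" for n using mom[of 0 n] one by simp
  define P where "P n = embed_pmf (wt n)" for n
  have pmfP: "pmf (P n) j = wt n j" for n j
    unfolding P_def
  proof (rule pmf_embed_pmf[OF wt0])
    have "(\<integral>\<^sup>+ x. ennreal (wt n x) \<partial>count_space UNIV) = (\<Sum>j\<le>n. ennreal (wt n j))"
      by (rule nn_integral_count_space'[of "{..n}"]) (auto simp: wt_def)
    also have "\<dots> = 1" using wt1[of n] by (simp add: sum_ennreal wt0)
    finally show "(\<integral>\<^sup>+ x. ennreal (wt n x) \<partial>count_space UNIV) = 1" .
  qed
  define \<mu> where "\<mu> n = distr (measure_pmf (P (Suc n))) borel (\<lambda>j. real j / real (Suc n))" for n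
  have int: "(\<integral>x. f x \<partial>\<mu> n) = (\<Sum>j\<le>Suc n. wt (Suc n) j * f (real j / real (Suc n)))" if [measurable]: "f \<in> borel_measurable borel" for f :: "real \<Rightarrow> real" and n
  proof -
    have "(\<integral>x. f x \<partial>\<mu> n) = measure_pmf.expectation (P (Suc n)) (\<lambda>j. f (real j / real (Suc n)))"
      unfolding \<mu>_def by (rule integral_distr) auto
    also have "\<dots> = (\<Sum>j\<in>{..Suc n}. pmf (P (Suc n)) j *\<^sub>R f (real j / real (Suc n)))"
      by (rule integral_measure_pmf) (auto simp: set_pmf_eq pmfP wt_def split: if_splits)
    finally show ?thesis by (simp add: pmfP)
  qed
  have rd: "real_distribution (\<mu> n)" for n
  proof -
    interpret prob_space "\<mu> n" unfolding \<mu>_def by (rule measure_pmf.prob_space_distr) auto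
    show ?thesis by unfold_locales (simp add: \<mu>_def)
  qed
  \<comment> \<open>Tightness is phrased with half-open intervals; the left end is -1 because 0 may
    carry mass.\<close>
  have supp: "measure (\<mu> n) {-1<..1} = 1" for n
  proof -
    have "measure (\<mu> n) {-1<..1} = measure_pmf.prob (P (Suc n)) ((\<lambda>j. real j / real (Suc n)) -` {-1<..1})"
      unfolding \<mu>_def by (subst measure_distr) auto
    also have "\<dots> = 1"
    proof (rule measure_pmf.prob_eq_1[THEN iffD2])
      have "j \<le> Suc n" if "j \<in> set_pmf (P (Suc n))" for j using that by (auto simp: set_pmf_eq pmfP wt_def split: if_splits)
      then have "-1 < real j / real (Suc n) \<and> real j / real (Suc n) \<le> 1" if "j \<in> set_pmf (P (Suc n))" for j
      proof -
        have "real j \<le> real (Suc n)" using that \<open>\<And>j. j \<in> set_pmf (P (Suc n)) \<Longrightarrow> j \<le> Suc n\<close> of_nat_le_iff by blast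
        moreover have "-1 < real j / real (Suc n)" by (rule less_le_trans[of _ 0]) auto
        ultimately show ?thesis by (simp del: of_nat_Suc)
      qed
      then show "AE x in measure_pmf (P (Suc n)). x \<in> (\<lambda>j. real j / real (Suc n)) -` {- 1<..1}"
        by (simp add: AE_measure_pmf_iff)
    qed simp
    finally show ?thesis .
  qed
  have tight: "tight \<mu>"
    unfolding tight_def
  proof (intro conjI allI impI)
    show "real_distribution (\<mu> n)" for n by (rule rd)
    fix \<epsilon> :: real assume "0 < \<epsilon>"
    then show "\<exists>a b. a < b \<and> (\<forall>n. 1 - \<epsilon> < measure (\<mu> n) {a<..b})"
      by (intro exI[of _ "-1"] exI[of _ 1]) (simp add: supp)
  qed
  obtain r M where r: "strict_mono (r :: nat \<Rightarrow> nat)" and M: "real_distribution M" and weak: "weak_conv_m (\<mu> \<circ> id \<circ> r) M"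
    using tight_imp_convergent_subsubsequence[OF tight strict_mono_id] by blast
  interpret M: real_distribution M by fact
  \<comment> \<open>Clamping to [0, 1] turns powers into bounded continuous functions, as weak
    convergence requires. It changes nothing for the approximating measures, and the limit is
    finally replaced by its image under the clamp.\<close>
  define cl where "cl x = max 0 (min 1 x)" for x :: real
  have cl_cont: "isCont cl x" for x unfolding cl_def by (intro continuous_intros)
  have clm [measurable]: "cl \<in> borel_measurable borel" unfolding cl_def by measurable
  have cl01: "0 \<le> cl x" "cl x \<le> 1" for x by (auto simp: cl_def)
  have conv: "(\<lambda>n. \<integral>x. cl x ^ k \<partial>\<mu> n) \<longlonglongrightarrow> L (?X ^ k)" for k
  proof -
    have err: "\<bar>(\<integral>x. cl x ^ k \<partial>\<mu> n) - L (?X ^ k)\<bar> \<le> real k * real k / real (Suc n - k)" if n: "2 * k < Suc n" for n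
    proof -
      let ?n = "Suc n"
      have ck: "0 < real (?n choose k)" using n by simp
      have "L (?X ^ k) = (\<Sum>j\<le>?n. real (j choose k) * wt ?n j) / real (?n choose k)"
        using mom[of k ?n] n ck by (simp add: field_simps)
      also have "\<dots> = (\<Sum>j\<le>?n. wt ?n j * (real (j choose k) / real (?n choose k)))"
        unfolding sum_divide_distrib by (rule sum.cong[OF refl]) (simp only: times_divide_eq_right mult.commute)
      finally have Lk: "L (?X ^ k) = (\<Sum>j\<le>?n. wt ?n j * (real (j choose k) / real (?n choose k)))" .
      have "(\<integral>x. cl x ^ k \<partial>\<mu> n) = (\<Sum>j\<le>?n. wt ?n j * cl (real j / real ?n) ^ k)" by (rule int) measurable
      also have "\<dots> = (\<Sum>j\<le>?n. wt ?n j * (real j / real ?n) ^ k)"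
        by (intro sum.cong refl) (simp add: cl_def)
      finally have "(\<integral>x. cl x ^ k \<partial>\<mu> n) - L (?X ^ k) = (\<Sum>j\<le>?n. wt ?n j * ((real j / real ?n) ^ k - real (j choose k) / real (?n choose k)))"
        unfolding Lk by (simp only: sum_subtractf right_diff_distrib)
      also have "\<bar>\<dots>\<bar> \<le> (\<Sum>j\<le>?n. wt ?n j * (real k * real k / real (?n - k)))"
      proof (rule order_trans[OF sum_abs], rule sum_mono)
        fix j assume "j \<in> {..?n}"
        then have "\<bar>(real j / real ?n) ^ k - real (j choose k) / real (?n choose k)\<bar> \<le> real k * real k / real (?n - k)"
          by (intro choose_ratio_close n) simp
        then show "\<bar>wt ?n j * ((real j / real ?n) ^ k - real (j choose k) / real (?n choose k))\<bar> \<le> wt ?n j * (real k * real k / real (?n - k))"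
          unfolding abs_mult abs_of_nonneg[OF wt0] by (rule mult_left_mono[OF _ wt0])
      qed
      also have "\<dots> = real k * real k / real (?n - k)"
        unfolding sum_distrib_right[symmetric] wt1 by simp
      finally show ?thesis .
    qed
    have "(\<lambda>n. real k * real k / real (Suc n - k)) \<longlonglongrightarrow> 0"
    proof (rule tendsto_divide_0[OF tendsto_const])
      have "filterlim (\<lambda>n. real (Suc n - k)) at_top sequentially"
        proof (rule filterlim_compose[OF filterlim_real_sequentially])
        have "Z \<le> Suc n - k" if "Z + k \<le> n" for Z n using that by linarith
        then show "filterlim (\<lambda>n. Suc n - k) at_top sequentially"
          unfolding filterlim_at_top eventually_sequentially by blast
      qed
      then show "filterlim (\<lambda>n. real (Suc n - k)) at_infinity sequentially" by (rule filterlim_at_top_imp_at_infinity)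
    qed
    then have "(\<lambda>n. (\<integral>x. cl x ^ k \<partial>\<mu> n) - L (?X ^ k)) \<longlonglongrightarrow> 0"
      by (rule Lim_null_comparison[rotated]) (rule eventually_sequentiallyI[of "2 * k"], use err in simp)
    then show ?thesis by (rule LIM_zero_cancel)
  qed
  have cm: "(\<integral>x. cl x ^ k \<partial>M) = L (?X ^ k)" for k
  proof (rule LIMSEQ_unique)
    show "(\<lambda>n. \<integral>x. cl x ^ k \<partial>\<mu> (r n)) \<longlonglongrightarrow> L (?X ^ k)"
      using LIMSEQ_subseq_LIMSEQ[OF conv r] by (simp add: comp_def)
    have "(\<lambda>n. integral\<^sup>L ((\<mu> \<circ> id \<circ> r) n) (\<lambda>x. cl x ^ k)) \<longlonglongrightarrow> integral\<^sup>L M (\<lambda>x. cl x ^ k)"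
      by (rule weak_conv_imp_integral_bdd_continuous_conv[OF _ M weak, of _ 1])
         (use rd cl01 in \<open>auto intro!: isCont_power cl_cont power_le_one\<close>)
    then show "(\<lambda>n. \<integral>x. cl x ^ k \<partial>\<mu> (r n)) \<longlonglongrightarrow> (\<integral>x. cl x ^ k \<partial>M)" by simp
  qed
  define N where "N = distr M borel cl"
  have NP: "prob_space N" unfolding N_def by (rule M.prob_space_distr) measurable
  have Nk: "integrable N (\<lambda>x. x ^ k)" "(\<integral>x. x ^ k \<partial>N) = L (?X ^ k)" for k
  proof -
    have "integrable M (\<lambda>x. cl x ^ k)"
      by (rule M.integrable_const_bound[of _ 1]) (use cl01 in \<open>auto intro!: power_le_one\<close>)
    then show "integrable N (\<lambda>x. x ^ k)" unfolding N_def by (subst integrable_distr_eq) auto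
    show "(\<integral>x. x ^ k \<partial>N) = L (?X ^ k)" unfolding N_def by (subst integral_distr) (auto simp: cm)
  qed
  have Xk: "?X ^ k = monom 1 k" for k by (simp add: monom_altdef)
  have "integrable N (poly q) \<and> (\<integral>x. poly q x \<partial>N) = L q" for q
  proof -
    have "L q = L (\<Sum>i\<le>degree q. smult (coeff q i) (monom 1 i))" by (simp add: smult_monom poly_as_sum_of_monoms)
    also have "\<dots> = (\<Sum>i\<le>degree q. coeff q i * (\<integral>x. x ^ i \<partial>N))" unfolding Lsum smult Nk(2) Xk ..
    also have "\<dots> = (\<integral>x. (\<Sum>i\<le>degree q. coeff q i * x ^ i) \<partial>N)" using Nk(1) by simp
    finally show ?thesis using Nk(1) by (simp add: poly_altdef[abs_def])
  qed
  moreover have "sets N = sets borel" by (simp add: N_def)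
  ultimately show ?thesis using NP by blast
qed

lemma pcompose_power: "pcompose (q ^ n) r = pcompose q r ^ n"
  by (induction n) (simp_all add: pcompose_mult pcompose_1)

text \<open>The map (x + 4)/8 carries [-4, 4] to [0, 1] and the Bernstein basis to the polynomials
  of \<open>bernstein_positive\<close>; the solution on [0, 1] is transported back by 8t -
  4.\<close>

lemma expected_spectral_measure_exists: "\<exists>\<mu>. expected_spectral_measure p \<mu>"
proof -
  let ?f = "[:1/2, 1/8:] :: real poly" and ?g = "[:-4, 8:] :: real poly"
  define L where "L q = EL p (pcompose q ?f)" for q
  have "\<exists>M. prob_space M \<and> sets M = sets borel \<and> (\<forall>q. integrable M (poly q) \<and> (\<integral>x. poly q x \<partial>M) = L q)"
  proof (rule hausdorff_moment)
    show "L (q + r) = L q + L r" for q r by (simp add: L_def pcompose_add EL_add)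
    show "L (smult c q) = c * L q" for c q by (simp add: L_def pcompose_smult EL_smult)
    show "L 1 = 1" by (simp add: L_def EL_1 pcompose_1)
    fix j k
    have "pcompose ([:0, 1:] ^ j * (1 - [:0, 1:]) ^ k) ?f = ?f ^ j * [:1/2, -1/8:] ^ k"
      by (simp add: pcompose_mult pcompose_power pcompose_diff pcompose_1 pcompose_pCons one_pCons)
    then show "0 \<le> L ([:0, 1:] ^ j * (1 - [:0, 1:]) ^ k)"
      using bernstein_positive[of "ev1 origin" _ j k] by (simp only: L_def inner_ev1 EL_nonneg)
  qed
  then obtain M where M: "prob_space M" "sets M = sets borel" "\<And>q. integrable M (poly q)" "\<And>q. (\<integral>x. poly q x \<partial>M) = L q" by blast
  interpret M: prob_space M by fact
  define N where "N = distr M borel (\<lambda>t. 8 * t - 4)"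
  have m: "(\<lambda>t. 8 * t - 4) \<in> borel_measurable M" unfolding measurable_cong_sets[OF M(2) refl] by measurable
  have Nk: "integrable N (\<lambda>x. x ^ k) \<and> (\<integral>x. x ^ k \<partial>N) = EL p (monom 1 k)" for k
  proof -
    have eq: "(8 * t - 4) ^ k = poly (pcompose (monom 1 k) ?g) t" for t :: real
      by (simp add: poly_pcompose poly_monom algebra_simps)
    have "pcompose (pcompose (monom 1 k) ?g) ?f = pcompose (monom 1 k) (pcompose ?g ?f)" by (simp add: pcompose_assoc)
    also have "pcompose ?g ?f = [:0, 1:]" by (simp add: pcompose_pCons)
    finally have "L (pcompose (monom 1 k) ?g) = EL p (monom 1 k)" by (simp add: L_def pcompose_idR)
    then show ?thesis unfolding N_def using m M(3,4)
      by (subst integrable_distr_eq[OF m], simp, subst integral_distr[OF m], simp) (simp add: eq)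
  qed
  have "expected_spectral_measure p N"
    unfolding expected_spectral_measure_def
    using Nk EL_monom[of p] M.prob_space_distr[OF m] by (simp add: N_def)
  then show ?thesis by blast
qed

section \<open>Support of the expected spectral measure\<close>

lemma esm_poly:
  assumes "expected_spectral_measure p \<mu>"
  shows "integrable \<mu> (poly q)" "(\<integral>x. poly q x \<partial>\<mu>) = EL p q"
proof -
  interpret prob_space \<mu> using assms by (simp add: expected_spectral_measure_def)
  have k: "integrable \<mu> (\<lambda>x. x ^ k)" "(\<integral>x. x ^ k \<partial>\<mu>) = EL p (monom 1 k)" for k
  proof -
    have "integrable \<mu> (\<lambda>x. x ^ k) \<and> (\<integral>x. x ^ k \<partial>\<mu>) = EL p (monom 1 k)"
    \<comment> \<open>The moment condition starts at k = 1; the moment of order 0 is the total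
      mass.\<close>
    proof (cases "k = 0")
      case True
      then show ?thesis using prob_space by (simp add: EL_1 monom_0 one_pCons[symmetric])
    next
      case False
      then show ?thesis using assms by (simp add: expected_spectral_measure_def EL_monom)
    qed
    then show "integrable \<mu> (\<lambda>x. x ^ k)" "(\<integral>x. x ^ k \<partial>\<mu>) = EL p (monom 1 k)" by auto
  qed
  show "integrable \<mu> (poly q)" unfolding poly_altdef[abs_def] using k(1) by simp
  have "EL p q = EL p (\<Sum>i\<le>degree q. smult (coeff q i) (monom 1 i))" by (simp add: smult_monom poly_as_sum_of_monoms)
  also have "\<dots> = (\<Sum>i\<le>degree q. coeff q i * (\<integral>x. x ^ i \<partial>\<mu>))" unfolding EL_sum EL_smult k(2) ..
  also have "\<dots> = (\<integral>x. poly q x \<partial>\<mu>)" unfolding poly_altdef using k(1) by simp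
  finally show "(\<integral>x. poly q x \<partial>\<mu>) = EL p q" ..
qed

lemma norm_adj_pow: "norm ((adj w ^^ k) x) \<le> 4 ^ k * norm x"
proof (induction k)
  case (Suc k)
  have "norm ((adj w ^^ Suc k) x) \<le> 4 * norm ((adj w ^^ k) x)" by (simp add: norm_adj)
  then show ?case using Suc by simp
qed simp

text \<open>The norm bound gives moments of order 2k of size at most 16^k. Markov's inequality at 4
  + e then bounds the outer mass by (16/(4 + e)^2)^k for every k.\<close>

lemma esm_support:
  assumes "expected_spectral_measure p \<mu>"
  shows "AE x in \<mu>. \<bar>x\<bar> \<le> 4"
proof -
  interpret prob_space \<mu> using assms by (simp add: expected_spectral_measure_def)
  have sb: "sets \<mu> = sets borel" using assms by (simp add: expected_spectral_measure_def)
  have sm: "{x. c \<le> x ^ (2 * k)} \<in> sets \<mu>" for c :: real and k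
    unfolding sb by measurable
  have mom: "(\<integral>x. x ^ (2 * k) \<partial>\<mu>) \<le> 16 ^ k" for k
  proof -
    have "fv (pop (adj w) (monom 1 (2 * k)) (ev1 origin)) origin \<le> fv (pop (adj w) [:16 ^ k:] (ev1 origin)) origin" for w
    proof -
      have m: "monom 1 (2 * k) = monom 1 k * 1 * (monom 1 k :: real poly)" by (simp add: mult_monom mult_2)
      have pm: "pop (adj w) (monom 1 k) x = (adj w ^^ k) x" for x
      proof -
        have "monom 1 k = ([:0, 1:] :: real poly) ^ k" by (simp add: monom_altdef)
        moreover have "pop (adj w) [:0, 1:] = adj w" by (rule ext) (simp add: pop_pCons[OF linear_adj] pop_const linear_0[OF linear_adj])
        ultimately show ?thesis by (simp only: pop_power[OF linear_adj])
      qed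
      have "fv (pop (adj w) (monom 1 (2 * k)) (ev1 origin)) origin = inner (ev1 origin) (pop (adj w) (monom 1 k * 1 * monom 1 k) (ev1 origin))"
        by (simp add: m)
      also have "\<dots> = (norm ((adj w ^^ k) (ev1 origin)))\<^sup>2" unfolding pop_adj_square by (simp add: pm power2_norm_eq_inner)
      also have "\<dots> \<le> (4 ^ k)\<^sup>2" using norm_adj_pow[where w=w and k=k and x="ev1 origin"] by (intro power_mono) auto
      also have "\<dots> = 16 ^ k" by (simp add: power2_eq_square flip: power_mult_distrib)
      finally show ?thesis by (simp add: pop_const)
    qed
    then have "EL p (monom 1 (2 * k)) \<le> EL p [:16 ^ k:]" by (rule EL_mono)
    also have "\<dots> = 16 ^ k" by (simp add: EL_def pop_const)
    finally show ?thesis using esm_poly(2)[OF assms, of "monom 1 (2 * k)"] by (simp add: poly_monom)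
  qed
  have null: "measure \<mu> {x. (4 + e)\<^sup>2 \<le> x ^ 2} = 0" if e: "0 < e" for e
  proof -
    define r where "r = 16 / (4 + e)\<^sup>2"
    have "16 < (4 + e)\<^sup>2" using e by (simp add: power2_eq_square algebra_simps add_pos_pos)
    then have r: "0 \<le> r" "r < 1" unfolding r_def by (simp, subst divide_less_eq_1_pos) auto
    have "measure \<mu> {x. (4 + e)\<^sup>2 \<le> x ^ 2} \<le> r ^ k" for k
    proof -
      have pos: "0 < ((4 + e)\<^sup>2) ^ k" using e by simp
      have "{x. (4 + e)\<^sup>2 \<le> x ^ 2} \<subseteq> {x \<in> space \<mu>. ((4 + e)\<^sup>2) ^ k \<le> x ^ (2 * k)}"
        using sets_eq_imp_space_eq[OF sb] by (auto simp: power_mult intro!: power_mono)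
      then have "measure \<mu> {x. (4 + e)\<^sup>2 \<le> x ^ 2} \<le> measure \<mu> {x \<in> space \<mu>. ((4 + e)\<^sup>2) ^ k \<le> x ^ (2 * k)}"
        by (rule finite_measure_mono) (use sm[of "((4 + e)\<^sup>2) ^ k" k] sets_eq_imp_space_eq[OF sb] in simp)
      also have "\<dots> \<le> (\<integral>x. x ^ (2 * k) \<partial>\<mu>) / ((4 + e)\<^sup>2) ^ k"
        using esm_poly(1)[OF assms, of "monom 1 (2 * k)", unfolded poly_monom[abs_def]] pos
        by (intro integral_Markov_inequality_measure[where A="space \<mu>"]) (auto simp: poly_monom sb sets_eq_imp_space_eq[OF sb] power_mult)
      also have "\<dots> \<le> 16 ^ k / ((4 + e)\<^sup>2) ^ k" using mom pos by (intro divide_right_mono) auto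
      also have "\<dots> = r ^ k" by (simp add: r_def power_divide)
      finally show ?thesis .
    qed
    moreover have "(\<lambda>k. r ^ k) \<longlonglongrightarrow> 0" using r by (intro LIMSEQ_realpow_zero) auto
    ultimately have "measure \<mu> {x. (4 + e)\<^sup>2 \<le> x ^ 2} \<le> 0" by (intro LIMSEQ_le_const[of "\<lambda>k. r ^ k"]) auto
    then show ?thesis by (simp add: antisym)
  qed
  have "{x. (4 + 1 / real (Suc n))\<^sup>2 \<le> x\<^sup>2} \<in> null_sets \<mu>" for n
    using null[of "1 / real (Suc n)"] sm[of "(4 + 1 / real (Suc n))\<^sup>2" 1] by (intro null_setsI) (simp_all add: emeasure_eq_measure)
  then have "(\<Union>n. {x. (4 + 1 / real (Suc n))\<^sup>2 \<le> x\<^sup>2}) \<in> null_sets \<mu>" by (intro null_sets_UN) auto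
  then show ?thesis
  proof (rule AE_I')
    show "{x \<in> space \<mu>. \<not> \<bar>x\<bar> \<le> 4} \<subseteq> (\<Union>n. {x. (4 + 1 / real (Suc n))\<^sup>2 \<le> x\<^sup>2})"
    proof
      fix x assume "x \<in> {x \<in> space \<mu>. \<not> \<bar>x\<bar> \<le> 4}"
      then have "0 < \<bar>x\<bar> - 4" by simp
      then obtain n where "inverse (real (Suc n)) < \<bar>x\<bar> - 4" using reals_Archimedean by blast
      then have "4 + 1 / real (Suc n) \<le> \<bar>x\<bar>" by (simp add: inverse_eq_divide)
      then have "(4 + 1 / real (Suc n))\<^sup>2 \<le> \<bar>x\<bar>\<^sup>2" by (intro power_mono) auto
      then show "x \<in> (\<Union>n. {x. (4 + 1 / real (Suc n))\<^sup>2 \<le> x\<^sup>2})" by (auto simp del: of_nat_Suc)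
    qed
  qed
qed

text \<open>The bridge from moments to masses: on [-4, 4] the powers of g converge boundedly to the
  indicator of {g = 1}.\<close>

lemma esm_limit:
  assumes esm: "expected_spectral_measure p \<mu>" and g: "\<And>x. \<bar>x\<bar> \<le> 4 \<Longrightarrow> 0 \<le> poly g x \<and> poly g x \<le> 1"
  shows "(\<lambda>m. EL p (g ^ m)) \<longlonglongrightarrow> measure \<mu> {x. poly g x = 1}"
proof -
  interpret prob_space \<mu> using esm by (simp add: expected_spectral_measure_def)
  have sb: "sets \<mu> = sets borel" using esm by (simp add: expected_spectral_measure_def)
  have pm: "poly q \<in> borel_measurable \<mu>" for q using esm_poly(1)[OF esm] by blast
  have "(\<lambda>m. \<integral>x. poly g x ^ m \<partial>\<mu>) \<longlonglongrightarrow> (\<integral>x. indicator {x. poly g x = 1} x \<partial>\<mu>)"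
  proof (rule integral_dominated_convergence[of _ _ _ "\<lambda>_. 1"])
    show "(\<lambda>x. indicat_real {x. poly g x = 1} x) \<in> borel_measurable \<mu>"
    proof (rule borel_measurable_indicator)
      have "{x. poly g x = 1} = poly g -` {1} \<inter> space \<mu>" using sets_eq_imp_space_eq[OF sb] by auto
      then show "{x. poly g x = 1} \<in> sets \<mu>" using pm[of g] by (simp add: measurable_sets)
    qed
    show "(\<lambda>x. poly g x ^ m) \<in> borel_measurable \<mu>" for m using pm[of "g ^ m"] unfolding poly_power[abs_def] .
    show "AE x in \<mu>. (\<lambda>m. poly g x ^ m) \<longlonglongrightarrow> indicat_real {x. poly g x = 1} x"
      using esm_support[OF esm]
    proof eventually_elim
      case (elim x)
      show ?case
      proof (cases "poly g x = 1")
        case False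
        then have "0 \<le> poly g x" "poly g x < 1" using g[OF elim] by auto
        then show ?thesis using False by (simp add: LIMSEQ_realpow_zero)
      qed simp
    qed
    show "AE x in \<mu>. norm (poly g x ^ m) \<le> 1" for m
      using esm_support[OF esm] by eventually_elim (use g in \<open>auto intro!: power_le_one\<close>)
  qed simp
  moreover have "(\<integral>x. poly g x ^ m \<partial>\<mu>) = EL p (g ^ m)" for m using esm_poly(2)[OF esm, of "g ^ m"] by (simp add: poly_power)
  moreover have "(\<integral>x. indicator {x. poly g x = 1} x \<partial>\<mu>) = measure \<mu> {x. poly g x = 1}"
    using sets_eq_imp_space_eq[OF sb] by simp
  ultimately show ?thesis by simp
qed

section \<open>Annihilating polynomials of finite clusters\<close>

text \<open>The diagonal pairs record the vertex set, which the edges alone would miss for an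
  isolated origin. A finite cluster gives a finite set of pairs, and there are countably many of
  those.\<close>

definition cluster_graph :: "(edge \<Rightarrow> bool) \<Rightarrow> (vertex \<times> vertex) set" where
  "cluster_graph w = {(u, v). u \<in> cluster w \<and> v \<in> cluster w \<and> (u = v \<or> open_adj w u v)}"

lemma adj_pow_cong_cluster:
  assumes "cluster_graph w = cluster_graph w'"
  shows "(adj w ^^ k) (ev1 origin) = (adj w' ^^ k) (ev1 origin)"
proof -
  have mem: "u \<in> cluster x \<longleftrightarrow> (u, u) \<in> cluster_graph x" for u x by (simp add: cluster_graph_def)
  have noloop: "\<not> open_adj x u u" for x u by (cases u) (auto simp: open_adj_def)
  have adj: "cl_adj x u v \<longleftrightarrow> u \<noteq> v \<and> (u, v) \<in> cluster_graph x" for x u v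
    using noloop[of x u] by (auto simp: cluster_graph_def cl_adj_def)
  have A: "A_pow w j u origin = A_pow w' j u origin" for j u
    by (induction j arbitrary: u) (simp_all add: adj assms cong: if_cong)
  show ?thesis
  proof (rule fvec_eqI)
    fix u
    show "fv ((adj w ^^ k) (ev1 origin)) u = fv ((adj w' ^^ k) (ev1 origin)) u"
    proof (cases "u \<in> cluster w")
      case True
      then have "u \<in> cluster w'" using mem[of u] assms by simp
      then show ?thesis using True A by (simp add: A_pow_eq[symmetric])
    next
      case False
      then have "u \<notin> cluster w'" using mem[of u] assms by simp
      then show ?thesis using False by (simp add: adj_pow_outside_cluster)
    qed
  qed
qed

lemma annihilating_poly_exists:
  assumes fin: "finite (cluster w)"
  shows "\<exists>q. q \<noteq> 0 \<and> pop (adj w) q (ev1 origin) = 0"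
proof -
  define n where "n = card (cluster w)"
  define y where "y k = (adj w ^^ k) (ev1 origin)" for k
  have inspan: "y k \<in> span (ev1 ` cluster w)" for k
  proof -
    have "y k = (\<Sum>v\<in>cluster w. fv (y k) v *\<^sub>R ev1 v)"
      by (rule fvec_expand[OF fin]) (use adj_pow_outside_cluster[where w=w and k=k] in \<open>auto simp: y_def\<close>)
    also have "\<dots> \<in> span (ev1 ` cluster w)" by (intro span_sum span_scale span_base) auto
    finally show ?thesis .
  qed
  have key: "pop (adj w) q (ev1 origin) = (\<Sum>k\<le>degree q. coeff q k *\<^sub>R y k)" for q
    by (simp add: pop_def y_def)
  have mon: "pop (adj w) (monom c k) (ev1 origin) = c *\<^sub>R y k" for c k
  proof -
    have "pop (adj w) (monom c k) (ev1 origin) = (\<Sum>i\<le>k. (if i = k then c else 0) *\<^sub>R y i)"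
      unfolding pop_ge_degree[of "monom c k" k "adj w", OF degree_monom_le] y_def by (simp add: coeff_monom eq_commute)
    also have "\<dots> = (\<Sum>i\<le>k. if i = k then c *\<^sub>R y i else 0)" by (rule sum.cong) auto
    finally show ?thesis by simp
  qed
  \<comment> \<open>The n + 1 vectors A^k e_o lie in a space of dimension at most n. Dependence of a
    set does not see repetitions, so coinciding vectors are treated separately.\<close>
  show ?thesis
  proof (cases "inj_on y {..n}")
    case False
    then obtain k l where kl: "k \<noteq> l" "y k = y l" by (auto simp: inj_on_def)
    have "coeff (monom 1 k + monom (-1) l :: real poly) k \<noteq> coeff 0 k" using kl(1) by (simp add: coeff_monom)
    then have "monom 1 k + monom (-1) l \<noteq> (0 :: real poly)" by metis
    moreover have "pop (adj w) (monom 1 k + monom (-1) l) (ev1 origin) = 0" by (simp add: pop_add mon kl(2))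
    ultimately show ?thesis by blast
  next
    case True
    have card: "card (y ` {..n}) = Suc n" using card_image[OF True] by simp
    have "card (ev1 ` cluster w :: vertex fvec set) \<le> n" unfolding n_def by (rule card_image_le[OF fin])
    then have "dependent (y ` {..n})"
      using independent_span_bound[of "ev1 ` cluster w" "y ` {..n}"] fin inspan card by fastforce
    then obtain u where u: "\<exists>v\<in>y ` {..n}. u v \<noteq> 0" "(\<Sum>v\<in>y ` {..n}. u v *\<^sub>R v) = 0"
      using dependent_finite[of "y ` {..n}"] by auto
    define q where "q = (\<Sum>k\<le>n. monom (u (y k)) k)"
    have "pop (adj w) q (ev1 origin) = (\<Sum>k\<le>n. u (y k) *\<^sub>R y k)" by (simp add: q_def pop_sum mon)
    also have "\<dots> = 0" using u(2) by (simp add: sum.reindex[OF True])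
    finally have "pop (adj w) q (ev1 origin) = 0" .
    moreover have "q \<noteq> 0"
    proof -
      obtain k where k: "k \<le> n" "u (y k) \<noteq> 0" using u(1) by auto
      have "coeff q k = (\<Sum>j\<le>n. if j = k then u (y k) else 0)"
        unfolding q_def coeff_sum by (rule sum.cong) auto
      then have "coeff q k \<noteq> 0" using k by simp
      then show ?thesis by auto
    qed
    ultimately show ?thesis by blast
  qed
qed

lemma annihilating_sequence:
  "\<exists>ann_p :: nat \<Rightarrow> real poly. (\<forall>n. ann_p n \<noteq> 0) \<and> (\<forall>w. finite (cluster w) \<longrightarrow> (\<exists>n. pop (adj w) (ann_p n) (ev1 origin) = 0))"
proof -
  define K where "K = cluster_graph ` {w. finite (cluster w)}"
  have "K \<subseteq> Collect finite"
  proof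
    fix G assume "G \<in> K"
    then obtain w where w: "G = cluster_graph w" "finite (cluster w)" by (auto simp: K_def)
    have "G \<subseteq> cluster w \<times> cluster w" by (auto simp: w(1) cluster_graph_def)
    then show "G \<in> Collect finite" using w(2) finite_subset by auto
  qed
  then have cK: "countable K" using countable_Collect_finite countable_subset by blast
  have "\<exists>q. q \<noteq> 0 \<and> (\<forall>w. cluster_graph w = G \<longrightarrow> finite (cluster w) \<longrightarrow> pop (adj w) q (ev1 origin) = 0)" for G
  proof (cases "\<exists>w. cluster_graph w = G \<and> finite (cluster w)")
    case True
    then obtain w where w: "cluster_graph w = G" "finite (cluster w)" by blast
    obtain q where q: "q \<noteq> 0" "pop (adj w) q (ev1 origin) = 0" using annihilating_poly_exists[OF w(2)] by blast
    have "pop (adj w') q (ev1 origin) = 0" if "cluster_graph w' = G" for w'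
      using q(2) adj_pow_cong_cluster[of w w'] that w(1) by (simp add: pop_def)
    then show ?thesis using q(1) by blast
  next
    case False
    then show ?thesis by (intro exI[of _ 1]) auto
  qed
  then obtain X where X: "\<And>G. X G \<noteq> 0" "\<And>G w. cluster_graph w = G \<Longrightarrow> finite (cluster w) \<Longrightarrow> pop (adj w) (X G) (ev1 origin) = 0"
    by metis
  have "\<exists>n. pop (adj w) (X (from_nat_into K n)) (ev1 origin) = 0" if fin: "finite (cluster w)" for w
  proof -
    have "cluster_graph w \<in> K" using fin by (auto simp: K_def)
    then obtain n where "from_nat_into K n = cluster_graph w" using subset_range_from_nat_into[OF cK] by (metis imageE subsetD)
    then show ?thesis using X(2)[OF _ fin] by metis
  qed
  then show ?thesis using X(1) by (intro exI[of _ "\<lambda>n. X (from_nat_into K n)"]) blast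
qed

section \<open>Finite clusters have atomic expected spectral measure\<close>

text \<open>The polynomial g = 1 - f^2/C takes values in [0, 1] on [-4, 4] and equals 1 exactly at
  the roots of f. Where f(A) kills e_o, all powers of g(A) fix e_o and contribute 1; elsewhere even
  powers contribute something nonnegative.\<close>

lemma esm_roots_ge:
  assumes esm: "expected_spectral_measure p \<mu>"
  shows "PP (\<lambda>_. p) (\<lambda>w. pop (adj w) f (ev1 origin) = 0) \<le> measure \<mu> {x. poly f x = 0}"
proof -
  have "compact ((\<lambda>x. (poly f x)\<^sup>2) ` {-4..4})" by (intro compact_continuous_image continuous_intros) auto
  then have "bounded ((\<lambda>x. (poly f x)\<^sup>2) ` {-4..4})" by (rule compact_imp_bounded)
  then obtain B where B: "\<And>y. y \<in> (\<lambda>x. (poly f x)\<^sup>2) ` {-4..4} \<Longrightarrow> norm y \<le> B" unfolding bounded_iff by blast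
  define C where "C = max 1 B"
  have C: "0 < C" "(poly f x)\<^sup>2 \<le> C" if "\<bar>x\<bar> \<le> 4" for x
    using B[of "(poly f x)\<^sup>2"] that by (auto simp: C_def abs_le_iff)
  have C0: "0 < C" by (simp add: C_def)
  define g where "g = 1 - smult (1 / C) (f * f)"
  have pg: "poly g x = 1 - (poly f x)\<^sup>2 / C" for x by (simp add: g_def power2_eq_square)
  have lim: "(\<lambda>m. EL p (g ^ m)) \<longlonglongrightarrow> measure \<mu> {x. poly g x = 1}"
  proof (rule esm_limit[OF esm])
    show "0 \<le> poly g x \<and> poly g x \<le> 1" if "\<bar>x\<bar> \<le> 4" for x using C[OF that] by (simp add: pg)
  qed
  have "(\<lambda>m. EL p (g ^ (2 * m))) \<longlonglongrightarrow> measure \<mu> {x. poly g x = 1}"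
    using LIMSEQ_subseq_LIMSEQ[OF lim, of "\<lambda>m. 2 * m"] by (simp add: strict_mono_def comp_def)
  moreover have "PP (\<lambda>_. p) (\<lambda>w. pop (adj w) f (ev1 origin) = 0) \<le> EL p (g ^ (2 * m))" for m
  proof -
    \<comment> \<open>The vanishing of a vector becomes that of one local number, its squared norm,
      which gives measurability.\<close>
    have z: "pop (adj w) f (ev1 origin) = 0 \<longleftrightarrow> fv (pop (adj w) (f * f) (ev1 origin)) origin = 0" for w
    proof -
      have "fv (pop (adj w) (f * f) (ev1 origin)) origin = inner (ev1 origin) (pop (adj w) (f * 1 * f) (ev1 origin))" by simp
      also have "\<dots> = inner (pop (adj w) f (ev1 origin)) (pop (adj w) f (ev1 origin))" unfolding pop_adj_square by simp
      finally show ?thesis by simp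
    qed
    have int: "integrable (percf (\<lambda>_. p)) (\<lambda>w. of_bool (pop (adj w) f (ev1 origin) = 0) :: real)"
      unfolding z by (rule dep_integrable[OF finite_ein[OF finite_hood]], rule dep_comp[OF dep_pop])
    have "of_bool (pop (adj w) f (ev1 origin) = 0) \<le> fv (pop (adj w) (g ^ (2 * m)) (ev1 origin)) origin" for w
    proof (cases "pop (adj w) f (ev1 origin) = 0")
      case True
      have "pop (adj w) g (ev1 origin) = ev1 origin + (- 1 / C) *\<^sub>R pop (adj w) (f * f) (ev1 origin)"
      proof -
        have "g = 1 + smult (- 1 / C) (f * f)" by (simp add: g_def)
        then show ?thesis by (simp only: pop_add pop_smult pop_1)
      qed
      also have "\<dots> = ev1 origin" using True by (simp add: pop_mult[OF linear_adj] linear_0[OF linear_pop[OF linear_adj]])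
      finally have g1: "pop (adj w) g (ev1 origin) = ev1 origin" .
      have "pop (adj w) (g ^ k) (ev1 origin) = ev1 origin" for k
        by (induction k) (simp_all add: pop_mult[OF linear_adj] g1 mult.commute[of g])
      then show ?thesis using True by simp
    next
      case False
      have "fv (pop (adj w) (g ^ (2 * m)) (ev1 origin)) origin = inner (ev1 origin) (pop (adj w) (g ^ m * 1 * g ^ m) (ev1 origin))"
        by (simp add: mult_2 power_add)
      also have "\<dots> \<ge> 0" unfolding pop_adj_square by simp
      finally show ?thesis using False by simp
    qed
    then show ?thesis unfolding EL_def by (intro integral_mono[OF int integrable_pop]) auto
  qed
  ultimately have "PP (\<lambda>_. p) (\<lambda>w. pop (adj w) f (ev1 origin) = 0) \<le> measure \<mu> {x. poly g x = 1}"
    by (intro LIMSEQ_le_const) auto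
  also have "{x. poly g x = 1} = {x. poly f x = 0}" using C0 by (auto simp: pg)
  finally show ?thesis .
qed

theorem purely_atomic_if_finite_clusters:
  assumes esm: "expected_spectral_measure p \<mu>" and fin: "AE w in perc p. finite (cluster w)"
  shows "purely_atomic \<mu>"
proof -
  interpret prob_space \<mu> using esm by (simp add: expected_spectral_measure_def)
  interpret P: prob_space "percf (\<lambda>_ :: edge. p)" by (rule prob_space_percf)
  have sb: "sets \<mu> = sets borel" using esm by (simp add: expected_spectral_measure_def)
  obtain ann_p :: "nat \<Rightarrow> real poly" where nz: "\<And>n. ann_p n \<noteq> 0"
    and annih: "\<And>w. finite (cluster w) \<Longrightarrow> \<exists>n. pop (adj w) (ann_p n) (ev1 origin) = 0"
    using annihilating_sequence by blast
  \<comment> \<open>With products, the events that f N annihilates e_o increase with N and exhaust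
    all finite clusters, so their probabilities tend to 1.\<close>
  define f where "f N = (\<Prod>n\<le>N. ann_p n)" for N
  define S where "S = (\<Union>N. {x. poly (f N) x = 0})"
  have "f N \<noteq> 0" for N using nz by (simp add: f_def)
  then have cS: "countable S" unfolding S_def using poly_roots_finite by (intro countable_UN) (auto intro: countable_finite)
  have "countable T \<Longrightarrow> T \<in> sets borel" for T :: "real set" by (rule sets.countable) auto
  then have meas: "T \<in> sets \<mu>" if "countable T" for T using that sb by simp
  define Z where "Z N w \<longleftrightarrow> pop (adj w) (f N) (ev1 origin) = 0" for N w
  have ZS: "PP (\<lambda>_. p) (Z N) \<le> measure \<mu> S" for N
  proof -
    have "PP (\<lambda>_. p) (Z N) \<le> measure \<mu> {x. poly (f N) x = 0}" unfolding Z_def by (rule esm_roots_ge[OF esm])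
    also have "\<dots> \<le> measure \<mu> S" by (rule finite_measure_mono[OF _ meas[OF cS]]) (auto simp: S_def)
    finally show ?thesis .
  qed
  have Zn: "Z N w" if "pop (adj w) (ann_p n) (ev1 origin) = 0" "n \<le> N" for N n w
  proof -
    have "f N = (\<Prod>k\<in>{..N} - {n}. ann_p k) * ann_p n"
      unfolding f_def using prod.remove[of "{..N}" n ann_p] that(2) by (simp add: mult.commute)
    then show ?thesis by (simp add: Z_def pop_mult[OF linear_adj] that(1) linear_0[OF linear_pop[OF linear_adj]])
  qed
  have "(\<lambda>N. PP (\<lambda>_. p) (Z N)) \<longlonglongrightarrow> (\<integral>w. 1 \<partial>percf (\<lambda>_ :: edge. p))"
  proof (rule integral_dominated_convergence[of _ _ _ "\<lambda>_. 1"])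
    show "(\<lambda>w. of_bool (Z N w) :: real) \<in> borel_measurable (percf (\<lambda>_. p))" for N
    proof -
      have z: "Z N w \<longleftrightarrow> fv (pop (adj w) (f N * f N) (ev1 origin)) origin = 0" for w
      proof -
        have "fv (pop (adj w) (f N * f N) (ev1 origin)) origin = inner (ev1 origin) (pop (adj w) (f N * 1 * f N) (ev1 origin))" by simp
        also have "\<dots> = inner (pop (adj w) (f N) (ev1 origin)) (pop (adj w) (f N) (ev1 origin))" unfolding pop_adj_square by simp
        finally show ?thesis by (simp add: Z_def)
      qed
      have "integrable (percf (\<lambda>_. p)) (\<lambda>w. of_bool (Z N w) :: real)"
        unfolding z by (rule dep_integrable[OF finite_ein[OF finite_hood]], rule dep_comp[OF dep_pop])
      then show ?thesis by blast
    qed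
    show "AE w in percf (\<lambda>_. p). (\<lambda>N. of_bool (Z N w) :: real) \<longlonglongrightarrow> 1"
      using fin unfolding perc_eq_percf
    proof eventually_elim
      case (elim w)
      obtain n where n: "pop (adj w) (ann_p n) (ev1 origin) = 0" using annih[OF elim] by blast
      have "eventually (\<lambda>N. of_bool (Z N w) = (1 :: real)) sequentially"
        by (rule eventually_sequentiallyI[of n]) (use Zn[OF n] in simp)
      then show ?case by (rule tendsto_eventually)
    qed
  qed auto
  then have "(\<lambda>N. PP (\<lambda>_. p) (Z N)) \<longlonglongrightarrow> 1" by (simp add: P.prob_space)
  then have "1 \<le> measure \<mu> S" using ZS by (intro LIMSEQ_le_const2) auto
  then have "measure \<mu> S = 1" using prob_le_1[of S] by simp
  then have "emeasure \<mu> S = emeasure \<mu> (space \<mu>)" by (simp add: emeasure_eq_measure prob_space)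
  then show ?thesis unfolding purely_atomic_def using cS meas[OF cS] by blast
qed

section \<open>Determinants over a finite index set\<close>

text \<open>The Leibniz formula over a finite subset of the index type, since the box grows while
  the type of vertices stays fixed.\<close>

definition DET :: "'a set \<Rightarrow> ('a \<Rightarrow> 'a \<Rightarrow> 'b::comm_ring_1) \<Rightarrow> 'b" where
  "DET V M = (\<Sum>\<sigma>\<in>{\<sigma>. \<sigma> permutes V}. of_int (sign \<sigma>) * (\<Prod>u\<in>V. M u (\<sigma> u)))"

lemma DET_cong: "(\<And>u v. u \<in> V \<Longrightarrow> v \<in> V \<Longrightarrow> M u v = M' u v) \<Longrightarrow> DET V M = DET V M'"
  unfolding DET_def by (intro sum.cong refl arg_cong2[where f="(*)"] prod.cong) (simp add: permutes_in_image)

lemma DET_scale_columns: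
  assumes "finite V"
  shows "DET V (\<lambda>u v. d v * M u v) = (\<Prod>v\<in>V. d v) * DET V M"
  unfolding DET_def sum_distrib_left
proof (rule sum.cong[OF refl])
  fix \<sigma> assume "\<sigma> \<in> {\<sigma>. \<sigma> permutes V}"
  then have "\<sigma> permutes V" by simp
  then have "(\<Prod>u\<in>V. d (\<sigma> u)) = (\<Prod>v\<in>V. d v)"
    by (intro prod.reindex_bij_betw permutes_imp_bij)
  then show "of_int (sign \<sigma>) * (\<Prod>u\<in>V. d (\<sigma> u) * M u (\<sigma> u)) = (\<Prod>v\<in>V. d v) * (of_int (sign \<sigma>) * (\<Prod>u\<in>V. M u (\<sigma> u)))"
    by (simp add: prod.distrib ac_simps)
qed

lemma DET_row_map:
  fixes B :: "'a \<Rightarrow> 'a \<Rightarrow> 'b::{idom, ring_char_0}"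
  assumes V: "finite V" and f: "f ` V \<subseteq> V" and noninj: "\<not> inj_on f V"
  shows "DET V (\<lambda>u. B (f u)) = 0"
proof -
  obtain x y where xy: "x \<in> V" "y \<in> V" "x \<noteq> y" "f x = f y" using noninj by (auto simp: inj_on_def)
  let ?t = "Transposition.transpose x y"
  have t: "?t permutes V" by (rule permutes_swap_id[OF xy(1,2)])
  have "DET V (\<lambda>u. B (f u)) = (\<Sum>\<sigma>\<in>{\<sigma>. \<sigma> permutes V}. of_int (sign (\<sigma> \<circ> ?t)) * (\<Prod>u\<in>V. B (f u) ((\<sigma> \<circ> ?t) u)))"
    unfolding DET_def by (rule sum_permutations_compose_right[OF t])
  also have "\<dots> = (\<Sum>\<sigma>\<in>{\<sigma>. \<sigma> permutes V}. - (of_int (sign \<sigma>) * (\<Prod>u\<in>V. B (f u) (\<sigma> u))))"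
  proof (rule sum.cong[OF refl])
    fix \<sigma> assume "\<sigma> \<in> {\<sigma>. \<sigma> permutes V}"
    then have s: "permutation \<sigma>" using V permutes_imp_permutation by auto
    have ft: "f (?t u) = f u" for u by (simp add: xy(4) Transposition.transpose_def)
    have "(\<Prod>u\<in>V. B (f u) (\<sigma> (?t u))) = (\<Prod>u\<in>V. B (f (?t u)) (\<sigma> (?t u)))" by (simp add: ft)
    also have "\<dots> = (\<Prod>u\<in>V. B (f u) (\<sigma> u))"
      by (rule prod.reindex_bij_betw[OF permutes_imp_bij[OF t]])
    finally show "of_int (sign (\<sigma> \<circ> ?t)) * (\<Prod>u\<in>V. B (f u) ((\<sigma> \<circ> ?t) u)) = - (of_int (sign \<sigma>) * (\<Prod>u\<in>V. B (f u) (\<sigma> u)))"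
      using xy(3) by (simp add: sign_compose[OF s permutation_swap_id] sign_swap_id)
  qed
  also have "\<dots> = - DET V (\<lambda>u. B (f u))" by (simp add: DET_def sum_negf)
  finally have "DET V (\<lambda>u. B (f u)) + DET V (\<lambda>u. B (f u)) = 0" by (simp add: eq_neg_iff_add_eq_0)
  then show ?thesis by (simp only: mult_2[symmetric] mult_eq_0_iff) simp
qed

lemma DET_permute_rows:
  assumes V: "finite V" and t: "\<tau> permutes V"
  shows "DET V (\<lambda>u. B (\<tau> u)) = of_int (sign \<tau>) * DET V B"
proof -
  have "DET V (\<lambda>u. B (\<tau> u)) = (\<Sum>\<sigma>\<in>{\<sigma>. \<sigma> permutes V}. of_int (sign (\<sigma> \<circ> \<tau>)) * (\<Prod>u\<in>V. B (\<tau> u) ((\<sigma> \<circ> \<tau>) u)))"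
    unfolding DET_def by (rule sum_permutations_compose_right[OF t])
  also have "\<dots> = of_int (sign \<tau>) * DET V B"
    unfolding DET_def sum_distrib_left
  proof (rule sum.cong[OF refl])
    fix \<sigma> assume "\<sigma> \<in> {\<sigma>. \<sigma> permutes V}"
    then have s: "permutation \<sigma>" using V permutes_imp_permutation by auto
    have "(\<Prod>u\<in>V. B (\<tau> u) (\<sigma> (\<tau> u))) = (\<Prod>u\<in>V. B u (\<sigma> u))"
      by (rule prod.reindex_bij_betw[OF permutes_imp_bij[OF t]])
    then show "of_int (sign (\<sigma> \<circ> \<tau>)) * (\<Prod>u\<in>V. B (\<tau> u) ((\<sigma> \<circ> \<tau>) u)) = of_int (sign \<tau>) * (of_int (sign \<sigma>) * (\<Prod>u\<in>V. B u (\<sigma> u)))"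
      by (simp add: sign_compose[OF s permutes_imp_permutation[OF V t]])
  qed
  finally show ?thesis .
qed

text \<open>Expanding the product chooses a summation index f u for every row; a choice that is not
  injective repeats a row of \<open>B\<close> and vanishes, and the others are permutations.\<close>

lemma DET_mult:
  fixes A B :: "'a \<Rightarrow> 'a \<Rightarrow> 'b::{idom, ring_char_0}"
  assumes V: "finite V"
  shows "DET V (\<lambda>u v. \<Sum>k\<in>V. A u k * B k v) = DET V A * DET V B"
proof -
  let ?P = "{\<sigma>. \<sigma> permutes V}" and ?F = "Pi\<^sub>E V (\<lambda>_. V)"
  have finP: "finite ?P" by (rule finite_permutations[OF V])
  have finF: "finite ?F" using V by (intro finite_PiE) auto
  have "DET V (\<lambda>u v. \<Sum>k\<in>V. A u k * B k v)
      = (\<Sum>\<sigma>\<in>?P. \<Sum>f\<in>?F. of_int (sign \<sigma>) * (\<Prod>u\<in>V. A u (f u) * B (f u) (\<sigma> u)))"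
    unfolding DET_def by (intro sum.cong refl) (subst prod_sum_PiE, use V in \<open>auto simp: sum_distrib_left\<close>)
  also have "\<dots> = (\<Sum>f\<in>?F. (\<Prod>u\<in>V. A u (f u)) * DET V (\<lambda>u. B (f u)))"
    unfolding DET_def sum_distrib_left by (subst sum.swap) (simp add: prod.distrib ac_simps)
  also have "\<dots> = (\<Sum>f\<in>{f \<in> ?F. inj_on f V}. (\<Prod>u\<in>V. A u (f u)) * DET V (\<lambda>u. B (f u)))"
  proof (rule sum.mono_neutral_right[OF finF])
    show "\<forall>f\<in>?F - {f \<in> ?F. inj_on f V}. (\<Prod>u\<in>V. A u (f u)) * DET V (\<lambda>u. B (f u)) = 0"
    proof
      fix f assume f: "f \<in> ?F - {f \<in> ?F. inj_on f V}"
      then have "f ` V \<subseteq> V" by auto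
      then have "DET V (\<lambda>u. B (f u)) = 0" by (rule DET_row_map[OF V]) (use f in auto)
      then show "(\<Prod>u\<in>V. A u (f u)) * DET V (\<lambda>u. B (f u)) = 0" by simp
    qed
  qed auto
  also have "\<dots> = (\<Sum>\<tau>\<in>?P. (\<Prod>u\<in>V. A u (\<tau> u)) * DET V (\<lambda>u. B (\<tau> u)))"
  proof (rule sum.reindex_bij_witness[of _ "\<lambda>\<tau>. restrict \<tau> V" "\<lambda>f u. if u \<in> V then f u else u"])
    fix f assume f: "f \<in> {f \<in> ?F. inj_on f V}"
    then show "restrict (\<lambda>u. if u \<in> V then f u else u) V = f" by (auto simp: fun_eq_iff PiE_def extensional_def)
    have "f ` V \<subseteq> V" "inj_on f V" using f by auto
    then have "bij_betw f V V" using V by (simp add: bij_betw_def endo_inj_surj)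
    then have "bij_betw (\<lambda>u. if u \<in> V then f u else u) V V" by (rule bij_betw_cong[THEN iffD1, rotated]) simp
    then show "(\<lambda>u. if u \<in> V then f u else u) \<in> ?P" by (auto intro: bij_imp_permutes)
    have "DET V (\<lambda>u. B (if u \<in> V then f u else u)) = DET V (\<lambda>u. B (f u))" by (rule DET_cong) simp
    then show "(\<Prod>u\<in>V. A u (if u \<in> V then f u else u)) * DET V (\<lambda>u. B (if u \<in> V then f u else u)) = (\<Prod>u\<in>V. A u (f u)) * DET V (\<lambda>u. B (f u))"
      by (simp cong: prod.cong)
  next
    fix \<tau> assume t: "\<tau> \<in> ?P"
    then show "(\<lambda>u. if u \<in> V then restrict \<tau> V u else u) = \<tau>" by (auto simp: fun_eq_iff permutes_def)
    show "restrict \<tau> V \<in> {f \<in> ?F. inj_on f V}" using t by (auto simp: permutes_in_image permutes_inj_on)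
  qed
  also have "\<dots> = (\<Sum>\<tau>\<in>?P. (\<Prod>u\<in>V. A u (\<tau> u)) * (of_int (sign \<tau>) * DET V B))"
    by (intro sum.cong refl) (simp add: DET_permute_rows[OF V])
  also have "\<dots> = DET V A * DET V B" unfolding DET_def[of V A] sum_distrib_right by (simp add: ac_simps)
  finally show ?thesis .
qed

lemma DET_unit:
  assumes V: "finite V"
  shows "DET V (\<lambda>u v. if u = v then 1 else 0 :: 'b::comm_ring_1) = 1"
proof -
  have "DET V (\<lambda>u v. if u = v then 1 else 0 :: 'b) = (\<Sum>\<sigma>\<in>{\<sigma>. \<sigma> permutes V}. if \<sigma> = id then 1 else 0)"
    unfolding DET_def
  proof (rule sum.cong[OF refl])
    fix \<sigma> assume "\<sigma> \<in> {\<sigma>. \<sigma> permutes V}"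
    then have s: "\<sigma> permutes V" by simp
    show "of_int (sign \<sigma>) * (\<Prod>u\<in>V. if u = \<sigma> u then 1 else 0 :: 'b) = (if \<sigma> = id then 1 else 0)"
    proof (cases "\<sigma> = id")
      case False
      then obtain u where "\<sigma> u \<noteq> u" by (auto simp: fun_eq_iff)
      then have "u \<in> V" "u \<noteq> \<sigma> u" using s by (auto simp: permutes_def)
      then have "(\<Prod>u\<in>V. if u = \<sigma> u then 1 else 0 :: 'b) = 0" using V by (intro prod_zero) auto
      then show ?thesis using False by simp
    qed simp
  qed
  also have "\<dots> = 1" using finite_permutations[OF V] by (simp add: permutes_id)
  finally show ?thesis .
qed

section \<open>The sign of a permutation with marked cycles\<close>

text \<open>Every nontrivial cycle contains exactly one element of \<open>J\<close>. A cycle of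
  length n has sign (-1)^(n - 1), and n - 1 is the number of its elements outside
  \<open>J\<close>.\<close>

lemma sign_marked_cycles:
  assumes "\<sigma> permutes V" "finite V" "J \<subseteq> V"
    and one: "\<And>j j' n. j \<in> J \<Longrightarrow> j' \<in> J \<Longrightarrow> (\<sigma> ^^ n) j = j' \<Longrightarrow> j = j'"
    and hit: "\<And>x. \<sigma> x \<noteq> x \<Longrightarrow> \<exists>n. (\<sigma> ^^ n) x \<in> J"
  shows "sign \<sigma> = (-1) ^ card ({x \<in> V. \<sigma> x \<noteq> x} - J)"
  using assms
proof (induction "card ({x \<in> V. \<sigma> x \<noteq> x} - J)" arbitrary: \<sigma> rule: less_induct)
  case less
  note perm = less.prems(1) and V = less.prems(2) and one = less.prems(4) and hit = less.prems(5)
  have inj: "\<sigma> a = \<sigma> b \<longleftrightarrow> a = b" for a b using permutes_inj[OF perm] by (auto simp: inj_def)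
  show ?case
  proof (cases "{x \<in> V. \<sigma> x \<noteq> x} - J = {}")
    case True
    have nf: "x \<in> J" if "\<sigma> x \<noteq> x" for x
    proof -
      have "x \<in> V" using that perm by (auto simp: permutes_def)
      then show ?thesis using True that by blast
    qed
    have "\<sigma> x = x" for x
    proof (rule ccontr)
      assume x: "\<sigma> x \<noteq> x"
      then have "\<sigma> (\<sigma> x) \<noteq> \<sigma> x" by (simp add: inj)
      then have "x = \<sigma> x" using one[OF nf[OF x] nf, of "\<sigma> x" 1] by simp
      then show False using x by simp
    qed
    then have "\<sigma> = id" by (simp add: fun_eq_iff)
    then show ?thesis by simp
  next
    case False
    then obtain x where x: "x \<in> V" "\<sigma> x \<noteq> x" "x \<notin> J" by blast
    define y where "y = \<sigma> x"
    have yV: "y \<in> V" using x(1) perm by (simp add: y_def permutes_in_image)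
    have yx: "y \<noteq> x" using x(2) by (simp add: y_def)
    \<comment> \<open>Cuts x out of its cycle and makes it a fixed point: the predecessor of x now
      maps to y. The marked element stays because x is not in \<open>J\<close>.\<close>
    define \<tau> where "\<tau> = Transposition.transpose x y \<circ> \<sigma>"
    have tperm: "\<tau> permutes V" unfolding \<tau>_def by (rule permutes_compose[OF perm permutes_swap_id[OF x(1) yV]])
    have t: "\<tau> u = (if u = x then x else if \<sigma> u = x then y else \<sigma> u)" for u
      unfolding \<tau>_def using inj[of u x] by (auto simp: Transposition.transpose_def y_def)
    have pw: "(\<sigma> ^^ Suc n) u = (\<sigma> ^^ n) (\<sigma> u)" for n u by (simp add: funpow_swap1)
    have pwt: "(\<tau> ^^ Suc n) u = (\<tau> ^^ n) (\<tau> u)" for n u by (simp add: funpow_swap1)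
    have orb: "\<exists>m. (\<tau> ^^ n) u = (\<sigma> ^^ m) u" for n u
    proof (induction n)
      case 0
      show ?case by (rule exI[of _ 0]) simp
    next
      case (Suc n)
      then obtain m where m: "(\<tau> ^^ n) u = (\<sigma> ^^ m) u" by blast
      let ?z = "(\<sigma> ^^ m) u"
      have "\<tau> ?z = ?z \<or> \<tau> ?z = \<sigma> (\<sigma> ?z) \<or> \<tau> ?z = \<sigma> ?z" by (auto simp: t y_def)
      then show ?case
      proof (elim disjE)
        assume "\<tau> ?z = ?z" then show ?thesis by (intro exI[of _ m]) (simp add: m)
      next
        assume "\<tau> ?z = \<sigma> (\<sigma> ?z)" then show ?thesis by (intro exI[of _ "Suc (Suc m)"]) (simp add: m)
      next
        assume "\<tau> ?z = \<sigma> ?z" then show ?thesis by (intro exI[of _ "Suc m"]) (simp add: m)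
      qed
    qed
    have hitt: "u \<noteq> x \<Longrightarrow> (\<sigma> ^^ n) u \<in> J \<Longrightarrow> \<exists>m. (\<tau> ^^ m) u \<in> J" for n u
    proof (induction n arbitrary: u rule: less_induct)
      case (less n)
      show ?case
      proof (cases n)
        case 0
        then show ?thesis using less.prems by (intro exI[of _ 0]) simp
      next
        case (Suc k)
        have k: "(\<sigma> ^^ k) (\<sigma> u) \<in> J" using less.prems(2) by (simp only: Suc pw)
        have "\<exists>m. (\<tau> ^^ m) (\<tau> u) \<in> J"
        proof (cases "\<sigma> u = x")
          case False
          then have "\<tau> u = \<sigma> u" using less.prems(1) by (simp add: t)
          then show ?thesis using less.IH[of k "\<sigma> u"] k Suc False by simp
        next
          case True
          have tu: "\<tau> u = y" using True less.prems(1) by (simp add: t)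
          obtain l where l: "k = Suc l" using k x(3) True by (cases k) auto
          have "(\<sigma> ^^ l) y \<in> J" using k by (simp only: l pw True y_def)
          then show ?thesis using less.IH[of l y] Suc l yx tu by simp
        qed
        then obtain m where "(\<tau> ^^ Suc m) u \<in> J" unfolding pwt by blast
        then show ?thesis by blast
      qed
    qed
    have set: "{u \<in> V. \<tau> u \<noteq> u} - J = ({u \<in> V. \<sigma> u \<noteq> u} - J) - {x}"
    proof -
      have "\<tau> u \<noteq> u \<longleftrightarrow> \<sigma> u \<noteq> u \<and> u \<noteq> x" if uJ: "u \<notin> J" for u
      proof (cases "u = x \<or> \<sigma> u \<noteq> x")
        case True
        then show ?thesis using t[of u] by auto
      next
        case False
        then have u: "u \<noteq> x" "\<sigma> u = x" by auto
        have "y \<noteq> u"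
        proof
          assume yu: "y = u"
          have "(\<sigma> ^^ n) u = u \<or> (\<sigma> ^^ n) u = x" for n
            by (induction n) (use u yu in \<open>auto simp: y_def\<close>)
          moreover obtain n where "(\<sigma> ^^ n) u \<in> J" using hit[of u] u by auto
          ultimately show False using uJ x(3) by metis
        qed
        then show ?thesis using u t[of u] by auto
      qed
      then show ?thesis by blast
    qed
    let ?N = "{u \<in> V. \<sigma> u \<noteq> u} - J"
    have xN: "x \<in> ?N" using x by simp
    have fN: "finite ?N" using V by simp
    have c: "card ?N = Suc (card (?N - {x}))" by (rule card.remove[OF fN xN])
    have "sign \<tau> = (-1) ^ card ({u \<in> V. \<tau> u \<noteq> u} - J)"
    proof (rule less.hyps[OF _ tperm V less.prems(3)])
      show "card ({u \<in> V. \<tau> u \<noteq> u} - J) < card ?N" unfolding set c by simp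
      show "j = j'" if jj: "j \<in> J" "j' \<in> J" "(\<tau> ^^ n) j = j'" for j j' n
      proof -
        obtain m where "(\<tau> ^^ n) j = (\<sigma> ^^ m) j" using orb by blast
        then show ?thesis using one[OF jj(1,2)] jj(3) by metis
      qed
      show "\<exists>n. (\<tau> ^^ n) u \<in> J" if u: "\<tau> u \<noteq> u" for u
      proof -
        have ux: "u \<noteq> x" using u t[of x] by auto
        show ?thesis
        proof (cases "\<sigma> u = u")
          case True
          then show ?thesis using u t[of u] ux by auto
        next
          case False
          then obtain n where "(\<sigma> ^^ n) u \<in> J" using hit by blast
          then show ?thesis by (rule hitt[OF ux])
        qed
      qed
    qed
    moreover have "sign \<tau> = - sign \<sigma>"
      unfolding \<tau>_def using yx sign_compose[OF permutation_swap_id permutes_imp_permutation[OF V perm], of x y]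
      by (simp add: sign_swap_id)
    ultimately show ?thesis unfolding set c by simp
  qed
qed

section \<open>Linked permutations\<close>

text \<open>For the least moved s, the value g s must lie above s. As g is a bijection of
  \<open>J\<close>, some t maps to s; t below s is fixed, t = s is excluded, and t above s
  contradicts monotonicity.\<close>

lemma strict_mono_endo_id:
  fixes key :: "'a \<Rightarrow> int"
  assumes J: "finite J" and g: "\<And>j. j \<in> J \<Longrightarrow> g j \<in> J" and inj: "inj_on key J"
    and mono: "\<And>j j'. j \<in> J \<Longrightarrow> j' \<in> J \<Longrightarrow> key j < key j' \<Longrightarrow> key (g j) < key (g j')"
    and j: "j \<in> J"
  shows "g j = j"
proof (rule ccontr)
  assume "g j \<noteq> j"
  define S where "S = {j \<in> J. g j \<noteq> j}"
  have S: "finite S" "S \<noteq> {}" using J j \<open>g j \<noteq> j\<close> by (auto simp: S_def)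
  obtain s where s: "s \<in> S" "\<And>t. t \<in> S \<Longrightarrow> key s \<le> key t"
    using arg_min_if_finite[OF S, of key] by (metis not_le)
  have sJ: "s \<in> J" "g s \<noteq> s" using s(1) by (auto simp: S_def)
  have small: "g t = t" if "t \<in> J" "key t < key s" for t using s(2)[of t] that by (force simp: S_def)
  have "inj_on g J"
  proof (rule inj_onI)
    fix a b assume ab: "a \<in> J" "b \<in> J" "g a = g b"
    then have "key a = key b" using mono[of a b] mono[of b a] by (metis less_irrefl not_less_iff_gr_or_eq)
    then show "a = b" using inj ab by (auto simp: inj_on_def)
  qed
  then have "g ` J = J" using J g by (intro endo_inj_surj) auto
  then obtain t where t: "t \<in> J" "g t = s" using sJ(1) by (metis imageE)
  have neq: "key a = key b \<longleftrightarrow> a = b" if "a \<in> J" "b \<in> J" for a b using inj that by (auto simp: inj_on_def)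
  have gs: "key s < key (g s)"
  proof (rule ccontr)
    assume "\<not> ?thesis"
    then have "key (g s) < key s" using neq[OF g[OF sJ(1)] sJ(1)] sJ(2) by linarith
    then have "g (g s) = g s" "key (g (g s)) < key (g s)" using small mono g sJ(1) by blast+
    then show False by simp
  qed
  consider "key t < key s" | "t = s" | "key s < key t" using neq[OF t(1) sJ(1)] by linarith
  then show False
  proof cases
    case 1
    then show False using small[OF t(1)] t(2) by simp
  next
    case 2
    then show False using t(2) sJ(2) by simp
  next
    case 3
    then show False using mono[OF sJ(1) t(1)] t(2) gs by simp
  qed
qed

text \<open>This is where planarity enters. The chains of \<sigma> from the points \<pi> j to their
  exits into \<open>J\<close> are disjoint crossings, so their ends are ordered like their starts;
  \<pi> preserves the order too, and an order preserving map of \<open>J\<close> to itself is the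
  identity. Hence the chain from \<pi> j closes up at j: one cycle for each crossing, visiting all K
  + 1 columns.\<close>

lemma linked_perm_cycles:
  assumes K: "1 \<le> K" and om: "order_match K J \<pi>" and lp: "linked_perm K w J \<pi> \<sigma>"
  defines "Z \<equiv> \<lambda>j. chain \<sigma> (sqK K - J) (\<pi> j)"
  shows "\<And>j. j \<in> J \<Longrightarrow> chain_end \<sigma> (sqK K - J) (\<pi> j) = j"
    and "\<And>j u. j \<in> J \<Longrightarrow> u \<in> Z j \<Longrightarrow> \<sigma> u \<in> Z j"
    and "\<And>j u. j \<in> J \<Longrightarrow> u \<in> Z j \<Longrightarrow> \<exists>n. (\<sigma> ^^ n) u = j"
    and "\<And>j j' u. j \<in> J \<Longrightarrow> j' \<in> J \<Longrightarrow> u \<in> Z j \<Longrightarrow> u \<in> Z j' \<Longrightarrow> j = j'"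
    and "\<And>j. j \<in> J \<Longrightarrow> nat (K + 1) \<le> card (Z j)"
    and "\<And>j. j \<in> J \<Longrightarrow> Z j \<subseteq> sqK K"
    and "\<And>j. j \<in> J \<Longrightarrow> j \<in> Z j"
    and "\<And>j u. j \<in> J \<Longrightarrow> u \<in> Z j \<Longrightarrow> u \<in> J \<Longrightarrow> u = j"
    and "\<And>j u. j \<in> J \<Longrightarrow> u \<in> Z j \<Longrightarrow> \<sigma> u \<noteq> u"
proof -
  let ?V = "sqK K" and ?X = "sqK K - J"
  have perm: "\<sigma> permutes ?V" and sJ: "\<And>j. j \<in> J \<Longrightarrow> \<sigma> j = \<pi> j"
    and sX: "\<And>u. u \<in> ?X \<Longrightarrow> \<sigma> u = u \<or> open_adj w u (\<sigma> u)" using lp by (auto simp: linked_perm_def)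
  have JV: "\<And>j. j \<in> J \<Longrightarrow> j \<in> ?V \<and> fst j = K" and piV: "\<And>j. j \<in> J \<Longrightarrow> \<pi> j \<in> ?V \<and> fst (\<pi> j) = 0"
    and mono: "\<And>j j'. j \<in> J \<Longrightarrow> j' \<in> J \<Longrightarrow> snd j < snd j' \<Longrightarrow> snd (\<pi> j) < snd (\<pi> j')"
    using om by (auto simp: order_match_def)
  have fX: "finite ?X" by simp
  have inj: "inj \<sigma>" by (rule permutes_inj[OF perm])
  then have injX: "inj_on \<sigma> ?X" by (rule inj_on_subset) simp
  have nbrX: "\<sigma> u = u \<or> nbr u (\<sigma> u)" if "u \<in> ?X" for u using sX[OF that] open_adj_nbr by blast
  have inV: "\<sigma> u \<in> ?V \<longleftrightarrow> u \<in> ?V" for u by (rule permutes_in_image[OF perm])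
  have start: "\<pi> j \<notin> \<sigma> ` ?X" if j: "j \<in> J" for j
  proof
    assume "\<pi> j \<in> \<sigma> ` ?X"
    then obtain u where "u \<in> ?X" "\<sigma> u = \<sigma> j" using sJ[OF j] by auto
    then have "u = j" "u \<in> ?X" using injD[OF inj] by blast+
    then show False using j by simp
  qed
  let ?e = "\<lambda>j. chain_end \<sigma> ?X (\<pi> j)"
  note cp = chain_props[OF fX injX start]
  have powV: "(\<sigma> ^^ n) u \<in> ?V" if "u \<in> ?V" for n u by (induction n) (use that inV in auto)
  have sub: "Z j \<subseteq> ?V" if "j \<in> J" for j unfolding Z_def chain_def using powV[of "\<pi> j"] piV[OF that] by blast
  then show "\<And>j. j \<in> J \<Longrightarrow> Z j \<subseteq> sqK K" .
  have eJ: "?e j \<in> J" if j: "j \<in> J" for j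
    using chain_exits(1)[OF fX injX start[OF j]] sub[OF j] cp(2)[OF j] by (auto simp: Z_def)
  have fin: "finite J" using JV finite_subset[OF _ finite_sqK[of K]] by blast
  have ends: "?e j = j" if "j \<in> J" for j
  proof (rule strict_mono_endo_id[where key=snd and g="?e", OF fin eJ _ _ that])
    show "inj_on snd J" using JV by (auto simp: inj_on_def prod_eq_iff)
    show "snd (?e j) < snd (?e j')" if j: "j \<in> J" "j' \<in> J" "snd j < snd j'" for j j'
      by (rule chains_ordered[OF fX injX nbrX _ _ start[OF j(1)] _ _ _ start[OF j(2)]])
         (use piV[OF j(1)] piV[OF j(2)] JV[OF eJ[OF j(1)]] JV[OF eJ[OF j(2)]] mono[OF j] inV in auto)
  qed
  then show "\<And>j. j \<in> J \<Longrightarrow> ?e j = j" .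
  show jZ: "\<And>j. j \<in> J \<Longrightarrow> j \<in> Z j" using cp(2) ends by (simp add: Z_def)
  show ZJ: "u = j" if "j \<in> J" "u \<in> Z j" "u \<in> J" for j u
    using cp(4)[OF that(1)] ends[OF that(1)] that(2,3) by (auto simp: Z_def)
  show closed: "\<sigma> u \<in> Z j" if j: "j \<in> J" "u \<in> Z j" for j u
  proof (cases "u \<in> J")
    case True
    then have "\<sigma> u = \<pi> j" using ZJ[OF j] sJ[OF j(1)] by simp
    then show ?thesis using cp(1)[OF j(1)] by (simp add: Z_def)
  next
    case False
    then have "u \<in> ?X" using sub[OF j(1)] j(2) by auto
    then show ?thesis using cp(5)[OF j(1)] j(2) by (simp add: Z_def)
  qed
  show reach: "\<exists>n. (\<sigma> ^^ n) u = j" if j: "j \<in> J" "u \<in> Z j" for j u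
  proof -
    obtain m where m: "m \<le> exit_time \<sigma> ?X (\<pi> j)" "u = (\<sigma> ^^ m) (\<pi> j)" using j(2) by (auto simp: Z_def chain_def)
    have "(\<sigma> ^^ (exit_time \<sigma> ?X (\<pi> j) - m)) u = (\<sigma> ^^ (exit_time \<sigma> ?X (\<pi> j) - m + m)) (\<pi> j)"
      by (simp only: m(2) funpow_add comp_apply)
    also have "\<dots> = ?e j" using m(1) by (simp add: chain_end_def)
    finally show ?thesis using ends[OF j(1)] by auto
  qed
  show "j = j'" if j: "j \<in> J" "j' \<in> J" and u: "u \<in> Z j" "u \<in> Z j'" for j j' u
  proof -
    have "\<pi> j = \<pi> j'" using chain_unique[OF fX injX start[OF j(1)] start[OF j(2)]] u by (simp add: Z_def)
    then have "\<sigma> j = \<sigma> j'" using sJ j by simp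
    then show ?thesis by (rule injD[OF inj])
  qed
  show "\<sigma> u \<noteq> u" if j: "j \<in> J" "u \<in> Z j" for j u
  proof
    assume fixed: "\<sigma> u = u"
    obtain n where n: "(\<sigma> ^^ n) u = j" using reach[OF j] by blast
    have "(\<sigma> ^^ n) u = u" by (induction n) (simp_all add: fixed)
    then have "u = j" using n by simp
    then have "j = \<pi> j" using fixed sJ[OF j(1)] by simp
    then show False using piV[OF j(1)] JV[OF j(1)] K by auto
  qed
  show "nat (K + 1) \<le> card (Z j)" if j: "j \<in> J" for j
  proof -
    have lc: "lconn nbr (Z j) (\<pi> j) j"
      using chain_lconn[where r=nbr, OF fX injX start[OF j] nbrX] ends[OF j] by (simp add: Z_def)
    have "{0..K} \<subseteq> fst ` Z j"
    proof
      fix c assume c: "c \<in> {0..K}"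
      have "\<exists>u'. fst u' = c \<and> lconn nbr {x \<in> Z j. c \<le> fst x} u' j"
        by (rule lconn_truncate_start[OF lc]) (use c piV[OF j] JV[OF j] in \<open>auto simp: nbr_def\<close>)
      then obtain u' where u': "fst u' = c" "lconn nbr {x \<in> Z j. c \<le> fst x} u' j" by blast
      then have "u' \<in> Z j" using lconn_in[OF u'(2)] by simp
      then show "c \<in> fst ` Z j" using u'(1) by blast
    qed
    then have "card {0..K} \<le> card (fst ` Z j)" by (intro card_mono finite_imageI finite_subset[OF sub[OF j]]) auto
    also have "\<dots> \<le> card (Z j)" by (rule card_image_le) (rule finite_subset[OF sub[OF j]], simp)
    finally show ?thesis by simp
  qed
qed

lemma linked_perm_fixed_bound:
  assumes K: "1 \<le> K" and om: "order_match K J \<pi>" and lp: "linked_perm K w J \<pi> \<sigma>"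
  shows "card {u \<in> sqK K. \<sigma> u = u} + card J * nat (K + 1) \<le> card (sqK K)"
proof -
  let ?Z = "\<lambda>j. chain \<sigma> (sqK K - J) (\<pi> j)"
  note lc = linked_perm_cycles[OF K om lp]
  have J: "finite J" using om finite_subset[OF _ finite_sqK[of K]] by (auto simp: order_match_def)
  have finZ: "finite (?Z j)" if "j \<in> J" for j by (rule finite_subset[OF lc(6)[OF that]]) simp
  have "card J * nat (K + 1) \<le> (\<Sum>j\<in>J. card (?Z j))" using sum_mono[of J "\<lambda>_. nat (K + 1)", OF lc(5)] by simp
  also have "\<dots> = card (\<Union>j\<in>J. ?Z j)"
    by (rule card_UN_disjoint[symmetric, OF J]) (use finZ lc(4) in blast)+
  finally have 1: "card J * nat (K + 1) \<le> card (\<Union>j\<in>J. ?Z j)" .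
  have disj: "{u \<in> sqK K. \<sigma> u = u} \<inter> (\<Union>j\<in>J. ?Z j) = {}" using lc(9) by blast
  have finU: "finite (\<Union>j\<in>J. ?Z j)" using J finZ by blast
  have "card {u \<in> sqK K. \<sigma> u = u} + card (\<Union>j\<in>J. ?Z j) = card ({u \<in> sqK K. \<sigma> u = u} \<union> (\<Union>j\<in>J. ?Z j))"
    by (rule card_Un_disjoint[symmetric, OF _ finU disj]) simp
  also have "\<dots> \<le> card (sqK K)" by (rule card_mono) (use lc(6) in auto)
  finally show ?thesis using 1 by linarith
qed

text \<open>Turning all cycles without a marked point into fixed points gives another linked
  permutation. If the number of fixed points is already maximal there are no such cycles, and
  \<open>sign_marked_cycles\<close> applies.\<close>

lemma linked_perm_max_sign:
  assumes K: "1 \<le> K" and om: "order_match K J \<pi>" and lp: "linked_perm K w J \<pi> \<sigma>"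
    and max: "\<And>\<sigma>'. linked_perm K w J \<pi> \<sigma>' \<Longrightarrow> card {u \<in> sqK K. \<sigma>' u = u} \<le> card {u \<in> sqK K. \<sigma> u = u}"
  shows "sign \<sigma> = (-1) ^ card ({u \<in> sqK K. \<sigma> u \<noteq> u} - J)"
proof (rule sign_marked_cycles)
  let ?Z = "\<lambda>j. chain \<sigma> (sqK K - J) (\<pi> j)"
  define Y where "Y = (\<Union>j\<in>J. ?Z j)"
  note lc = linked_perm_cycles[OF K om lp]
  show perm: "\<sigma> permutes sqK K" using lp by (simp add: linked_perm_def)
  show "finite (sqK K)" "J \<subseteq> sqK K" using om by (auto simp: order_match_def)
  have pow: "(\<sigma> ^^ n) u \<in> ?Z j" if "j \<in> J" "u \<in> ?Z j" for j u n
    by (induction n) (use that lc(2) in auto)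
  show "j = j'" if "j \<in> J" "j' \<in> J" "(\<sigma> ^^ n) j = j'" for j j' n
    using lc(8)[OF that(1) pow[OF that(1) lc(7)[OF that(1)], of n]] that by simp
  have YV: "Y \<subseteq> sqK K" using lc(6) by (auto simp: Y_def)
  have Yc: "\<sigma> u \<in> Y" if "u \<in> Y" for u using that lc(2) unfolding Y_def by blast
  have YJ: "J \<subseteq> Y" using lc(7) by (auto simp: Y_def)
  define \<sigma>' where "\<sigma>' u = (if u \<in> Y then \<sigma> u else u)" for u
  have finY: "finite Y" by (rule finite_subset[OF YV]) simp
  have "bij_betw \<sigma> Y Y"
    unfolding bij_betw_def using endo_inj_surj[OF finY, of \<sigma>] Yc permutes_inj_on[OF perm] by blast
  then have "bij_betw \<sigma>' Y Y" by (rule bij_betw_cong[THEN iffD1, rotated]) (simp add: \<sigma>'_def)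
  then have "\<sigma>' permutes Y" by (rule bij_imp_permutes) (simp add: \<sigma>'_def)
  then have "\<sigma>' permutes sqK K" by (rule permutes_subset[OF _ YV])
  then have lp': "linked_perm K w J \<pi> \<sigma>'" using lp YJ by (auto simp: linked_perm_def \<sigma>'_def)
  have "{u \<in> sqK K. \<sigma> u = u} \<subseteq> {u \<in> sqK K. \<sigma>' u = u}" by (auto simp: \<sigma>'_def)
  then have eq: "{u \<in> sqK K. \<sigma> u = u} = {u \<in> sqK K. \<sigma>' u = u}"
    using max[OF lp'] by (intro card_seteq) auto
  show "\<exists>n. (\<sigma> ^^ n) x \<in> J" if x: "\<sigma> x \<noteq> x" for x
  proof -
    have "x \<in> sqK K" using x permutes_not_in[OF perm] by blast
    then have "\<sigma>' x \<noteq> x" using eq x by blast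
    then have "x \<in> Y" by (auto simp: \<sigma>'_def split: if_splits)
    then obtain j where "j \<in> J" "x \<in> ?Z j" by (auto simp: Y_def)
    then show ?thesis using lc(3) by metis
  qed
qed


section \<open>Eigenvectors vanishing on the left ends of the crossings\<close>

definition crossing_matrix :: "(edge \<Rightarrow> bool) \<Rightarrow> vertex set \<Rightarrow> (vertex \<Rightarrow> vertex) \<Rightarrow> vertex \<Rightarrow> vertex \<Rightarrow> real poly" where
  "crossing_matrix w J \<pi> u v =
     (if u \<in> J then (if v = \<pi> u then 1 else 0)
      else if v = u then [:0, 1:] else if open_adj w u v then - 1 else 0)"

lemma crossing_matrix_term:
  assumes K: "1 \<le> K" and om: "order_match K J \<pi>" and perm: "\<sigma> permutes sqK K"
  shows "(\<Prod>u\<in>sqK K. crossing_matrix w J \<pi> u (\<sigma> u)) =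
    (if linked_perm K w J \<pi> \<sigma>
     then (-1) ^ card ({u \<in> sqK K. \<sigma> u \<noteq> u} - J) * [:0, 1:] ^ card {u \<in> sqK K. \<sigma> u = u} else 0)"
proof (cases "linked_perm K w J \<pi> \<sigma>")
  case False
  then have "\<not> ((\<forall>j\<in>J. \<sigma> j = \<pi> j) \<and> (\<forall>u\<in>sqK K - J. \<sigma> u = u \<or> open_adj w u (\<sigma> u)))"
    using perm by (simp add: linked_perm_def)
  then have "\<exists>u\<in>sqK K. crossing_matrix w J \<pi> u (\<sigma> u) = 0"
  proof (rule contrapos_np)
    assume no: "\<not> (\<exists>u\<in>sqK K. crossing_matrix w J \<pi> u (\<sigma> u) = 0)"
    have "\<sigma> j = \<pi> j" if j: "j \<in> J" for j
    proof -
      have "j \<in> sqK K" using om j by (auto simp: order_match_def)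
      then have "crossing_matrix w J \<pi> j (\<sigma> j) \<noteq> 0" using no by blast
      then show ?thesis using j by (simp add: crossing_matrix_def split: if_splits)
    qed
    moreover have "\<sigma> u = u \<or> open_adj w u (\<sigma> u)" if "u \<in> sqK K - J" for u
    proof -
      have "crossing_matrix w J \<pi> u (\<sigma> u) \<noteq> 0" using no that by blast
      then show ?thesis using that by (auto simp: crossing_matrix_def split: if_splits)
    qed
    ultimately show "(\<forall>j\<in>J. \<sigma> j = \<pi> j) \<and> (\<forall>u\<in>sqK K - J. \<sigma> u = u \<or> open_adj w u (\<sigma> u))" by blast
  qed
  then have "(\<Prod>u\<in>sqK K. crossing_matrix w J \<pi> u (\<sigma> u)) = 0" by (intro prod_zero) simp_all
  then show ?thesis using False by simp
next
  case True
  have JV: "J \<subseteq> sqK K" using om by (auto simp: order_match_def)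
  have s: "\<sigma> j = \<pi> j" if "j \<in> J" for j using True that by (simp add: linked_perm_def)
  have nf: "\<sigma> j \<noteq> j" if j: "j \<in> J" for j
  proof -
    have "fst j = K" "fst (\<pi> j) = 0" using om j by (auto simp: order_match_def)
    then show ?thesis using s[OF j] K by auto
  qed
  have "(\<Prod>u\<in>sqK K. crossing_matrix w J \<pi> u (\<sigma> u)) = (\<Prod>u\<in>sqK K - J. crossing_matrix w J \<pi> u (\<sigma> u)) * (\<Prod>u\<in>J. crossing_matrix w J \<pi> u (\<sigma> u))"
    by (rule prod.subset_diff[OF JV]) simp
  also have "(\<Prod>u\<in>J. crossing_matrix w J \<pi> u (\<sigma> u)) = 1" by (rule prod.neutral) (simp add: crossing_matrix_def s)
  also have "(\<Prod>u\<in>sqK K - J. crossing_matrix w J \<pi> u (\<sigma> u)) = (\<Prod>u\<in>sqK K - J. if \<sigma> u = u then [:0, 1:] else -1)"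
    using True by (intro prod.cong refl) (auto simp: crossing_matrix_def linked_perm_def)
  also have "\<dots> = [:0, 1:] ^ card {u \<in> sqK K - J. \<sigma> u = u} * (-1) ^ card {u \<in> sqK K - J. \<sigma> u \<noteq> u}"
    by (subst prod.If_cases) (simp_all add: Int_def Collect_conj_eq[symmetric])
  also have "{u \<in> sqK K - J. \<sigma> u = u} = {u \<in> sqK K. \<sigma> u = u}" using nf by blast
  also have "{u \<in> sqK K - J. \<sigma> u \<noteq> u} = {u \<in> sqK K. \<sigma> u \<noteq> u} - J" by blast
  finally show ?thesis using True by (simp add: mult.commute)
qed

text \<open>In top degree the sign of a linked permutation cancels against the signs of the entries
  -1, so the leading coefficient counts the linked permutations with the most fixed points. Their
  number of fixed points is at most |V| - |J|(K + 1), as every marked cycle moves at least K + 1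
  vertices.\<close>

lemma crossing_matrix_DET:
  assumes K: "1 \<le> K" and om: "order_match K J \<pi>" and ex: "linked_perm K w J \<pi> \<sigma>0"
  shows "DET (sqK K) (crossing_matrix w J \<pi>) \<noteq> 0"
    and "degree (DET (sqK K) (crossing_matrix w J \<pi>)) + card J * nat (K + 1) \<le> card (sqK K)"
proof -
  let ?V = "sqK K" and ?P = "{\<sigma>. \<sigma> permutes sqK K}" and ?M = "crossing_matrix w J \<pi>"
  define F where "F \<sigma> = card {u \<in> sqK K. \<sigma> u = u}" for \<sigma>
  define c where "c \<sigma> = sign \<sigma> * (-1) ^ card ({u \<in> sqK K. \<sigma> u \<noteq> u} - J)" for \<sigma>
  have finP: "finite ?P" by (rule finite_permutations) simp
  have tm: "of_int (sign \<sigma>) * (\<Prod>u\<in>?V. ?M u (\<sigma> u)) = (if linked_perm K w J \<pi> \<sigma> then monom (of_int (c \<sigma>)) (F \<sigma>) else (0 :: real poly))"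
    if "\<sigma> \<in> ?P" for \<sigma>
  proof -
    have "of_int (sign \<sigma>) * ((-1) ^ n * [:0, 1:] ^ k) = monom (of_int (sign \<sigma> * (-1) ^ n) :: real) k" for n k
    proof -
      have "[:0, 1:] ^ k = (monom 1 k :: real poly)" by (simp add: monom_altdef)
      then have "of_int (sign \<sigma>) * ((-1) ^ n * [:0, 1:] ^ k) = of_int (sign \<sigma> * (-1) ^ n) * (monom 1 k :: real poly)"
        by (simp add: mult.assoc)
      also have "\<dots> = monom (of_int (sign \<sigma> * (-1) ^ n)) k"
        by (simp only: of_int_poly) (simp add: smult_monom)
      finally show ?thesis .
    qed
    then show ?thesis using crossing_matrix_term[OF K om, of \<sigma> w] that by (simp add: c_def F_def)
  qed
  define L where "L = {\<sigma>. linked_perm K w J \<pi> \<sigma>}"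
  have LP: "L \<subseteq> ?P" by (auto simp: L_def linked_perm_def)
  then have finL: "finite L" using finP finite_subset by blast
  have DET: "DET ?V ?M = (\<Sum>\<sigma>\<in>L. monom (of_int (c \<sigma>)) (F \<sigma>))"
  proof -
    have "DET ?V ?M = (\<Sum>\<sigma>\<in>?P. if linked_perm K w J \<pi> \<sigma> then monom (of_int (c \<sigma>)) (F \<sigma>) else 0)"
      unfolding DET_def by (rule sum.cong[OF refl tm])
    also have "\<dots> = (\<Sum>\<sigma>\<in>L. monom (of_int (c \<sigma>)) (F \<sigma>))"
      using LP by (intro sum.mono_neutral_cong_right[OF finP]) (auto simp: L_def)
    finally show ?thesis .
  qed
  have Fb: "F \<sigma> + card J * nat (K + 1) \<le> card ?V" if "\<sigma> \<in> L" for \<sigma>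
    using linked_perm_fixed_bound[OF K om] that by (simp add: F_def L_def)
  have "degree (DET ?V ?M) \<le> card ?V - card J * nat (K + 1)"
    unfolding DET
  proof (rule degree_sum_le[OF finL])
    fix \<sigma> assume "\<sigma> \<in> L"
    then show "degree (monom (of_int (c \<sigma>) :: real) (F \<sigma>)) \<le> card ?V - card J * nat (K + 1)"
      using Fb[of \<sigma>] degree_monom_le[of "of_int (c \<sigma>) :: real" "F \<sigma>"] by linarith
  qed
  moreover have "card J * nat (K + 1) \<le> card ?V" using Fb[of \<sigma>0] ex by (simp add: L_def)
  ultimately show "degree (DET ?V ?M) + card J * nat (K + 1) \<le> card ?V" by linarith
  define m where "m = Max (F ` L)"
  have L0: "L \<noteq> {}" using ex by (auto simp: L_def)
  have Fm: "F \<sigma> \<le> m" if "\<sigma> \<in> L" for \<sigma> unfolding m_def using finL that by simp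
  have "m \<in> F ` L" unfolding m_def using finL L0 by (intro Max_in) auto
  then obtain \<sigma>1 where s1: "\<sigma>1 \<in> L" "F \<sigma>1 = m" by auto
  have c1: "c \<sigma> = 1" if "\<sigma> \<in> L" "F \<sigma> = m" for \<sigma>
  proof -
    have "sign \<sigma> = (-1) ^ card ({u \<in> sqK K. \<sigma> u \<noteq> u} - J)"
      by (rule linked_perm_max_sign[OF K om]) (use that Fm in \<open>auto simp: L_def F_def\<close>)
    then show ?thesis by (simp add: c_def flip: power_add mult_2)
  qed
  have "coeff (DET ?V ?M) m = (\<Sum>\<sigma>\<in>L. if F \<sigma> = m then 1 else 0)"
    unfolding DET coeff_sum by (rule sum.cong[OF refl]) (auto simp: c1)
  also have "\<dots> \<ge> (\<Sum>\<sigma>\<in>{\<sigma>1}. if F \<sigma> = m then 1 else 0)"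
    by (rule sum_mono2[OF finL]) (use s1 in auto)
  finally have "coeff (DET ?V ?M) m \<noteq> 0" using s1 by simp
  then show "DET ?V ?M \<noteq> 0" by auto
qed

lemma independent_ev1: "independent (ev1 ` V)"
proof (rule pairwise_orthogonal_independent)
  show "pairwise orthogonal (ev1 ` V)" by (auto simp: pairwise_def orthogonal_def)
  show "0 \<notin> ev1 ` V"
  proof
    assume "0 \<in> ev1 ` V"
    then obtain v :: 'a where "ev1 v = 0" by auto
    then have "fv (ev1 v) v = fv 0 v" by simp
    then show False by simp
  qed
qed

lemma inj_ev1: "inj ev1"
proof (rule injI)
  fix u v :: 'a assume "ev1 u = ev1 v"
  then have "fv (ev1 u) u = fv (ev1 v) u" by simp
  then show "u = v" by (auto split: if_splits)
qed

lemma supported_span: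
  assumes "finite V"
  shows "span (ev1 ` V) = {x. \<forall>v. v \<notin> V \<longrightarrow> fv x v = 0}"
proof
  show "span (ev1 ` V) \<subseteq> {x. \<forall>v. v \<notin> V \<longrightarrow> fv x v = 0}"
    by (rule span_minimal) (auto simp: subspace_def)
  show "{x. \<forall>v. v \<notin> V \<longrightarrow> fv x v = 0} \<subseteq> span (ev1 ` V)"
  proof
    fix x assume "x \<in> {x. \<forall>v. v \<notin> V \<longrightarrow> fv x v = 0}"
    then have "x = (\<Sum>v\<in>V. fv x v *\<^sub>R ev1 v)" by (intro fvec_expand[OF assms]) auto
    moreover have "(\<Sum>v\<in>V. fv x v *\<^sub>R ev1 v) \<in> span (ev1 ` V)"
      by (rule span_sum) (rule span_scale, rule span_base, rule imageI)
    ultimately show "x \<in> span (ev1 ` V)" by simp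
  qed
qed

lemma poly_const_sum: "(\<Sum>k\<in>A. [:f k:]) = [:\<Sum>k\<in>A. f k:]"
  by (induction A rule: infinite_finite_induct) auto

text \<open>Extend \<open>C\<close> to a basis of the functions on V and use it as the columns of an
  invertible constant matrix Q. Column c of MQ is divisible by X - lam c, so the product of card C
  linear factors divides det M.\<close>

lemma DET_divisible:
  fixes M :: "'a \<Rightarrow> 'a \<Rightarrow> real poly"
  assumes V: "finite V" and C: "independent C" "\<And>c v. c \<in> C \<Longrightarrow> v \<notin> V \<Longrightarrow> fv c v = 0"
    and div: "\<And>c u. c \<in> C \<Longrightarrow> u \<in> V \<Longrightarrow> \<exists>r. (\<Sum>k\<in>V. M u k * [:fv c k:]) = [:- lam c, 1:] * r"
    and nz: "DET V M \<noteq> 0"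
  shows "finite C \<and> card C \<le> degree (DET V M)"
proof -
  have CE: "C \<subseteq> span (ev1 ` V)" unfolding supported_span[OF V] using C(2) by auto
  obtain B where B: "C \<subseteq> B" "B \<subseteq> span (ev1 ` V)" "independent B" "span (ev1 ` V) \<subseteq> span B"
    using maximal_independent_subset_extend[OF CE C(1)] by blast
  have "span B = span (ev1 ` V)" using B(2,4) span_minimal[OF B(2)] by auto
  then obtain \<beta>0 where "bij_betw \<beta>0 (ev1 ` V) B"
    using bij_if_span_eq_span_bases[OF independent_ev1[of V] B(3)] by metis
  then have bij: "bij_betw (\<beta>0 \<circ> ev1) V B"
    by (rule bij_betw_trans[rotated]) (simp add: bij_betw_def inj_on_subset[OF inj_ev1])
  define \<beta> where "\<beta> = \<beta>0 \<circ> ev1"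
  have bij: "bij_betw \<beta> V B" using bij by (simp add: \<beta>_def)
  have finB: "finite B" using bij V bij_betw_finite by blast
  have "\<exists>r. \<forall>u\<in>V. (\<Sum>k\<in>V. M u k * [:fv b k:]) = (if b \<in> C then [:- lam b, 1:] else 1) * r u" for b
  proof (cases "b \<in> C")
    case True
    have "\<forall>u\<in>V. \<exists>r. (\<Sum>k\<in>V. M u k * [:fv b k:]) = [:- lam b, 1:] * r" using div[OF True] by blast
    from bchoice[OF this] show ?thesis using True by simp
  qed auto
  then obtain r where r: "\<And>b u. u \<in> V \<Longrightarrow> (\<Sum>k\<in>V. M u k * [:fv b k:]) = (if b \<in> C then [:- lam b, 1:] else 1) * r b u"
    by metis
  have "\<exists>g. ev1 v = (\<Sum>b\<in>B. g b *\<^sub>R b)" if "v \<in> V" for v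
  proof -
    have "ev1 v \<in> span B" using that B(4) span_base[of "ev1 v" "ev1 ` V"] by blast
    then show ?thesis unfolding span_finite[OF finB] by auto
  qed
  then obtain g where g: "\<And>v. v \<in> V \<Longrightarrow> ev1 v = (\<Sum>b\<in>B. g v b *\<^sub>R b)" by metis
  define Q where "Q u v = [:fv (\<beta> v) u:]" for u v
  define Q' where "Q' u v = [:g v (\<beta> u):]" for u v
  define R where "R u v = r (\<beta> v) u" for u v
  define d where "d v = (if \<beta> v \<in> C then [:- lam (\<beta> v), 1:] else 1 :: real poly)" for v
  have "DET V M * DET V Q = DET V (\<lambda>u v. \<Sum>k\<in>V. M u k * Q k v)" by (rule DET_mult[OF V, symmetric])
  also have "\<dots> = DET V (\<lambda>u v. d v * R u v)" unfolding Q_def d_def R_def by (rule DET_cong) (rule r)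
  also have "\<dots> = (\<Prod>v\<in>V. d v) * DET V R" by (rule DET_scale_columns[OF V])
  finally have 1: "DET V M * DET V Q = (\<Prod>v\<in>V. d v) * DET V R" .
  have "DET V Q * DET V Q' = DET V (\<lambda>u v. \<Sum>k\<in>V. Q u k * Q' k v)" by (rule DET_mult[OF V, symmetric])
  also have "\<dots> = DET V (\<lambda>u v. if u = v then 1 else 0)"
  proof (rule DET_cong)
    fix u v assume uv: "u \<in> V" "v \<in> V"
    have "(\<Sum>k\<in>V. Q u k * Q' k v) = (\<Sum>k\<in>V. [:g v (\<beta> k) * fv (\<beta> k) u:])" by (simp add: Q_def Q'_def mult.commute)
    also have "\<dots> = (\<Sum>b\<in>B. [:g v b * fv b u:])" by (rule sum.reindex_bij_betw[OF bij])
    also have "\<dots> = [:\<Sum>b\<in>B. g v b * fv b u:]" by (rule poly_const_sum)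
    also have "(\<Sum>b\<in>B. g v b * fv b u) = fv (ev1 v) u" unfolding g[OF uv(2)] by simp
    finally show "(\<Sum>k\<in>V. Q u k * Q' k v) = (if u = v then 1 else 0)" by (simp add: one_pCons)
  qed
  also have "\<dots> = 1" by (rule DET_unit[OF V])
  finally have 2: "DET V Q * DET V Q' = 1" .
  have "DET V M = DET V M * (DET V Q * DET V Q')" by (simp add: 2)
  also have "\<dots> = (\<Prod>v\<in>V. d v) * (DET V R * DET V Q')" by (simp only: 1 mult.assoc[symmetric])
  finally have "(\<Prod>v\<in>V. d v) dvd DET V M" by (rule dvdI)
  then have le: "degree (\<Prod>v\<in>V. d v) \<le> degree (DET V M)" using nz by (rule dvd_imp_degree_le)
  have "degree (\<Prod>v\<in>V. d v) = (\<Sum>v\<in>V. degree (d v))" by (rule degree_prod_sum_eq) (simp add: d_def)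
  also have "\<dots> = (\<Sum>v\<in>V. if \<beta> v \<in> C then 1 else 0)" by (rule sum.cong) (auto simp: d_def)
  also have "\<dots> = (\<Sum>b\<in>B. if b \<in> C then 1 else 0)" by (rule sum.reindex_bij_betw[OF bij])
  also have "\<dots> = card C" using finB B(1) by (simp add: sum.If_cases Int_absorb1)
  finally show ?thesis using le finB B(1) finite_subset by auto
qed

text \<open>A row of the crossing matrix in \<open>J\<close> evaluates c at a left end, which gives
  0; any other row gives (X - lam c) times the value of c. So \<open>DET_divisible\<close> applies,
  even with several eigenvalues at once.\<close>

lemma crossings_bound_eigenvectors:
  assumes K: "1 \<le> K" and mc: "many_crossings K b w"
  shows "\<exists>I\<subseteq>sqK K. card I = b \<and> (\<forall>C lam. independent C \<longrightarrow>
    (\<forall>c\<in>C. (\<forall>v. v \<notin> sqK K \<longrightarrow> fv c v = 0) \<and> (\<forall>u\<in>sqK K. fv (adj w c) u = lam c * fv c u) \<and> (\<forall>i\<in>I. fv c i = 0)) \<longrightarrow>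
    finite C \<and> card C + b * nat (K + 1) \<le> card (sqK K))"
proof -
  obtain J \<pi> \<sigma> where cJ: "card J = b" and om: "order_match K J \<pi>" and lp: "linked_perm K w J \<pi> \<sigma>"
    using mc by (auto simp: many_crossings_def)
  have inj: "inj_on \<pi> J"
  proof (rule inj_onI)
    fix j j' assume j: "j \<in> J" "j' \<in> J" "\<pi> j = \<pi> j'"
    then have "\<sigma> j = \<sigma> j'" using lp by (simp add: linked_perm_def)
    moreover have "inj \<sigma>" using permutes_inj[of \<sigma> "sqK K"] lp by (simp add: linked_perm_def)
    ultimately show "j = j'" by (simp add: inj_eq del: split_paired_All)
  qed
  have "\<pi> ` J \<subseteq> sqK K" using om by (auto simp: order_match_def)
  moreover have "card (\<pi> ` J) = b" using card_image[OF inj] cJ by simp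
  moreover have "finite C \<and> card C + b * nat (K + 1) \<le> card (sqK K)"
    if C: "independent C" and c: "\<forall>c\<in>C. (\<forall>v. v \<notin> sqK K \<longrightarrow> fv c v = 0) \<and> (\<forall>u\<in>sqK K. fv (adj w c) u = lam c * fv c u) \<and> (\<forall>i\<in>\<pi> ` J. fv c i = 0)"
    for C lam
  proof -
    let ?M = "crossing_matrix w J \<pi>"
    have "finite C \<and> card C \<le> degree (DET (sqK K) ?M)"
    proof (rule DET_divisible[OF _ C _ _ crossing_matrix_DET(1)[OF K om lp], where lam=lam])
      show "fv x v = 0" if "x \<in> C" "v \<notin> sqK K" for x v using c that by blast
      fix x u assume x: "x \<in> C" and u: "u \<in> sqK K"
      show "\<exists>r. (\<Sum>k\<in>sqK K. ?M u k * [:fv x k:]) = [:- lam x, 1:] * r"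
      proof (cases "u \<in> J")
        case True
        have "?M u k * [:fv x k:] = 0" for k using c x True by (auto simp: crossing_matrix_def)
        then have "(\<Sum>k\<in>sqK K. ?M u k * [:fv x k:]) = 0" by (rule sum.neutral[OF ballI])
        then show ?thesis by (intro exI[of _ 0]) simp
      next
        case False
        have noloop: "\<not> open_adj w u u" by (cases u) (auto simp: open_adj_def)
        have "(\<Sum>k\<in>sqK K. ?M u k * [:fv x k:])
          = (\<Sum>k\<in>sqK K. (if k = u then [:0, fv x u:] else 0) - [:if open_adj w u k then fv x k else 0:])"
          using False noloop by (intro sum.cong refl) (auto simp: crossing_matrix_def)
        also have "\<dots> = [:0, fv x u:] - (\<Sum>k\<in>sqK K. [:if open_adj w u k then fv x k else 0:])"
          using u by (simp add: sum_subtractf)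
        also have "(\<Sum>k\<in>sqK K. [:if open_adj w u k then fv x k else 0:]) = [:\<Sum>k\<in>sqK K. if open_adj w u k then fv x k else 0:]"
          by (rule poly_const_sum)
        also have "(\<Sum>k\<in>sqK K. if open_adj w u k then fv x k else 0) = fv (adj w x) u"
          using c x by (intro adj_sum_over[symmetric]) (simp, blast)
        also have "\<dots> = lam x * fv x u" using c x u by blast
        finally have "(\<Sum>k\<in>sqK K. ?M u k * [:fv x k:]) = [:- lam x, 1:] * [:fv x u:]" by simp
        then show ?thesis by blast
      qed
    qed simp
    then show ?thesis using crossing_matrix_DET(2)[OF K om lp] cJ by auto
  qed
  ultimately show ?thesis by (intro exI[of _ "\<pi> ` J"]) blast
qed

section \<open>Spectral projections as limits of polynomials\<close>

text \<open>For \<open>|l| \<le> 4\<close> the operator \<open>bump l\<close> evaluated at the adjacency operator lies between 0 and 1, and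
  its powers decrease to the projection onto the eigenspace of \<open>l\<close>.\<close>

definition bump :: "real \<Rightarrow> real poly" where
  "bump l = 1 - smult (1 / 64) ([:- l, 1:] * [:- l, 1:])"

lemma poly_bump: "poly (bump l) x = 1 - (x - l)\<^sup>2 / 64"
  by (simp add: bump_def power2_eq_square algebra_simps add_divide_distrib diff_divide_distrib)

lemma bump_complement: "1 - bump l = smult (1 / 64) ([:- l, 1:] * [:- l, 1:])"
  unfolding bump_def by (simp only: diff_diff_eq2 add_diff_cancel_left')

lemma pop_linear_factor: "pop (adj w) [:- l, 1:] x = adj w x - l *\<^sub>R x"
  by (simp add: pop_pCons[OF linear_adj] pop_const)

lemma pop_diff: "pop T (p - q) x = pop T p x - pop T q x"
  using pop_add[of T "p - q" q x] by simp

lemma bump_form: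
  "inner x (pop (adj w) (r * r - bump l * (r * r)) x) = inner (pop (adj w) ([:- l, 1:] * r) x) (pop (adj w) ([:- l, 1:] * r) x) / 64"
proof -
  have "r * r - bump l * (r * r) = (1 - bump l) * (r * r)" by (simp only: left_diff_distrib mult_1)
  also have "\<dots> = smult (1 / 64) (([:- l, 1:] * r) * 1 * ([:- l, 1:] * r))"
    unfolding bump_complement mult_smult_left mult_1_right by (simp only: ac_simps)
  finally have "r * r - bump l * (r * r) = smult (1 / 64) (([:- l, 1:] * r) * 1 * ([:- l, 1:] * r))" .
  then show ?thesis by (simp only: pop_smult inner_scaleR_right pop_adj_square pop_1 mult_1_left times_divide_eq_left)
qed

lemma bump_square_diff:
  "inner x (pop (adj w) (bump l ^ m) x) - inner x (pop (adj w) (bump l ^ Suc m) x) =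
     inner (pop (adj w) [:- l, 1:] x) (pop (adj w) (bump l ^ m) (pop (adj w) [:- l, 1:] x)) / 64"
proof -
  have "bump l ^ m = bump l ^ Suc m + (1 - bump l) * bump l ^ m" by (simp add: left_diff_distrib)
  also have "(1 - bump l) * bump l ^ m = smult (1 / 64) ([:- l, 1:] * bump l ^ m * [:- l, 1:])"
    unfolding bump_complement mult_smult_left by (simp only: ac_simps)
  finally have "inner x (pop (adj w) (bump l ^ m) x) = inner x (pop (adj w) (bump l ^ Suc m + smult (1 / 64) ([:- l, 1:] * bump l ^ m * [:- l, 1:])) x)"
    by (rule arg_cong)
  then show ?thesis by (simp only: pop_add pop_smult inner_right_distrib inner_scaleR_right pop_adj_square add_diff_cancel_left' mult_1_left times_divide_eq_left)
qed

text \<open>The operator A - l has norm at most 8, which is where the constant 64 in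
  \<open>bump\<close> comes from.\<close>

lemma bump_bounds:
  assumes "\<bar>l\<bar> \<le> 4"
  shows "0 \<le> inner x (pop (adj w) (bump l) x)"
proof -
  let ?y = "pop (adj w) [:- l, 1:] x"
  have "norm ?y \<le> norm (adj w x) + norm (l *\<^sub>R x)" unfolding pop_linear_factor by (rule norm_triangle_ineq4)
  also have "\<dots> \<le> 8 * norm x" using norm_adj[of w x] mult_right_mono[OF assms norm_ge_zero[of x]] by simp
  finally have "inner ?y ?y \<le> 64 * inner x x"
    using power_mono[of "norm ?y" "8 * norm x" 2] by (simp add: power_mult_distrib power2_norm_eq_inner)
  then show ?thesis using bump_square_diff[of x w l 0] by simp
qed

lemma bump_power_nonneg:
  assumes "\<bar>l\<bar> \<le> 4"
  shows "0 \<le> inner x (pop (adj w) (bump l ^ m) x)"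
proof -
  have "0 \<le> inner x (pop (adj w) (bump l ^ k * r * bump l ^ k) x)" if "r = 1 \<or> r = bump l" for k r
    unfolding pop_adj_square using that bump_bounds[OF assms] by auto
  moreover have "\<exists>k r. bump l ^ m = bump l ^ k * r * bump l ^ k \<and> (r = 1 \<or> r = bump l)"
  proof (cases "even m")
    case True
    then obtain k where "m = k + k" by (auto elim: evenE simp: mult_2)
    then show ?thesis by (intro exI[of _ k] exI[of _ 1]) (simp add: power_add)
  next
    case False
    then obtain k where "m = k + 1 + k" by (auto elim!: oddE simp: mult_2)
    then show ?thesis by (intro exI[of _ k] exI[of _ "bump l"]) (simp add: power_add)
  qed
  ultimately show ?thesis by metis
qed

lemma bump_power_decseq:
  assumes "\<bar>l\<bar> \<le> 4"
  shows "decseq (\<lambda>m. inner x (pop (adj w) (bump l ^ m) x))"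
proof (rule decseq_SucI)
  fix m
  show "inner x (pop (adj w) (bump l ^ Suc m) x) \<le> inner x (pop (adj w) (bump l ^ m) x)"
    using bump_square_diff[of x w l m] bump_power_nonneg[OF assms, of "pop (adj w) [:- l, 1:] x" w m] by simp
qed

lemma bump_power_le:
  assumes "\<bar>l\<bar> \<le> 4"
  shows "inner x (pop (adj w) (bump l ^ m) x) \<le> inner x x"
  using decseqD[OF bump_power_decseq[OF assms], of 0 m x w] by simp

text \<open>Diagonal values decrease and stay nonnegative; polarization reduces the general case to
  them.\<close>

lemma bump_power_convergent:
  assumes "\<bar>l\<bar> \<le> 4"
  shows "convergent (\<lambda>m. inner x (pop (adj w) (bump l ^ m) y))"
proof -
  have diag: "convergent (\<lambda>m. inner z (pop (adj w) (bump l ^ m) z))" for z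
    using decseq_convergent[OF bump_power_decseq[OF assms], of 0 z w] bump_power_nonneg[OF assms] by (metis convergentI)
  have polar: "inner x (pop (adj w) (bump l ^ m) y) = (inner (x + y) (pop (adj w) (bump l ^ m) (x + y))
      - inner x (pop (adj w) (bump l ^ m) x) - inner y (pop (adj w) (bump l ^ m) y)) * (1 / 2)" for m
    using pop_adj_sym[of w "bump l ^ m" y x]
    by (simp add: linear_add[OF linear_pop[OF linear_adj]] inner_left_distrib inner_right_distrib inner_commute)
  show ?thesis
    unfolding polar by (rule convergent_mult[OF convergent_diff[OF convergent_diff[OF diag diag] diag] convergent_const])
qed

text \<open>The entry at (u, v) of the projection onto the l-eigenspace. The projection itself leads
  out of the finitely supported functions, so it exists here only through its entries.\<close>

definition eigenproj :: "(edge \<Rightarrow> bool) \<Rightarrow> real \<Rightarrow> vertex \<Rightarrow> vertex \<Rightarrow> real" where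
  "eigenproj w l u v = lim (\<lambda>m. fv (pop (adj w) (bump l ^ m) (ev1 v)) u)"

lemma eigenproj_lim:
  assumes "\<bar>l\<bar> \<le> 4"
  shows "(\<lambda>m. fv (pop (adj w) (bump l ^ m) (ev1 v)) u) \<longlonglongrightarrow> eigenproj w l u v"
  using bump_power_convergent[OF assms, of "ev1 u" w "ev1 v"] by (simp add: eigenproj_def convergent_LIMSEQ_iff)

text \<open>With a_k the diagonal value of the k-th power of \<open>bump l\<close> at e_v, the
  squared norm of (A - l) applied to the m-th power at e_v equals 64(a_(2m) - a_(2m+1)), which tends
  to 0 because a_k converges.\<close>

lemma eigenproj_eigen:
  assumes "\<bar>l\<bar> \<le> 4"
  shows "(\<Sum>x\<in>nbrs u. if open_adj w u x then eigenproj w l x v else 0) = l * eigenproj w l u v"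
proof -
  let ?y = "\<lambda>m. pop (adj w) (bump l ^ m) (ev1 v)"
  let ?a = "\<lambda>m. inner (ev1 v) (pop (adj w) (bump l ^ m) (ev1 v))"
  have sq: "(norm (pop (adj w) [:- l, 1:] (?y m)))\<^sup>2 = 64 * (?a (2 * m) - ?a (Suc (2 * m)))" for m
  proof -
    have "bump l ^ (2 * m) - bump l ^ Suc (2 * m) = bump l ^ m * bump l ^ m - bump l * (bump l ^ m * bump l ^ m)"
      by (simp add: mult_2 power_add)
    then have "?a (2 * m) - ?a (Suc (2 * m)) = inner (ev1 v) (pop (adj w) (bump l ^ m * bump l ^ m - bump l * (bump l ^ m * bump l ^ m)) (ev1 v))"
      by (simp only: pop_diff[symmetric] inner_diff_right[symmetric])
    also have "\<dots> = (norm (pop (adj w) [:- l, 1:] (?y m)))\<^sup>2 / 64"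
      unfolding bump_form power2_norm_eq_inner pop_mult[OF linear_adj, where p="[:- l, 1:]"] ..
    finally show ?thesis by (simp del: inner_ev1 inner_ev1_right power_Suc)
  qed
  obtain L where L: "?a \<longlonglongrightarrow> L" using bump_power_convergent[OF assms, of "ev1 v" w "ev1 v"] unfolding convergent_def by blast
  have "(\<lambda>m. 64 * (?a (2 * m) - ?a (Suc (2 * m)))) \<longlonglongrightarrow> 64 * (L - L)"
    by (intro tendsto_intros LIMSEQ_subseq_LIMSEQ[OF L, unfolded comp_def]) (auto simp: strict_mono_def)
  then have "(\<lambda>m. sqrt ((norm (pop (adj w) [:- l, 1:] (?y m)))\<^sup>2)) \<longlonglongrightarrow> sqrt 0"
    unfolding sq[symmetric] by (intro tendsto_intros) simp
  then have n0: "(\<lambda>m. norm (pop (adj w) [:- l, 1:] (?y m))) \<longlonglongrightarrow> 0" by simp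
  have "(\<lambda>m. inner (ev1 u) (pop (adj w) [:- l, 1:] (?y m))) \<longlonglongrightarrow> 0"
  proof (rule Lim_null_comparison[OF _ n0], rule always_eventually, rule allI)
    show "norm (inner (ev1 u) (pop (adj w) [:- l, 1:] (?y m))) \<le> norm (pop (adj w) [:- l, 1:] (?y m))" for m
      using Cauchy_Schwarz_ineq2[of "ev1 u" "pop (adj w) [:- l, 1:] (?y m)"] by (simp del: inner_ev1)
  qed
  then have z: "(\<lambda>m. (\<Sum>x\<in>nbrs u. if open_adj w u x then fv (?y m) x else 0) - l * fv (?y m) u) \<longlonglongrightarrow> 0"
    by (simp add: pop_linear_factor adj.rep_eq)
  have "(\<lambda>m. (\<Sum>x\<in>nbrs u. if open_adj w u x then fv (?y m) x else 0) - l * fv (?y m) u)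
      \<longlonglongrightarrow> (\<Sum>x\<in>nbrs u. if open_adj w u x then eigenproj w l x v else 0) - l * eigenproj w l u v"
  proof (intro tendsto_diff tendsto_sum tendsto_mult_left eigenproj_lim[OF assms])
    fix x assume "x \<in> nbrs u"
    show "(\<lambda>m. if open_adj w u x then fv (?y m) x else 0) \<longlonglongrightarrow> (if open_adj w u x then eigenproj w l x v else 0)"
      using eigenproj_lim[OF assms] by simp
  qed
  from LIMSEQ_unique[OF this z] show ?thesis by simp
qed

section \<open>Traces and dimensions\<close>

lemma orthogonal_basis_exists:
  assumes V: "finite V" and W: "subspace W" "W \<subseteq> span (ev1 ` V)"
  shows "\<exists>C. finite C \<and> pairwise orthogonal C \<and> 0 \<notin> C \<and> span C = W"
proof -
  obtain B where B: "B \<subseteq> W" "independent B" "W \<subseteq> span B" by (rule basis_exists[of W])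
  have finB: "finite B" using independent_span_bound[of "ev1 ` V" B] V B(1,2) W(2) by auto
  have spB: "span B = W" using B(1,3) W(1) span_minimal by blast
  obtain C where C: "finite C" "span C = span B" "pairwise orthogonal C" using basis_orthogonal[OF finB] by blast
  show ?thesis
    by (rule exI[of _ "C - {0}"]) (use C spB in \<open>auto simp: pairwise_def span_delete_0\<close>)
qed

lemma orthogonal_expansion:
  fixes x :: "'v::real_inner"
  assumes C: "finite C" "pairwise orthogonal C" "0 \<notin> C" and x: "x \<in> span C"
  shows "x = (\<Sum>c\<in>C. (inner c x / inner c c) *\<^sub>R c)"
proof -
  obtain g where g: "x = (\<Sum>c\<in>C. g c *\<^sub>R c)" using x unfolding span_finite[OF C(1)] by auto
  have "inner c x = g c * inner c c" if c: "c \<in> C" for c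
  proof -
    have "inner c x = (\<Sum>d\<in>C. g d * inner c d)" unfolding g by (simp add: inner_sum_right)
    also have "\<dots> = (\<Sum>d\<in>C. if d = c then g c * inner c c else 0)"
      by (rule sum.cong) (use C(2) c in \<open>auto simp: pairwise_def orthogonal_def\<close>)
    finally show ?thesis using C(1) c by simp
  qed
  then have "(\<Sum>c\<in>C. (inner c x / inner c c) *\<^sub>R c) = (\<Sum>c\<in>C. g c *\<^sub>R c)"
    by (intro sum.cong refl) (use C(3) in auto)
  then show ?thesis using g by simp
qed

lemma eigenproj_form_le:
  assumes l: "\<bar>l\<bar> \<le> 4" and V: "finite V" and c: "\<And>v. v \<notin> V \<Longrightarrow> fv c v = 0"
  shows "(\<Sum>v\<in>V. \<Sum>u\<in>V. fv c v * (fv c u * eigenproj w l u v)) \<le> inner c c"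
proof (rule LIMSEQ_le_const2)
  show "(\<lambda>m. \<Sum>v\<in>V. \<Sum>u\<in>V. fv c v * (fv c u * fv (pop (adj w) (bump l ^ m) (ev1 v)) u)) \<longlonglongrightarrow> (\<Sum>v\<in>V. \<Sum>u\<in>V. fv c v * (fv c u * eigenproj w l u v))"
    by (intro tendsto_sum tendsto_mult_left eigenproj_lim[OF l])
  have sub: "{v. fv c v \<noteq> 0} \<subseteq> V" using c by auto
  have "(\<Sum>v\<in>V. \<Sum>u\<in>V. fv c v * (fv c u * fv (pop (adj w) q (ev1 v)) u)) = inner c (pop (adj w) q c)" for q
  proof -
    have "pop (adj w) q c = pop (adj w) q (\<Sum>v\<in>V. fv c v *\<^sub>R ev1 v)" using fvec_expand[OF V sub] by simp
    also have "\<dots> = (\<Sum>v\<in>V. fv c v *\<^sub>R pop (adj w) q (ev1 v))"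
      by (simp add: linear_sum[OF linear_pop[OF linear_adj]] linear_scale[OF linear_pop[OF linear_adj]])
    finally show ?thesis by (simp add: inner_sum_right inner_fvec_sum[OF V sub] sum_distrib_left)
  qed
  then show "\<exists>N. \<forall>m\<ge>N. (\<Sum>v\<in>V. \<Sum>u\<in>V. fv c v * (fv c u * fv (pop (adj w) (bump l ^ m) (ev1 v)) u)) \<le> inner c c"
    using bump_power_le[OF l] by auto
qed

text \<open>The equation is demanded only at interior vertices, because restricting a column of
  \<open>eigenproj\<close> to V spoils it at the boundary.\<close>

definition inner_eigen :: "(edge \<Rightarrow> bool) \<Rightarrow> vertex set \<Rightarrow> real \<Rightarrow> vertex fvec set" where
  "inner_eigen w V l = {\<psi>. (\<forall>v. v \<notin> V \<longrightarrow> fv \<psi> v = 0) \<and> (\<forall>u\<in>V. nbrs u \<subseteq> V \<longrightarrow> fv (adj w \<psi>) u = l * fv \<psi> u)}"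

lemma subspace_inner_eigen: "subspace (inner_eigen w V l)"
  by (auto simp: subspace_def inner_eigen_def linear_0[OF linear_adj] linear_add[OF linear_adj] linear_scale[OF linear_adj] algebra_simps)

text \<open>The restricted columns of the projection lie in \<open>inner_eigen\<close>. Expanding
  them in an orthogonal basis writes the trace as a sum over basis vectors c of (c, Pc)/(c, c), each
  at most 1, so the trace is at most the dimension.\<close>

lemma trace_le_spanning_card:
  assumes l: "\<bar>l\<bar> \<le> 4" and V: "finite V" and D: "finite D" "inner_eigen w V l \<subseteq> span D"
  shows "(\<Sum>v\<in>V. eigenproj w l v v) \<le> real (card D)"
proof -
  define \<psi> where "\<psi> v = (\<Sum>u\<in>V. eigenproj w l u v *\<^sub>R ev1 u)" for v
  have fpsi: "fv (\<psi> v) u = (if u \<in> V then eigenproj w l u v else 0)" for u v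
  proof -
    have "fv (\<psi> v) u = (\<Sum>x\<in>V. if x = u then eigenproj w l u v else 0)"
      unfolding \<psi>_def fv_sum by (rule sum.cong) auto
    then show ?thesis using V by simp
  qed
  have psiW: "\<psi> v \<in> inner_eigen w V l" for v
    unfolding inner_eigen_def
  proof (intro CollectI conjI allI ballI impI)
    show "fv (\<psi> v) u = 0" if "u \<notin> V" for u using that by (simp add: fpsi)
    fix u assume u: "u \<in> V" "nbrs u \<subseteq> V"
    have "fv (adj w (\<psi> v)) u = (\<Sum>x\<in>nbrs u. if open_adj w u x then eigenproj w l x v else 0)"
      unfolding adj.rep_eq by (rule sum.cong) (use u in \<open>auto simp: fpsi\<close>)
    then show "fv (adj w (\<psi> v)) u = l * fv (\<psi> v) u" using eigenproj_eigen[OF l] u by (simp add: fpsi)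
  qed
  have WV: "inner_eigen w V l \<subseteq> span (ev1 ` V)" unfolding supported_span[OF V] by (auto simp: inner_eigen_def)
  obtain C where C: "finite C" "pairwise orthogonal C" "0 \<notin> C" "span C = inner_eigen w V l"
    using orthogonal_basis_exists[OF V subspace_inner_eigen WV] by blast
  have indC: "independent C" by (rule pairwise_orthogonal_independent[OF C(2,3)])
  have CD: "card C \<le> card D" using independent_span_bound[OF D(1) indC] D(2) C(4) span_superset[of C] by auto
  have suppC: "fv c v = 0" if "c \<in> C" "v \<notin> V" for c v
  proof -
    have "c \<in> inner_eigen w V l" using that(1) C(4) span_superset[of C] by blast
    then show ?thesis using that(2) unfolding inner_eigen_def by blast
  qed
  have "(\<Sum>v\<in>V. eigenproj w l v v) = (\<Sum>v\<in>V. fv (\<psi> v) v)" by (simp add: fpsi)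
  also have "\<dots> = (\<Sum>v\<in>V. \<Sum>c\<in>C. inner c (\<psi> v) / inner c c * fv c v)"
  proof (rule sum.cong[OF refl])
    fix v assume "v \<in> V"
    have "\<psi> v = (\<Sum>c\<in>C. (inner c (\<psi> v) / inner c c) *\<^sub>R c)"
      by (rule orthogonal_expansion[OF C(1-3)]) (use psiW C(4) in simp)
    then have "fv (\<psi> v) v = fv (\<Sum>c\<in>C. (inner c (\<psi> v) / inner c c) *\<^sub>R c) v" by simp
    then show "fv (\<psi> v) v = (\<Sum>c\<in>C. inner c (\<psi> v) / inner c c * fv c v)" by simp
  qed
  also have "\<dots> = (\<Sum>c\<in>C. (\<Sum>v\<in>V. \<Sum>u\<in>V. fv c v * (fv c u * eigenproj w l u v)) / inner c c)"
  proof (subst sum.swap, rule sum.cong[OF refl])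
    fix c assume c: "c \<in> C"
    have "inner c (\<psi> v) = (\<Sum>u\<in>V. fv c u * eigenproj w l u v)" for v
    proof -
      have "inner c (\<psi> v) = (\<Sum>u\<in>V. fv c u * fv (\<psi> v) u)"
        by (rule inner_fvec_sum[OF V]) (use suppC[OF c] in blast)
      then show ?thesis by (simp add: fpsi)
    qed
    then show "(\<Sum>v\<in>V. inner c (\<psi> v) / inner c c * fv c v) = (\<Sum>v\<in>V. \<Sum>u\<in>V. fv c v * (fv c u * eigenproj w l u v)) / inner c c"
      by (simp add: sum_divide_distrib sum_distrib_left sum_distrib_right mult.commute)
  qed
  also have "\<dots> \<le> (\<Sum>c\<in>C. 1)"
  proof (rule sum_mono)
    fix c assume c: "c \<in> C"
    then have "0 < inner c c" using C(3) by auto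
    moreover have "(\<Sum>v\<in>V. \<Sum>u\<in>V. fv c v * (fv c u * eigenproj w l u v)) \<le> inner c c"
      by (rule eigenproj_form_le[OF l V suppC[OF c]])
    ultimately show "(\<Sum>v\<in>V. \<Sum>u\<in>V. fv c v * (fv c u * eigenproj w l u v)) / inner c c \<le> 1" by (simp add: divide_le_eq_1)
  qed
  finally show ?thesis using CD by simp
qed

text \<open>A linear functional lowers the dimension by at most one: adding a single vector on which
  it does not vanish recovers the space. Dimensions are expressed by sizes of spanning sets.\<close>

lemma drop_constraints:
  fixes W :: "'v::real_vector set" and \<Phi> :: "('v \<Rightarrow> real) set"
  assumes "finite \<Phi>" "\<And>\<phi>. \<phi> \<in> \<Phi> \<Longrightarrow> linear \<phi>" "subspace W" "finite B" "{x \<in> W. \<forall>\<phi>\<in>\<Phi>. \<phi> x = 0} \<subseteq> span B"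
  shows "\<exists>D. finite D \<and> W \<subseteq> span D \<and> card D \<le> card B + card \<Phi>"
  using assms
proof (induction \<Phi> arbitrary: W rule: finite_induct)
  case empty
  then show ?case by (intro exI[of _ B]) auto
next
  case (insert \<phi> \<Phi>)
  have lin: "linear \<phi>" using insert.prems(1) by simp
  let ?W = "{x \<in> W. \<phi> x = 0}"
  have subW: "subspace ?W"
    using insert.prems(2) by (auto simp: subspace_def linear_0[OF lin] linear_add[OF lin] linear_scale[OF lin])
  have "\<exists>D. finite D \<and> ?W \<subseteq> span D \<and> card D \<le> card B + card \<Phi>"
    by (rule insert.IH[OF _ subW insert.prems(3)]) (use insert.prems(1,4) in auto)
  then obtain D where D: "finite D" "?W \<subseteq> span D" "card D \<le> card B + card \<Phi>" by blast
  show ?case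
  proof (cases "\<exists>x0\<in>W. \<phi> x0 \<noteq> 0")
    case False
    then have "W \<subseteq> span D" using D(2) by auto
    then show ?thesis using D insert.hyps by (intro exI[of _ D]) auto
  next
    case True
    then obtain x0 where x0: "x0 \<in> W" "\<phi> x0 \<noteq> 0" by blast
    have "x \<in> span (insert x0 D)" if x: "x \<in> W" for x
    proof -
      let ?y = "x - (\<phi> x / \<phi> x0) *\<^sub>R x0"
      have "?y \<in> W" using x x0(1) insert.prems(2) by (intro subspace_diff subspace_scale)
      moreover have "\<phi> ?y = 0" using x0(2) by (simp add: linear_diff[OF lin] linear_scale[OF lin])
      ultimately have "?y \<in> span (insert x0 D)" using D(2) span_mono[of D "insert x0 D"] by blast
      moreover have "(\<phi> x / \<phi> x0) *\<^sub>R x0 \<in> span (insert x0 D)" by (intro span_scale span_base) simp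
      ultimately have "?y + (\<phi> x / \<phi> x0) *\<^sub>R x0 \<in> span (insert x0 D)" by (rule span_add)
      then show ?thesis by simp
    qed
    moreover have "card (insert x0 D) \<le> Suc (card D)" by (rule card_insert_le_m1) simp_all
    ultimately show ?thesis using D insert.hyps by (intro exI[of _ "insert x0 D"]) auto
  qed
qed

lemma card_boundary: "0 \<le> K \<Longrightarrow> card {u \<in> sqK K. \<not> nbrs u \<subseteq> sqK K} \<le> 4 * nat (K + 1)"
proof -
  assume K: "0 \<le> K"
  have "{u \<in> sqK K. \<not> nbrs u \<subseteq> sqK K} \<subseteq> (\<lambda>y. (0, y)) ` {0..K} \<union> (\<lambda>y. (K, y)) ` {0..K} \<union> (\<lambda>x. (x, 0)) ` {0..K} \<union> (\<lambda>x. (x, K)) ` {0..K}"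
    (is "?A \<subseteq> ?B")
  proof
    fix u assume u: "u \<in> ?A"
    then have "u \<in> sqK K" "fst u = 0 \<or> fst u = K \<or> snd u = 0 \<or> snd u = K"
      by (auto simp: nbrs_def mem_sqK)
    then show "u \<in> ?B" by (cases u) (auto simp: mem_sqK)
  qed
  then have "card ?A \<le> card ?B" by (intro card_mono) auto
  also have "\<dots> \<le> card ((\<lambda>y. (0::int, y)) ` {0..K}) + card ((\<lambda>y. (K, y)) ` {0..K}) + card ((\<lambda>x. (x, 0::int)) ` {0..K}) + card ((\<lambda>x. (x, K)) ` {0..K})"
    by (intro order_trans[OF card_Un_le] add_right_mono order.refl)
  also have "\<dots> \<le> card {0..K} + card {0..K} + card {0..K} + card {0..K}"
    by (intro add_mono card_image_le) simp_all
  finally show ?thesis by simp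
qed

text \<open>For each eigenvalue, imposing the equation at the boundary and vanishing at the b left
  ends costs 4(K + 1) + b dimensions. What remains are true eigenvectors of the restricted matrix;
  those of different eigenvalues are orthogonal, so together they fall under
  \<open>crossings_bound_eigenvectors\<close>.\<close>

lemma traces_le:
  assumes K: "1 \<le> K" and mc: "many_crossings K b w" and F: "finite F" "\<And>l. l \<in> F \<Longrightarrow> \<bar>l\<bar> \<le> 4"
  shows "(\<Sum>l\<in>F. \<Sum>v\<in>sqK K. eigenproj w l v v) + real (b * nat (K + 1)) \<le> real (card (sqK K)) + real (card F) * real (4 * nat (K + 1) + b)"
proof -
  let ?V = "sqK K"
  from crossings_bound_eigenvectors[OF K mc] obtain I where I: "I \<subseteq> ?V" "card I = b" and bound: "\<forall>C lam. independent C \<longrightarrow>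
    (\<forall>c\<in>C. (\<forall>v. v \<notin> ?V \<longrightarrow> fv c v = 0) \<and> (\<forall>u\<in>?V. fv (adj w c) u = lam c * fv c u) \<and> (\<forall>i\<in>I. fv c i = 0)) \<longrightarrow>
    finite C \<and> card C + b * nat (K + 1) \<le> card ?V"
    by (elim exE conjE) (rule that)
  have finI: "finite I" by (rule finite_subset[OF I(1)]) simp
  define U where "U l = {\<psi>. (\<forall>v. v \<notin> ?V \<longrightarrow> fv \<psi> v = 0) \<and> (\<forall>u\<in>?V. fv (adj w \<psi>) u = l * fv \<psi> u) \<and> (\<forall>i\<in>I. fv \<psi> i = 0)}" for l
  have subU: "subspace (U l)" for l
    by (auto simp: subspace_def U_def linear_0[OF linear_adj] linear_add[OF linear_adj] linear_scale[OF linear_adj] algebra_simps)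
  have "U l \<subseteq> span (ev1 ` ?V)" for l unfolding supported_span[OF finite_sqK] by (auto simp: U_def)
  then have "\<exists>C. finite C \<and> pairwise orthogonal C \<and> 0 \<notin> C \<and> span C = U l" for l
    by (intro orthogonal_basis_exists[OF finite_sqK subU])
  then have "\<exists>B. \<forall>l. finite (B l) \<and> pairwise orthogonal (B l) \<and> 0 \<notin> B l \<and> span (B l) = U l" by (intro choice allI)
  then obtain B where B: "\<And>l. finite (B l)" "\<And>l. pairwise orthogonal (B l)" "\<And>l. 0 \<notin> B l" "\<And>l. span (B l) = U l" by blast
  have BU: "c \<in> U l" if "c \<in> B l" for c l using that B(4) span_superset by blast
  have orth: "inner c d = 0" if cd: "c \<in> B l" "d \<in> B \<mu>" "l \<noteq> \<mu>" for c d l \<mu>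
  proof -
    have eig: "inner x (adj w y) = \<nu> * inner x y" if "x \<in> U \<nu>'" "y \<in> U \<nu>" for x y \<nu> \<nu>'
    proof -
      have sx: "{v. fv x v \<noteq> 0} \<subseteq> ?V" using that(1) unfolding U_def by blast
      have "inner x (adj w y) = (\<Sum>v\<in>?V. fv x v * (\<nu> * fv y v))"
        unfolding inner_fvec_sum[OF finite_sqK sx] by (rule sum.cong) (use that(2) in \<open>auto simp: U_def\<close>)
      then show ?thesis unfolding inner_fvec_sum[OF finite_sqK sx] by (simp add: sum_distrib_left ac_simps)
    qed
    have "\<mu> * inner c d = inner c (adj w d)" using eig[OF BU[OF cd(1)] BU[OF cd(2)]] by simp
    also have "\<dots> = inner (adj w c) d" by (rule adj_sym[symmetric])
    also have "\<dots> = inner d (adj w c)" by (rule inner_commute)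
    also have "\<dots> = l * inner d c" by (rule eig[OF BU[OF cd(2)] BU[OF cd(1)]])
    also have "inner d c = inner c d" by (rule inner_commute)
    finally show ?thesis using cd(3) by simp
  qed
  define C where "C = (\<Union>l\<in>F. B l)"
  have disj: "l = \<mu>" if "c \<in> B l" "c \<in> B \<mu>" for c l \<mu>
    using orth[OF that] B(3)[of l] that(1) by auto
  have "pairwise orthogonal C"
    unfolding pairwise_def
  proof (intro ballI impI)
    fix c d assume cd: "c \<in> C" "d \<in> C" "c \<noteq> d"
    then obtain l \<mu> where lm: "c \<in> B l" "d \<in> B \<mu>" by (auto simp: C_def)
    show "orthogonal c d"
    proof (cases "l = \<mu>")
      case True
      then show ?thesis using B(2)[of l] lm cd(3) by (auto simp: pairwise_def)
    next
      case False
      then show ?thesis using orth[OF lm] by (simp add: orthogonal_def)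
    qed
  qed
  moreover have "0 \<notin> C" using B(3) by (simp add: C_def)
  ultimately have indC: "independent C" by (rule pairwise_orthogonal_independent)
  have "\<exists>l. c \<in> B l" if "c \<in> C" for c using that by (auto simp: C_def)
  then obtain lam where lam: "\<And>c. c \<in> C \<Longrightarrow> c \<in> B (lam c)" by metis
  have "card C + b * nat (K + 1) \<le> card ?V"
  proof (rule bound[THEN spec, THEN spec, THEN mp, OF indC, THEN mp, THEN conjunct2], rule ballI)
    fix c assume "c \<in> C"
    then have "c \<in> U (lam c)" by (rule BU[OF lam])
    then show "(\<forall>v. v \<notin> ?V \<longrightarrow> fv c v = 0) \<and> (\<forall>u\<in>?V. fv (adj w c) u = lam c * fv c u) \<and> (\<forall>i\<in>I. fv c i = 0)"
      by (simp add: U_def)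
  qed
  moreover have "card C = (\<Sum>l\<in>F. card (B l))"
    unfolding C_def by (rule card_UN_disjoint[OF F(1)]) (use B(1) disj in blast)+
  ultimately have cards: "(\<Sum>l\<in>F. card (B l)) + b * nat (K + 1) \<le> card ?V" by simp
  have tr: "(\<Sum>v\<in>?V. eigenproj w l v v) \<le> real (card (B l)) + real (4 * nat (K + 1) + b)" if l: "l \<in> F" for l
  proof -
    define \<Phi> where "\<Phi> = (\<lambda>u \<psi>. fv (adj w \<psi>) u - l * fv \<psi> u) ` {u \<in> ?V. \<not> nbrs u \<subseteq> ?V} \<union> (\<lambda>i \<psi>. fv \<psi> i) ` I"
    have lin: "linear \<phi>" if "\<phi> \<in> \<Phi>" for \<phi>
      using that unfolding \<Phi>_def
      by (auto intro!: linearI simp: linear_add[OF linear_adj] linear_scale[OF linear_adj] algebra_simps)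
    have fPhi: "finite \<Phi>" using finI by (simp add: \<Phi>_def)
    have sub: "{x \<in> inner_eigen w ?V l. \<forall>\<phi>\<in>\<Phi>. \<phi> x = 0} \<subseteq> span (B l)"
    proof
      fix x assume x: "x \<in> {x \<in> inner_eigen w ?V l. \<forall>\<phi>\<in>\<Phi>. \<phi> x = 0}"
      then have zero: "\<phi> x = 0" if "\<phi> \<in> \<Phi>" for \<phi> using that by simp
      have "fv (adj w x) u = l * fv x u" if u: "u \<in> ?V" for u
      proof (cases "nbrs u \<subseteq> ?V")
        case True
        then show ?thesis using x u by (simp add: inner_eigen_def)
      next
        case False
        have "(\<lambda>\<psi>. fv (adj w \<psi>) u - l * fv \<psi> u) \<in> \<Phi>" unfolding \<Phi>_def using u False by blast
        from zero[OF this] show ?thesis by simp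
      qed
      moreover have "fv x i = 0" if i: "i \<in> I" for i
      proof -
        have "(\<lambda>\<psi>. fv \<psi> i) \<in> \<Phi>" unfolding \<Phi>_def using i by blast
        from zero[OF this] show ?thesis by simp
      qed
      ultimately show "x \<in> span (B l)" using x unfolding B(4) U_def inner_eigen_def by simp
    qed
    obtain D where D: "finite D" "inner_eigen w ?V l \<subseteq> span D" "card D \<le> card (B l) + card \<Phi>"
      using drop_constraints[OF fPhi lin subspace_inner_eigen B(1) sub] by blast
    have "card \<Phi> \<le> card {u \<in> ?V. \<not> nbrs u \<subseteq> ?V} + card I"
      unfolding \<Phi>_def by (rule order_trans[OF card_Un_le add_mono]) (intro card_image_le, use finI in simp)+
    also have "\<dots> \<le> 4 * nat (K + 1) + b" using card_boundary[of K] K I(2) by simp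
    finally have "card D \<le> card (B l) + (4 * nat (K + 1) + b)" using D(3) by simp
    then have "real (card D) \<le> real (card (B l)) + real (4 * nat (K + 1) + b)" by (metis of_nat_add of_nat_mono)
    then show ?thesis by (rule order_trans[OF trace_le_spanning_card[OF F(2)[OF l] finite_sqK D(1,2)]])
  qed
  have "(\<Sum>l\<in>F. \<Sum>v\<in>?V. eigenproj w l v v) \<le> (\<Sum>l\<in>F. real (card (B l)) + real (4 * nat (K + 1) + b))" by (rule sum_mono[OF tr])
  also have "\<dots> = real (\<Sum>l\<in>F. card (B l)) + real (card F) * real (4 * nat (K + 1) + b)" by (simp add: sum.distrib)
  finally have "(\<Sum>l\<in>F. \<Sum>v\<in>?V. eigenproj w l v v) \<le> real (\<Sum>l\<in>F. card (B l)) + real (card F) * real (4 * nat (K + 1) + b)" .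
  moreover have "real (\<Sum>l\<in>F. card (B l)) + real (b * nat (K + 1)) \<le> real (card ?V)"
    using cards by (simp only: of_nat_add[symmetric] of_nat_le_iff)
  ultimately show ?thesis by linarith
qed


section \<open>Translation invariance\<close>

definition shift_edge :: "vertex \<Rightarrow> edge \<Rightarrow> edge" where
  "shift_edge a e = (fst e + a, snd e)"

lemma open_adj_shift: "open_adj (\<lambda>e. w (shift_edge a e)) u v = open_adj w (u + a) (v + a)"
  by (cases u; cases v; cases a) (auto simp: open_adj_def shift_edge_def)

lemma nbrs_shift: "nbrs (u + a) = (\<lambda>x. x + a) ` nbrs u"
  by (cases u; cases a) (auto simp: nbrs_def)

lemma adj_pow_shift: "fv ((adj (\<lambda>e. w (shift_edge a e)) ^^ k) (ev1 v)) u = fv ((adj w ^^ k) (ev1 (v + a))) (u + a)"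
proof (induction k arbitrary: u)
  case (Suc k)
  have "fv ((adj w ^^ Suc k) (ev1 (v + a))) (u + a) = (\<Sum>x\<in>(\<lambda>x. x + a) ` nbrs u. if open_adj w (u + a) x then fv ((adj w ^^ k) (ev1 (v + a))) x else 0)"
    by (simp add: adj.rep_eq nbrs_shift)
  also have "\<dots> = (\<Sum>x\<in>nbrs u. if open_adj w (u + a) (x + a) then fv ((adj w ^^ k) (ev1 (v + a))) (x + a) else 0)"
    by (subst sum.reindex) (auto simp: inj_on_def comp_def)
  finally show ?case by (simp add: adj.rep_eq open_adj_shift Suc.IH cong: if_cong)
qed simp

lemma EE_pop_diag:
  assumes "0 \<le> p" "p \<le> 1"
  shows "EE (\<lambda>_. p) (\<lambda>w. fv (pop (adj w) q (ev1 v)) v) = EL p q"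
proof -
  have 0: "origin + v = v" by (cases v) (simp add: origin_def)
  have "fv (pop (adj (\<lambda>e. w (shift_edge v e))) q (ev1 origin)) origin = fv (pop (adj w) q (ev1 v)) v" for w
    by (simp add: pop_def adj_pow_shift 0)
  moreover have "inj (shift_edge v)" by (auto simp: inj_def shift_edge_def prod_eq_iff)
  ultimately show ?thesis
    using EE_bij_reindex[OF finite_ein[OF finite_hood] dep_pop, of "shift_edge v" p q origin origin] assms by (simp add: EL_def)
qed

section \<open>The mass of finite sets\<close>

text \<open>Feeds \<open>traces_le\<close> with b = 0 in configurations that lack the b crossings,
  where only the bound by the size of the box remains.\<close>

lemma many_crossings_0: "many_crossings K 0 w"
  unfolding many_crossings_def
  by (intro exI[of _ "{}"] exI[of _ id]) (auto simp: order_match_def linked_perm_def permutes_id)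

text \<open>By translation invariance the expected trace over the box of the m-th powers of
  \<open>bump l\<close> is |V| times \<open>EL p (bump l ^ m)\<close>. The limit in m gives |V|
  times the mass of l on one side and the expected trace of \<open>eigenproj\<close> on the other,
  and \<open>traces_le\<close> bounds the latter.\<close>

lemma esm_finite_set:
  assumes esm: "expected_spectral_measure p \<mu>" and p: "0 \<le> p" "p \<le> 1" and K: "1 \<le> K"
    and F: "finite F" "\<And>l. l \<in> F \<Longrightarrow> \<bar>l\<bar> \<le> 4"
  shows "real (card (sqK K)) * measure \<mu> F + real (b * nat (K + 1)) * PP (\<lambda>_. p) (many_crossings K b)
     \<le> real (card (sqK K)) + real (card F) * real (4 * nat (K + 1) + b)"
proof -
  interpret prob_space \<mu> using esm by (simp add: expected_spectral_measure_def)
  interpret P: prob_space "percf (\<lambda>_ :: edge. p)" by (rule prob_space_percf)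
  have sb: "sets \<mu> = sets borel" using esm by (simp add: expected_spectral_measure_def)
  let ?V = "sqK K"
  define f where "f w = (\<Sum>l\<in>F. \<Sum>v\<in>?V. eigenproj w l v v)" for w
  define fm where "fm m w = (\<Sum>l\<in>F. \<Sum>v\<in>?V. fv (pop (adj w) (bump l ^ m) (ev1 v)) v)" for m w
  have fm_int: "integrable (percf (\<lambda>_. p)) (fm m)" for m
    unfolding fm_def by (intro Bochner_Integration.integrable_sum integrable_pop)
  have lim: "(\<lambda>m. fm m w) \<longlonglongrightarrow> f w" for w
    unfolding fm_def f_def by (intro tendsto_sum eigenproj_lim F(2))
  have bnd: "\<bar>fm m w\<bar> \<le> real (card F) * real (card ?V)" for m w
  proof -
    have 1: "\<bar>fv (pop (adj w) (bump l ^ m) (ev1 v)) v\<bar> \<le> 1" if "l \<in> F" for l v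
      using bump_power_nonneg[OF F(2)[OF that], of "ev1 v" w m] bump_power_le[OF F(2)[OF that], of "ev1 v" w m] by simp
    have "\<bar>fm m w\<bar> \<le> (\<Sum>l\<in>F. \<Sum>v\<in>?V. 1)"
      unfolding fm_def by (intro order_trans[OF sum_abs] sum_mono 1)
    then show ?thesis by simp
  qed
  have f_meas: "f \<in> borel_measurable (percf (\<lambda>_. p))"
    by (rule borel_measurable_LIMSEQ_real[where u=fm]) (use lim fm_int in auto)
  have f_int: "integrable (percf (\<lambda>_. p)) f"
    by (rule integrable_dominated_convergence[where w="\<lambda>_. real (card F) * real (card ?V)" and s=fm])
       (use f_meas fm_int lim bnd in auto)
  have "(\<lambda>m. EE (\<lambda>_. p) (fm m)) \<longlonglongrightarrow> EE (\<lambda>_. p) f"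
    by (rule integral_dominated_convergence[where w="\<lambda>_. real (card F) * real (card ?V)"])
       (use f_meas fm_int lim bnd in auto)
  moreover have "EE (\<lambda>_. p) (fm m) = (\<Sum>l\<in>F. \<Sum>v\<in>?V. EL p (bump l ^ m))" for m
    unfolding fm_def by (simp add: integrable_pop EE_pop_diag[OF p])
  moreover have "(\<lambda>m. \<Sum>l\<in>F. \<Sum>v\<in>?V. EL p (bump l ^ m)) \<longlonglongrightarrow> (\<Sum>l\<in>F. \<Sum>v\<in>?V. measure \<mu> {l})"
  proof (intro tendsto_sum)
    fix l assume l: "l \<in> F"
    have "(\<lambda>m. EL p (bump l ^ m)) \<longlonglongrightarrow> measure \<mu> {x. poly (bump l) x = 1}"
    proof (rule esm_limit[OF esm])
      fix x :: real assume "\<bar>x\<bar> \<le> 4"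
      then have "\<bar>x - l\<bar> \<le> 8" using F(2)[OF l] by linarith
      then have "(x - l)\<^sup>2 \<le> 64" using power_mono[of "\<bar>x - l\<bar>" 8 2] by simp
      then show "0 \<le> poly (bump l) x \<and> poly (bump l) x \<le> 1" by (simp add: poly_bump)
    qed
    moreover have "{x. poly (bump l) x = 1} = {l}" by (auto simp: poly_bump)
    ultimately show "(\<lambda>m. EL p (bump l ^ m)) \<longlonglongrightarrow> measure \<mu> {l}" by simp
  qed
  ultimately have "EE (\<lambda>_. p) f = (\<Sum>l\<in>F. \<Sum>v\<in>?V. measure \<mu> {l})" using LIMSEQ_unique by simp
  also have "\<dots> = real (card ?V) * (\<Sum>l\<in>F. measure \<mu> {l})" by (simp add: sum_distrib_left)
  also have "(\<Sum>l\<in>F. measure \<mu> {l}) = measure \<mu> F"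
    using F(1) by (intro finite_measure_eq_sum_singleton[symmetric]) (simp_all add: sb)
  finally have Ef: "EE (\<lambda>_. p) f = real (card ?V) * measure \<mu> F" .
  let ?C = "real (card ?V) + real (card F) * real (4 * nat (K + 1) + b)"
  have mc_int: "integrable (percf (\<lambda>_. p)) (\<lambda>w. of_bool (many_crossings K b w) :: real)"
    by (rule dep_integrable[OF finite_ein[OF finite_sqK] dep_comp[OF dep_many_crossings]])
  have "f w + real (b * nat (K + 1)) * of_bool (many_crossings K b w) \<le> ?C" for w
  proof (cases "many_crossings K b w")
    case True
    then show ?thesis using traces_le[OF K True F] by (simp add: f_def)
  next
    case False
    have "f w \<le> real (card ?V) + real (card F) * real (4 * nat (K + 1) + 0)"
      using traces_le[OF K many_crossings_0 F] unfolding f_def by simp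
    also have "\<dots> \<le> ?C" by (intro add_left_mono mult_left_mono) auto
    finally show ?thesis using False by simp
  qed
  then have "EE (\<lambda>_. p) (\<lambda>w. f w + real (b * nat (K + 1)) * of_bool (many_crossings K b w)) \<le> EE (\<lambda>_ :: edge. p) (\<lambda>_. ?C)"
    by (intro integral_mono Bochner_Integration.integrable_add integrable_mult_right f_int mc_int) auto
  also have "EE (\<lambda>_ :: edge. p) (\<lambda>_. ?C) = ?C" by (simp add: P.prob_space)
  also have "EE (\<lambda>_. p) (\<lambda>w. f w + real (b * nat (K + 1)) * of_bool (many_crossings K b w))
      = real (card ?V) * measure \<mu> F + real (b * nat (K + 1)) * PP (\<lambda>_. p) (many_crossings K b)"
    by (subst Bochner_Integration.integral_add[OF f_int integrable_mult_right[OF mc_int]]) (simp only: Ef integral_mult_right_zero)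
  finally show ?thesis .
qed

text \<open>With j crossings likely in a box of side K = a j, dividing by the area (K + 1)^2 leaves
  a saving that tends to 1/(2a), while all terms containing the size of F vanish. The gap 1/(2a) is
  thus independent of F.\<close>

lemma esm_finite_set_gap:
  assumes esm: "expected_spectral_measure p \<mu>" and p: "1/2 < p" "p \<le> 1"
  shows "\<exists>c>0. \<forall>F. finite F \<longrightarrow> (\<forall>l\<in>F. \<bar>l\<bar> \<le> 4) \<longrightarrow> measure \<mu> F \<le> 1 - c"
proof -
  obtain L m k0 where L: "1 \<le> L" "1 \<le> m" and mc: "\<And>k. k0 \<le> k \<Longrightarrow> 1/2 \<le> PP (\<lambda>_. p) (many_crossings (int k * L) (k div m))"
    using many_crossings_likely[OF p] by blast
  define a where "a = real_of_int (int m * L)"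
  have "1 \<le> int m * L" using L mult_mono[of 1 "int m" 1 L] by simp
  then have a: "1 \<le> a" unfolding a_def by linarith
  have "measure \<mu> F \<le> 1 - 1 / (2 * a)" if F: "finite F" "\<forall>l\<in>F. \<bar>l\<bar> \<le> 4" for F
  proof (rule LIMSEQ_le_const)
    define n where "n = real (card F)"
    show "(\<lambda>j. 1 - real j / (2 * (a * real j + 1)) + n * (4 / (a * real j + 1) + real j / (a * real j + 1)\<^sup>2)) \<longlonglongrightarrow> 1 - 1 / (2 * a)"
      using a by (real_asymp simp: field_simps)
    show "\<exists>N. \<forall>j\<ge>N. measure \<mu> F \<le> 1 - real j / (2 * (a * real j + 1)) + n * (4 / (a * real j + 1) + real j / (a * real j + 1)\<^sup>2)"
    proof (intro exI allI impI)
      fix j assume j: "max 1 k0 \<le> j"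
      \<comment> \<open>Using k = m j makes k div m exactly j.\<close>
      define K where "K = int (m * j) * L"
      have "1 * j \<le> m * j" using L(2) by (rule mult_le_mono1)
      then have "k0 \<le> m * j" by (rule order_trans[rotated]) (use j in simp)
      then have "1/2 \<le> PP (\<lambda>_. p) (many_crossings K (m * j div m))" unfolding K_def by (rule mc)
      then have half: "1/2 \<le> PP (\<lambda>_. p) (many_crossings K j)" using L(2) by simp
      have Ka: "real_of_int K = a * real j" by (simp add: K_def a_def)
      have "1 * 1 \<le> a * real j" using a j by (intro mult_mono) auto
      then have K: "1 \<le> K" using Ka by linarith
      define t where "t = a * real j + 1"
      have t: "real (nat (K + 1)) = t" "0 < t" using K Ka by (simp_all add: t_def)
      have cV: "real (card (sqK K)) = t\<^sup>2" using K t(1) by (simp add: sqK_def power2_eq_square)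
      have "t\<^sup>2 * measure \<mu> F + (real j * t) * (1/2) \<le> t\<^sup>2 * measure \<mu> F + real (j * nat (K + 1)) * PP (\<lambda>_. p) (many_crossings K j)"
        using half t by (intro add_left_mono mult_mono) auto
      also have "\<dots> \<le> t\<^sup>2 + n * (4 * t + real j)"
        using esm_finite_set[OF esm _ p(2) K F(1), of j] F(2) p(1) t(1) by (simp add: cV n_def)
      finally have "t\<^sup>2 * measure \<mu> F + (real j * t) * (1/2) \<le> t\<^sup>2 + n * (4 * t + real j)" .
      then have "t\<^sup>2 * measure \<mu> F \<le> t\<^sup>2 * (1 - real j / (2 * t) + n * (4 / t + real j / t\<^sup>2))"
      proof -
        have "t\<^sup>2 * (1 - real j / (2 * t) + n * (4 / t + real j / t\<^sup>2)) = t\<^sup>2 - real j * t * (1/2) + n * (4 * t + real j)"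
          using t(2) by (simp add: field_simps power2_eq_square)
        then show ?thesis using \<open>t\<^sup>2 * measure \<mu> F + (real j * t) * (1/2) \<le> t\<^sup>2 + n * (4 * t + real j)\<close> by linarith
      qed
      then show "measure \<mu> F \<le> 1 - real j / (2 * (a * real j + 1)) + n * (4 / (a * real j + 1) + real j / (a * real j + 1)\<^sup>2)"
        using t(2) by (simp add: t_def[symmetric])
    qed
  qed
  then show ?thesis using a by (intro exI[of _ "1 / (2 * a)"]) auto
qed

lemma not_purely_atomic_supercritical:
  assumes esm: "expected_spectral_measure p \<mu>" and p: "1/2 < p" "p \<le> 1"
  shows "\<not> purely_atomic \<mu>"
proof
  assume "purely_atomic \<mu>"
  then obtain S where S: "countable S" "S \<in> sets \<mu>" "emeasure \<mu> S = emeasure \<mu> (space \<mu>)" unfolding purely_atomic_def by blast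
  interpret prob_space \<mu> using esm by (simp add: expected_spectral_measure_def)
  have sb: "sets \<mu> = sets borel" using esm by (simp add: expected_spectral_measure_def)
  obtain c where c: "0 < c" "\<And>F. finite F \<Longrightarrow> (\<forall>l\<in>F. \<bar>l\<bar> \<le> 4) \<Longrightarrow> measure \<mu> F \<le> 1 - c"
    using esm_finite_set_gap[OF esm p] by blast
  define T where "T = S \<inter> {-4..4}"
  have cT: "countable T" using S(1) by (auto simp: T_def)
  have mT: "X \<in> sets \<mu>" if "countable X" for X :: "real set" unfolding sb by (rule sets.countable[OF _ that]) auto
  have "measure \<mu> S = 1" using S(3) by (simp add: measure_def emeasure_space_1)
  then have "AE x in \<mu>. x \<in> S" using AE_in_set_eq_1[OF S(2)] by simp
  then have "AE x in \<mu>. x \<in> T" using esm_support[OF esm] by eventually_elim (auto simp: T_def abs_le_iff)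
  then have T1: "measure \<mu> T = 1" using AE_in_set_eq_1[OF mT[OF cT]] by simp
  then have T0: "T \<noteq> {}" by auto
  define A where "A n = from_nat_into T ` {..n}" for n
  have AT: "A n \<subseteq> T" for n using from_nat_into[OF T0] by (auto simp: A_def)
  have "T \<subseteq> (\<Union>n. A n)" using subset_range_from_nat_into[OF cT] by (fastforce simp: A_def)
  then have UA: "(\<Union>n. A n) = T" using AT by blast
  have finA: "finite (A n)" for n by (simp add: A_def)
  have "(\<lambda>n. measure \<mu> (A n)) \<longlonglongrightarrow> measure \<mu> (\<Union>n. A n)"
  proof (rule finite_Lim_measure_incseq)
    show "range A \<subseteq> sets \<mu>" using mT[OF countable_finite[OF finA]] by blast
    show "incseq A" by (rule incseq_SucI) (auto simp: A_def)
  qed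
  moreover have "measure \<mu> (A n) \<le> 1 - c" for n
    by (rule c(2)[OF finA]) (use AT[of n] in \<open>auto simp: T_def abs_le_iff\<close>)
  ultimately have "measure \<mu> (\<Union>n. A n) \<le> 1 - c" by (intro LIMSEQ_le_const2) auto
  then show False using T1 UA c(1) by simp
qed

theorem theorem1p1:
  fixes p :: real
  assumes "0 \<le> p" and "p \<le> 1"
  shows "(\<exists>\<mu>. expected_spectral_measure p \<mu>) \<and>
         (\<forall>\<mu>. expected_spectral_measure p \<mu> \<longrightarrow> (\<not> purely_atomic \<mu> \<longleftrightarrow> p > 1/2))"
proof (intro conjI allI impI iffI)
  show "\<exists>\<mu>. expected_spectral_measure p \<mu>" by (rule expected_spectral_measure_exists)
  fix \<mu> assume esm: "expected_spectral_measure p \<mu>"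
  show "p > 1/2" if "\<not> purely_atomic \<mu>"
    using that purely_atomic_if_finite_clusters[OF esm AE_cluster_finite[OF assms(1)]] by force
  show "\<not> purely_atomic \<mu>" if "p > 1/2" by (rule not_purely_atomic_supercritical[OF esm that assms(2)])
qed

end
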